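(* Let $\phi:\mathcal{P}(\mathbb{T}^d)\to\mathbb{R}$ be Lipschitz continuous with respect to the total variation distance. Then, for $\mathbb{P}$-almost every $m\in\mathcal{P}(\mathbb{T}^d)$, $\phi$ is differentiable at $m$ in the directions $\Re[e_k]$ and $\Im[e_k]$ (or, equivalently, with respect to $\Re[\widehat m^k]$ and $\Im[\widehat m^k]$) for any $k\in\mathbb{Z}^d\setminus\{0\}$. Moreover, as $N\to\infty$, the following convergences hold for the weak-star topology $\sigma^*\bigl(L^\infty(\mathcal{P}(\mathbb{T}^d),\mathbb{P});L^1(\mathcal{P}(\mathbb{T}^d),\mathbb{P})\bigr)$: for every $k\in\mathbb{Z}^d\setminus\{0\}$, $$\partial_{\widehat m^k}\phi(m*f_N)\ \rightharpoonup\ \partial_{\widehat m^k}\phi(m),$$ where the derivative on the left-hand side is the Lebesgue almost everywhere derivative of the restriction of $\phi$ to $\mathcal{P}_N$ (evaluated at $m*f_N$) and the derivative on the right-hand side is the $\mathbb{P}$-almost everywhere derivative of $\phi$ given by the first part of the statement.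
   Context: $\mathbb{T}^d=\mathbb{R}^d/\mathbb{Z}^d$; $\mathcal{P}(\mathbb{T}^d)$ is the set of Borel probability measures, equipped with the topology of the $1$-Wasserstein distance. Total variation: $d_{\rm TV}(m,m')=\sup_{\|h\|_\infty\le1}|\int h\,d(m-m')|$. Fourier notation: $e_k(x)=e^{\mathrm{i}2\pi k\cdot x}$, $\widehat m^k=\int e_k\,dm$, $\widehat h^k=\int h\,e_k\,dx$. $F_N=\{-N+1,\dots,N-1\}^d$; $F_N^+$ is the set of $k\in F_N\setminus\{0\}$ whose first non-zero coordinate is positive. Complex numbers are identified with vectors of $\mathbb{R}^2$. $\mathcal{O}_N=\{(\widehat m^k)_{k\in F_N^+}\in\mathbb{C}^{|F_N^+|}:\inf_x[1+2\Re\sum_{k\in F_N^+}\widehat m^ke_{-k}(x)]>0\}$; $\mathscr{I}_N$ maps $(\widehat m^k)_{k\in F_N^+}\in\mathcal{O}_N$ to the probability measure with density $1+2\sum_{k\in F_N^+}\Re[\widehat m^ke_{-k}]$; $\mathcal{P}_N=\mathscr{I}_N(\mathcal{O}_N)$. Fejér kernel: $f_N(\theta)=N^{-d}|\sum_{k\in\{1,\dots,N\}^d}e^{\mathrm{i}2\pi k\cdot\theta}|^2$. The measure $\mathbb{P}$: fix a real $p\ge5$, let $\Gamma_N$ be the probability measure on $\mathcal{O}_N$ with Lebesgue density $Z_N^{-1}\mathbf{1}_{\mathcal{O}_N}\exp(-\sum_{k\in F_N^+}|k|^{2pd}|\widehat m^k|^2)$, and $\mathbb{P}_N=\Gamma_N\circ\mathscr{I}_N^{-1}$.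 $\mathbb{P}$ denotes the weak limit of $(\mathbb{P}_N)_{N\ge1}$ on $\mathcal{P}(\mathbb{T}^d)$ (it exists). $\mathbb{P}$-almost every $m$ has a strictly positive continuous density, and the image of $\mathbb{P}$ by $m\mapsto(\widehat m^k\widehat f_N^k)_{k\in F_N^+}$ (the Fourier coefficients of $m*f_N$) is absolutely continuous with respect to the Lebesgue measure on $\mathcal{O}_N$, so that Lebesgue-a.e. defined functions on $\mathcal{O}_N\simeq\mathcal{P}_N$ can be evaluated at $m*f_N$ for $\mathbb{P}$-a.e. $m$. Derivatives: $\phi$ is differentiable at $m$ in the direction $\Re[e_k]$ (resp. $\Im[e_k]$) if $\lim_{\eta\to0}\eta^{-1}(\phi(m+\eta\Re[e_k])-\phi(m))$ (resp. with $\Im[e_k]$) exists, where $m+\eta\Re[e_k]$ is a probability measure for $|\eta|$ small because $m$ has a density bounded below by a positive constant. For $k\in\bigcup_NF_N^+$, $\partial_{\Re[\widehat m^k]}\phi(m)=\frac{d}{d\varepsilon}|_{\varepsilon=0}\phi(m+2\varepsilon\Re[e_k])$, $\partial_{\Im[\widehat m^k]}\phi(m)=\frac{d}{d\varepsilon}|_{\varepsilon=0}\phi(m+2\varepsilon\Im[e_k])$ and $\partial_{\widehat m^k}\phi(m)=\frac12\partial_{\Re[\widehat m^k]}\phi(m)-\frac{\mathrm{i}}2\partial_{\Im[\widehat m^k]}\phi(m)$; if $-k\in\bigcup_NF_N^+$, $\partial_{\widehat m^k}\phi(m)=\overline{\partial_{\widehat m^{-k}}\phi(m)}$. On $\mathcal{P}_N$,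 these derivatives are those of the function $\phi\circ\mathscr{I}_N$ on $\mathcal{O}_N$ with respect to the real and imaginary parts of its coordinates; they exist Lebesgue-almost everywhere when $\phi$ is $d_{\rm TV}$-Lipschitz. In the convergence, $N$ is taken large enough that $k\in F_N$. *)

theory Defs
  imports "HOL-Probability.Probability"
begin

definition int_lattice :: "(real^'d) set" where
  "int_lattice = {v. \<forall>i. v $ i \<in> \<int>}"

lemma int_lattice_0 [simp]: "0 \<in> int_lattice"
  by (simp add: int_lattice_def)

lemma int_lattice_add: "u \<in> int_lattice \<Longrightarrow> v \<in> int_lattice \<Longrightarrow> u + v \<in> int_lattice"
  by (simp add: int_lattice_def)

lemma int_lattice_uminus: "u \<in> int_lattice \<Longrightarrow> - u \<in> int_lattice"
  by (simp add: int_lattice_def)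

lemma int_lattice_diff: "u \<in> int_lattice \<Longrightarrow> v \<in> int_lattice \<Longrightarrow> u - v \<in> int_lattice"
  by (simp add: int_lattice_def)

lemma closed_int_lattice: "closed int_lattice"
proof -
  have "closed {v::real^'d. v $ i \<in> \<int>}" for i
    using continuous_closed_vimage[OF closed_Ints, of "\<lambda>v::real^'d. v $ i"]
    by (simp add: vimage_def)
  then show ?thesis
    unfolding int_lattice_def by (intro closed_Collect_all)
qed

definition lattice_rel :: "real^'d \<Rightarrow> real^'d \<Rightarrow> bool" where
  "lattice_rel x y \<longleftrightarrow> x - y \<in> int_lattice"

lemma equivp_lattice_rel: "equivp (lattice_rel :: real^'d \<Rightarrow> real^'d \<Rightarrow> bool)"
proof (rule equivpI)
  show "reflp (lattice_rel :: real^'d \<Rightarrow> real^'d \<Rightarrow> bool)"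
    by (simp add: reflp_def lattice_rel_def)
  show "symp (lattice_rel :: real^'d \<Rightarrow> real^'d \<Rightarrow> bool)"
  proof (rule sympI)
    fix x y :: "real^'d" assume "lattice_rel x y"
    then show "lattice_rel y x"
      using int_lattice_uminus[of "x - y"] by (simp add: lattice_rel_def)
  qed
  show "transp (lattice_rel :: real^'d \<Rightarrow> real^'d \<Rightarrow> bool)"
  proof (rule transpI)
    fix x y z :: "real^'d" assume "lattice_rel x y" "lattice_rel y z"
    then show "lattice_rel x z"
      using int_lattice_add[of "x - y" "y - z"] by (simp add: lattice_rel_def)
  qed
qed

quotient_type (overloaded) 'd torus = "real^('d::finite)" / lattice_rel
  morphisms rep_torus to_torus
  by (rule equivp_lattice_rel)

instantiation torus :: (finite) ab_group_add
begin

lift_definition zero_torus :: "'a torus" is 0 .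

lift_definition plus_torus :: "'a torus \<Rightarrow> 'a torus \<Rightarrow> 'a torus" is "(+)"
proof -
  fix x x' y y' :: "real^'a" assume "lattice_rel x x'" "lattice_rel y y'"
  then have "(x - x') + (y - y') \<in> int_lattice"
    unfolding lattice_rel_def by (rule int_lattice_add)
  then show "lattice_rel (x + y) (x' + y')"
    by (simp add: lattice_rel_def algebra_simps)
qed

lift_definition minus_torus :: "'a torus \<Rightarrow> 'a torus \<Rightarrow> 'a torus" is "(-)"
proof -
  fix x x' y y' :: "real^'a" assume "lattice_rel x x'" "lattice_rel y y'"
  then have "(x - x') - (y - y') \<in> int_lattice"
    unfolding lattice_rel_def by (rule int_lattice_diff)
  then show "lattice_rel (x - y) (x' - y')"
    by (simp add: lattice_rel_def algebra_simps)
qed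

lift_definition uminus_torus :: "'a torus \<Rightarrow> 'a torus" is uminus
proof -
  fix x x' :: "real^'a" assume "lattice_rel x x'"
  then have "- (x - x') \<in> int_lattice"
    unfolding lattice_rel_def by (rule int_lattice_uminus)
  then show "lattice_rel (- x) (- x')"
    by (simp add: lattice_rel_def algebra_simps)
qed

instance
  by standard (transfer; simp add: lattice_rel_def algebra_simps)+

end

lemma infdist_int_lattice_shift:
  assumes "n \<in> int_lattice"
  shows "infdist (x + n) int_lattice \<le> infdist x int_lattice"
proof -
  obtain m where "m \<in> int_lattice" "infdist x int_lattice = dist x m"
    using infdist_attains_inf[OF closed_int_lattice, of x] int_lattice_0 by blast
  then show ?thesis
    using infdist_le[OF int_lattice_add[OF \<open>m \<in> int_lattice\<close> assms], of "x + n"] by simp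
qed

lift_definition torus_norm :: "('d::finite) torus \<Rightarrow> real" is "\<lambda>x. infdist x int_lattice"
proof -
  fix x y :: "real^'d"
  assume "lattice_rel x y"
  then have d: "x - y \<in> int_lattice" by (simp add: lattice_rel_def)
  show "infdist x int_lattice = infdist y int_lattice"
    using infdist_int_lattice_shift[OF d, of y] infdist_int_lattice_shift[OF int_lattice_uminus[OF d], of x]
    by simp
qed

lemma torus_norm_eq_0: "torus_norm x = 0 \<longleftrightarrow> x = 0"
proof (transfer)
  fix x :: "real^'a"
  have "int_lattice \<noteq> ({} :: (real^'a) set)" using int_lattice_0 by blast
  from in_closed_iff_infdist_zero[OF closed_int_lattice this, of x]
  show "infdist x int_lattice = 0 \<longleftrightarrow> lattice_rel x 0"
    by (simp add: lattice_rel_def)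
qed

lemma torus_norm_triangle: "torus_norm (x + y) \<le> torus_norm x + torus_norm y"
proof (transfer)
  fix x y :: "real^'a"
  obtain m where m: "m \<in> int_lattice" "infdist x int_lattice = dist x m"
    using infdist_attains_inf[OF closed_int_lattice, of x] int_lattice_0 by blast
  obtain n where n: "n \<in> int_lattice" "infdist y int_lattice = dist y n"
    using infdist_attains_inf[OF closed_int_lattice, of y] int_lattice_0 by blast
  have "infdist (x + y) int_lattice \<le> dist (x + y) (m + n)"
    by (intro infdist_le int_lattice_add m n)
  also have "\<dots> \<le> dist x m + dist y n"
    by (rule dist_triangle_add)
  finally show "infdist (x + y) int_lattice \<le> infdist x int_lattice + infdist y int_lattice"
    by (simp add: m n)
qed

lemma torus_norm_minus: "torus_norm (- x) = torus_norm x"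
proof -
  have *: "infdist (- x) int_lattice \<le> infdist x int_lattice" for x :: "real^'a"
  proof -
    obtain m where m: "m \<in> int_lattice" "infdist x int_lattice = dist x m"
      using infdist_attains_inf[OF closed_int_lattice, of x] int_lattice_0 by blast
    then show ?thesis
      using infdist_le[OF int_lattice_uminus[OF m(1)], of "- x"] by (simp add: dist_minus)
  qed
  show ?thesis
  proof (transfer)
    fix x :: "real^'a"
    show "infdist (- x) int_lattice = infdist x int_lattice"
      using *[of x] *[of "- x"] by simp
  qed
qed

text \<open>The quotient metric: the distance of two points of the torus is the least Euclidean distance
  of their representatives.\<close>

instantiation torus :: (finite) metric_space
begin

definition dist_torus :: "'a torus \<Rightarrow> 'a torus \<Rightarrow> real" where
  "dist_torus x y = torus_norm (x - y)"

definition uniformity_torus :: "('a torus \<times> 'a torus) filter" where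
  "uniformity_torus = (INF e\<in>{0<..}. principal {(x, y). dist x y < e})"

definition open_torus :: "'a torus set \<Rightarrow> bool" where
  "open_torus U \<longleftrightarrow> (\<forall>x\<in>U. eventually (\<lambda>(x', y). x' = x \<longrightarrow> y \<in> U) uniformity)"

instance
proof
  fix x y z :: "'a torus"
  show "dist x y = 0 \<longleftrightarrow> x = y"
    by (simp add: dist_torus_def torus_norm_eq_0)
  show "dist x y \<le> dist x z + dist y z"
    using torus_norm_triangle[of "x - z" "z - y"] torus_norm_minus[of "y - z"]
    by (simp add: dist_torus_def)
qed (simp_all add: uniformity_torus_def open_torus_def)

end

definition torus_vol :: "('d::finite) torus measure" where
  "torus_vol = distr (restrict_space lborel (cbox 0 1)) borel to_torus"

definition torus_probs :: "('d::finite) torus measure set" where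
  "torus_probs = {m. prob_space m \<and> sets m = sets borel}"

definition tv_dist :: "('d::finite) torus measure \<Rightarrow> 'd torus measure \<Rightarrow> real" where
  "tv_dist m m' =
     (SUP h\<in>{h \<in> borel_measurable borel. \<forall>x. \<bar>h x\<bar> \<le> 1}. \<bar>(\<integral>x. h x \<partial>m) - (\<integral>x. h x \<partial>m')\<bar>)"

definition tv_lipschitz :: "(('d::finite) torus measure \<Rightarrow> real) \<Rightarrow> bool" where
  "tv_lipschitz \<phi> \<longleftrightarrow>
     (\<exists>C. \<forall>m\<in>torus_probs. \<forall>m'\<in>torus_probs. \<bar>\<phi> m - \<phi> m'\<bar> \<le> C * tv_dist m m')"

definition couplings ::
  "('d::finite) torus measure \<Rightarrow> 'd torus measure \<Rightarrow> ('d torus \<times> 'd torus) measure set" where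
  "couplings m m' =
     {\<pi>. prob_space \<pi> \<and> sets \<pi> = sets (borel \<Otimes>\<^sub>M borel) \<and>
         distr \<pi> borel fst = m \<and> distr \<pi> borel snd = m'}"

definition wasserstein :: "('d::finite) torus measure \<Rightarrow> 'd torus measure \<Rightarrow> real" where
  "wasserstein m m' = (INF \<pi>\<in>couplings m m'. \<integral>z. dist (fst z) (snd z) \<partial>\<pi>)"

text \<open>The metric topology of the Wasserstein distance. It is spelled out because the characteristic
  facts on \<^const>\<open>Metric_space.mtopology\<close> are only available once the metric axioms are proved.\<close>

definition wasserstein_topology :: "('d::finite) torus measure topology" where
  "wasserstein_topology =
     topology (\<lambda>U. U \<subseteq> torus_probs \<and>
       (\<forall>m\<in>U. \<exists>r>0. \<forall>m'\<in>torus_probs. wasserstein m m' < r \<longrightarrow> m' \<in> U))"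

lemma openin_wasserstein_topology:
  "openin wasserstein_topology U \<longleftrightarrow>
     U \<subseteq> torus_probs \<and>
       (\<forall>m\<in>U. \<exists>r>0. \<forall>m'\<in>torus_probs. wasserstein m m' < r \<longrightarrow> m' \<in> U)"
proof -
  define Q where "Q U \<longleftrightarrow> U \<subseteq> torus_probs \<and>
       (\<forall>m\<in>U. \<exists>r>0. \<forall>m'\<in>torus_probs. wasserstein m m' < r \<longrightarrow> m' \<in> U)"
    for U :: "'a torus measure set"
  have "istopology Q"
    unfolding istopology_def
  proof (intro conjI allI impI)
    fix S T assume S: "Q S" and T: "Q T"
    show "Q (S \<inter> T)"
      unfolding Q_def
    proof (intro conjI ballI)
      show "S \<inter> T \<subseteq> torus_probs" using S by (auto simp: Q_def)
      fix m assume "m \<in> S \<inter> T"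
      then obtain r s where "r > 0" "s > 0"
        and "\<forall>m'\<in>torus_probs. wasserstein m m' < r \<longrightarrow> m' \<in> S"
        and "\<forall>m'\<in>torus_probs. wasserstein m m' < s \<longrightarrow> m' \<in> T"
        using S T unfolding Q_def by blast
      then show "\<exists>r>0. \<forall>m'\<in>torus_probs. wasserstein m m' < r \<longrightarrow> m' \<in> S \<inter> T"
        by (intro exI[of _ "min r s"]) auto
    qed
  next
    fix \<K> :: "'a torus measure set set" assume *: "\<forall>K\<in>\<K>. Q K"
    show "Q (\<Union>\<K>)"
      unfolding Q_def
    proof (intro conjI ballI)
      show "\<Union>\<K> \<subseteq> torus_probs"
        using * by (auto simp: Q_def)
      fix m assume "m \<in> \<Union>\<K>"
      then obtain K where K: "K \<in> \<K>" "m \<in> K" by blast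
      then obtain r where "r > 0" "\<forall>m'\<in>torus_probs. wasserstein m m' < r \<longrightarrow> m' \<in> K"
        using * unfolding Q_def by meson
      then show "\<exists>r>0. \<forall>m'\<in>torus_probs. wasserstein m m' < r \<longrightarrow> m' \<in> \<Union>\<K>"
        using K(1) by blast
    qed
  qed
  then show ?thesis
    by (simp add: wasserstein_topology_def Q_def[abs_def])
qed

definition probs_borel :: "('d::finite) torus measure measure" where
  "probs_borel = sigma torus_probs {U. openin wasserstein_topology U}"

definition weak_limit ::
  "(nat \<Rightarrow> ('d::finite) torus measure measure) \<Rightarrow> 'd torus measure measure \<Rightarrow> bool" where
  "weak_limit \<mu> \<nu> \<longleftrightarrow>
     prob_space \<nu> \<and> sets \<nu> = sets probs_borel \<and>
     (\<forall>F. continuous_map wasserstein_topology euclideanreal F \<and> bounded (F ` torus_probs) \<longrightarrow>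
        (\<lambda>n. \<integral>m. F m \<partial>\<mu> n) \<longlonglongrightarrow> (\<integral>m. F m \<partial>\<nu>))"

type_synonym 'd freq = "(int, 'd) vec"

definition fvec :: "'d freq \<Rightarrow> real^('d::finite)" where
  "fvec k = (\<chi> i. real_of_int (k $ i))"

lemma fvec_inner_lattice: "v \<in> int_lattice \<Longrightarrow> fvec k \<bullet> v \<in> \<int>"
  by (auto simp: fvec_def int_lattice_def inner_vec_def intro!: Ints_sum Ints_mult)

lift_definition fourier_char :: "('d::finite) freq \<Rightarrow> 'd torus \<Rightarrow> complex"
  is "\<lambda>k x. cis (2 * pi * (fvec k \<bullet> x))"
proof -
  fix k :: "'d freq" and x y :: "real^'d"
  assume "lattice_rel x y"
  then have "fvec k \<bullet> (x - y) \<in> \<int>"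
    by (simp add: lattice_rel_def fvec_inner_lattice)
  then have "cis (2 * pi * (fvec k \<bullet> (x - y))) = 1"
    by (simp add: cis_multiple_2pi)
  moreover have "2 * pi * (fvec k \<bullet> (x - y)) + 2 * pi * (fvec k \<bullet> y) = 2 * pi * (fvec k \<bullet> x)"
    by (simp add: inner_diff_right algebra_simps)
  ultimately show "cis (2 * pi * (fvec k \<bullet> x)) = cis (2 * pi * (fvec k \<bullet> y))"
    using cis_mult[of "2 * pi * (fvec k \<bullet> (x - y))" "2 * pi * (fvec k \<bullet> y)"]
    by (simp only: mult_1_left)
qed

definition fourier_coeff :: "('d::finite) torus measure \<Rightarrow> 'd freq \<Rightarrow> complex" where
  "fourier_coeff m k = (\<integral>x. fourier_char k x \<partial>m)"

definition F_set :: "nat \<Rightarrow> (('d::finite) freq) set" where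
  "F_set N = {k. \<forall>i. \<bar>k $ i\<bar> < int N}"

text \<open>The linear order on the index type is that of the coordinates.\<close>

definition F_plus :: "nat \<Rightarrow> (('d::{finite,linorder}) freq) set" where
  "F_plus N = {k \<in> F_set N. \<exists>i. k $ i > 0 \<and> (\<forall>j<i. k $ j = 0)}"

definition fejer :: "nat \<Rightarrow> ('d::finite) torus \<Rightarrow> real" where
  "fejer N x =
     (cmod (\<Sum>k\<in>{k::'d freq. \<forall>i. 1 \<le> k $ i \<and> k $ i \<le> int N}. fourier_char k x))\<^sup>2 / real N ^ CARD('d)"

definition smooth_by :: "('d::finite) torus measure \<Rightarrow> ('d torus \<Rightarrow> real) \<Rightarrow> 'd torus measure"
    (infixl \<open>\<star>\<close> 70) where
  "m \<star> f = density torus_vol (\<lambda>x. ennreal (\<integral>y. f (x - y) \<partial>m))"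

text \<open>Elements of \<open>\<complex>\<close> to the power \<open>|F\<^sub>N\<^sup>+|\<close> are the extensional functions on
  \<^term>\<open>F_plus N\<close>, as in \<^const>\<open>PiM\<close>.\<close>

definition trig_density :: "nat \<Rightarrow> ('d freq \<Rightarrow> complex) \<Rightarrow> ('d::{finite,linorder}) torus \<Rightarrow> real" where
  "trig_density N a x = 1 + 2 * (\<Sum>k\<in>F_plus N. Re (a k * fourier_char (- k) x))"

definition O_set :: "nat \<Rightarrow> (('d::{finite,linorder}) freq \<Rightarrow> complex) set" where
  "O_set N = {a \<in> F_plus N \<rightarrow>\<^sub>E UNIV. (INF x. trig_density N a x) > 0}"

definition I_map :: "nat \<Rightarrow> ('d freq \<Rightarrow> complex) \<Rightarrow> ('d::{finite,linorder}) torus measure" where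
  "I_map N a = density torus_vol (\<lambda>x. ennreal (trig_density N a x))"

definition gamma_weight :: "real \<Rightarrow> nat \<Rightarrow> (('d::{finite,linorder}) freq \<Rightarrow> complex) \<Rightarrow> real" where
  "gamma_weight p N a =
     exp (- (\<Sum>k\<in>F_plus N. norm (fvec k) powr (2 * p * real CARD('d)) * (cmod (a k))\<^sup>2))"

definition gamma_meas :: "real \<Rightarrow> nat \<Rightarrow> (('d::{finite,linorder}) freq \<Rightarrow> complex) measure" where
  "gamma_meas p N =
     (let L = restrict_space (PiM (F_plus N) (\<lambda>_. lborel)) (O_set N);
          Z = (\<integral>a. gamma_weight p N a \<partial>L)
      in density L (\<lambda>a. ennreal (gamma_weight p N a / Z)))"

definition P_meas :: "real \<Rightarrow> nat \<Rightarrow> ('d::{finite,linorder}) torus measure measure" where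
  "P_meas p N = distr (gamma_meas p N) probs_borel (I_map N)"

text \<open>The measure \<open>m + \<eta> h dx\<close>. For a probability measure \<open>m\<close> and \<open>h\<close> of mean zero, if
  this signed measure is not non-negative, then its truncation by \<^const>\<open>ennreal\<close> is not additive
  and \<^const>\<open>measure_of\<close> yields the null measure, which is not in \<^const>\<open>torus_probs\<close>.\<close>

definition perturb ::
  "('d::finite) torus measure \<Rightarrow> real \<Rightarrow> ('d torus \<Rightarrow> real) \<Rightarrow> 'd torus measure" where
  "perturb m \<eta> h = measure_of UNIV (sets borel)
     (\<lambda>A. ennreal (measure m A + \<eta> * (LINT x:A|torus_vol. h x)))"

definition differentiable_in_direction ::
  "(('d::finite) torus measure \<Rightarrow> real) \<Rightarrow> 'd torus measure \<Rightarrow> ('d torus \<Rightarrow> real) \<Rightarrow> bool" where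
  "differentiable_in_direction \<phi> m h \<longleftrightarrow>
     (\<forall>\<^sub>F \<eta> in at 0. perturb m \<eta> h \<in> torus_probs) \<and>
     (\<exists>D. ((\<lambda>\<eta>. (\<phi> (perturb m \<eta> h) - \<phi> m) / \<eta>) \<longlongrightarrow> D) (at 0))"

definition re_line :: "(('d::finite) torus measure \<Rightarrow> real) \<Rightarrow> 'd freq \<Rightarrow> 'd torus measure \<Rightarrow> real \<Rightarrow> real"
  where "re_line \<phi> k m \<epsilon> = \<phi> (perturb m (2 * \<epsilon>) (\<lambda>x. Re (fourier_char k x)))"

definition im_line :: "(('d::finite) torus measure \<Rightarrow> real) \<Rightarrow> 'd freq \<Rightarrow> 'd torus measure \<Rightarrow> real \<Rightarrow> real"
  where "im_line \<phi> k m \<epsilon> = \<phi> (perturb m (2 * \<epsilon>) (\<lambda>x. Im (fourier_char k x)))"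

definition re_line_fin ::
  "nat \<Rightarrow> (('d::{finite,linorder}) torus measure \<Rightarrow> real) \<Rightarrow> 'd freq \<Rightarrow> ('d freq \<Rightarrow> complex) \<Rightarrow> real \<Rightarrow> real"
  where "re_line_fin N \<phi> k a \<epsilon> = \<phi> (I_map N (a(k := a k + of_real \<epsilon>)))"

definition im_line_fin ::
  "nat \<Rightarrow> (('d::{finite,linorder}) torus measure \<Rightarrow> real) \<Rightarrow> 'd freq \<Rightarrow> ('d freq \<Rightarrow> complex) \<Rightarrow> real \<Rightarrow> real"
  where "im_line_fin N \<phi> k a \<epsilon> = \<phi> (I_map N (a(k := a k + \<i> * of_real \<epsilon>)))"

text \<open>Half the real derivative minus half \<open>\<i>\<close> times the imaginary one, extended from the half-space
  \<open>H\<close> of frequencies to its opposite by conjugation.\<close>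

definition wirtinger ::
  "('d freq) set \<Rightarrow> ('d freq \<Rightarrow> real \<Rightarrow> real) \<Rightarrow> ('d freq \<Rightarrow> real \<Rightarrow> real) \<Rightarrow> ('d::finite) freq \<Rightarrow> complex" where
  "wirtinger H u v k =
     (let D = (\<lambda>l. of_real (deriv (u l) 0) / 2 - \<i> / 2 * of_real (deriv (v l) 0))
      in if k \<in> H then D k else cnj (D (- k)))"

definition fourier_deriv ::
  "(('d::{finite,linorder}) torus measure \<Rightarrow> real) \<Rightarrow> 'd freq \<Rightarrow> 'd torus measure \<Rightarrow> complex" where
  "fourier_deriv \<phi> k m =
     wirtinger (\<Union>N. F_plus N) (\<lambda>l. re_line \<phi> l m) (\<lambda>l. im_line \<phi> l m) k"

definition O_coords :: "nat \<Rightarrow> ('d::{finite,linorder}) torus measure \<Rightarrow> ('d freq \<Rightarrow> complex)" where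
  "O_coords N m = restrict (fourier_coeff m) (F_plus N)"

text \<open>The derivative of the restriction of \<open>\<phi>\<close> to \<open>\<P>\<^sub>N\<close>, at the point \<open>m\<close> of \<open>\<P>\<^sub>N\<close>: since
  \<^term>\<open>I_map N\<close> is inverted by \<^term>\<open>O_coords N\<close>, it is the derivative of \<open>\<phi> \<circ> I_map N\<close> at
  \<^term>\<open>O_coords N m\<close>.\<close>

definition fourier_deriv_fin ::
  "nat \<Rightarrow> (('d::{finite,linorder}) torus measure \<Rightarrow> real) \<Rightarrow> 'd freq \<Rightarrow> 'd torus measure \<Rightarrow> complex" where
  "fourier_deriv_fin N \<phi> k m =
     wirtinger (F_plus N) (\<lambda>l. re_line_fin N \<phi> l (O_coords N m))
                          (\<lambda>l. im_line_fin N \<phi> l (O_coords N m)) k"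

definition has_fourier_deriv_fin ::
  "nat \<Rightarrow> (('d::{finite,linorder}) torus measure \<Rightarrow> real) \<Rightarrow> 'd freq \<Rightarrow> 'd torus measure \<Rightarrow> bool" where
  "has_fourier_deriv_fin N \<phi> k m \<longleftrightarrow>
     O_coords N m \<in> O_set N \<and> I_map N (O_coords N m) = m \<and>
     (\<forall>l \<in> {k, - k} \<inter> F_plus N.
        re_line_fin N \<phi> l (O_coords N m) field_differentiable at 0 \<and>
        im_line_fin N \<phi> l (O_coords N m) field_differentiable at 0)"

text \<open>Measurability and integrals refer to the completion: a function that is Lipschitz continuous
  for the total variation distance need not be Borel measurable for the Wasserstein topology, and
  its derivatives are Borel measurable only up to null sets.\<close>

definition L_inf :: "'a measure \<Rightarrow> ('a \<Rightarrow> complex) set" where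
  "L_inf M = {f \<in> borel_measurable (completion M). \<exists>C. AE x in M. cmod (f x) \<le> C}"

definition weak_star_tendsto :: "'a measure \<Rightarrow> (nat \<Rightarrow> 'a \<Rightarrow> complex) \<Rightarrow> ('a \<Rightarrow> complex) \<Rightarrow> bool" where
  "weak_star_tendsto M f g \<longleftrightarrow>
     (\<forall>\<^sub>F n in sequentially. f n \<in> L_inf M) \<and> g \<in> L_inf M \<and>
     (\<forall>h::'a \<Rightarrow> complex. integrable (completion M) h \<longrightarrow>
        (\<lambda>n. \<integral>x. f n x * h x \<partial>completion M) \<longlonglongrightarrow> (\<integral>x. g x * h x \<partial>completion M))"

end

theory Submission
  imports Defs
begin

text \<open>A measure with strictly positive density is encoded by its Fourier coefficients on a half-space of
  frequencies, and \<open>\<P>\<close> becomes a product of Gaussian measures on summable sequences, conditioned on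
  positivity of the density. The total variation distance is at most twice the \<open>\<ell>\<^sup>1\<close> distance of the
  coefficients, so \<open>\<phi>\<close> becomes an \<open>\<ell>\<^sup>1\<close>-Lipschitz function \<open>\<Psi>\<close>, which extends to all summable
  sequences. Drawing one coordinate again and averaging over translates in it leaves the Gaussian law
  unchanged, so on almost every line \<open>\<Psi>\<close> is a Lipschitz function of one real variable, differentiable
  almost everywhere by Lebesgue's theorem. Convolution with the Fejer kernel multiplies the coefficients
  by weights in \<open>[0, 1]\<close> that tend to \<open>1\<close>, hence \<open>\<Psi>\<close> evaluated at the damped sequences is a family of
  functions with a common Lipschitz constant that converges pointwise to \<open>\<Psi>\<close>. On lines this implies weak-star
  convergence of the derivatives, and integrating over the lines gives the claim; the chain rule only
  contributes the inverse Fejer weight.\<close>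

section \<open>Lipschitz functions on the line\<close>

text \<open>Total variation is much finer than the Wasserstein topology in which \<open>\<P>\<close>
  is a limit, so weak convergence says nothing about \<open>\<phi>\<close> itself. It is tested on
  continuous functions of finitely many Fourier coefficients; these determine the law of the whole
  sequence, and \<open>\<phi>\<close> is studied afterwards under that fixed law. Two obstacles
  shape the proof. Positivity of the density is a discontinuous event, so the limit requires its
  boundary to be null: rescaling a finite block of coordinates changes the Gaussian law to an
  equivalent one, and along such a ray the boundary is met at most once. And the product
  sigma-algebra knows coordinates, not the summation norm: norm-open sets become measurable through
  rounded finite sequences, which makes \<open>\<Psi>\<close> a random variable. The convergence on
  lines rests on one fact: the integral of a derivative over an interval is an increment, and
  increments converge as soon as the functions do.\<close>

lemma vitali_intervals:
  fixes O1 S :: "real set" and P :: "real \<Rightarrow> real \<Rightarrow> bool"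
  assumes "open O1" "S \<subseteq> O1"
    and cover: "\<And>x d. x \<in> S \<Longrightarrow> 0 < d \<Longrightarrow> \<exists>u v. u < x \<and> x < v \<and> v - u < d \<and> P u v"
  obtains C :: "(real \<times> real) set" where "countable C" "\<And>u v. (u,v) \<in> C \<Longrightarrow> u < v \<and> P u v \<and> {u<..<v} \<subseteq> O1"
    "disjoint_family_on (\<lambda>(u,v). {u<..<v}) C" "negligible (S - (\<Union>(u,v)\<in>C. {u<..<v}))"
proof -
  \<comment> \<open>Intervals are pairs of end points here; \<open>a\<close> and \<open>r\<close>
    turn them into centres and radii, the form in which the covering theorem for balls is
    applied.\<close>
  define K where "K = {(u,v). u < v \<and> P u v \<and> {u<..<v} \<subseteq> O1}"
  define a :: "real \<times> real \<Rightarrow> real" where "a = (\<lambda>(u,v). (u+v)/2)"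
  define r :: "real \<times> real \<Rightarrow> real" where "r = (\<lambda>(u,v). (v-u)/2)"
  have ball: "ball (a i) (r i) = (case i of (u,v) \<Rightarrow> {u<..<v})" for i
    by (cases i) (simp add: a_def r_def ball_eq_greaterThanLessThan field_simps)
  have S: "\<exists>i. i \<in> K \<and> x \<in> ball (a i) (r i) \<and> r i < d" if x: "x \<in> S" and d: "0 < d" for x d
  proof -
    obtain e where e: "e > 0" "ball x e \<subseteq> O1"
      using x \<open>S \<subseteq> O1\<close> \<open>open O1\<close> by (meson open_contains_ball subsetD)
    have "0 < min d e" using d e by simp
    then obtain u v where uv: "u < x" "x < v" "v - u < min d e" "P u v"
      using cover[OF x] by blast
    have "{u<..<v} \<subseteq> ball x e"
      using uv by (auto simp: dist_real_def)
    then have "(u,v) \<in> K" using uv e by (auto simp: K_def)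
    moreover have "x \<in> ball (a (u,v)) (r (u,v))" using uv by (subst ball) auto
    moreover have "r (u,v) < d" using uv by (auto simp: r_def)
    ultimately show ?thesis by blast
  qed
  obtain C where C: "countable C" "C \<subseteq> K"
     "pairwise (\<lambda>i j. disjnt (ball (a i) (r i)) (ball (a j) (r j))) C"
     "negligible(S - (\<Union>i\<in>C. ball (a i) (r i)))"
    using S by (rule Vitali_covering_theorem_balls[where K=K and a=a and r=r and S=S])
  show ?thesis
  proof (rule that[of C])
    show "disjoint_family_on (\<lambda>(u,v). {u<..<v}) C"
      using C(3) unfolding disjoint_family_on_def pairwise_def ball disjnt_def by blast
    show "negligible (S - (\<Union>(u,v)\<in>C. {u<..<v}))" using C(4) unfolding ball .
  qed (use C in \<open>auto simp: K_def\<close>)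
qed

text \<open>Continuity of \<open>F\<close> makes single points null, so the formula for closed
  intervals carries over to open ones, the intervals that Vitali's theorem provides.\<close>

lemma emeasure_interval_measure_Ioo:
  assumes "u < v" "mono F" "continuous_on UNIV F"
  shows "emeasure (interval_measure F) {u<..<v} = ennreal (F v - F u)"
proof -
  have F: "\<And>x y. x \<le> y \<Longrightarrow> F x \<le> F y" using assms(2) by (auto simp: mono_def)
  have c: "\<And>a. continuous (at_right a) F"
    using assms(3) by (simp add: continuous_on_eq_continuous_within continuous_at_imp_continuous_within)
  have "emeasure (interval_measure F) {u..v} = ennreal (F v - F u)"
    by (rule emeasure_interval_measure_Icc) (use assms F in \<open>auto intro: continuous_on_subset\<close>)
  moreover have p: "emeasure (interval_measure F) {x} = 0" for x
    using emeasure_interval_measure_Icc[of x x F] F assms(3) by (auto intro: continuous_on_subset)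
  moreover have "emeasure (interval_measure F) {u..v} = emeasure (interval_measure F) {u<..<v}"
  proof (rule emeasure_eq_AE)
    have "AE x in interval_measure F. x \<notin> {u}" "AE x in interval_measure F. x \<notin> {v}"
      by (rule AE_not_in; simp add: null_sets_def p)+
    then show "AE x in interval_measure F. (x \<in> {u..v}) = (x \<in> {u<..<v})"
      by eventually_elim auto
  qed auto
  ultimately show ?thesis by simp
qed

text \<open>Summation over the disjoint Vitali family turns a comparison on small intervals into one
  on a single open set. What the family misses is null for Lebesgue measure only, so the conclusion
  compares the measures of \<open>U\<close> and not those of \<open>S\<close>.\<close>

lemma vitali_measure_le:
  fixes M N :: "real measure"
  assumes [measurable_cong]: "sets M = sets borel" "sets N = sets borel"
    and "open O1" "S \<subseteq> O1"
    and cover: "\<And>x d. x \<in> S \<Longrightarrow> 0 < d \<Longrightarrow>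
      \<exists>u v. u < x \<and> x < v \<and> v - u < d \<and> s * emeasure M {u<..<v} \<le> c * emeasure N {u<..<v}"
  obtains U where "open U" "U \<subseteq> O1" "negligible (S - U)" "s * emeasure M U \<le> c * emeasure N U"
proof -
  obtain C where C: "countable C"
    "\<And>u v. (u,v) \<in> C \<Longrightarrow> u < v \<and> s * emeasure M {u<..<v} \<le> c * emeasure N {u<..<v} \<and> {u<..<v} \<subseteq> O1"
    "disjoint_family_on (\<lambda>(u,v). {u<..<v}) C" "negligible (S - (\<Union>(u,v)\<in>C. {u<..<v}))"
    by (rule vitali_intervals[OF \<open>open O1\<close> \<open>S \<subseteq> O1\<close>,
          of "\<lambda>u v. s * emeasure M {u<..<v} \<le> c * emeasure N {u<..<v}"])
       (use cover in auto)
  let ?U = "\<Union>(u,v)\<in>C. {u<..<v}"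
  have *: "emeasure L ?U = (\<integral>\<^sup>+i. emeasure L (case i of (u,v) \<Rightarrow> {u<..<v}) \<partial>count_space C)"
    if "sets L = sets borel" for L
    by (rule emeasure_UN_countable) (use C that in auto)
  show ?thesis
  proof (rule that[of ?U])
    show "s * emeasure M ?U \<le> c * emeasure N ?U"
      unfolding *[OF assms(1)] *[OF assms(2)]
      by (subst (1 2) nn_integral_cmult[symmetric]; (rule nn_integral_mono)?) (use C(2) in auto)
  qed (use C in auto)
qed

text \<open>For each bound on the length the union of the admissible open intervals is open,
  whatever \<open>P\<close> is, so the set is a countable intersection of open sets.\<close>

lemma sets_small_intervals:
  fixes P :: "real \<Rightarrow> real \<Rightarrow> bool"
  shows "{x. \<forall>d>0. \<exists>u v. u < x \<and> x < v \<and> v - u < d \<and> P u v} \<in> sets borel"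
proof -
  have "{x. \<forall>d>0. \<exists>u v. u < x \<and> x < v \<and> v - u < d \<and> P u v}
     = (\<Inter>n. \<Union>{{u<..<v} |u v. v - u < 1 / real (Suc n) \<and> P u v})" (is "?L = ?R")
  proof (intro set_eqI iffI)
    fix x assume x: "x \<in> ?L"
    show "x \<in> ?R"
    proof
      fix n
      obtain u v where "u < x" "x < v" "v - u < 1 / real (Suc n)" "P u v"
        using x by (auto dest!: spec[of _ "1 / real (Suc n)"])
      then show "x \<in> \<Union>{{u<..<v} |u v. v - u < 1 / real (Suc n) \<and> P u v}"
        by (intro UnionI[of "{u<..<v}"]) auto
    qed
  next
    fix x assume x: "x \<in> ?R"
    show "x \<in> ?L"
    proof (clarify)
      fix d :: real assume "d > 0"
      then obtain n where n: "1 / real (Suc n) < d" using nat_approx_posE by blast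
      from x have "x \<in> \<Union>{{u<..<v} |u v. v - u < 1 / real (Suc n) \<and> P u v}" by blast
      then show "\<exists>u v. u < x \<and> x < v \<and> v - u < d \<and> P u v"
        using n by fastforce
    qed
  qed
  moreover have "open (\<Union>{{u<..<v} |u v. v - u < 1 / real (Suc n) \<and> P u v})" for n
    by (rule open_Union) auto
  ultimately show ?thesis by (auto intro!: borel_open)
qed

lemma emeasure_lborel_le_open_of_negligible:
  assumes "S \<in> sets borel" "U \<in> sets borel" "negligible (S - U)"
  shows "emeasure lborel S \<le> emeasure lborel U"
proof (rule emeasure_mono_AE)
  have "S - U \<in> null_sets lborel"
    using assms by (auto simp: negligible_iff_null_sets null_sets_completion_iff)
  then have "AE x in lborel. x \<notin> S - U" by (rule AE_not_in)
  then show "AE x in lborel. x \<in> S \<longrightarrow> x \<in> U" by eventually_elim auto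
qed (use assms in auto)

text \<open>Vitali's theorem is used twice: first for small intervals on which the increments of \<open>F\<close> are at
  most \<open>r\<close> times their length, and then, inside their union, for small intervals on which
  they are at least \<open>R\<close> times their length.\<close>

lemma null_sets_derivates_differ:
  fixes F :: "real \<Rightarrow> real"
  assumes mono: "mono F" and cont: "continuous_on UNIV F" and "0 \<le> r" "r < R"
  defines "A \<equiv> {x. \<forall>d>0. \<exists>u v. u < x \<and> x < v \<and> v - u < d \<and> F v - F u \<le> r * (v - u)}"
    and "B \<equiv> {x. \<forall>d>0. \<exists>u v. u < x \<and> x < v \<and> v - u < d \<and> R * (v - u) \<le> F v - F u}"
  shows "A \<inter> B \<in> null_sets lborel"
proof -
  have meas [measurable]: "A \<in> sets borel" "B \<in> sets borel"
    unfolding A_def B_def by (rule sets_small_intervals)+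
  have Ioo: "emeasure (interval_measure F) {u<..<v} = ennreal (F v - F u)" if "u < v" for u v
    by (rule emeasure_interval_measure_Ioo[OF that mono cont])
  have incr: "F u \<le> F v" if "u < v" for u v using mono that by (auto simp: mono_def)
  \<comment> \<open>Bounded windows make the Lebesgue measure finite, so that it can be cancelled at
    the end.\<close>
  have bounded_null: "A \<inter> B \<inter> {-real n<..<real n} \<in> null_sets lborel" for n
  proof -
    let ?S = "A \<inter> B \<inter> {-real n<..<real n}"
    have S[measurable]: "?S \<in> sets borel" by measurable
    have fin: "emeasure lborel ?S < \<infinity>"
      by (rule le_less_trans[OF emeasure_mono[of ?S "{-real n<..<real n}" lborel]]) auto
    \<comment> \<open>With \<open>mu\<close> the measure of the increments of \<open>F\<close>, the
      chain is \<open>R * |S| \<le> R * |V| \<le> mu V \<le> mu U \<le> r * |U| \<le> r * (|S| +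
      e)\<close>.\<close>
    have bd: "R * emeasure lborel ?S \<le> r * (emeasure lborel ?S + ennreal e)" if "e > 0" for e
    proof -
      obtain O1 where O1: "open O1" "?S \<subseteq> O1" "emeasure lborel O1 \<le> emeasure lborel ?S + ennreal e"
      proof -
        obtain T where "open T" "?S \<subseteq> T" "emeasure lebesgue (T - ?S) < ennreal e"
          using sets_lebesgue_outer_open[of ?S e] \<open>e > 0\<close> S by (metis sets_completionI_sets sets_lborel)
        moreover have "emeasure lborel T \<le> emeasure lborel ?S + emeasure lborel (T - ?S)"
        proof -
          have "T = ?S \<union> (T - ?S)" using \<open>?S \<subseteq> T\<close> by blast
          then show ?thesis using emeasure_subadditive[of ?S lborel "T - ?S"] \<open>open T\<close> S
            by (metis borel_open sets.Diff sets_lborel)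
        qed
        moreover have "emeasure lebesgue (T - ?S) = emeasure lborel (T - ?S)"
          by (subst emeasure_completion) (use \<open>open T\<close> S in \<open>auto intro!: sets.Diff borel_open\<close>)
        ultimately show ?thesis
          by (intro that[of T]) (auto elim!: order_trans intro!: add_left_mono simp: less_imp_le)
      qed
      obtain U where U: "open U" "U \<subseteq> O1" "negligible (?S - U)"
        "1 * emeasure (interval_measure F) U \<le> ennreal r * emeasure lborel U"
      proof (rule vitali_measure_le[of "interval_measure F" lborel O1 ?S 1 "ennreal r"])
        fix x d :: real assume "x \<in> ?S" "0 < d"
        then obtain u v where *: "u < x" "x < v" "v - u < d" "F v - F u \<le> r * (v - u)"
          unfolding A_def by blast
        then show "\<exists>u v. u < x \<and> x < v \<and> v - u < d \<and>
            1 * emeasure (interval_measure F) {u<..<v} \<le> ennreal r * emeasure lborel {u<..<v}"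
          using \<open>0 \<le> r\<close> by (intro exI[of _ u] exI[of _ v]) (auto simp: Ioo ennreal_mult[symmetric])
      qed (use O1 in auto)
      obtain V where V: "open V" "V \<subseteq> U" "negligible (?S \<inter> U - V)"
        "ennreal R * emeasure lborel V \<le> 1 * emeasure (interval_measure F) V"
      proof (rule vitali_measure_le[of lborel "interval_measure F" U "?S \<inter> U" "ennreal R" 1])
        fix x d :: real assume "x \<in> ?S \<inter> U" "0 < d"
        then obtain u v where *: "u < x" "x < v" "v - u < d" "R * (v - u) \<le> F v - F u"
          unfolding B_def by blast
        then show "\<exists>u v. u < x \<and> x < v \<and> v - u < d \<and>
            ennreal R * emeasure lborel {u<..<v} \<le> 1 * emeasure (interval_measure F) {u<..<v}"
          using \<open>0 \<le> r\<close> \<open>r < R\<close>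
          by (intro exI[of _ u] exI[of _ v]) (auto simp: Ioo ennreal_mult[symmetric] incr intro!: ennreal_leI)
      qed (use U in auto)
      have "negligible (?S - V)"
        by (rule negligible_subset[OF negligible_Un[OF U(3) V(3)]]) auto
      then have "R * emeasure lborel ?S \<le> R * emeasure lborel V"
        using V(1) by (intro mult_left_mono emeasure_lborel_le_open_of_negligible) (auto intro: borel_open)
      also have "\<dots> \<le> emeasure (interval_measure F) V" using V by simp
      also have "\<dots> \<le> emeasure (interval_measure F) U" using V U by (intro emeasure_mono) auto
      also have "\<dots> \<le> r * emeasure lborel U" using U by simp
      also have "\<dots> \<le> r * (emeasure lborel ?S + ennreal e)"
        using U O1 by (intro mult_left_mono order_trans[OF _ O1(3)] emeasure_mono) auto
      finally show ?thesis .
    qed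
    define m where "m = measure lborel ?S"
    have em: "emeasure lborel ?S = ennreal m"
      using fin unfolding m_def by (simp add: emeasure_eq_ennreal_measure)
    have m0: "m \<ge> 0" by (simp add: m_def)
    have "R * m \<le> r * (m + e)" if "e > 0" for e
      using bd[OF that] \<open>0 \<le> r\<close> \<open>r < R\<close> m0 that
      by (simp add: em ennreal_mult[symmetric] ennreal_plus[symmetric] del: ennreal_plus)
    then have "R * m \<le> r * m + e" if "e > 0" for e
    proof -
      \<comment> \<open>Dividing by \<open>r + 1\<close> instead of \<open>r\<close> also covers
        \<open>r = 0\<close>.\<close>
      have "r * (m + e / (r + 1)) \<le> r * m + e"
        using \<open>0 \<le> r\<close> that by (simp add: field_simps)
      then show ?thesis
        using \<open>\<And>e. e > 0 \<Longrightarrow> R * m \<le> r * (m + e)\<close>[of "e / (r + 1)"] \<open>0 \<le> r\<close> that by simp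
    qed
    then have "R * m \<le> r * m" by (rule field_le_epsilon)
    then have "m * (R - r) \<le> 0" by (simp add: algebra_simps)
    then have "m = 0" using m0 \<open>r < R\<close> by (simp add: mult_le_0_iff)
    then show ?thesis using em S by (simp add: null_sets_def)
  qed
  have "A \<inter> B = (\<Union>n. A \<inter> B \<inter> {-real n<..<real n})"
  proof (intro set_eqI iffI)
    fix x assume "x \<in> A \<inter> B"
    moreover obtain n where "\<bar>x\<bar> < real n" using reals_Archimedean2 by blast
    ultimately show "x \<in> (\<Union>n. A \<inter> B \<inter> {-real n<..<real n})" by (auto intro!: exI[of _ n])
  qed auto
  also have "\<dots> \<in> null_sets lborel" using bounded_null by (intro null_sets_UN) auto
  finally show ?thesis .
qed

section \<open>Differentiability of Lipschitz functions almost everywhere\<close>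

lemma lipschitz_continuous_on:
  fixes f :: "real \<Rightarrow> real"
  assumes lip: "\<And>x y. \<bar>f x - f y\<bar> \<le> C * \<bar>x - y\<bar>"
  shows "continuous_on A f"
proof (rule continuous_onI)
  fix x e :: real assume "e > 0"
  have "C * \<bar>1\<bar> \<ge> 0" using lip[of 0 1] by (smt (verit))
  then have "C \<ge> 0" by simp
  show "\<exists>d>0. \<forall>x'\<in>A. dist x' x < d \<longrightarrow> dist (f x') (f x) \<le> e"
  proof (intro exI[of _ "e / (C + 1)"] conjI ballI impI)
    show "e / (C + 1) > 0" using \<open>e > 0\<close> \<open>C \<ge> 0\<close> by simp
    fix x' assume "dist x' x < e / (C + 1)"
    then have "\<bar>x' - x\<bar> * (C + 1) \<le> e" using \<open>C \<ge> 0\<close> by (simp add: dist_real_def field_simps)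
    then show "dist (f x') (f x) \<le> e"
      using lip[of x' x] by (simp add: dist_real_def algebra_simps)
  qed
qed

text \<open>The intervals in the hypothesis contain \<open>x\<close> in their interior, as in a
  Vitali covering. Letting one end point tend to \<open>x\<close>, by continuity of
  \<open>F\<close>, gives the one-sided difference quotients.\<close>

lemma has_real_derivative_small_intervals:
  fixes F :: "real \<Rightarrow> real"
  assumes cont: "continuous_on UNIV F"
    and *: "\<And>e. e > 0 \<Longrightarrow> \<exists>d>0. \<forall>u v. u < x \<and> x < v \<and> v - u < d \<longrightarrow> \<bar>F v - F u - L * (v - u)\<bar> \<le> e * (v - u)"
  shows "(F has_real_derivative L) (at x)"
  unfolding has_field_derivative_iff
proof (rule tendstoI)
  have isc: "isCont F y" for y using cont by (simp add: continuous_on_eq_continuous_at)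
  fix e :: real assume "e > 0"
  obtain d where d: "d > 0"
    "\<And>u v. u < x \<Longrightarrow> x < v \<Longrightarrow> v - u < d \<Longrightarrow> \<bar>F v - F u - L * (v - u)\<bar> \<le> e / 2 * (v - u)"
    using *[of "e / 2"] \<open>e > 0\<close> by auto
  have right: "\<bar>F v - F x - L * (v - x)\<bar> \<le> e / 2 * (v - x)" if "x < v" "v < x + d" for v
  proof (rule tendsto_le[OF trivial_limit_at_left_real])
    show "((\<lambda>u. \<bar>F v - F u - L * (v - u)\<bar>) \<longlongrightarrow> \<bar>F v - F x - L * (v - x)\<bar>) (at_left x)"
      by (intro tendsto_intros) (use isc in \<open>auto simp: isCont_def intro: filterlim_mono at_le\<close>)
    show "((\<lambda>u. e / 2 * (v - u)) \<longlongrightarrow> e / 2 * (v - x)) (at_left x)"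
      by (intro tendsto_intros)
    show "\<forall>\<^sub>F u in at_left x. \<bar>F v - F u - L * (v - u)\<bar> \<le> e / 2 * (v - u)"
      unfolding eventually_at_left_field
      by (intro exI[of _ "v - d"] conjI allI impI d) (use that in auto)
  qed
  have left: "\<bar>F x - F u - L * (x - u)\<bar> \<le> e / 2 * (x - u)" if "u < x" "x - d < u" for u
  proof (rule tendsto_le[OF trivial_limit_at_right_real])
    show "((\<lambda>v. \<bar>F v - F u - L * (v - u)\<bar>) \<longlongrightarrow> \<bar>F x - F u - L * (x - u)\<bar>) (at_right x)"
      by (intro tendsto_intros) (use isc in \<open>auto simp: isCont_def intro: filterlim_mono at_le\<close>)
    show "((\<lambda>v. e / 2 * (v - u)) \<longlongrightarrow> e / 2 * (x - u)) (at_right x)"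
      by (intro tendsto_intros)
    show "\<forall>\<^sub>F v in at_right x. \<bar>F v - F u - L * (v - u)\<bar> \<le> e / 2 * (v - u)"
      unfolding eventually_at_right_field
      by (intro exI[of _ "u + d"] conjI allI impI d) (use that in auto)
  qed
  show "\<forall>\<^sub>F y in at x. dist ((F y - F x) / (y - x)) L < e"
    unfolding eventually_at
  proof (intro exI[of _ d] conjI ballI impI)
    fix y assume y: "y \<noteq> x \<and> dist y x < d"
    have "\<bar>F y - F x - L * (y - x)\<bar> \<le> e / 2 * \<bar>y - x\<bar>"
    proof (cases "y > x")
      case True then show ?thesis using right[of y] y by (auto simp: dist_real_def)
    next
      case False
      then have "\<bar>F y - F x - L * (y - x)\<bar> = \<bar>F x - F y - L * (x - y)\<bar>" by (simp add: algebra_simps)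
      then show ?thesis using left[of y] False y by (auto simp: dist_real_def)
    qed
    moreover have "(F y - F x) / (y - x) - L = (F y - F x - L * (y - x)) / (y - x)"
      using y by (simp add: field_simps)
    ultimately have "\<bar>(F y - F x) / (y - x) - L\<bar> \<le> e / 2"
      using y by (simp add: abs_divide divide_le_eq)
    then show "dist ((F y - F x) / (y - x)) L < e"
      using \<open>e > 0\<close> by (simp add: dist_real_def)
  qed (use d in auto)
qed

theorem lipschitz_AE_differentiable:
  fixes f :: "real \<Rightarrow> real"
  assumes lip: "\<And>x y. \<bar>f x - f y\<bar> \<le> C * \<bar>x - y\<bar>"
  shows "AE x in lborel. f field_differentiable at x"
proof -
  \<comment> \<open>Adding \<open>C * x\<close> makes the function increasing, so that its
    increments define a measure, with slopes between \<open>0\<close> and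
    \<open>2 * C\<close>.\<close>
  define F where "F x = f x + C * x" for x
  have cont: "continuous_on UNIV F"
    unfolding F_def by (intro continuous_intros lipschitz_continuous_on[OF lip])
  have C: "C * (y - x) \<ge> \<bar>f y - f x\<bar>" if "x \<le> y" for x y using lip[of y x] that by simp
  have mono: "mono F"
    by (rule monoI) (use C in \<open>fastforce simp: F_def algebra_simps\<close>)
  have up: "F v - F u \<le> 2 * C * (v - u)" if "u \<le> v" for u v
    using C[OF that] by (simp add: F_def algebra_simps)
  define A where "A r = {x. \<forall>d>0. \<exists>u v. u < x \<and> x < v \<and> v - u < d \<and> F v - F u \<le> r * (v - u)}" for r
  define B where "B r = {x. \<forall>d>0. \<exists>u v. u < x \<and> x < v \<and> v - u < d \<and> r * (v - u) \<le> F v - F u}" for r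
  have "AE x in lborel. \<forall>r\<in>\<rat>. \<forall>R\<in>\<rat>. 0 \<le> r \<longrightarrow> r < R \<longrightarrow> x \<notin> A r \<inter> B R"
  proof (simp only: AE_ball_countable[OF countable_rat], intro ballI)
    fix r R :: real
    show "AE x in lborel. 0 \<le> r \<longrightarrow> r < R \<longrightarrow> x \<notin> A r \<inter> B R"
    proof (cases "0 \<le> r \<and> r < R")
      case True
      then show ?thesis using null_sets_derivates_differ[OF mono cont, of r R]
        by (auto simp: A_def B_def dest: AE_not_in)
    qed auto
  qed
  then show ?thesis
  proof eventually_elim
    case (elim x)
    \<comment> \<open>\<open>T\<close> consists of the bounds \<open>r\<close> that slopes obey on
      arbitrarily small intervals around \<open>x\<close>. It is an upper set, and its infimum is
      the lower derivate; it contains \<open>2 * C\<close>, which bounds all slopes, and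
      \<open>0\<close> bounds it from below.\<close>
    define T where "T = {r. r \<ge> 0 \<and> x \<in> A r}"
    have Tup: "r' \<in> T" if "r \<in> T" "r \<le> r'" for r r'
      unfolding T_def
    proof (safe)
      show "0 \<le> r'" using that by (auto simp: T_def)
      show "x \<in> A r'"
        unfolding A_def
      proof safe
        fix d :: real assume "d > 0"
        then obtain u v where "u < x" "x < v" "v - u < d" "F v - F u \<le> r * (v - u)"
          using \<open>r \<in> T\<close> unfolding T_def A_def by blast
        moreover have "r * (v - u) \<le> r' * (v - u)"
          using mult_right_mono[of r r' "v - u"] calculation that by linarith
        ultimately show "\<exists>u v. u < x \<and> x < v \<and> v - u < d \<and> F v - F u \<le> r' * (v - u)"
          by (intro exI[of _ u] exI[of _ v] conjI) linarith+
      qed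
    qed
    have "2 * C \<in> T"
    proof -
      have "C \<ge> 0" using C[of 0 1] by simp
      moreover have "\<exists>u v. u < x \<and> x < v \<and> v - u < d \<and> F v - F u \<le> 2 * C * (v - u)" if "d > 0" for d
        using that up[of "x - d / 3" "x + d / 3"]
        by (intro exI[of _ "x - d / 3"] exI[of _ "x + d / 3"] conjI) linarith+
      ultimately show ?thesis by (auto simp: T_def A_def)
    qed
    then have T: "T \<noteq> {}" "bdd_below T" by (blast, auto simp: T_def intro!: bdd_belowI[of _ 0])
    define L where "L = Inf T"
    have L0: "L \<ge> 0" unfolding L_def using T by (intro cInf_greatest) (auto simp: T_def)
    have "(F has_real_derivative L) (at x)"
    proof (rule has_real_derivative_small_intervals[OF cont])
      fix e :: real assume "e > 0"
      \<comment> \<open>If slopes of at least \<open>R\<close> occurred on arbitrarily small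
        intervals, \<open>x\<close> would lie in \<open>A r\<close> and in \<open>B R\<close> with
        rational \<open>r < R\<close>, which is excluded almost everywhere.\<close>
      obtain r where r: "r \<in> \<rat>" "L < r" "r < L + e / 2"
        using Rats_dense_in_real[of L "L + e / 2"] \<open>e > 0\<close> by auto
      obtain R where R: "R \<in> \<rat>" "r < R" "R < L + e"
        using Rats_dense_in_real[of r "L + e"] r by auto
      obtain t where "t \<in> T" "t < r" using cInf_lessD[OF T(1), of r] r by (auto simp: L_def)
      then have "x \<in> A r" using Tup[of t r] by (auto simp: T_def)
      then have "x \<notin> B R" using elim r R L0 by auto
      then obtain d1 where d1: "d1 > 0" "\<And>u v. u < x \<Longrightarrow> x < v \<Longrightarrow> v - u < d1 \<Longrightarrow> F v - F u < R * (v - u)"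
        unfolding B_def by force
      \<comment> \<open>For the lower estimate, slopes of at most \<open>L - e\<close> on
        arbitrarily small intervals would put \<open>L - e\<close> into \<open>T\<close>, below its
        infimum; if \<open>L - e\<close> is negative, monotonicity of \<open>F\<close>
        suffices.\<close>
      have "\<exists>d>0. \<forall>u v. u < x \<and> x < v \<and> v - u < d \<longrightarrow> (L - e) * (v - u) \<le> F v - F u"
      proof (cases "L - e \<ge> 0")
        case True
        have "L - e \<notin> T" using cInf_lower[OF _ T(2), of "L - e"] \<open>e > 0\<close> by (auto simp: L_def)
        then have "x \<notin> A (L - e)" using True by (auto simp: T_def)
        then show ?thesis unfolding A_def by force
      next
        case False
        have "(L - e) * (v - u) \<le> F v - F u" if "u < v" for u v
        proof -
          have "(L - e) * (v - u) \<le> 0" using False that by (simp add: mult_nonpos_nonneg)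
          also have "0 \<le> F v - F u" using mono that by (simp add: mono_def)
          finally show ?thesis .
        qed
        then show ?thesis by (intro exI[of _ 1]) auto
      qed
      then obtain d2 where d2: "d2 > 0"
        "\<And>u v. u < x \<Longrightarrow> x < v \<Longrightarrow> v - u < d2 \<Longrightarrow> (L - e) * (v - u) \<le> F v - F u"
        by auto
      show "\<exists>d>0. \<forall>u v. u < x \<and> x < v \<and> v - u < d \<longrightarrow> \<bar>F v - F u - L * (v - u)\<bar> \<le> e * (v - u)"
      proof (intro exI[of _ "min d1 d2"] conjI allI impI)
        fix u v assume uv: "u < x \<and> x < v \<and> v - u < min d1 d2"
        have "R * (v - u) \<le> (L + e) * (v - u)" using R uv by (intro mult_right_mono) auto
        then show "\<bar>F v - F u - L * (v - u)\<bar> \<le> e * (v - u)"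
          using d1(2)[of u v] d2(2)[of u v] uv by (auto simp: algebra_simps)
      qed (use d1 d2 in auto)
    qed
    then have "((\<lambda>y. F y - C * y) has_real_derivative L - C) (at x)"
      by (auto intro!: derivative_eq_intros)
    then show "f field_differentiable at x"
      unfolding field_differentiable_def F_def by auto
  qed
qed


section \<open>The derivative as a bounded measurable function, and its integral\<close>

text \<open>Only the increments \<open>1 / (n + 1)\<close> are used: the limit is a measurable
  function of \<open>x\<close> for every measurable \<open>f\<close>, and it agrees with the
  derivative wherever one exists.\<close>

definition seq_deriv :: "(real \<Rightarrow> real) \<Rightarrow> real \<Rightarrow> real" where
  "seq_deriv f x = lim (\<lambda>n. (f (x + 1 / real (Suc n)) - f x) * real (Suc n))"

lemma seq_deriv_eq:
  assumes "(f has_real_derivative D) (at x)"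
  shows "(\<lambda>n. (f (x + 1 / real (Suc n)) - f x) * real (Suc n)) \<longlonglongrightarrow> D" "seq_deriv f x = D"
proof -
  have "((\<lambda>h. (f (x + h) - f x) / h) \<longlongrightarrow> D) (at 0)"
    using assms by (simp add: DERIV_def)
  moreover have "filterlim (\<lambda>n. 1 / real (Suc n)) (at 0) sequentially"
    unfolding filterlim_at using LIMSEQ_inverse_real_of_nat by (auto simp: inverse_eq_divide)
  ultimately have "(\<lambda>n. (f (x + 1 / real (Suc n)) - f x) / (1 / real (Suc n))) \<longlonglongrightarrow> D"
    by (rule filterlim_compose)
  then show *: "(\<lambda>n. (f (x + 1 / real (Suc n)) - f x) * real (Suc n)) \<longlonglongrightarrow> D" by simp
  show "seq_deriv f x = D" unfolding seq_deriv_def by (rule limI[OF *])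
qed

lemma seq_deriv_eq_deriv: "f field_differentiable at x \<Longrightarrow> seq_deriv f x = deriv f x"
  by (metis field_differentiable_derivI seq_deriv_eq(2))

lemma abs_deriv_le_lipschitz:
  assumes lip: "\<And>x y. \<bar>f x - f y\<bar> \<le> C * \<bar>x - y :: real\<bar>" and "(f has_real_derivative D) (at x)"
  shows "\<bar>D\<bar> \<le> C"
proof (rule tendsto_upperbound)
  show "(\<lambda>n. \<bar>(f (x + 1 / real (Suc n)) - f x) * real (Suc n)\<bar>) \<longlonglongrightarrow> \<bar>D\<bar>"
    by (intro tendsto_rabs seq_deriv_eq assms)
  show "\<forall>\<^sub>F n in sequentially. \<bar>(f (x + 1 / real (Suc n)) - f x) * real (Suc n)\<bar> \<le> C"
  proof (intro always_eventually allI)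
    fix n
    have "\<bar>f (x + 1 / real (Suc n)) - f x\<bar> * real (Suc n) \<le> C * (1 / real (Suc n)) * real (Suc n)"
      using lip[of "x + 1 / real (Suc n)" x] by (intro mult_right_mono) auto
    then show "\<bar>(f (x + 1 / real (Suc n)) - f x) * real (Suc n)\<bar> \<le> C"
      by (simp add: abs_mult)
  qed
qed auto

lemma abs_difference_quotient_le:
  assumes lip: "\<And>x y. \<bar>f x - f y\<bar> \<le> C * \<bar>x - y :: real\<bar>"
  shows "\<bar>(f (x + 1 / real (Suc n)) - f x) * real (Suc n)\<bar> \<le> C"
proof -
  have "\<bar>f (x + 1 / real (Suc n)) - f x\<bar> * real (Suc n) \<le> C * (1 / real (Suc n)) * real (Suc n)"
    using lip[of "x + 1 / real (Suc n)" x] by (intro mult_right_mono) auto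
  then show ?thesis by (simp add: abs_mult)
qed

lemma borel_measurable_seq_deriv:
  assumes [measurable]: "f \<in> borel_measurable borel"
  shows "seq_deriv f \<in> borel_measurable borel"
  unfolding seq_deriv_def[abs_def] by measurable

lemma AE_abs_seq_deriv_le:
  assumes lip: "\<And>x y. \<bar>f x - f y\<bar> \<le> C * \<bar>x - y :: real\<bar>"
  shows "AE x in lborel. \<bar>seq_deriv f x\<bar> \<le> C"
  using lipschitz_AE_differentiable[OF lip]
  by eventually_elim (auto simp: field_differentiable_def seq_deriv_eq dest: abs_deriv_le_lipschitz[OF lip])

text \<open>With an antiderivative \<open>g\<close> of \<open>f\<close>, the integral of a
  difference quotient of \<open>f\<close> over \<open>{s..t}\<close> is the quotient of
  \<open>g\<close> at \<open>t\<close> minus that at \<open>s\<close>. The quotients of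
  \<open>f\<close> are bounded by \<open>C\<close>, so dominated convergence gives one side and
  differentiability of \<open>g\<close> the other.\<close>

lemma integral_seq_deriv:
  fixes f :: "real \<Rightarrow> real"
  assumes lip: "\<And>x y. \<bar>f x - f y\<bar> \<le> C * \<bar>x - y\<bar>" and "s \<le> t"
  shows "(\<integral>x. indicator {s..t} x * seq_deriv f x \<partial>lborel) = f t - f s"
proof -
  have cont: "continuous_on A f" for A by (rule lipschitz_continuous_on[OF lip])
  have [measurable]: "f \<in> borel_measurable borel" using cont by (rule borel_measurable_continuous_onI)
  have [measurable]: "seq_deriv f \<in> borel_measurable borel" by (rule borel_measurable_seq_deriv) measurable
  let ?q = "\<lambda>n x. (f (x + 1 / real (Suc n)) - f x) * real (Suc n)"
  have lim1: "(\<lambda>n. \<integral>x. indicator {s..t} x * ?q n x \<partial>lborel)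
      \<longlonglongrightarrow> (\<integral>x. indicator {s..t} x * seq_deriv f x \<partial>lborel)"
  proof (rule integral_dominated_convergence[where w = "\<lambda>x. C * indicator {s..t} x"])
    show "AE x in lborel. (\<lambda>n. indicator {s..t} x * ?q n x) \<longlonglongrightarrow> indicator {s..t} x * seq_deriv f x"
      using lipschitz_AE_differentiable[OF lip]
      by eventually_elim (auto simp: field_differentiable_def seq_deriv_eq(2) intro!: tendsto_mult seq_deriv_eq(1) simp del: of_nat_Suc)
    show "AE x in lborel. norm (indicator {s..t} x * ?q n x) \<le> C * indicator {s..t} x" for n
      using abs_difference_quotient_le[of f C, OF lip] by (auto simp: indicator_def simp del: of_nat_Suc)
    show "integrable lborel (\<lambda>x. C * indicator {s..t} x)"
      by (intro integrable_mult_right integrable_real_indicator) (use \<open>s \<le> t\<close> in auto)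
  qed auto
  \<comment> \<open>The interval exceeds \<open>{s..t}\<close> on both sides: \<open>g\<close> is
    differentiated at points up to \<open>t + 1\<close>, and two-sided derivatives need interior
    points.\<close>
  obtain g where g: "\<And>x. x \<in> {s - 1..t + 2} \<Longrightarrow> (g has_vector_derivative f x) (at x within {s - 1..t + 2})"
    using antiderivative_continuous[OF cont, of "s - 1" "t + 2"] by blast
  have g': "(g has_real_derivative f x) (at x)" if "s \<le> x" "x \<le> t + 1" for x
  proof -
    have "(g has_vector_derivative f x) (at x)"
      using g[of x] that by (auto simp: at_within_Icc_at)
    then show ?thesis by (simp add: has_real_derivative_iff_has_vector_derivative)
  qed
  have "(\<integral>x. indicator {s..t} x * ?q n x \<partial>lborel)
     = (g (t + 1 / real (Suc n)) - g t) * real (Suc n) - (g (s + 1 / real (Suc n)) - g s) * real (Suc n)" for n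
  proof -
    have h: "0 < 1 / real (Suc n)" "1 / real (Suc n) \<le> 1" by auto
    let ?h = "1 / real (Suc n)"
    have "(\<integral>x. ?q n x * indicator {s..t} x \<partial>lborel)
        = (g (t + ?h) - g t) * real (Suc n) - (g (s + ?h) - g s) * real (Suc n)"
    proof (subst integral_FTC_Icc_real[where F = "\<lambda>x. (g (x + ?h) - g x) * real (Suc n)"])
      fix x assume x: "s \<le> x" "x \<le> t"
      have "((\<lambda>x. g (x + ?h)) has_real_derivative f (x + ?h)) (at x)"
        unfolding DERIV_shift[symmetric] by (rule g'; use x h in linarith)
      then show "((\<lambda>x. (g (x + ?h) - g x) * real (Suc n)) has_real_derivative ?q n x) (at x)"
        using g'[of x] x by (auto intro!: derivative_eq_intros simp del: of_nat_Suc)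
      show "isCont (?q n) x"
      proof -
        have isc: "isCont f y" for y using cont[of UNIV] by (simp add: continuous_on_eq_continuous_at)
        have "isCont (\<lambda>x. f (x + ?h)) x" by (rule isCont_o2[OF _ isc]) (intro continuous_intros)
        then show ?thesis by (intro continuous_intros isc)
      qed
    qed (use \<open>s \<le> t\<close> in auto)
    then show ?thesis by (simp add: mult.commute)
  qed
  moreover have "(\<lambda>n. (g (t + 1 / real (Suc n)) - g t) * real (Suc n) - (g (s + 1 / real (Suc n)) - g s) * real (Suc n))
    \<longlonglongrightarrow> f t - f s"
    by (intro tendsto_diff seq_deriv_eq g') (use \<open>s \<le> t\<close> in auto)
  ultimately show ?thesis using lim1 LIMSEQ_unique by auto
qed

section \<open>Weak-star convergence of derivatives on the line\<close>

lemma tendsto_uniform_approx: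
  fixes X :: "nat \<Rightarrow> nat \<Rightarrow> 'b::real_normed_vector"
  assumes "\<And>i. X i \<longlonglongrightarrow> Y i" and "\<And>i n. norm (X i n - Z n) \<le> e i"
    and "\<And>i. norm (Y i - W) \<le> e i" and "e \<longlonglongrightarrow> 0"
  shows "Z \<longlonglongrightarrow> W"
proof (rule LIMSEQ_I)
  fix r :: real assume "r > 0"
  then have "\<forall>\<^sub>F i in sequentially. e i < r / 3" using order_tendstoD(2)[OF assms(4), of "r / 3"] by simp
  then obtain i where i: "e i < r / 3" by (auto simp: eventually_sequentially)
  obtain no where no: "\<And>n. n \<ge> no \<Longrightarrow> norm (X i n - Y i) < r / 3"
    using LIMSEQ_D[OF assms(1)[of i], of "r / 3"] \<open>r > 0\<close> by auto
  show "\<exists>no. \<forall>n\<ge>no. norm (Z n - W) < r"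
  proof (intro exI allI impI)
    fix n assume "n \<ge> no"
    have "Z n - W = - (X i n - Z n) + (X i n - Y i) + (Y i - W)" by simp
    then have "norm (Z n - W) \<le> norm (X i n - Z n) + norm (X i n - Y i) + norm (Y i - W)"
      by (metis norm_minus_cancel norm_triangle_ineq norm_triangle_le add_mono order_refl)
    then show "norm (Z n - W) < r"
      using assms(2)[of i n] assms(3)[of i] no[OF \<open>n \<ge> no\<close>] i by linarith
  qed
qed


lemma abs_le_of_AE_le_integral:
  fixes g :: "real \<Rightarrow> real" and h :: "real \<Rightarrow> 'b::{banach,second_countable_topology}"
  assumes [measurable]: "g \<in> borel_measurable borel" and g: "AE x in lborel. \<bar>g x\<bar> \<le> C"
    and h: "integrable lborel h"
  shows "integrable lborel (\<lambda>x. g x *\<^sub>R h x)"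
    "norm (\<integral>x. g x *\<^sub>R h x \<partial>lborel) \<le> C * (\<integral>x. norm (h x) \<partial>lborel)"
proof -
  have [measurable]: "h \<in> borel_measurable borel" using h by auto
  show int: "integrable lborel (\<lambda>x. g x *\<^sub>R h x)"
  proof (rule Bochner_Integration.integrable_bound[where f="\<lambda>x. C *\<^sub>R h x"])
    show "AE x in lborel. norm (g x *\<^sub>R h x) \<le> norm (C *\<^sub>R h x)"
      using g by eventually_elim (auto intro!: mult_right_mono)
  qed (use h in auto)
  have "norm (\<integral>x. g x *\<^sub>R h x \<partial>lborel) \<le> (\<integral>x. norm (g x *\<^sub>R h x) \<partial>lborel)"
    by (rule integral_norm_bound)
  also have "\<dots> \<le> (\<integral>x. C * norm (h x) \<partial>lborel)"
  proof (rule integral_mono_AE)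
    show "AE x in lborel. norm (g x *\<^sub>R h x) \<le> C * norm (h x)"
      using g by eventually_elim (auto intro!: mult_right_mono)
  qed (use h integrable_norm[OF int] in auto)
  finally show "norm (\<integral>x. g x *\<^sub>R h x \<partial>lborel) \<le> C * (\<integral>x. norm (h x) \<partial>lborel)" by simp
qed

text \<open>The common bound \<open>C\<close> makes the error of replacing \<open>h\<close> by
  \<open>hs i\<close> uniform in \<open>n\<close>, so the two limits may be exchanged.\<close>

lemma tendsto_integral_scaleR_approx:
  fixes g :: "nat \<Rightarrow> real \<Rightarrow> real" and h :: "real \<Rightarrow> 'b::{banach,second_countable_topology}"
  assumes meas: "\<And>n. g n \<in> borel_measurable borel" "g0 \<in> borel_measurable borel"
    and bd: "\<And>n. AE x in lborel. \<bar>g n x\<bar> \<le> C" "AE x in lborel. \<bar>g0 x\<bar> \<le> C"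
    and conv: "\<And>i. (\<lambda>n. \<integral>x. g n x *\<^sub>R hs i x \<partial>lborel) \<longlonglongrightarrow> (\<integral>x. g0 x *\<^sub>R hs i x \<partial>lborel)"
    and hs: "\<And>i. integrable lborel (hs i)" and h: "integrable lborel h"
    and lim: "(\<lambda>i. \<integral>x. norm (hs i x - h x) \<partial>lborel) \<longlonglongrightarrow> 0"
  shows "(\<lambda>n. \<integral>x. g n x *\<^sub>R h x \<partial>lborel) \<longlonglongrightarrow> (\<integral>x. g0 x *\<^sub>R h x \<partial>lborel)"
proof (rule tendsto_uniform_approx[OF conv])
  have *: "norm ((\<integral>x. k x *\<^sub>R hs i x \<partial>lborel) - (\<integral>x. k x *\<^sub>R h x \<partial>lborel)) \<le> C * (\<integral>x. norm (hs i x - h x) \<partial>lborel)"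
    if "k \<in> borel_measurable borel" "AE x in lborel. \<bar>k x\<bar> \<le> C" for k i
    using abs_le_of_AE_le_integral[OF that Bochner_Integration.integrable_diff[OF hs h]]
      abs_le_of_AE_le_integral(1)[OF that hs] abs_le_of_AE_le_integral(1)[OF that h]
    by (simp add: scaleR_diff_right)
  show "norm ((\<integral>x. g n x *\<^sub>R hs i x \<partial>lborel) - (\<integral>x. g n x *\<^sub>R h x \<partial>lborel)) \<le> C * (\<integral>x. norm (hs i x - h x) \<partial>lborel)" for i n
    by (rule * meas bd)+
  show "norm ((\<integral>x. g0 x *\<^sub>R hs i x \<partial>lborel) - (\<integral>x. g0 x *\<^sub>R h x \<partial>lborel)) \<le> C * (\<integral>x. norm (hs i x - h x) \<partial>lborel)" for i
    by (rule * meas bd)+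
  show "(\<lambda>i. C * (\<integral>x. norm (hs i x - h x) \<partial>lborel)) \<longlonglongrightarrow> 0"
    using tendsto_mult_left[OF lim, of C] by simp
qed

text \<open>If \<open>h\<close> is the indicator of an interval, the integrals are increments of
  \<open>f n\<close>, which converge by assumption. The good test functions are closed under sums,
  differences and dominated limits; a pi-system argument reaches the Borel sets, and simple
  functions give the rest.\<close>

lemma tendsto_integral_seq_deriv:
  fixes f :: "nat \<Rightarrow> real \<Rightarrow> real" and h :: "real \<Rightarrow> 'b::{banach,second_countable_topology}"
  assumes lip: "\<And>n x y. \<bar>f n x - f n y\<bar> \<le> C * \<bar>x - y\<bar>" and lim: "\<And>x. (\<lambda>n. f n x) \<longlonglongrightarrow> f0 x"
    and h: "integrable lborel h"
  shows "(\<lambda>n. \<integral>x. seq_deriv (f n) x *\<^sub>R h x \<partial>lborel) \<longlonglongrightarrow> (\<integral>x. seq_deriv f0 x *\<^sub>R h x \<partial>lborel)"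
proof -
  have lip0: "\<bar>f0 x - f0 y\<bar> \<le> C * \<bar>x - y\<bar>" for x y
    by (rule tendsto_upperbound[of "\<lambda>n. \<bar>f n x - f n y\<bar>" _ sequentially])
       (auto intro!: tendsto_intros lim always_eventually lip)
  have m: "seq_deriv k \<in> borel_measurable borel" if "\<And>x y. \<bar>k x - k y\<bar> \<le> C * \<bar>x - y\<bar>" for k
    by (intro borel_measurable_seq_deriv borel_measurable_continuous_onI lipschitz_continuous_on[OF that])
  note approx = tendsto_integral_scaleR_approx[where g="\<lambda>n. seq_deriv (f n)" and ?g0.0="seq_deriv f0" and C=C,
    OF m[OF lip] m[OF lip0] AE_abs_seq_deriv_le[OF lip] AE_abs_seq_deriv_le[OF lip0]]
  define T where "T k (h :: real \<Rightarrow> 'b) = (\<integral>x. seq_deriv k x *\<^sub>R h x \<partial>lborel)" for k h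
  define good where "good h \<longleftrightarrow> (\<lambda>n. T (f n) h) \<longlonglongrightarrow> T f0 h" for h
  have Tadd: "T k (\<lambda>x. h1 x + h2 x) = T k h1 + T k h2"
    if "\<And>x y. \<bar>k x - k y\<bar> \<le> C * \<bar>x - y\<bar>" "integrable lborel h1" "integrable lborel h2" for k h1 h2
    unfolding T_def scaleR_add_right
    by (intro Bochner_Integration.integral_add abs_le_of_AE_le_integral(1)[of _ C] m AE_abs_seq_deriv_le that)
  have Tdiff: "T k (\<lambda>x. h1 x - h2 x) = T k h1 - T k h2"
    if "\<And>x y. \<bar>k x - k y\<bar> \<le> C * \<bar>x - y\<bar>" "integrable lborel h1" "integrable lborel h2" for k h1 h2
    unfolding T_def scaleR_diff_right
    by (intro Bochner_Integration.integral_diff abs_le_of_AE_le_integral(1)[of _ C] m AE_abs_seq_deriv_le that)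
  have good_add: "good (\<lambda>x. h1 x + h2 x)" if "good h1" "good h2" "integrable lborel h1" "integrable lborel h2" for h1 h2
    using that unfolding good_def by (simp add: Tadd[OF lip] Tadd[OF lip0] tendsto_add)
  have good_diff: "good (\<lambda>x. h1 x - h2 x)" if "good h1" "good h2" "integrable lborel h1" "integrable lborel h2" for h1 h2
    using that unfolding good_def by (simp add: Tdiff[OF lip] Tdiff[OF lip0] tendsto_diff)
  have good_lim: "good h" if "\<And>i. good (hs i)" "\<And>i. integrable lborel (hs i)" "integrable lborel h"
    "integrable lborel w" "\<And>i x. norm (hs i x - h x) \<le> w x" "\<And>x. (\<lambda>i. hs i x) \<longlonglongrightarrow> h x" for hs h w
    unfolding good_def T_def
  proof (rule approx)
    show "(\<lambda>n. \<integral>x. seq_deriv (f n) x *\<^sub>R hs i x \<partial>lborel) \<longlonglongrightarrow> (\<integral>x. seq_deriv f0 x *\<^sub>R hs i x \<partial>lborel)" for i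
      using that(1) unfolding good_def T_def by auto
    have "(\<lambda>i. \<integral>x. norm (hs i x - h x) \<partial>lborel) \<longlonglongrightarrow> (\<integral>x. 0 \<partial>(lborel :: real measure))"
    proof (rule integral_dominated_convergence[where w=w])
      show "AE x in lborel. (\<lambda>i. norm (hs i x - h x)) \<longlonglongrightarrow> 0"
        using tendsto_norm_zero[OF LIM_zero[OF that(6)]] by auto
    qed (use that in auto)
    then show "(\<lambda>i. \<integral>x. norm (hs i x - h x) \<partial>lborel) \<longlonglongrightarrow> 0" by simp
  qed (use that in auto)
  have int_b: "integrable lborel (\<lambda>x. indicator (A \<inter> {- real i..real i}) x *\<^sub>R (c::'b))"
    if "A \<in> sets borel" for A i c
  proof -
    have "emeasure lborel (A \<inter> {- real i..real i}) < \<infinity>"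
      by (rule le_less_trans[OF emeasure_mono[of _ "{- real i..real i}"]]) (use that in auto)
    then show ?thesis using that by (intro integrable_scaleR_left) simp
  qed
  have good_Icc: "good (\<lambda>x. indicator {s..t} x *\<^sub>R c)" for s t c
  proof (cases "s \<le> t")
    case True
    have *: "T k (\<lambda>x. indicator {s..t} x *\<^sub>R c) = (k t - k s) *\<^sub>R c"
      if "\<And>x y. \<bar>k x - k y\<bar> \<le> C * \<bar>x - y\<bar>" for k
    proof -
      have "T k (\<lambda>x. indicator {s..t} x *\<^sub>R c) = (\<integral>x. (indicator {s..t} x * seq_deriv k x) *\<^sub>R c \<partial>lborel)"
        unfolding T_def by (intro Bochner_Integration.integral_cong) (auto simp: mult.commute)
      also have "\<dots> = (\<integral>x. indicator {s..t} x * seq_deriv k x \<partial>lborel) *\<^sub>R c"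
        using abs_le_of_AE_le_integral(1)[OF m[OF that] AE_abs_seq_deriv_le[OF that]
            integrable_real_indicator[of "{s..t}" lborel]]
        True by (intro integral_scaleR_left) (simp add: mult.commute)
      finally show ?thesis using integral_seq_deriv[OF that True] by simp
    qed
    show ?thesis unfolding good_def *[OF lip] *[OF lip0] by (intro tendsto_intros lim)
  qed (simp add: good_def T_def)
  \<comment> \<open>The windows \<open>{- real i..real i}\<close> keep the indicators integrable
    during the induction over Borel sets, where complements are taken; a dominated limit in
    \<open>i\<close> removes them later.\<close>
  have good_bounded: "good (\<lambda>x. indicator (A \<inter> {- real i..real i}) x *\<^sub>R c)" if "A \<in> sets borel" for A i c
  proof -
    have "A \<in> sigma_sets UNIV (range (\<lambda>(a, b). {a..b}) :: real set set)"
      using that unfolding borel_eq_atLeastAtMost by simp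
    have "Int_stable (range (\<lambda>(a, b). {a..b}) :: real set set)"
      by (auto simp: Int_stable_def)
    moreover have "range (\<lambda>(a, b). {a..b}) \<subseteq> Pow (UNIV :: real set)" by simp
    moreover note \<open>A \<in> sigma_sets UNIV (range (\<lambda>(a, b). {a..b}))\<close>
    ultimately show ?thesis
    proof (induction A rule: sigma_sets_induct_disjoint)
      fix A assume "A \<in> range (\<lambda>(a, b). {a..b::real})"
      then obtain a b where A: "A = {a..b}" by auto
      show "good (\<lambda>x. indicator (A \<inter> {- real i..real i}) x *\<^sub>R c)"
        unfolding A by (simp add: good_Icc)
    next
      show "good (\<lambda>x. indicator ({} \<inter> {- real i..real i}) x *\<^sub>R c)" by (simp add: good_def T_def)
    next
      fix A assume A: "A \<in> sigma_sets UNIV (range (\<lambda>(a, b). {a..b}) :: real set set)"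
        and IH: "good (\<lambda>x. indicator (A \<inter> {- real i..real i}) x *\<^sub>R c)"
      have A': "A \<in> sets borel" using A unfolding borel_eq_atLeastAtMost by simp
      have "(\<lambda>x. indicator ((UNIV - A) \<inter> {- real i..real i}) x *\<^sub>R c)
        = (\<lambda>x. indicator (UNIV \<inter> {- real i..real i}) x *\<^sub>R c - indicator (A \<inter> {- real i..real i}) x *\<^sub>R c)"
        by (auto simp: indicator_def fun_eq_iff)
      then show "good (\<lambda>x. indicator ((UNIV - A) \<inter> {- real i..real i}) x *\<^sub>R c)"
        using good_diff[OF _ IH int_b[of UNIV i c] int_b[OF A']] good_Icc[of "- real i" "real i" c] by simp
    next
      fix A :: "nat \<Rightarrow> real set"
      assume dis: "disjoint_family A" and A: "range A \<subseteq> sigma_sets UNIV (range (\<lambda>(a, b). {a..b}))"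
        and IH: "\<And>j. good (\<lambda>x. indicator (A j \<inter> {- real i..real i}) x *\<^sub>R c)"
      have A': "A j \<in> sets borel" for j using A unfolding borel_eq_atLeastAtMost by auto
      define hs where "hs n = (\<lambda>x. indicator ((\<Union>j<n. A j) \<inter> {- real i..real i}) x *\<^sub>R c)" for n
      have hs_int: "integrable lborel (hs n)" for n unfolding hs_def by (rule int_b) (use A' in auto)
      have "good (hs n)" for n
      proof (induction n)
        case 0 show ?case by (simp add: hs_def good_def T_def)
      next
        case (Suc n)
        have "A n \<inter> A j = {}" if "j < n" for j
          using dis that unfolding disjoint_family_on_def by (metis UNIV_I less_irrefl)
        then have "A n \<inter> (\<Union>j<n. A j) = {}" by auto
        then have "hs (Suc n) = (\<lambda>x. hs n x + indicator (A n \<inter> {- real i..real i}) x *\<^sub>R c)"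
          unfolding hs_def by (auto simp: indicator_def fun_eq_iff lessThan_Suc)
        then show ?case using good_add[OF Suc IH hs_int int_b[OF A']] by simp
      qed
      then show "good (\<lambda>x. indicator (\<Union> (range A) \<inter> {- real i..real i}) x *\<^sub>R c)"
      proof (rule good_lim[where w = "\<lambda>x. indicator (UNIV \<inter> {- real i..real i}) x *\<^sub>R norm c"])
        show "integrable lborel (hs n)" for n by (rule hs_int)
        show "integrable lborel (\<lambda>x. indicator (\<Union> (range A) \<inter> {- real i..real i}) x *\<^sub>R c)"
          by (rule int_b) (use A' in auto)
        have "emeasure lborel {- real i..real i} < \<infinity>" by simp
        then show "integrable lborel (\<lambda>x. indicator (UNIV \<inter> {- real i..real i}) x *\<^sub>R norm c)"
          by (intro integrable_scaleR_left) simp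
        show "norm (hs n x - indicator (\<Union> (range A) \<inter> {- real i..real i}) x *\<^sub>R c)
            \<le> indicator (UNIV \<inter> {- real i..real i}) x *\<^sub>R norm c" for n x
          by (auto simp: hs_def indicator_def)
        show "(\<lambda>n. hs n x) \<longlonglongrightarrow> indicator (\<Union> (range A) \<inter> {- real i..real i}) x *\<^sub>R c" for x
        proof (cases "x \<in> \<Union> (range A)")
          case True
          then obtain j where "x \<in> A j" by auto
          then have "\<forall>\<^sub>F n in sequentially. hs n x = indicator (\<Union> (range A) \<inter> {- real i..real i}) x *\<^sub>R c"
            by (intro eventually_sequentiallyI[of "Suc j"]) (auto simp: hs_def indicator_def)
          then show ?thesis by (rule tendsto_eventually)
        qed (auto simp: hs_def)
      qed
    qed
  qed
  have "good h"
    using h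
  proof (induction h rule: integrable_induct)
    case (base A c)
    show ?case
    proof (rule good_lim[where hs = "\<lambda>i x. indicator (A \<inter> {- real i..real i}) x *\<^sub>R c"
            and w = "\<lambda>x. indicator A x *\<^sub>R norm c"])
      show "good (\<lambda>x. indicator (A \<inter> {- real i..real i}) x *\<^sub>R c)" for i by (rule good_bounded) (use base in simp)
      show "integrable lborel (\<lambda>x. indicator (A \<inter> {- real i..real i}) x *\<^sub>R c)" for i
        by (rule int_b) (use base in simp)
      show "integrable lborel (\<lambda>x. indicator A x *\<^sub>R c)" "integrable lborel (\<lambda>x. indicator A x *\<^sub>R norm c)"
        by (intro integrable_scaleR_left; use base in simp)+
      show "norm (indicator (A \<inter> {- real i..real i}) x *\<^sub>R c - indicator A x *\<^sub>R c) \<le> indicator A x *\<^sub>R norm c" for i x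
        by (auto simp: indicator_def)
      show "(\<lambda>i. indicator (A \<inter> {- real i..real i}) x *\<^sub>R c) \<longlonglongrightarrow> indicator A x *\<^sub>R c" for x
      proof -
        obtain j :: nat where "\<bar>x\<bar> \<le> real j" using real_arch_simple by blast
        then have "\<forall>\<^sub>F i in sequentially. indicator (A \<inter> {- real i..real i}) x *\<^sub>R c = indicator A x *\<^sub>R c"
          by (intro eventually_sequentiallyI[of j]) (auto simp: indicator_def)
        then show ?thesis by (rule tendsto_eventually)
      qed
    qed
  next
    case (add f g)
    then show ?case by (intro good_add)
  next
    case (lim h s)
    show ?case
    proof (rule good_lim[where hs = s and w = "\<lambda>x. 3 * norm (h x)"])
      show "norm (s i x - h x) \<le> 3 * norm (h x)" for i x
        using lim(3)[of x i] norm_triangle_ineq4[of "s i x" "h x"] by simp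
    qed (use lim in auto)
  qed
  then show ?thesis by (simp add: good_def T_def)
qed

section \<open>The torus and its measures\<close>

lemma to_torus_eq_iff: "to_torus x = to_torus y \<longleftrightarrow> x - y \<in> int_lattice"
  using torus.abs_eq_iff[of x y] by (simp add: lattice_rel_def)

lemma to_torus_cases: obtains x where "t = to_torus x"
  using torus.abs_induct[of "\<lambda>t. \<exists>x. t = to_torus x" t] by blast

lemma dist_to_torus: "dist (to_torus x) (to_torus y) = infdist (x - y) int_lattice"
  by (simp add: dist_torus_def minus_torus.abs_eq torus_norm.abs_eq)

lemma dist_to_torus_le: "dist (to_torus x) (to_torus y) \<le> dist x y"
  unfolding dist_to_torus using infdist_le[OF int_lattice_0, of "x - y"] by (simp add: dist_norm)

lemma dist_to_torus_attained:
  obtains n where "n \<in> int_lattice" "dist (to_torus x) (to_torus y) = norm (x - y - n)"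
  using infdist_attains_inf[OF closed_int_lattice, of "x - y"] int_lattice_0
  unfolding dist_to_torus by (metis dist_norm empty_iff)

lemma continuous_on_to_torus: "continuous_on A to_torus"
  by (rule continuous_onI) (use dist_to_torus_le le_less_trans less_imp_le in blast)

lemma measurable_to_torus [measurable]: "to_torus \<in> borel \<rightarrow>\<^sub>M borel"
  by (rule borel_measurable_continuous_onI[OF continuous_on_to_torus])

lemma to_torus_image_cbox: "to_torus ` cbox 0 1 = UNIV"
proof -
  have "t \<in> to_torus ` cbox 0 1" for t :: "'a torus"
  proof -
    obtain x where x: "t = to_torus x" by (rule to_torus_cases)
    define y :: "real^'a" where "y = (\<chi> i. frac (x $ i))"
    have "x - y \<in> int_lattice" by (auto simp: int_lattice_def y_def frac_def)
    moreover have "y \<in> cbox 0 1"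
      by (auto simp: y_def mem_box_cart frac_lt_1 less_imp_le)
    ultimately show ?thesis unfolding x by (metis image_eqI to_torus_eq_iff)
  qed
  then show ?thesis by blast
qed

lemma compact_UNIV_torus: "compact (UNIV :: ('d::finite) torus set)"
  using compact_continuous_image[OF continuous_on_to_torus compact_cbox[of "0 :: real^'d" 1]]
  by (simp add: to_torus_image_cbox)

text \<open>A point close to \<open>to_torus x\<close> has a representative equally close to
  \<open>x\<close>, because the quotient distance is attained at a lattice vector.\<close>

lemma open_to_torus_image:
  assumes "open S" shows "open (to_torus ` S)"
  unfolding open_dist
proof safe
  fix x assume "x \<in> S"
  then obtain e where e: "e > 0" "\<And>y. dist y x < e \<Longrightarrow> y \<in> S"
    using assms unfolding open_dist by blast
  show "\<exists>e>0. \<forall>y. dist y (to_torus x) < e \<longrightarrow> y \<in> to_torus ` S"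
  proof (intro exI[of _ e] conjI allI impI)
    fix t assume t: "dist t (to_torus x) < e"
    obtain y where y: "t = to_torus y" by (rule to_torus_cases)
    obtain n where n: "n \<in> int_lattice" "dist (to_torus y) (to_torus x) = norm (y - x - n)"
      by (rule dist_to_torus_attained)
    have "y - n \<in> S" using e(2)[of "y - n"] n t y by (simp add: dist_norm algebra_simps)
    moreover have "to_torus (y - n) = t" using n y by (simp add: to_torus_eq_iff int_lattice_uminus)
    ultimately show "t \<in> to_torus ` S" by blast
  qed (use e in auto)
qed

text \<open>The open quotient map carries a countable base along. Second countability makes the
  distance measurable for the product sigma-algebra on which couplings live.\<close>

instance torus :: (finite) second_countable_topology
proof
  obtain B :: "(real^'a) set set" where B: "countable B" "topological_basis B"
    using ex_countable_basis by blast
  let ?B = "(\<lambda>b. to_torus ` b) ` B"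
  have "topological_basis ?B"
  proof (rule topological_basisI)
    show "open b" if "b \<in> ?B" for b
      using that B by (auto intro!: open_to_torus_image topological_basis_open)
  next
    fix U :: "'a torus set" and t assume U: "open U" "t \<in> U"
    obtain x where x: "t = to_torus x" by (rule to_torus_cases)
    have U': "open (to_torus -` U)" "x \<in> to_torus -` U"
      using U x open_vimage[OF U(1) continuous_on_to_torus] by auto
    obtain b where "b \<in> B" "x \<in> b" "b \<subseteq> to_torus -` U"
      by (rule topological_basisE[OF B(2) U'])
    then show "\<exists>b\<in>?B. t \<in> b \<and> b \<subseteq> U"
      unfolding x by (intro bexI[of _ "to_torus ` b"] conjI imageI) auto
  qed
  then show "\<exists>B :: 'a torus set set. countable B \<and> open = generate_topology B"
    using B(1) by (metis countable_image topological_basis_imp_subbasis)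
qed

lemma sets_torus_vol [simp, measurable_cong]: "sets torus_vol = sets borel"
  by (simp add: torus_vol_def)

lemma space_torus_vol [simp]: "space torus_vol = UNIV"
  by (simp add: torus_vol_def)

lemma emeasure_unit_cube: "emeasure lborel (cbox 0 1 :: (real^'d) set) = 1"
  by (subst emeasure_lborel_cbox) (auto simp: Basis_vec_def inner_axis intro!: prod.neutral)

lemma measurable_to_torus_cube [measurable]:
  "to_torus \<in> restrict_space lborel (cbox 0 1) \<rightarrow>\<^sub>M borel"
  by (intro measurable_restrict_space1) simp

lemma prob_space_torus_vol: "prob_space torus_vol"
  unfolding torus_vol_def
  by (rule prob_space.prob_space_distr)
     (auto intro!: prob_spaceI simp: space_restrict_space emeasure_restrict_space emeasure_unit_cube)

interpretation torus_vol: prob_space torus_vol by (rule prob_space_torus_vol)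

lemma integral_torus_vol:
  fixes f :: "('d::finite) torus \<Rightarrow> 'b::{banach,second_countable_topology}"
  assumes [measurable]: "f \<in> borel_measurable borel"
  shows "(\<integral>x. f x \<partial>torus_vol) = (\<integral>x. indicator (cbox 0 1) x *\<^sub>R f (to_torus x) \<partial>lborel)"
  unfolding torus_vol_def by (simp add: integral_distr integral_restrict_space)

section \<open>Characters and their orthogonality\<close>

lemma fourier_char_to_torus: "fourier_char k (to_torus x) = cis (2 * pi * (fvec k \<bullet> x))"
  by (simp add: fourier_char.abs_eq)

lemma norm_fourier_char [simp]: "norm (fourier_char k x) = 1"
  by (cases x rule: to_torus_cases) (simp add: fourier_char_to_torus)

lemma fvec_0 [simp]: "fvec 0 = 0"
  by (simp add: fvec_def vec_eq_iff)

lemma fvec_add: "fvec (k + l) = fvec k + fvec l"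
  by (simp add: fvec_def vec_eq_iff)

lemma fvec_uminus: "fvec (- k) = - fvec k"
  by (simp add: fvec_def vec_eq_iff)

lemma fourier_char_0 [simp]: "fourier_char 0 x = 1"
  by (cases x rule: to_torus_cases) (simp add: fourier_char_to_torus)

lemma fourier_char_add: "fourier_char (k + l) x = fourier_char k x * fourier_char l x"
  by (cases x rule: to_torus_cases) (simp add: fourier_char_to_torus fvec_add inner_add_left cis_mult algebra_simps)

lemma fourier_char_uminus: "fourier_char (- k) x = cnj (fourier_char k x)"
  by (cases x rule: to_torus_cases) (simp add: fourier_char_to_torus fvec_uminus cis_cnj)

lemma fourier_char_diff_point: "fourier_char k (x - y) = fourier_char k x * cnj (fourier_char k y)"
proof -
  obtain a b where "x = to_torus a" "y = to_torus b" by (metis to_torus_cases)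
  then show ?thesis
    by (simp add: fourier_char_to_torus minus_torus.abs_eq cis_cnj cis_mult inner_diff_right algebra_simps)
qed

lemma norm_cis_diff_le: "norm (cis a - cis b) \<le> \<bar>a - b\<bar>"
proof -
  have "norm (cis a - cis b) = norm (cis b * (cis (a - b) - 1))"
    by (simp add: algebra_simps cis_mult)
  also have "\<dots> = norm (exp (\<i> * of_real (a - b)) - 1)" by (simp add: norm_mult cis_conv_exp)
  also have "\<dots> = 2 * \<bar>sin ((a - b) / 2)\<bar>" by (rule dist_exp_i_1)
  also have "\<dots> \<le> \<bar>a - b\<bar>" using abs_sin_x_le_abs_x[of "(a - b) / 2"] by simp
  finally show ?thesis .
qed

text \<open>The second point is represented by the lift at which the quotient distance is attained.
  This estimate is what makes Fourier coefficients Lipschitz for the Wasserstein distance.\<close>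

lemma fourier_char_lipschitz: "norm (fourier_char k x - fourier_char k y) \<le> 2 * pi * norm (fvec k) * dist x y"
proof -
  obtain a b where ab: "x = to_torus a" "y = to_torus b" by (metis to_torus_cases)
  obtain n where n: "n \<in> int_lattice" "dist (to_torus a) (to_torus b) = norm (a - b - n)"
    by (rule dist_to_torus_attained)
  have y: "y = to_torus (b + n)" using ab n by (simp add: to_torus_eq_iff int_lattice_uminus)
  have "norm (fourier_char k x - fourier_char k y) \<le> \<bar>2 * pi * (fvec k \<bullet> a) - 2 * pi * (fvec k \<bullet> (b + n))\<bar>"
    unfolding ab(1) y fourier_char_to_torus by (rule norm_cis_diff_le)
  also have "\<dots> = 2 * pi * \<bar>fvec k \<bullet> (a - b - n)\<bar>"
  proof -
    have "2 * pi * (fvec k \<bullet> a) - 2 * pi * (fvec k \<bullet> (b + n)) = 2 * pi * (fvec k \<bullet> (a - b - n))"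
      by (simp add: inner_diff_right inner_add_right algebra_simps)
    then show ?thesis by (simp add: abs_mult)
  qed
  also have "\<dots> \<le> 2 * pi * (norm (fvec k) * norm (a - b - n))"
    by (intro mult_left_mono Cauchy_Schwarz_ineq2) auto
  finally show ?thesis using n ab by (simp add: algebra_simps)
qed

lemma continuous_on_fourier_char [continuous_intros]: "continuous_on A (fourier_char k)"
proof (rule continuous_onI)
  fix x and e :: real assume "e > 0"
  let ?L = "2 * pi * norm (fvec k) + 1"
  have "?L > 0" by (simp add: add_nonneg_pos)
  show "\<exists>d>0. \<forall>y\<in>A. dist y x < d \<longrightarrow> dist (fourier_char k y) (fourier_char k x) \<le> e"
  proof (intro exI[of _ "e / ?L"] conjI ballI impI)
    fix y assume "dist y x < e / ?L"
    then have "?L * dist y x \<le> e" using \<open>?L > 0\<close> by (simp add: pos_less_divide_eq mult.commute)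
    then show "dist (fourier_char k y) (fourier_char k x) \<le> e"
      using fourier_char_lipschitz[of k y x] zero_le_dist[of y x]
      unfolding dist_norm[of "fourier_char k y"] distrib_right mult_1 by linarith
  qed (use \<open>?L > 0\<close> \<open>e > 0\<close> in auto)
qed

lemma borel_measurable_fourier_char [measurable]: "fourier_char k \<in> borel_measurable borel"
  by (rule borel_measurable_continuous_onI[OF continuous_on_fourier_char])

lemma integral_lborel_prod:
  fixes f :: "'a::euclidean_space \<Rightarrow> real \<Rightarrow> complex"
  assumes "\<And>b. b \<in> Basis \<Longrightarrow> integrable lborel (f b)"
  shows "(\<integral>x. (\<Prod>b\<in>Basis. f b (x \<bullet> b)) \<partial>lborel) = (\<Prod>b\<in>Basis. (\<integral>x. f b x \<partial>lborel))"
proof -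
  interpret product_sigma_finite "\<lambda>_::'a. lborel :: real measure"
    by standard
  have [measurable]: "\<And>b. b \<in> Basis \<Longrightarrow> f b \<in> borel_measurable borel"
    using assms by auto
  have "(\<integral>x. (\<Prod>b\<in>Basis. f b (x \<bullet> b)) \<partial>lborel)
    = (\<integral>x. (\<Prod>b\<in>Basis. f b ((\<Sum>c\<in>Basis. x c *\<^sub>R c) \<bullet> b)) \<partial>(\<Pi>\<^sub>M b\<in>Basis. lborel))"
    by (subst lborel_eq, subst integral_distr) auto
  also have "\<dots> = (\<integral>x. (\<Prod>b\<in>Basis. f b (x b)) \<partial>(\<Pi>\<^sub>M b\<in>Basis. lborel))"
    by (intro Bochner_Integration.integral_cong refl prod.cong) simp
  also have "\<dots> = (\<Prod>b\<in>Basis. (\<integral>x. f b x \<partial>lborel))"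
    by (rule product_integral_prod) (use assms in auto)
  finally show ?thesis .
qed

lemma integral_cis_unit_interval:
  fixes j :: int
  assumes "j \<noteq> 0"
  shows "(\<integral>t. indicator {0..1} t *\<^sub>R cis (2 * pi * of_int j * t) \<partial>lborel) = 0"
proof -
  let ?F = "\<lambda>t::real. exp (\<i> * of_real (2 * pi * of_int j * t)) / (\<i> * of_real (2 * pi * of_int j))"
  have nz: "of_int j * complex_of_real pi \<noteq> 0" using assms by simp
  have "(\<integral>t. indicator {0..1} t *\<^sub>R cis (2 * pi * of_int j * t) \<partial>lborel) = ?F 1 - ?F 0"
  proof (rule integral_FTC_Icc)
    fix t :: real
    let ?c = "\<i> * of_real (2 * pi * of_int j) :: complex"
    have "((\<lambda>z. exp (?c * z) / ?c) has_field_derivative exp (?c * of_real t)) (at (of_real t))"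
      using nz by (auto intro!: derivative_eq_intros)
    from has_vector_derivative_at_within[OF has_vector_derivative_real_field[OF this]]
    have "(?F has_vector_derivative exp (\<i> * of_real (2 * pi * of_int j * t))) (at t within {0..1})"
      by (simp add: mult_ac)
    then show "(?F has_vector_derivative cis (2 * pi * of_int j * t)) (at t within {0..1})"
      by (simp add: cis_conv_exp)
  next
    show "continuous_on {0..1} (\<lambda>t. cis (2 * pi * of_int j * t))"
      by (intro continuous_intros)
  qed auto
  also have "?F 1 - ?F 0 = 0"
  proof -
    have "cis (2 * pi * of_int j) = 1" by (rule cis_multiple_2pi) simp
    then show ?thesis by (simp add: cis_conv_exp)
  qed
  finally show ?thesis .
qed

text \<open>The character factors over the coordinates of the unit cube, and a coordinate with
  \<open>k $ i \<noteq> 0\<close> runs through a whole number of periods.\<close>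

lemma integral_fourier_char:
  fixes k :: "('d::finite) freq"
  shows "(\<integral>x. fourier_char k x \<partial>torus_vol) = (if k = 0 then 1 else 0)"
proof (cases "k = 0")
  case True
  then show ?thesis using torus_vol.prob_space[where 'a='d] by simp
next
  case False
  then obtain i where i: "k $ i \<noteq> 0" by (auto simp: vec_eq_iff)
  let ?g = "\<lambda>(b::real^'d) t. indicator {0..1} t *\<^sub>R cis (2 * pi * (fvec k \<bullet> b) * t)"
  have eq: "indicator (cbox 0 1) x *\<^sub>R fourier_char k (to_torus x) = (\<Prod>b\<in>Basis. ?g b (x \<bullet> b))" for x :: "real^'d"
  proof -
    have "indicator (cbox 0 1) x = (\<Prod>b\<in>Basis. indicator {0..1} (x \<bullet> b) :: real)"
    proof (cases "x \<in> cbox 0 1")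
      case True
      then have "x \<bullet> b \<in> {0..1}" if "b \<in> Basis" for b
        using that by (auto simp: mem_box Basis_vec_def inner_axis)
      then show ?thesis using True by simp
    next
      case False
      moreover have "1 \<bullet> b = (1::real)" if "b \<in> Basis" for b :: "real^'d"
        using that by (auto simp: Basis_vec_def inner_axis)
      ultimately have "\<exists>b\<in>Basis. x \<bullet> b \<notin> {0..1}" by (auto simp: mem_box)
      then obtain b where "b \<in> Basis" "x \<bullet> b \<notin> {0..1}" by blast
      then have "(\<Prod>b\<in>Basis. indicator {0..1} (x \<bullet> b) :: real) = 0"
        by (intro prod_zero bexI[of _ b]) auto
      then show ?thesis using False by simp
    qed
    moreover have "fvec k \<bullet> x = (\<Sum>b\<in>Basis. (fvec k \<bullet> b) * (x \<bullet> b))" by (rule euclidean_inner)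
    moreover have "cis (\<Sum>b\<in>A. u b) = (\<Prod>b\<in>A. cis (u b))" if "finite A" for u and A :: "(real^'d) set"
      using that by (induction A) (auto simp: cis_mult[symmetric])
    ultimately show ?thesis
      by (simp add: fourier_char_to_torus scaleR_conv_of_real prod.distrib sum_distrib_left mult.assoc)
  qed
  have "(\<integral>x. fourier_char k x \<partial>torus_vol) = (\<integral>x. (\<Prod>b\<in>Basis. ?g b (x \<bullet> b)) \<partial>lborel)"
    by (subst integral_torus_vol) (auto simp only: eq borel_measurable_fourier_char)
  also have "\<dots> = (\<Prod>b\<in>Basis. (\<integral>t. ?g b t \<partial>lborel))"
  proof (rule integral_lborel_prod)
    fix b :: "real^'d"
    have "set_integrable lborel {0..1} (\<lambda>t. cis (2 * pi * (fvec k \<bullet> b) * t))"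
      by (rule borel_integrable_atLeastAtMost') (intro continuous_intros)
    then show "integrable lborel (?g b)" by (simp add: set_integrable_def)
  qed
  also have "\<dots> = 0"
  proof (rule prod_zero)
    have "fvec k \<bullet> axis i 1 = of_int (k $ i)" by (simp add: inner_axis fvec_def)
    then show "\<exists>b\<in>Basis. (\<integral>t. ?g b t \<partial>lborel) = 0"
      using integral_cis_unit_interval[OF i] by (intro bexI[of _ "axis i 1"]) (auto simp: axis_in_Basis_iff)
  qed auto
  finally show ?thesis using False by simp
qed

section \<open>Trigonometric polynomials and uniqueness of Fourier coefficients\<close>

inductive_set trig_poly :: "(('d::finite) torus \<Rightarrow> complex) set" where
  char: "(\<lambda>x. c * fourier_char k x) \<in> trig_poly"
| add: "f \<in> trig_poly \<Longrightarrow> g \<in> trig_poly \<Longrightarrow> (\<lambda>x. f x + g x) \<in> trig_poly"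

lemma trig_poly_mult:
  assumes "f \<in> trig_poly" "g \<in> trig_poly"
  shows "(\<lambda>x. f x * g x) \<in> trig_poly"
  using assms(1)
proof induction
  case (char c k)
  show ?case using assms(2)
  proof induction
    case (char c' k')
    show ?case using trig_poly.char[of "c * c'" "k + k'"] by (simp add: fourier_char_add mult_ac)
  next
    case (add f g)
    then show ?case using trig_poly.add by (simp add: distrib_left)
  qed
next
  case (add f1 f2)
  then show ?case using trig_poly.add[OF add.IH] by (simp add: distrib_right)
qed

lemma trig_poly_cnj: "f \<in> trig_poly \<Longrightarrow> (\<lambda>x. cnj (f x)) \<in> trig_poly"
proof (induction rule: trig_poly.induct)
  case (char c k)
  show ?case using trig_poly.char[of "cnj c" "- k"] by (simp add: fourier_char_uminus)
qed (simp add: trig_poly.add)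

lemma continuous_on_trig_poly: "f \<in> trig_poly \<Longrightarrow> continuous_on A f"
  by (induction rule: trig_poly.induct) (auto intro!: continuous_intros)

lemma fourier_char_separates:
  fixes x y :: "('d::finite) torus"
  assumes "x \<noteq> y"
  shows "\<exists>k. fourier_char k x \<noteq> fourier_char k y"
proof -
  obtain a b where ab: "x = to_torus a" "y = to_torus b" by (metis to_torus_cases)
  have "a - b \<notin> int_lattice" using assms ab by (simp add: to_torus_eq_iff)
  then obtain i where i: "(a - b) $ i \<notin> \<int>" by (auto simp: int_lattice_def)
  let ?k = "axis i 1 :: 'd freq"
  have k: "fvec ?k = axis i 1" by (simp add: fvec_def axis_def vec_eq_iff)
  have "fourier_char ?k x \<noteq> fourier_char ?k y"
  proof
    assume "fourier_char ?k x = fourier_char ?k y"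
    then have "fourier_char ?k (x - y) = 1"
      by (simp add: fourier_char_diff_point complex_norm_square[symmetric])
    then have "cis (2 * pi * (a - b) $ i) = 1"
      by (simp add: ab minus_torus.abs_eq fourier_char_to_torus k inner_axis' )
    then have "cos (2 * pi * (a - b) $ i) = 1" by (simp add: complex_eq_iff)
    then obtain n :: int where "2 * pi * (a - b) $ i = of_int n * (2 * pi)" by (auto simp: cos_one_2pi_int)
    then have "(a - b) $ i = of_int n" by simp
    then show False using i by simp
  qed
  then show ?thesis by blast
qed

text \<open>Stone-Weierstrass, applied to the real algebra formed by the real parts of trigonometric
  polynomials.\<close>

lemma trig_poly_dense:
  fixes f :: "('d::finite) torus \<Rightarrow> real"
  assumes "continuous_on UNIV f" "e > 0"
  shows "\<exists>g\<in>trig_poly. \<forall>x. \<bar>f x - Re (g x)\<bar> < e"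
proof -
  define P where "P f \<longleftrightarrow> (\<exists>g\<in>trig_poly. f = (\<lambda>x. Re (g x)))" for f :: "'d torus \<Rightarrow> real"
  have "\<exists>g. P g \<and> (\<forall>x\<in>UNIV. \<bar>f x - g x\<bar> < e)"
  proof (rule Stone_Weierstrass_HOL[OF compact_UNIV_torus])
    show "P (\<lambda>x. c)" for c
      unfolding P_def using trig_poly.char[of "of_real c" 0] by force
    show "continuous_on UNIV f" if "P f" for f
      using that unfolding P_def by (auto intro!: continuous_intros continuous_on_trig_poly)
    show "P (\<lambda>x. f x + g x)" if "P f \<and> P g" for f g
      using that unfolding P_def by (auto intro!: bexI[OF _ trig_poly.add])
    show "P (\<lambda>x. f x * g x)" if fg: "P f \<and> P g" for f g
    proof -
      obtain u v where uv: "u \<in> trig_poly" "v \<in> trig_poly" "f = (\<lambda>x. Re (u x))" "g = (\<lambda>x. Re (v x))"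
        using fg unfolding P_def by blast
      \<comment> \<open>The identity \<open>2 * Re u * Re v = Re (u * v + u * cnj v)\<close> keeps
        products of real parts in the class.\<close>
      let ?w = "\<lambda>x. (1/2 * fourier_char 0 x) * (u x * v x + u x * cnj (v x))"
      have "?w \<in> trig_poly"
        by (intro trig_poly_mult trig_poly.add trig_poly.char trig_poly_cnj uv)
      moreover have "f x * g x = Re (?w x)" for x by (simp add: uv field_simps)
      ultimately show ?thesis unfolding P_def by (intro bexI[of _ ?w] ext)
    qed
    show "\<exists>f. P f \<and> f x \<noteq> f y" if xy: "x \<in> UNIV \<and> y \<in> UNIV \<and> x \<noteq> y" for x y
    proof -
      obtain k where k: "fourier_char k x \<noteq> fourier_char k y" using fourier_char_separates xy by blast
      \<comment> \<open>The factor \<open>- \<i>\<close> turns the imaginary part into a real part,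
        so both parts of a separating character are available.\<close>
      have "P (\<lambda>x. Re (c * fourier_char k x))" for c
        unfolding P_def by (rule bexI[OF _ trig_poly.char]) (rule refl)
      from this[of 1] this[of "- \<i>"]
      have "P (\<lambda>x. Re (1 * fourier_char k x))" "P (\<lambda>x. Re (- \<i> * fourier_char k x))" .
      then show ?thesis using k by (auto simp: complex_eq_iff)
    qed
  qed (use assms in auto)
  then show ?thesis unfolding P_def by auto
qed

text \<open>The functions \<open>1 - n * infdist x C\<close>, cut off at \<open>0\<close>, decrease
  to the indicator of a closed set \<open>C\<close>, and the closed sets form a generating
  pi-system. Generality in the metric space serves the torus here and the complex plane
  later.\<close>

lemma measure_eqI_continuous:
  fixes M N :: "'a::metric_space measure"
  assumes M: "finite_measure M" "sets M = sets borel" and N: "finite_measure N" "sets N = sets borel"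
    and eq: "\<And>f :: 'a \<Rightarrow> real. continuous_on UNIV f \<Longrightarrow> (\<And>x. 0 \<le> f x) \<Longrightarrow> (\<And>x. f x \<le> 1) \<Longrightarrow> (\<integral>x. f x \<partial>M) = (\<integral>x. f x \<partial>N)"
  shows "M = N"
proof (rule measure_eqI_generator_eq[where E="Collect closed" and \<Omega>=UNIV and A="\<lambda>_. UNIV"])
  interpret M: finite_measure M by fact
  interpret N: finite_measure N by fact
  note [measurable_cong] = M(2) N(2)
  show "Int_stable (Collect closed :: 'a set set)" by (auto simp: Int_stable_def)
  show "sets M = sigma_sets UNIV (Collect closed)" "sets N = sigma_sets UNIV (Collect closed)"
    using M(2) N(2) by (simp_all add: borel_eq_closed)
  show "emeasure M C = emeasure N C" if "C \<in> Collect closed" for C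
  proof (cases "C = {}")
    case False
    have C: "closed C" using that by simp
    define f where "f n x = max 0 (1 - real n * infdist x C)" for n x
    have cont: "continuous_on UNIV (f n)" for n unfolding f_def by (intro continuous_intros)
    have b: "0 \<le> f n x" "f n x \<le> 1" for n x by (auto simp: f_def infdist_nonneg)
    have [measurable]: "f n \<in> borel_measurable borel" for n by (rule borel_measurable_continuous_onI[OF cont])
    have [measurable]: "C \<in> sets borel" using C by (rule borel_closed)
    have lim: "(\<lambda>n. f n x) \<longlonglongrightarrow> indicator C x" for x
    proof (cases "x \<in> C")
      case True
      then show ?thesis by (simp add: f_def)
    next
      case F: False
      then have pos: "infdist x C > 0" using C False infdist_pos_not_in_closed by blast
      obtain n0 :: nat where n0: "1 / infdist x C < real n0" using reals_Archimedean2 by blast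
      have "f n x = 0" if "n \<ge> n0" for n
      proof -
        have "1 < real n0 * infdist x C" using n0 pos by (simp add: pos_divide_less_eq)
        also have "\<dots> \<le> real n * infdist x C" using that pos by simp
        finally show ?thesis by (simp add: f_def)
      qed
      then show ?thesis using F by (intro tendsto_eventually eventually_sequentiallyI[of n0]) auto
    qed
    have conv: "(\<lambda>n. \<integral>x. f n x \<partial>L) \<longlonglongrightarrow> measure L C" if "finite_measure L" "sets L = sets borel" for L
    proof -
      interpret finite_measure L by fact
      note that(2)[measurable_cong]
      have "(\<lambda>n. \<integral>x. f n x \<partial>L) \<longlonglongrightarrow> (\<integral>x. indicator C x \<partial>L)"
        by (rule integral_dominated_convergence[where w="\<lambda>_. 1"]) (use b lim in auto)
      then show ?thesis using sets_eq_imp_space_eq[OF that(2)] by simp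
    qed
    have "measure M C = measure N C"
      using conv[OF M] conv[OF N] eq[OF cont b] by (simp add: LIMSEQ_unique)
    then show ?thesis by (simp add: M.emeasure_eq_measure N.emeasure_eq_measure)
  qed simp
  show "emeasure M UNIV \<noteq> \<infinity>"
    using M.emeasure_finite by (simp add: top.not_eq_extremum)
qed auto

lemma integral_Re_trig_poly:
  assumes m: "m \<in> torus_probs" "m' \<in> torus_probs"
    and eq: "\<And>k. fourier_coeff m k = fourier_coeff m' k" and "f \<in> trig_poly"
  shows "integrable m f \<and> (\<integral>x. f x \<partial>m) = (\<integral>x. f x \<partial>m')"
  using assms(4)
proof -
  have "integrable m f \<and> integrable m' f \<and> (\<integral>x. f x \<partial>m) = (\<integral>x. f x \<partial>m')"
    using assms(4)
  proof induction
    case (char c k)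
    have int: "integrable L (fourier_char k)" if "L \<in> torus_probs" for L
    proof -
      interpret prob_space L using that by (simp add: torus_probs_def)
      have [measurable_cong]: "sets L = sets borel" using that by (simp add: torus_probs_def)
      show ?thesis by (rule integrable_const_bound[where B=1]) auto
    qed
    show ?case using int[OF m(1)] int[OF m(2)] eq[of k] by (simp add: fourier_coeff_def)
  qed auto
  then show ?thesis by simp
qed

theorem torus_probs_eqI_fourier_coeff:
  assumes m: "m \<in> torus_probs" "m' \<in> torus_probs"
    and eq: "\<And>k. fourier_coeff m k = fourier_coeff m' k"
  shows "m = m'"
proof (rule measure_eqI_continuous)
  show *: "finite_measure m" "sets m = sets borel" "finite_measure m'" "sets m' = sets borel"
    using m by (auto simp: torus_probs_def intro: prob_space.finite_measure)
  have "prob_space m" "prob_space m'" using m by (auto simp: torus_probs_def)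
  then interpret m: prob_space m by simp
  interpret m': prob_space m' by fact
  note [measurable_cong] = *(2) *(4)
  fix f :: "'a torus \<Rightarrow> real" assume f: "continuous_on UNIV f" "\<And>x. 0 \<le> f x" "\<And>x. f x \<le> 1"
  have [measurable]: "f \<in> borel_measurable borel" using f(1) by (rule borel_measurable_continuous_onI)
  have "\<bar>(\<integral>x. f x \<partial>m) - (\<integral>x. f x \<partial>m')\<bar> \<le> 2 * e" if e: "e > 0" for e
  proof -
    obtain g where g: "g \<in> trig_poly" "\<And>x. \<bar>f x - Re (g x)\<bar> < e"
      using trig_poly_dense[OF f(1) e] by blast
    have "integrable m g" "integrable m' g" "(\<integral>x. g x \<partial>m) = (\<integral>x. g x \<partial>m')"
      using integral_Re_trig_poly[OF m eq g(1)] integral_Re_trig_poly[OF m(2,1) eq[symmetric] g(1)] by auto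
    then have g': "integrable m (\<lambda>x. Re (g x))" "integrable m' (\<lambda>x. Re (g x))"
      "(\<integral>x. Re (g x) \<partial>m) = (\<integral>x. Re (g x) \<partial>m')"
      by auto
    have *: "\<bar>(\<integral>x. f x \<partial>L) - (\<integral>x. Re (g x) \<partial>L)\<bar> \<le> e" if "prob_space L" "sets L = sets borel" "integrable L (\<lambda>x. Re (g x))" for L
    proof -
      interpret prob_space L by fact
      note that(2)[measurable_cong]
      have "integrable L f" by (rule integrable_const_bound[where B=1]) (use f in auto)
      then have "(\<integral>x. f x \<partial>L) - (\<integral>x. Re (g x) \<partial>L) = (\<integral>x. f x - Re (g x) \<partial>L)"
        using that(3) by simp
      also have "\<bar>\<dots>\<bar> \<le> (\<integral>x. \<bar>f x - Re (g x)\<bar> \<partial>L)" by (rule integral_abs_bound)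
      also have "\<dots> \<le> (\<integral>x. e \<partial>L)"
        by (intro integral_mono) (use \<open>integrable L f\<close> that(3) g(2) in \<open>auto intro: less_imp_le\<close>)
      also have "\<dots> = e" using prob_space by simp
      finally show ?thesis .
    qed
    show ?thesis using *[of m] *[of m'] g' m.prob_space_axioms m'.prob_space_axioms \<open>sets m = sets borel\<close> \<open>sets m' = sets borel\<close> by auto
  qed
  then have "\<bar>(\<integral>x. f x \<partial>m) - (\<integral>x. f x \<partial>m')\<bar> \<le> 0 + e" if "e > 0" for e
    using that by (metis add_0 field_sum_of_halves half_gt_zero mult_2)
  then have "\<bar>(\<integral>x. f x \<partial>m) - (\<integral>x. f x \<partial>m')\<bar> \<le> 0" by (rule field_le_epsilon)
  then show "(\<integral>x. f x \<partial>m) = (\<integral>x. f x \<partial>m')" by simp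
qed

section \<open>Densities: total variation, perturbations and couplings\<close>

lemma density_torus_probs:
  assumes [measurable]: "f \<in> borel_measurable borel" and "\<And>x. 0 \<le> f x" "\<And>x. f x \<le> B"
    and "(\<integral>x. f x \<partial>torus_vol) = 1"
  shows "density torus_vol (\<lambda>x. ennreal (f x)) \<in> torus_probs"
proof -
  have int: "integrable torus_vol f"
    by (rule torus_vol.integrable_const_bound[where B=B]) (use assms in auto)
  have "(\<integral>\<^sup>+x. ennreal (f x) \<partial>torus_vol) = ennreal 1"
    using nn_integral_eq_integral[OF int] assms by auto
  then show ?thesis
    by (auto simp: torus_probs_def emeasure_density intro!: prob_spaceI)
qed

lemma tv_dist_density_le:
  assumes [measurable]: "f \<in> borel_measurable borel" "g \<in> borel_measurable borel"
    and f: "\<And>x. 0 \<le> f x" "\<And>x. f x \<le> B" and g: "\<And>x. 0 \<le> g x" "\<And>x. g x \<le> B"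
    and fg: "\<And>x. \<bar>f x - g x\<bar> \<le> d"
  shows "tv_dist (density torus_vol (\<lambda>x. ennreal (f x))) (density torus_vol (\<lambda>x. ennreal (g x))) \<le> d"
  unfolding tv_dist_def
proof (rule cSUP_least)
  show "{h \<in> borel_measurable borel. \<forall>x. \<bar>h x\<bar> \<le> 1} \<noteq> ({} :: ('a torus \<Rightarrow> real) set)"
    by (auto intro!: exI[of _ "\<lambda>_. 0"])
  fix h :: "'a torus \<Rightarrow> real" assume "h \<in> {h \<in> borel_measurable borel. \<forall>x. \<bar>h x\<bar> \<le> 1}"
  then have [measurable]: "h \<in> borel_measurable borel" and h: "\<And>x. \<bar>h x\<bar> \<le> 1" by auto
  have B: "0 \<le> B" using f[of 0] by linarith
  have int: "integrable torus_vol (\<lambda>x. u x * h x)"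
    if [measurable]: "u \<in> borel_measurable borel" and "\<And>x. 0 \<le> u x" "\<And>x. u x \<le> B" for u
  proof (rule torus_vol.integrable_const_bound[where B=B])
    show "AE x in torus_vol. norm (u x * h x) \<le> B"
    proof (intro AE_I2)
      fix x show "norm (u x * h x) \<le> B"
        using mult_mono[of "\<bar>u x\<bar>" B "\<bar>h x\<bar>" 1] that h[of x] B by (simp add: abs_mult)
    qed
  qed simp
  have "(\<integral>x. h x \<partial>density torus_vol (\<lambda>x. ennreal (f x))) - (\<integral>x. h x \<partial>density torus_vol (\<lambda>x. ennreal (g x)))
     = (\<integral>x. f x * h x - g x * h x \<partial>torus_vol)"
    using int[of f] int[of g] f g by (simp add: integral_real_density)
  also have "\<bar>\<dots>\<bar> \<le> (\<integral>x. \<bar>f x * h x - g x * h x\<bar> \<partial>torus_vol)" by (rule integral_abs_bound)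
  also have "\<dots> \<le> (\<integral>x. d \<partial>(torus_vol :: 'a torus measure))"
  proof (rule Bochner_Integration.integral_mono)
    fix x
    have "\<bar>f x * h x - g x * h x\<bar> = \<bar>f x - g x\<bar> * \<bar>h x\<bar>" by (simp add: abs_mult[symmetric] algebra_simps)
    also have "\<dots> \<le> d * 1" by (intro mult_mono fg h) (use fg[of x] in auto)
    finally show "\<bar>f x * h x - g x * h x\<bar> \<le> d" by simp
  qed (use int f g in auto)
  also have "\<dots> = d" using torus_vol.prob_space[where 'a='a] by simp
  finally show "\<bar>(\<integral>x. h x \<partial>density torus_vol (\<lambda>x. ennreal (f x))) - (\<integral>x. h x \<partial>density torus_vol (\<lambda>x. ennreal (g x)))\<bar> \<le> d" .
qed

text \<open>A real supremum is informative only over a bounded set, so the bound \<open>2\<close>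
  has to come before the test function \<open>0\<close> settles the sign.\<close>

lemma tv_dist_nonneg:
  fixes m m' :: "('d::finite) torus measure"
  assumes "m \<in> torus_probs" "m' \<in> torus_probs"
  shows "0 \<le> tv_dist m m'"
  unfolding tv_dist_def
proof (rule cSUP_upper2[where x="\<lambda>_. 0"])
  have "\<bar>(\<integral>x. h x \<partial>m) - (\<integral>x. h x \<partial>m')\<bar> \<le> 2"
    if h: "h \<in> {h \<in> borel_measurable borel. \<forall>x. \<bar>h x\<bar> \<le> 1}" for h :: "'d torus \<Rightarrow> real"
  proof -
    have "\<bar>\<integral>x. h x \<partial>m\<bar> \<le> 1" if "m \<in> torus_probs" for m
    proof -
      interpret prob_space m using that by (simp add: torus_probs_def)
      have [measurable_cong]: "sets m = sets borel" using that by (simp add: torus_probs_def)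
      have [measurable]: "h \<in> borel_measurable borel" using h by simp
      have "\<bar>\<integral>x. h x \<partial>m\<bar> \<le> (\<integral>x. \<bar>h x\<bar> \<partial>m)" by (rule integral_abs_bound)
      also have "\<dots> \<le> (\<integral>x. 1 \<partial>m)"
        by (rule Bochner_Integration.integral_mono) (use h in \<open>auto intro!: integrable_const_bound[where B=1]\<close>)
      finally show ?thesis using prob_space by simp
    qed
    from this[OF assms(1)] this[OF assms(2)]
    show ?thesis by linarith
  qed
  then show "bdd_above ((\<lambda>h :: 'd torus \<Rightarrow> real. \<bar>(\<integral>x. h x \<partial>m) - (\<integral>x. h x \<partial>m')\<bar>) ` {h \<in> borel_measurable borel. \<forall>x. \<bar>h x\<bar> \<le> 1})"
    by (auto simp: bdd_above_def)
qed auto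

text \<open>As long as the perturbed density is non-negative, the set function in
  \<open>perturb\<close> is that of a density, and \<open>measure_of\<close> gives this measure
  back.\<close>

lemma perturb_density:
  assumes [measurable]: "f \<in> borel_measurable borel" "h \<in> borel_measurable borel"
    and f: "\<And>x. 0 \<le> f x" "\<And>x. f x \<le> B" and h: "\<And>x. \<bar>h x\<bar> \<le> B" and fh: "\<And>x. 0 \<le> f x + \<eta> * h x"
  shows "perturb (density torus_vol (\<lambda>x. ennreal (f x))) \<eta> h = density torus_vol (\<lambda>x. ennreal (f x + \<eta> * h x))"
proof -
  let ?D = "density torus_vol (\<lambda>x. ennreal (f x + \<eta> * h x))"
  have intf: "integrable torus_vol f"
    by (rule torus_vol.integrable_const_bound[where B=B]) (use f in auto)
  have inth: "integrable torus_vol h"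
    by (rule torus_vol.integrable_const_bound[where B=B]) (use h in auto)
  have "ennreal (measure (density torus_vol (\<lambda>x. ennreal (f x))) A + \<eta> * (LINT x:A|torus_vol. h x)) = emeasure ?D A"
    if A[measurable]: "A \<in> sets borel" for A
  proof -
    have iA: "integrable torus_vol (\<lambda>x. u x * indicator A x)" if "integrable torus_vol u" for u :: "_ \<Rightarrow> real"
      using that A by (intro integrable_real_mult_indicator) auto
    have "emeasure (density torus_vol (\<lambda>x. ennreal (f x))) A = (\<integral>\<^sup>+x. ennreal (f x * indicator A x) \<partial>torus_vol)"
      by (subst emeasure_density) (auto intro!: nn_integral_cong simp: indicator_def)
    also have "\<dots> = ennreal (\<integral>x. f x * indicator A x \<partial>torus_vol)"
      by (rule nn_integral_eq_integral[OF iA[OF intf]]) (use f in auto)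
    finally have 1: "measure (density torus_vol (\<lambda>x. ennreal (f x))) A = (\<integral>x. f x * indicator A x \<partial>torus_vol)"
      using f by (simp add: measure_def integral_nonneg_AE)
    have 2: "(LINT x:A|torus_vol. h x) = (\<integral>x. h x * indicator A x \<partial>torus_vol)"
      unfolding set_lebesgue_integral_def by (intro Bochner_Integration.integral_cong) auto
    have "emeasure ?D A = (\<integral>\<^sup>+x. ennreal ((f x + \<eta> * h x) * indicator A x) \<partial>torus_vol)"
      by (subst emeasure_density) (auto intro!: nn_integral_cong simp: indicator_def)
    also have "\<dots> = ennreal (\<integral>x. (f x + \<eta> * h x) * indicator A x \<partial>torus_vol)"
      by (rule nn_integral_eq_integral[OF iA]) (use fh intf inth in auto)
    also have "(\<integral>x. (f x + \<eta> * h x) * indicator A x \<partial>torus_vol)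
       = (\<integral>x. f x * indicator A x + \<eta> * (h x * indicator A x) \<partial>torus_vol)"
      by (simp add: algebra_simps)
    also have "\<dots> = (\<integral>x. f x * indicator A x \<partial>torus_vol) + \<eta> * (\<integral>x. h x * indicator A x \<partial>torus_vol)"
      using iA[OF intf] iA[OF inth] by simp
    finally show ?thesis unfolding 1 2 ..
  qed
  then have "perturb (density torus_vol (\<lambda>x. ennreal (f x))) \<eta> h = measure_of UNIV (sets borel) (emeasure ?D)"
    unfolding perturb_def by (intro measure_of_eq) (auto simp: sets.sigma_sets_eq[of borel, simplified])
  also have "\<dots> = ?D" using measure_of_of_measure[of ?D] by simp
  finally show ?thesis .
qed

lemma wasserstein_le_coupling:
  assumes "\<pi> \<in> couplings m m'"
  shows "wasserstein m m' \<le> (\<integral>z. dist (fst z) (snd z) \<partial>\<pi>)"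
  unfolding wasserstein_def
  by (rule cINF_lower[OF _ assms]) (auto intro!: bdd_belowI2[where m=0] integral_nonneg_AE)

lemma torus_dist_bounded: "\<exists>R>0. \<forall>x y :: ('d::finite) torus. dist x y \<le> R"
proof -
  obtain R where R: "\<forall>x\<in>UNIV. \<forall>y\<in>UNIV. dist (x :: 'd torus) y \<le> R"
    using compact_imp_bounded[OF compact_UNIV_torus[where 'd='d]] unfolding bounded_two_points by blast
  then show ?thesis by (intro exI[of _ "max R 1"]) (auto simp: le_max_iff_disj)
qed

text \<open>Coupling by a biased coin: with probability \<open>1 - \<epsilon>\<close> the two points coincide.\<close>

lemma wasserstein_mixture_le:
  fixes m m' \<nu> :: "('d::finite) torus measure"
  assumes m: "m \<in> torus_probs" and m': "m' \<in> torus_probs" and \<nu>: "\<nu> \<in> torus_probs"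
    and e: "0 \<le> e" "e \<le> 1"
    and mix: "\<And>A. A \<in> sets borel \<Longrightarrow> emeasure m' A = ennreal (1 - e) * emeasure m A + ennreal e * emeasure \<nu> A"
    and R: "\<And>x y :: 'd torus. dist x y \<le> R"
  shows "wasserstein m m' \<le> e * R"
proof -
  interpret m: prob_space m using m by (simp add: torus_probs_def)
  interpret \<nu>: prob_space \<nu> using \<nu> by (simp add: torus_probs_def)
  interpret m': prob_space m' using m' by (simp add: torus_probs_def)
  have [measurable_cong, simp]: "sets m = sets borel" "sets \<nu> = sets borel" "sets m' = sets borel"
    using m \<nu> m' by (auto simp: torus_probs_def)
  have [simp]: "space m = UNIV" "space \<nu> = UNIV" "space m' = UNIV"
    using sets_eq_imp_space_eq[of m borel] sets_eq_imp_space_eq[of \<nu> borel] sets_eq_imp_space_eq[of m' borel] by auto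
  let ?b = "measure_pmf (bernoulli_pmf e)"
  interpret b: prob_space ?b by (rule prob_space_measure_pmf)
  interpret mn: pair_prob_space m \<nu> ..
  interpret bmn: pair_prob_space ?b "m \<Otimes>\<^sub>M \<nu>" ..
  define \<pi> where "\<pi> = distr (?b \<Otimes>\<^sub>M (m \<Otimes>\<^sub>M \<nu>)) (borel \<Otimes>\<^sub>M borel) (\<lambda>(b, x, y). (x, if b then y else x))"
  have meas[measurable]: "(\<lambda>(b, x, y). (x, if b then y else x)) \<in> ?b \<Otimes>\<^sub>M (m \<Otimes>\<^sub>M \<nu>) \<rightarrow>\<^sub>M borel \<Otimes>\<^sub>M borel"
    by measurable
  \<comment> \<open>Tonelli for the coin, the first point and the second point, in a form that
    serves both marginals.\<close>
  have split: "(\<integral>\<^sup>+z. F (fst z) (fst (snd z)) (snd (snd z)) \<partial>(?b \<Otimes>\<^sub>M (m \<Otimes>\<^sub>M \<nu>)))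
      = (\<integral>\<^sup>+b. \<integral>\<^sup>+x. \<integral>\<^sup>+y. F b x y \<partial>\<nu> \<partial>m \<partial>?b)"
    if [measurable]: "(\<lambda>z. F (fst z) (fst (snd z)) (snd (snd z))) \<in> borel_measurable (?b \<Otimes>\<^sub>M (m \<Otimes>\<^sub>M \<nu>))"
      "\<And>b. (\<lambda>w. F b (fst w) (snd w)) \<in> borel_measurable (m \<Otimes>\<^sub>M \<nu>)" for F
  proof -
    have "(\<integral>\<^sup>+b. \<integral>\<^sup>+x. \<integral>\<^sup>+y. F b x y \<partial>\<nu> \<partial>m \<partial>?b) = (\<integral>\<^sup>+b. \<integral>\<^sup>+w. F b (fst w) (snd w) \<partial>(m \<Otimes>\<^sub>M \<nu>) \<partial>?b)"
      by (intro nn_integral_cong) (use \<nu>.nn_integral_fst[OF that(2)] in simp)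
    also have "\<dots> = (\<integral>\<^sup>+z. F (fst z) (fst (snd z)) (snd (snd z)) \<partial>(?b \<Otimes>\<^sub>M (m \<Otimes>\<^sub>M \<nu>)))"
      using mn.nn_integral_fst[OF that(1)] by simp
    finally show ?thesis ..
  qed
  have \<pi>: "\<pi> \<in> couplings m m'"
    unfolding couplings_def
  proof (intro CollectI conjI)
    show "prob_space \<pi>" unfolding \<pi>_def by (rule bmn.prob_space_distr[OF meas])
    show "sets \<pi> = sets (borel \<Otimes>\<^sub>M borel)" by (simp add: \<pi>_def)
    show "distr \<pi> borel fst = m"
    proof (rule measure_eqI)
      fix A assume "A \<in> sets (distr \<pi> borel fst)"
      then have A[measurable]: "A \<in> sets borel" by simp
      have "distr \<pi> borel fst = distr (?b \<Otimes>\<^sub>M (m \<Otimes>\<^sub>M \<nu>)) borel (\<lambda>z. fst (snd z))"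
        unfolding \<pi>_def by (subst distr_distr) (auto simp: comp_def split_beta)
      then have "emeasure (distr \<pi> borel fst) A
        = (\<integral>\<^sup>+x. indicator A x \<partial>distr (?b \<Otimes>\<^sub>M (m \<Otimes>\<^sub>M \<nu>)) borel (\<lambda>z. fst (snd z)))"
        by simp
      also have "\<dots> = (\<integral>\<^sup>+z. indicator A (fst (snd z)) \<partial>(?b \<Otimes>\<^sub>M (m \<Otimes>\<^sub>M \<nu>)))"
        by (rule nn_integral_distr) auto
      also have "\<dots> = (\<integral>\<^sup>+b. \<integral>\<^sup>+x. \<integral>\<^sup>+y. indicator A x \<partial>\<nu> \<partial>m \<partial>?b)"
        by (rule split) auto
      also have "\<dots> = emeasure m A" by (simp add: \<nu>.emeasure_space_1[simplified] measure_pmf.emeasure_space_1[simplified])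
      finally show "emeasure (distr \<pi> borel fst) A = emeasure m A" .
    qed simp
    show "distr \<pi> borel snd = m'"
    proof (rule measure_eqI)
      fix A assume "A \<in> sets (distr \<pi> borel snd)"
      then have A[measurable]: "A \<in> sets borel" by simp
      have "distr \<pi> borel snd = distr (?b \<Otimes>\<^sub>M (m \<Otimes>\<^sub>M \<nu>)) borel (\<lambda>z. if fst z then snd (snd z) else fst (snd z))"
        unfolding \<pi>_def by (subst distr_distr) (auto simp: comp_def split_beta)
      then have "emeasure (distr \<pi> borel snd) A
        = (\<integral>\<^sup>+x. indicator A x \<partial>distr (?b \<Otimes>\<^sub>M (m \<Otimes>\<^sub>M \<nu>)) borel (\<lambda>z. if fst z then snd (snd z) else fst (snd z)))"
        by simp
      also have "\<dots> = (\<integral>\<^sup>+z. indicator A (if fst z then snd (snd z) else fst (snd z)) \<partial>(?b \<Otimes>\<^sub>M (m \<Otimes>\<^sub>M \<nu>)))"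
        by (rule nn_integral_distr) auto
      also have "\<dots> = (\<integral>\<^sup>+b. \<integral>\<^sup>+x. \<integral>\<^sup>+y. indicator A (if b then y else x) \<partial>\<nu> \<partial>m \<partial>?b)"
        by (rule split) auto
      also have "\<dots> = ennreal e * emeasure \<nu> A + ennreal (1 - e) * emeasure m A"
        using e by (simp add: mult.commute nn_integral_bernoulli_pmf \<nu>.emeasure_space_1[simplified] m.emeasure_space_1[simplified])
      finally show "emeasure (distr \<pi> borel snd) A = emeasure m' A" using mix[OF A] by (simp add: add.commute)
    qed simp
  qed
  have "(\<integral>z. dist (fst z) (snd z) \<partial>\<pi>)
     = (\<integral>z. dist (fst (snd z)) (if fst z then snd (snd z) else fst (snd z)) \<partial>(?b \<Otimes>\<^sub>M (m \<Otimes>\<^sub>M \<nu>)))"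
    unfolding \<pi>_def by (subst integral_distr[OF meas]) (auto simp: split_beta)
  \<comment> \<open>The two points differ only when the coin shows \<open>True\<close>, and then by
    at most \<open>R\<close>.\<close>
  also have "\<dots> \<le> (\<integral>z. R * indicator {True} (fst z) \<partial>(?b \<Otimes>\<^sub>M (m \<Otimes>\<^sub>M \<nu>)))"
  proof (rule Bochner_Integration.integral_mono)
    show "integrable (?b \<Otimes>\<^sub>M (m \<Otimes>\<^sub>M \<nu>)) (\<lambda>z. dist (fst (snd z)) (if fst z then snd (snd z) else fst (snd z)))"
      by (rule bmn.integrable_const_bound[where B=R]) (use R in auto)
    show "integrable (?b \<Otimes>\<^sub>M (m \<Otimes>\<^sub>M \<nu>)) (\<lambda>z. R * indicator {True} (fst z))"
      by (rule bmn.integrable_const_bound[where B="\<bar>R\<bar>"]) (auto simp: indicator_def)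
  qed (use R in \<open>auto simp: indicator_def\<close>)
  also have "\<dots> = R * (\<integral>z. indicat_real {True} (fst z) \<partial>(?b \<Otimes>\<^sub>M (m \<Otimes>\<^sub>M \<nu>)))" by simp
  also have "(\<integral>z. indicat_real {True} (fst z) \<partial>(?b \<Otimes>\<^sub>M (m \<Otimes>\<^sub>M \<nu>)))
      = (\<integral>b. indicat_real {True} b \<partial>distr (?b \<Otimes>\<^sub>M (m \<Otimes>\<^sub>M \<nu>)) ?b fst)"
    by (rule integral_distr[symmetric]) auto
  also have "distr (?b \<Otimes>\<^sub>M (m \<Otimes>\<^sub>M \<nu>)) ?b fst = ?b"
    by (rule mn.P.distr_pair_fst)
  also have "(\<integral>b. indicat_real {True} b \<partial>?b) = e" using e by (simp add: measure_pmf_single)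
  finally show ?thesis using wasserstein_le_coupling[OF \<pi>] by (simp add: mult.commute)
qed

text \<open>If \<open>g\<close> dominates \<open>(1 - e) * f\<close>, then
  \<open>(g - (1 - e) * f) / e\<close> is again a probability density, and \<open>g\<close> is the
  mixture of \<open>f\<close> and this rest with weight \<open>e\<close> on the rest.\<close>

lemma wasserstein_density_le:
  fixes f g :: "('d::finite) torus \<Rightarrow> real"
  assumes [measurable]: "f \<in> borel_measurable borel" "g \<in> borel_measurable borel"
    and f: "\<And>x. 0 \<le> f x" "\<And>x. f x \<le> B" "(\<integral>x. f x \<partial>torus_vol) = 1"
    and g: "\<And>x. 0 \<le> g x" "\<And>x. g x \<le> B" "(\<integral>x. g x \<partial>torus_vol) = 1"
    and e: "0 < e" "e \<le> 1" and fg: "\<And>x. (1 - e) * f x \<le> g x"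
    and R: "\<And>x y :: 'd torus. dist x y \<le> R"
  shows "wasserstein (density torus_vol (\<lambda>x. ennreal (f x))) (density torus_vol (\<lambda>x. ennreal (g x))) \<le> e * R"
proof (rule wasserstein_mixture_le[where \<nu>="density torus_vol (\<lambda>x. ennreal ((g x - (1 - e) * f x) / e))"])
  have intf: "integrable torus_vol f" "integrable torus_vol g"
    by (rule torus_vol.integrable_const_bound[where B=B]; use f g in auto)+
  show "density torus_vol (\<lambda>x. ennreal (f x)) \<in> torus_probs" "density torus_vol (\<lambda>x. ennreal (g x)) \<in> torus_probs"
    by (rule density_torus_probs; use f g in auto)+
  show "density torus_vol (\<lambda>x. ennreal ((g x - (1 - e) * f x) / e)) \<in> torus_probs"
  proof (rule density_torus_probs)
    show "(g x - (1 - e) * f x) / e \<le> B / e" for x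
      using g(2)[of x] f(1)[of x] e mult_nonneg_nonneg[of "1 - e" "f x"] by (intro divide_right_mono) linarith+
    show "(\<integral>x. (g x - (1 - e) * f x) / e \<partial>torus_vol) = 1" using intf f g e by simp
  qed (use fg e in auto)
  fix A :: "'d torus set" assume [measurable]: "A \<in> sets borel"
  have "emeasure (density torus_vol (\<lambda>x. ennreal (g x))) A
     = (\<integral>\<^sup>+x. ennreal (1 - e) * (ennreal (f x) * indicator A x)
         + ennreal e * (ennreal ((g x - (1 - e) * f x) / e) * indicator A x) \<partial>torus_vol)"
  proof (subst emeasure_density, simp_all, rule nn_integral_cong)
    fix x
    have "ennreal (g x) = ennreal ((1 - e) * f x + e * ((g x - (1 - e) * f x) / e))" using e by simp
    also have "\<dots> = ennreal (1 - e) * ennreal (f x) + ennreal e * ennreal ((g x - (1 - e) * f x) / e)"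
    proof -
      have "0 \<le> (g x - (1 - e) * f x) / e" "0 \<le> (1 - e) * f x" using e f(1)[of x] fg[of x] by auto
      moreover have "0 \<le> 1 - e" "0 \<le> e" using e by auto
      ultimately show ?thesis using f(1)[of x] by (simp only: ennreal_mult[symmetric] ennreal_plus[symmetric] mult_nonneg_nonneg)
    qed
    finally show "ennreal (g x) * indicator A x = ennreal (1 - e) * (ennreal (f x) * indicator A x)
         + ennreal e * (ennreal ((g x - (1 - e) * f x) / e) * indicator A x)"
      by (simp add: indicator_def)
  qed
  also have "\<dots> = ennreal (1 - e) * emeasure (density torus_vol (\<lambda>x. ennreal (f x))) A
     + ennreal e * emeasure (density torus_vol (\<lambda>x. ennreal ((g x - (1 - e) * f x) / e))) A"
    by (subst nn_integral_add) (auto simp: emeasure_density nn_integral_cmult)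
  finally show "emeasure (density torus_vol (\<lambda>x. ennreal (g x))) A = \<dots>" .
qed (use e R in auto)

section \<open>Fourier coefficients as continuous functions of the measure\<close>

lemma space_probs_borel [simp]: "space probs_borel = torus_probs"
  by (simp add: probs_borel_def space_measure_of_conv)

lemma openin_torus_probs: "openin wasserstein_topology torus_probs"
  by (auto simp: openin_wasserstein_topology intro!: exI[of _ 1])

lemma topspace_wasserstein [simp]: "topspace wasserstein_topology = torus_probs"
proof
  show "topspace wasserstein_topology \<subseteq> torus_probs"
    unfolding topspace_def by (auto simp: openin_wasserstein_topology)
  show "torus_probs \<subseteq> topspace wasserstein_topology"
    by (rule openin_subset[OF openin_torus_probs])
qed

lemma sets_probs_borel_open: "openin wasserstein_topology U \<Longrightarrow> U \<in> sets probs_borel"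
  unfolding probs_borel_def by (subst sets_measure_of) (auto simp: openin_wasserstein_topology)

lemma measurable_probs_borelI:
  assumes "\<And>x. x \<in> space M \<Longrightarrow> f x \<in> torus_probs"
    and "\<And>U. openin wasserstein_topology U \<Longrightarrow> f -` U \<inter> space M \<in> sets M"
  shows "f \<in> M \<rightarrow>\<^sub>M probs_borel"
  unfolding probs_borel_def
  by (rule measurable_sigma_sets[OF sets_measure_of]) (use assms in \<open>auto simp: openin_wasserstein_topology\<close>)

text \<open>Under a coupling of cost below \<open>r\<close> the difference of the coefficients is
  the integral of the difference of a Lipschitz character at the two points.\<close>

lemma wasserstein_fourier_coeff:
  assumes m: "m \<in> torus_probs" and m': "m' \<in> torus_probs" and "wasserstein m m' < r"
  shows "norm (fourier_coeff m k - fourier_coeff m' k) \<le> 2 * pi * norm (fvec k) * r"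
proof -
  interpret m: prob_space m using m by (simp add: torus_probs_def)
  interpret m': prob_space m' using m' by (simp add: torus_probs_def)
  have [measurable_cong, simp]: "sets m = sets borel" "sets m' = sets borel"
    using m m' by (auto simp: torus_probs_def)
  interpret mm: pair_prob_space m m' ..
  have s: "sets (m \<Otimes>\<^sub>M m') = sets (borel \<Otimes>\<^sub>M borel)" by (intro sets_pair_measure_cong) simp_all
  \<comment> \<open>The product coupling shows that the infimum in \<open>wasserstein\<close> runs
    over a non-empty set, so that a coupling of cost below \<open>r\<close> exists.\<close>
  have "m \<Otimes>\<^sub>M m' \<in> couplings m m'"
    unfolding couplings_def
  proof (intro CollectI conjI s)
    show "prob_space (m \<Otimes>\<^sub>M m')" by (rule mm.P.prob_space_axioms)
    have "distr (m \<Otimes>\<^sub>M m') m fst = m" by (rule m'.distr_pair_fst)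
    then show "distr (m \<Otimes>\<^sub>M m') borel fst = m"
      by (metis (mono_tags, lifting) \<open>sets m = sets borel\<close> distr_cong)
    have "distr (m \<Otimes>\<^sub>M m') m' snd = m'"
    proof -
      have "emeasure (distr (m \<Otimes>\<^sub>M m') m' snd) A = emeasure m' A" if A: "A \<in> sets m'" for A
      proof -
        have "emeasure (distr (m \<Otimes>\<^sub>M m') m' snd) A = emeasure (m \<Otimes>\<^sub>M m') (space m \<times> A)"
          using A sets.sets_into_space[OF A]
          by (subst emeasure_distr) (auto intro!: arg_cong[where f="emeasure _"] simp: space_pair_measure)
        then show ?thesis by (simp add: m'.emeasure_pair_measure_Times[OF sets.top A] m.emeasure_space_1)
      qed
      then show ?thesis by (intro measure_eqI) auto
    qed
    then show "distr (m \<Otimes>\<^sub>M m') borel snd = m'"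
      by (metis (mono_tags, lifting) \<open>sets m' = sets borel\<close> distr_cong)
  qed
  then have ne: "couplings m m' \<noteq> {}" by blast
  have "bdd_below ((\<lambda>\<pi>. \<integral>z. dist (fst z) (snd z) \<partial>\<pi>) ` couplings m m')"
    by (auto intro!: bdd_belowI2[where m=0] integral_nonneg_AE)
  then obtain \<pi> where \<pi>: "\<pi> \<in> couplings m m'" "(\<integral>z. dist (fst z) (snd z) \<partial>\<pi>) < r"
    using assms(3) cINF_less_iff[OF ne] unfolding wasserstein_def by blast
  interpret \<pi>: prob_space \<pi> using \<pi> by (simp add: couplings_def)
  have [measurable_cong]: "sets \<pi> = sets (borel \<Otimes>\<^sub>M borel)" using \<pi> by (simp add: couplings_def)
  have marg: "m = distr \<pi> borel fst" "m' = distr \<pi> borel snd" using \<pi> by (auto simp: couplings_def)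
  obtain R where R: "\<And>x y :: 'a torus. dist x y \<le> R" using torus_dist_bounded by blast
  let ?e = "fourier_char k"
  have int: "integrable \<pi> (\<lambda>z. ?e (fst z))" "integrable \<pi> (\<lambda>z. ?e (snd z))"
    by (rule \<pi>.integrable_const_bound[where B=1]; auto)+
  have intd: "integrable \<pi> (\<lambda>z. dist (fst z) (snd z))"
    by (rule \<pi>.integrable_const_bound[where B=R]) (use R in auto)
  have "fourier_coeff m k = (\<integral>z. ?e (fst z) \<partial>\<pi>)"
    unfolding fourier_coeff_def by (subst marg(1), rule integral_distr) auto
  moreover have "fourier_coeff m' k = (\<integral>z. ?e (snd z) \<partial>\<pi>)"
    unfolding fourier_coeff_def by (subst marg(2), rule integral_distr) auto
  ultimately have "norm (fourier_coeff m k - fourier_coeff m' k) = norm (\<integral>z. ?e (fst z) - ?e (snd z) \<partial>\<pi>)"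
    using int by simp
  also have "\<dots> \<le> (\<integral>z. norm (?e (fst z) - ?e (snd z)) \<partial>\<pi>)" by (rule integral_norm_bound)
  also have "\<dots> \<le> (\<integral>z. 2 * pi * norm (fvec k) * dist (fst z) (snd z) \<partial>\<pi>)"
    by (rule Bochner_Integration.integral_mono) (use int intd fourier_char_lipschitz in auto)
  also have "\<dots> = 2 * pi * norm (fvec k) * (\<integral>z. dist (fst z) (snd z) \<partial>\<pi>)" by simp
  also have "\<dots> \<le> 2 * pi * norm (fvec k) * r"
    using \<pi>(2) by (intro mult_left_mono) auto
  finally show ?thesis .
qed

lemma openin_fourier_coeff:
  fixes k :: "('d::finite) freq"
  assumes "open V"
  shows "openin wasserstein_topology {m \<in> torus_probs. fourier_coeff m k \<in> V}"
  unfolding openin_wasserstein_topology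
proof safe
  fix m :: "'d torus measure" assume m: "m \<in> torus_probs" "fourier_coeff m k \<in> V"
  obtain e where e: "e > 0" "ball (fourier_coeff m k) e \<subseteq> V"
    using assms m(2) by (meson open_contains_ball)
  let ?L = "2 * pi * norm (fvec k) + 1"
  have L: "?L > 0" by (simp add: add_nonneg_pos)
  show "\<exists>r>0. \<forall>m'\<in>torus_probs. wasserstein m m' < r \<longrightarrow> m' \<in> {m \<in> torus_probs. fourier_coeff m k \<in> V}"
  proof (intro exI[of _ "e / ?L"] conjI ballI impI)
    fix m' :: "'d torus measure" assume m': "m' \<in> torus_probs" "wasserstein m m' < e / ?L"
    have "norm (fourier_coeff m k - fourier_coeff m' k) \<le> 2 * pi * norm (fvec k) * (e / ?L)"
      by (rule wasserstein_fourier_coeff[OF m(1) m'])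
    also have "\<dots> < ?L * (e / ?L)" using e L by (intro mult_strict_right_mono) auto
    also have "\<dots> = e" using L by simp
    finally show "m' \<in> {m \<in> torus_probs. fourier_coeff m k \<in> V}"
      using e m' by (auto simp: dist_norm subset_iff)
  qed (use e L in auto)
qed

text \<open>Bounded continuous functions of finitely many coefficients thereby become admissible
  test functions in \<open>weak_limit\<close>.\<close>

lemma continuous_map_fourier_coeff:
  "continuous_map wasserstein_topology euclidean (\<lambda>m. fourier_coeff m k)"
  using openin_fourier_coeff by (auto simp: continuous_map_def)

lemma borel_measurable_fourier_coeff [measurable]:
  "(\<lambda>m. fourier_coeff m k) \<in> borel_measurable probs_borel"
proof (rule borel_measurableI)
  fix S :: "complex set" assume "open S"
  have "(\<lambda>m. fourier_coeff m k) -` S \<inter> space probs_borel = {m \<in> torus_probs. fourier_coeff m k \<in> S}"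
    by auto
  then show "(\<lambda>m. fourier_coeff m k) -` S \<inter> space probs_borel \<in> sets probs_borel"
    using sets_probs_borel_open[OF openin_fourier_coeff[OF \<open>open S\<close>]] by simp
qed

lemma fourier_coeff_0: "m \<in> torus_probs \<Longrightarrow> fourier_coeff m 0 = 1"
  by (auto simp: fourier_coeff_def torus_probs_def prob_space.prob_space)

lemma fourier_coeff_uminus: "fourier_coeff m (- k) = cnj (fourier_coeff m k)"
  by (simp add: fourier_coeff_def fourier_char_uminus)

section \<open>Summable coefficient sequences\<close>

definition half_space :: "(('d::{finite,linorder}) freq) set" where
  "half_space = (\<Union>N. F_plus N)"

lemma finite_F_set: "finite (F_set N :: ('d::finite) freq set)"
proof (rule finite_subset)
  show "F_set N \<subseteq> vec_lambda ` (PiE UNIV (\<lambda>_::'d. {- int N..int N}))"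
  proof
    fix k :: "'d freq" assume k: "k \<in> F_set N"
    have "vec_nth k \<in> PiE UNIV (\<lambda>_::'d. {- int N..int N})"
    proof (rule PiE_I)
      fix i show "k $ i \<in> {- int N..int N}"
        using k by (auto simp: F_set_def abs_less_iff dest!: spec[of _ i])
    qed simp
    then show "k \<in> vec_lambda ` (PiE UNIV (\<lambda>_::'d. {- int N..int N}))"
      by (metis imageI vec_nth_inverse)
  qed
  show "finite (vec_lambda ` (PiE UNIV (\<lambda>_::'d. {- int N..int N})))"
    by (intro finite_imageI finite_PiE) auto
qed

lemma finite_F_plus [simp]: "finite (F_plus N)"
  by (rule finite_subset[OF _ finite_F_set[of N]]) (auto simp: F_plus_def)

lemma F_set_covers: "\<exists>N. (k :: ('d::finite) freq) \<in> F_set N"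
proof -
  have "\<bar>k $ i\<bar> < int (Suc (nat (\<Sum>j\<in>UNIV. \<bar>k $ j\<bar>)))" for i
    using member_le_sum[of i UNIV "\<lambda>j. \<bar>k $ j\<bar>"] by simp
  then show ?thesis unfolding F_set_def by blast
qed

lemma F_plus_eq: "F_plus N = F_set N \<inter> half_space"
  by (auto simp: half_space_def F_plus_def)

lemma F_set_mono: "M \<le> N \<Longrightarrow> F_set M \<subseteq> F_set N"
  by (auto simp: F_set_def) (meson less_le_trans of_nat_le_iff)

lemma F_plus_mono: "M \<le> N \<Longrightarrow> F_plus M \<subseteq> F_plus N"
  using F_set_mono by (auto simp: F_plus_eq)

lemma F_plus_subset: "F_plus N \<subseteq> half_space"
  by (auto simp: F_plus_eq)

lemma half_space_iff: "k \<in> half_space \<longleftrightarrow> (\<exists>i. k $ i > 0 \<and> (\<forall>j<i. k $ j = 0))"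
  using F_set_covers[of k] by (auto simp: half_space_def F_plus_def)

lemma zero_notin_half_space [simp]: "0 \<notin> half_space"
  by (simp add: half_space_iff)

lemma uminus_notin_half_space:
  assumes "k \<in> half_space" shows "- k \<notin> half_space"
proof
  assume "- k \<in> half_space"
  then obtain j where j: "k $ j < 0" "\<forall>l<j. k $ l = 0" by (auto simp: half_space_iff)
  obtain i where i: "k $ i > 0" "\<forall>l<i. k $ l = 0" using assms by (auto simp: half_space_iff)
  show False using i j by (metis less_irrefl linorder_neqE order.asym)
qed

lemma half_space_cases:
  assumes "k \<noteq> 0" obtains "k \<in> half_space" | "- k \<in> half_space"
proof -
  have ne: "{i. k $ i \<noteq> 0} \<noteq> {}" using assms by (auto simp: vec_eq_iff)
  define i where "i = Min {i. k $ i \<noteq> 0}"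
  have "k $ i \<noteq> 0" using Min_in[OF _ ne] by (simp add: i_def)
  moreover have "k $ j = 0" if "j < i" for j
  proof (rule ccontr)
    assume "k $ j \<noteq> 0"
    then have "i \<le> j" unfolding i_def by (intro Min_le) auto
    then show False using that by simp
  qed
  ultimately have "k \<in> half_space \<or> - k \<in> half_space"
    unfolding half_space_iff by (metis linorder_neqE neg_0_less_iff_less vector_uminus_component neg_equal_0_iff_equal)
  then show thesis using that by blast
qed

lemma countable_half_space [simp]: "countable half_space"
  unfolding half_space_def by (intro countable_UN) (auto intro: countable_finite)

text \<open>Through this filter limit the sums over the boxes \<open>F_plus N\<close> converge to
  the unordered sum over \<open>half_space\<close>.\<close>

lemma filterlim_F_plus: "filterlim F_plus (finite_subsets_at_top half_space) sequentially"
  unfolding filterlim_finite_subsets_at_top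
proof (intro allI impI)
  fix X :: "'a freq set" assume X: "finite X \<and> X \<subseteq> half_space"
  then have "\<forall>\<^sub>F N in sequentially. \<forall>k\<in>X. k \<in> F_plus N"
  proof (intro eventually_ball_finite ballI)
    fix k assume "k \<in> X"
    then obtain N where "k \<in> F_plus N" using X by (auto simp: half_space_def)
    then show "\<forall>\<^sub>F N in sequentially. k \<in> F_plus N"
      by (intro eventually_sequentiallyI[of N]) (use F_plus_mono in blast)
  qed auto
  then show "\<forall>\<^sub>F N in sequentially. finite (F_plus N) \<and> X \<subseteq> F_plus N \<and> F_plus N \<subseteq> half_space"
    by eventually_elim (use F_plus_subset in auto)
qed

section \<open>Summable sequences: distance, tails and scaling\<close>

text \<open>Extensionality on \<open>half_space\<close> makes these sequences points of the product
  space that carries the Gaussian measure.\<close>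

definition l1_seq :: "(('d::{finite,linorder}) freq \<Rightarrow> complex) set" where
  "l1_seq = {a \<in> half_space \<rightarrow>\<^sub>E UNIV. (\<lambda>k. norm (a k)) summable_on half_space}"

definition l1_dist :: "(('d::{finite,linorder}) freq \<Rightarrow> complex) \<Rightarrow> ('d freq \<Rightarrow> complex) \<Rightarrow> real" where
  "l1_dist a b = (\<Sum>\<^sub>\<infinity>k\<in>half_space. norm (a k - b k))"

lemma l1_diff_summable:
  assumes "a \<in> l1_seq" "b \<in> l1_seq"
  shows "(\<lambda>k. norm (a k - b k)) summable_on half_space"
proof (rule Infinite_Sum.abs_summable_on_comparison_test')
  show "(\<lambda>k. norm (a k) + norm (b k)) summable_on half_space"
    using assms by (intro summable_on_add) (auto simp: l1_seq_def)
qed (rule norm_triangle_ineq4)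

lemma l1_dist_nonneg: "0 \<le> l1_dist a b"
  by (simp add: l1_dist_def infsum_nonneg)

lemma l1_dist_self [simp]: "l1_dist a a = 0"
  by (simp add: l1_dist_def)

lemma l1_dist_commute: "l1_dist a b = l1_dist b a"
  by (simp add: l1_dist_def norm_minus_commute)

lemma l1_dist_triangle:
  assumes "a \<in> l1_seq" "b \<in> l1_seq" "c \<in> l1_seq"
  shows "l1_dist a c \<le> l1_dist a b + l1_dist b c"
proof -
  have "l1_dist a c \<le> (\<Sum>\<^sub>\<infinity>k\<in>half_space. norm (a k - b k) + norm (b k - c k))"
    unfolding l1_dist_def
  proof (intro infsum_mono summable_on_add l1_diff_summable assms)
    show "norm (a k - c k) \<le> norm (a k - b k) + norm (b k - c k)" for k
      using norm_triangle_ineq[of "a k - b k" "b k - c k"] by simp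
  qed
  then show ?thesis
    unfolding l1_dist_def by (subst (asm) infsum_add) (intro l1_diff_summable assms)+
qed

definition l1_tail :: "nat \<Rightarrow> (('d::{finite,linorder}) freq \<Rightarrow> complex) \<Rightarrow> real" where
  "l1_tail N a = (\<Sum>\<^sub>\<infinity>k\<in>half_space - F_plus N. norm (a k))"

lemma l1_tail_tendsto:
  assumes "a \<in> l1_seq" shows "(\<lambda>N. l1_tail N a) \<longlonglongrightarrow> 0"
proof -
  have s: "(\<lambda>k. norm (a k)) summable_on half_space" using assms by (simp add: l1_seq_def)
  have "l1_tail N a = (\<Sum>\<^sub>\<infinity>k\<in>half_space. norm (a k)) - (\<Sum>k\<in>F_plus N. norm (a k))" for N
  proof -
    have "(\<Sum>\<^sub>\<infinity>k\<in>F_plus N \<union> (half_space - F_plus N). norm (a k)) = (\<Sum>\<^sub>\<infinity>k\<in>F_plus N. norm (a k)) + l1_tail N a"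
      unfolding l1_tail_def
      by (rule infsum_Un_disjoint) (auto intro!: summable_on_subset[OF s])
    moreover have *: "F_plus N \<union> (half_space - F_plus N) = half_space" using F_plus_subset by blast
    ultimately show ?thesis unfolding * by simp
  qed
  moreover have "(\<lambda>N. \<Sum>k\<in>F_plus N. norm (a k)) \<longlonglongrightarrow> (\<Sum>\<^sub>\<infinity>k\<in>half_space. norm (a k))"
    by (rule filterlim_compose[OF infsum_tendsto[OF s] filterlim_F_plus])
  ultimately show ?thesis using tendsto_diff[OF tendsto_const, of _ "\<Sum>\<^sub>\<infinity>k\<in>half_space. norm (a k)" sequentially "\<Sum>\<^sub>\<infinity>k\<in>half_space. norm (a k)"] by simp
qed

lemma l1_tail_nonneg: "0 \<le> l1_tail N a"
  by (simp add: l1_tail_def infsum_nonneg)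

text \<open>Truncation, Fejer damping and the rescaling of a block of coordinates are all of this
  form.\<close>

definition scale_seq :: "(('d::{finite,linorder}) freq \<Rightarrow> real) \<Rightarrow> ('d freq \<Rightarrow> complex) \<Rightarrow> 'd freq \<Rightarrow> complex" where
  "scale_seq w a = (\<lambda>k\<in>half_space. of_real (w k) * a k)"

lemma scale_seq_apply [simp]: "k \<in> half_space \<Longrightarrow> scale_seq w a k = of_real (w k) * a k"
  by (simp add: scale_seq_def)

lemma scale_seq_in_l1:
  assumes "a \<in> l1_seq" "\<And>k. \<bar>w k\<bar> \<le> 1"
  shows "scale_seq w a \<in> l1_seq"
proof -
  have "(\<lambda>k. norm (scale_seq w a k)) summable_on half_space"
  proof (rule Infinite_Sum.abs_summable_on_comparison_test')
    show "(\<lambda>k. norm (a k)) summable_on half_space" using assms by (simp add: l1_seq_def)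
    show "norm (scale_seq w a k) \<le> norm (a k)" if "k \<in> half_space" for k
      using that mult_right_mono[OF assms(2)[of k], of "norm (a k)"] by (simp add: norm_mult)
  qed
  then show ?thesis by (auto simp: l1_seq_def scale_seq_def)
qed

lemma l1_dist_scale_seq_le:
  assumes "a \<in> l1_seq" "b \<in> l1_seq" "\<And>k. \<bar>w k\<bar> \<le> 1"
  shows "l1_dist (scale_seq w a) (scale_seq w b) \<le> l1_dist a b"
  unfolding l1_dist_def
proof (rule infsum_mono)
  show "norm (scale_seq w a k - scale_seq w b k) \<le> norm (a k - b k)" if "k \<in> half_space" for k
    using that mult_right_mono[OF assms(3)[of k], of "norm (a k - b k)"]
    by (simp add: right_diff_distrib[symmetric] norm_mult)
qed (intro l1_diff_summable scale_seq_in_l1 assms)+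

text \<open>Dominated convergence by hand: weights of size at most \<open>1\<close> control the
  tail, and the head is a finite sum.\<close>

lemma scale_seq_tendsto:
  fixes a :: "('d::{finite,linorder}) freq \<Rightarrow> complex" and w :: "nat \<Rightarrow> 'd freq \<Rightarrow> real"
  assumes a: "a \<in> l1_seq" and w: "\<And>N k. \<bar>w N k\<bar> \<le> 1" and lim: "\<And>k. k \<in> half_space \<Longrightarrow> (\<lambda>N. w N k) \<longlonglongrightarrow> 1"
  shows "(\<lambda>N. l1_dist a (scale_seq (w N) a)) \<longlonglongrightarrow> 0"
proof (rule LIMSEQ_I)
  fix e :: real assume "e > 0"
  have s: "(\<lambda>k. norm (a k)) summable_on half_space" using a by (simp add: l1_seq_def)
  \<comment> \<open>The tail of the difference is at most twice the tail of \<open>a\<close>, hence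
    \<open>e / 4\<close>; the head takes the other \<open>e / 2\<close>.\<close>
  obtain M where M: "l1_tail M a < e / 4"
    using LIMSEQ_D[OF l1_tail_tendsto[OF a], of "e / 4"] \<open>e > 0\<close> l1_tail_nonneg[of _ a] by force
  have "(\<lambda>N. \<Sum>k\<in>F_plus M. norm (a k - scale_seq (w N) a k)) \<longlonglongrightarrow> (\<Sum>k\<in>F_plus M. norm (a k - of_real 1 * a k))"
  proof (intro tendsto_intros)
    fix k :: "'d freq" assume "k \<in> F_plus M"
    then have k: "k \<in> half_space" using F_plus_subset by blast
    show "(\<lambda>N. scale_seq (w N) a k) \<longlonglongrightarrow> of_real 1 * a k"
      unfolding scale_seq_apply[OF k] by (intro tendsto_intros lim k)
  qed
  then obtain no where no: "\<And>N. N \<ge> no \<Longrightarrow> (\<Sum>k\<in>F_plus M. norm (a k - scale_seq (w N) a k)) < e / 2"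
    using LIMSEQ_D[of _ _ "e / 2"] \<open>e > 0\<close> by fastforce
  show "\<exists>no. \<forall>N\<ge>no. norm (l1_dist a (scale_seq (w N) a) - 0) < e"
  proof (intro exI[of _ no] allI impI)
    fix N assume "N \<ge> no"
    let ?f = "\<lambda>k. norm (a k - scale_seq (w N) a k)"
    have sf: "?f summable_on half_space" by (intro l1_diff_summable scale_seq_in_l1 a w)
    have "l1_dist a (scale_seq (w N) a) = infsum ?f (F_plus M \<union> (half_space - F_plus M))"
      unfolding l1_dist_def by (intro arg_cong[where f="infsum _"]) (use F_plus_subset in blast)
    also have "\<dots> = (\<Sum>k\<in>F_plus M. ?f k) + infsum ?f (half_space - F_plus M)"
      by (subst infsum_Un_disjoint) (auto intro!: summable_on_subset[OF sf])
    also have "infsum ?f (half_space - F_plus M) \<le> infsum (\<lambda>k. 2 * norm (a k)) (half_space - F_plus M)"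
    proof (rule infsum_mono)
      show "?f summable_on half_space - F_plus M" by (rule summable_on_subset[OF sf]) auto
      show "(\<lambda>k. 2 * norm (a k)) summable_on half_space - F_plus M"
        by (intro summable_on_cmult_right summable_on_subset[OF s]) auto
      fix k :: "'d freq" assume "k \<in> half_space - F_plus M"
      then have k: "k \<in> half_space" by simp
      have "?f k \<le> norm (a k) + norm (scale_seq (w N) a k)" by (rule norm_triangle_ineq4)
      also have "norm (scale_seq (w N) a k) \<le> norm (a k)"
        using k mult_right_mono[OF w[of N k], of "norm (a k)"] by (simp add: norm_mult)
      finally show "?f k \<le> 2 * norm (a k)" by simp
    qed
    also have "infsum (\<lambda>k. 2 * norm (a k)) (half_space - F_plus M) = 2 * l1_tail M a"
      unfolding l1_tail_def by (rule infsum_cmult_right')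
    finally show "norm (l1_dist a (scale_seq (w N) a) - 0) < e"
      using no[OF \<open>N \<ge> no\<close>] M l1_dist_nonneg[of a "scale_seq (w N) a"] by simp
  qed
qed

definition trunc_seq :: "nat \<Rightarrow> (('d::{finite,linorder}) freq \<Rightarrow> complex) \<Rightarrow> 'd freq \<Rightarrow> complex" where
  "trunc_seq N a = (\<lambda>k\<in>half_space. if k \<in> F_plus N then a k else 0)"

lemma trunc_seq_eq: "trunc_seq N = scale_seq (indicator (F_plus N))"
  by (auto simp: trunc_seq_def scale_seq_def fun_eq_iff indicator_def)

lemma trunc_seq_in_l1: "trunc_seq N a \<in> l1_seq"
proof -
  have "(\<lambda>k. norm (trunc_seq N a k)) summable_on half_space"
    by (rule finite_nonzero_values_imp_summable_on)
       (rule finite_subset[OF _ finite_F_plus[of N]], auto simp: trunc_seq_def split: if_splits)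
  then show ?thesis by (auto simp: l1_seq_def trunc_seq_def)
qed

lemma trunc_seq_tendsto:
  assumes "a \<in> l1_seq" shows "(\<lambda>N. l1_dist a (trunc_seq N a)) \<longlonglongrightarrow> 0"
  unfolding trunc_seq_eq
proof (rule scale_seq_tendsto[OF assms])
  fix k :: "'a freq" assume "k \<in> half_space"
  then obtain M where "k \<in> F_plus M" by (auto simp: half_space_def)
  then show "(\<lambda>N. indicator (F_plus N) k) \<longlonglongrightarrow> (1::real)"
    by (intro tendsto_eventually eventually_sequentiallyI[of M]) (use F_plus_mono in \<open>auto simp: indicator_def\<close>)
qed (auto simp: indicator_def)

section \<open>Measurability of sets that are open in the summation norm\<close>

abbreviation seq_space :: "(('d::{finite,linorder}) freq \<Rightarrow> complex) measure" where
  "seq_space \<equiv> PiM half_space (\<lambda>_. borel)"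

lemma borel_measurable_coord [measurable]:
  "k \<in> half_space \<Longrightarrow> (\<lambda>a. a k) \<in> borel_measurable seq_space"
  using measurable_component_singleton[of k half_space "\<lambda>_. borel"] by simp

lemma space_seq_space: "space seq_space = (half_space \<rightarrow>\<^sub>E UNIV)"
  by (simp add: space_PiM)

lemma l1_seq_subset: "l1_seq \<subseteq> space seq_space"
  by (auto simp: space_seq_space l1_seq_def)

text \<open>A bound by some natural number on all the nested finite sums is a countable condition on
  coordinates, which gives measurability.\<close>

lemma l1_seq_eq:
  "(l1_seq :: (('d::{finite,linorder}) freq \<Rightarrow> complex) set) = {a \<in> space seq_space. \<exists>C::nat. \<forall>N. (\<Sum>k\<in>F_plus N. norm (a k)) \<le> real C}"
proof (intro set_eqI iffI)
  fix a :: "'d freq \<Rightarrow> complex" assume a: "a \<in> l1_seq"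
  then have s: "(\<lambda>k. norm (a k)) summable_on half_space" by (simp add: l1_seq_def)
  obtain C :: nat where "(\<Sum>\<^sub>\<infinity>k\<in>half_space. norm (a k)) \<le> real C" using real_arch_simple by blast
  then have "(\<Sum>k\<in>F_plus N. norm (a k)) \<le> real C" for N
    using finite_sum_le_infsum[OF s finite_F_plus F_plus_subset, of N] by simp
  then show "a \<in> {a \<in> space seq_space. \<exists>C::nat. \<forall>N. (\<Sum>k\<in>F_plus N. norm (a k)) \<le> real C}"
    using a l1_seq_subset by blast
next
  fix a :: "'d freq \<Rightarrow> complex" assume "a \<in> {a \<in> space seq_space. \<exists>C::nat. \<forall>N. (\<Sum>k\<in>F_plus N. norm (a k)) \<le> real C}"
  then obtain C :: nat where a: "a \<in> space seq_space" and C: "\<And>N. (\<Sum>k\<in>F_plus N. norm (a k)) \<le> real C" by blast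
  have "bdd_above (sum (\<lambda>k. norm (a k)) ` {F. F \<subseteq> half_space \<and> finite F})"
  proof (rule bdd_aboveI2)
    fix F :: "'d freq set" assume F: "F \<in> {F. F \<subseteq> half_space \<and> finite F}"
    then have "\<forall>\<^sub>F N in sequentially. finite (F_plus N) \<and> F \<subseteq> F_plus N \<and> F_plus N \<subseteq> (half_space :: 'd freq set)"
      using filterlim_F_plus[where 'a='d, unfolded filterlim_finite_subsets_at_top, rule_format, of F] by simp
    then obtain N where N: "F \<subseteq> F_plus N" by (auto simp: eventually_sequentially)
    have "(\<Sum>k\<in>F. norm (a k)) \<le> (\<Sum>k\<in>F_plus N. norm (a k))"
      by (rule sum_mono2[OF finite_F_plus N]) auto
    then show "(\<Sum>k\<in>F. norm (a k)) \<le> real C" using C[of N] by simp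
  qed
  then have "(\<lambda>k. norm (a k)) summable_on half_space" by (simp add: Infinite_Sum.abs_summable_iff_bdd_above)
  then show "a \<in> l1_seq" using a by (auto simp: l1_seq_def space_seq_space)
qed

lemma sets_l1_seq: "(l1_seq :: (('d::{finite,linorder}) freq \<Rightarrow> complex) set) \<in> sets seq_space"
proof -
  have [measurable]: "(\<lambda>a. \<Sum>k\<in>F_plus N. norm (a k)) \<in> borel_measurable (seq_space :: ('d freq \<Rightarrow> complex) measure)" for N
    proof (rule borel_measurable_sum)
      fix k :: "'d freq" assume "k \<in> F_plus N"
      then have [measurable]: "k \<in> half_space" using F_plus_subset by blast
      show "(\<lambda>a. norm (a k)) \<in> borel_measurable seq_space" by measurable
    qed
  show ?thesis unfolding l1_seq_eq by measurable
qed

definition l1_open :: "(('d::{finite,linorder}) freq \<Rightarrow> complex) set \<Rightarrow> bool" where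
  "l1_open V \<longleftrightarrow> V \<subseteq> l1_seq \<and> (\<forall>a\<in>V. \<exists>e>0. \<forall>b\<in>l1_seq. l1_dist a b < e \<longrightarrow> b \<in> V)"

text \<open>Rounding to a grid takes countably many values, so every property of the rounded sequence is
  measurable.\<close>

definition grid_floor :: "nat \<Rightarrow> (('d::{finite,linorder}) freq \<Rightarrow> complex) \<Rightarrow> 'd freq \<Rightarrow> int \<times> int" where
  "grid_floor n a = (\<lambda>k\<in>F_plus n.
     (\<lfloor>Re (a k) * (real (Suc n) * (real (card (F_plus n :: 'd freq set)) + 1))\<rfloor>,
      \<lfloor>Im (a k) * (real (Suc n) * (real (card (F_plus n :: 'd freq set)) + 1))\<rfloor>))"

definition grid_seq :: "nat \<Rightarrow> (('d::{finite,linorder}) freq \<Rightarrow> int \<times> int) \<Rightarrow> 'd freq \<Rightarrow> complex" where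
  "grid_seq n u = (\<lambda>k\<in>half_space. if k \<in> F_plus n
     then Complex (real_of_int (fst (u k)) / (real (Suc n) * (real (card (F_plus n :: 'd freq set)) + 1)))
                  (real_of_int (snd (u k)) / (real (Suc n) * (real (card (F_plus n :: 'd freq set)) + 1))) else 0)"

lemma measurable_grid_floor:
  "grid_floor n \<in> seq_space \<rightarrow>\<^sub>M count_space (F_plus n \<rightarrow>\<^sub>E (UNIV :: (int \<times> int) set))"
proof -
  have [measurable]: "k \<in> half_space" if "k \<in> F_plus n" for k using that F_plus_subset by blast
  have "(\<lambda>x::real. \<lfloor>x\<rfloor>) \<in> borel \<rightarrow>\<^sub>M count_space UNIV" by simp
  have "grid_floor n \<in> seq_space \<rightarrow>\<^sub>M PiM (F_plus n) (\<lambda>_. count_space (UNIV :: (int \<times> int) set))"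
    unfolding grid_floor_def[abs_def]
  proof (rule measurable_restrict)
    fix k assume "k \<in> F_plus n"
    then have [measurable]: "k \<in> half_space" using F_plus_subset by blast
    show "(\<lambda>a. (\<lfloor>Re (a k) * (real (Suc n) * (real (card (F_plus n)) + 1))\<rfloor>,
      \<lfloor>Im (a k) * (real (Suc n) * (real (card (F_plus n)) + 1))\<rfloor>)) \<in> seq_space \<rightarrow>\<^sub>M count_space UNIV"
    proof -
      have "(\<lambda>a. (\<lfloor>Re (a k) * (real (Suc n) * (real (card (F_plus n)) + 1))\<rfloor>,
        \<lfloor>Im (a k) * (real (Suc n) * (real (card (F_plus n)) + 1))\<rfloor>)) \<in> seq_space \<rightarrow>\<^sub>M count_space UNIV \<Otimes>\<^sub>M count_space UNIV"
        by measurable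
      then show ?thesis by (simp add: pair_measure_countable)
    qed
  qed
  then show ?thesis by (simp add: count_space_PiM_finite)
qed

lemma sets_grid_property: "{a \<in> space seq_space. P (grid_seq n (grid_floor n a))} \<in> sets seq_space"
proof -
  have "{a \<in> space seq_space. P (grid_seq n (grid_floor n a))}
     = grid_floor n -` {u \<in> F_plus n \<rightarrow>\<^sub>E UNIV. P (grid_seq n u)} \<inter> space seq_space"
    by (auto simp: grid_floor_def)
  also have "\<dots> \<in> sets seq_space" by (rule measurable_sets[OF measurable_grid_floor]) auto
  finally show ?thesis .
qed

lemma grid_seq_in_l1: "grid_seq n u \<in> l1_seq"
proof -
  have "(\<lambda>k. norm (grid_seq n u k)) summable_on half_space"
    by (rule finite_nonzero_values_imp_summable_on)
       (rule finite_subset[OF _ finite_F_plus[of n]], auto simp: grid_seq_def split: if_splits)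
  then show ?thesis by (auto simp: l1_seq_def grid_seq_def)
qed

lemma grid_seq_tendsto:
  fixes a :: "('d::{finite,linorder}) freq \<Rightarrow> complex"
  assumes a: "a \<in> l1_seq"
  shows "(\<lambda>n. l1_dist a (grid_seq n (grid_floor n a))) \<longlonglongrightarrow> 0"
proof (rule tendsto_sandwich[OF always_eventually always_eventually tendsto_const])
  show "\<forall>n. 0 \<le> l1_dist a (grid_seq n (grid_floor n a))" by (simp add: l1_dist_nonneg)
  show "\<forall>n. l1_dist a (grid_seq n (grid_floor n a)) \<le> l1_dist a (trunc_seq n a) + 2 / real (Suc n)"
  proof
    fix n
    \<comment> \<open>In each coordinate of the box the rounding error is at most
      \<open>2 / ?c\<close>, real and imaginary part together, so over the whole box it is at most
      \<open>2 / (n + 1)\<close>. The summand \<open>1\<close> keeps \<open>?c\<close> positive when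
      the box is empty.\<close>
    let ?c = "real (Suc n) * (real (card (F_plus n :: 'd freq set)) + 1)"
    have c: "?c > 0" by (intro mult_pos_pos) auto
    let ?t = "trunc_seq n a" and ?g = "grid_seq n (grid_floor n a)"
    have fl: "\<bar>x - real_of_int \<lfloor>x * ?c\<rfloor> / ?c\<bar> \<le> 1 / ?c" for x
    proof -
      have "\<bar>x * ?c - real_of_int \<lfloor>x * ?c\<rfloor>\<bar> \<le> 1" by linarith
      moreover have "x - real_of_int \<lfloor>x * ?c\<rfloor> / ?c = (x * ?c - real_of_int \<lfloor>x * ?c\<rfloor>) / ?c"
        using c by (simp add: diff_divide_distrib)
      ultimately show ?thesis using c by (simp only: abs_divide) (simp add: divide_right_mono)
    qed
    have "l1_dist ?t ?g = (\<Sum>\<^sub>\<infinity>k\<in>F_plus n. norm (?t k - ?g k))"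
      unfolding l1_dist_def
      by (rule infsum_cong_neutral) (use F_plus_subset in \<open>auto simp: trunc_seq_def grid_seq_def\<close>)
    also have "\<dots> = (\<Sum>k\<in>F_plus n. norm (?t k - ?g k))" by simp
    also have "\<dots> \<le> (\<Sum>k\<in>(F_plus n :: 'd freq set). 2 / ?c)"
    proof (rule sum_mono)
      fix k :: "'d freq" assume k: "k \<in> F_plus n"
      then have "k \<in> half_space" using F_plus_subset by blast
      then have "?t k - ?g k = Complex (Re (a k) - real_of_int \<lfloor>Re (a k) * ?c\<rfloor> / ?c) (Im (a k) - real_of_int \<lfloor>Im (a k) * ?c\<rfloor> / ?c)"
        using k by (simp add: trunc_seq_def grid_seq_def grid_floor_def complex_eq_iff)
      then have "norm (?t k - ?g k) \<le> \<bar>Re (a k) - real_of_int \<lfloor>Re (a k) * ?c\<rfloor> / ?c\<bar> + \<bar>Im (a k) - real_of_int \<lfloor>Im (a k) * ?c\<rfloor> / ?c\<bar>"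
        using cmod_le[of "?t k - ?g k"] by simp
      also have "\<dots> \<le> 1 / ?c + 1 / ?c" by (intro add_mono fl)
      finally show "norm (?t k - ?g k) \<le> 2 / ?c" by simp
    qed
    also have "\<dots> = real (card (F_plus n :: 'd freq set)) * (2 / ?c)" by simp
    also have "\<dots> \<le> (real (card (F_plus n :: 'd freq set)) + 1) * (2 / ?c)"
      using c by (intro mult_right_mono) auto
    also have "\<dots> = 2 / real (Suc n)"
      by (simp only: times_divide_eq_right mult.commute[of "real (Suc n)"] mult_divide_mult_cancel_left_if) simp
    finally show "l1_dist a ?g \<le> l1_dist a ?t + 2 / real (Suc n)"
      using l1_dist_triangle[of a ?t ?g] a trunc_seq_in_l1[of n a] grid_seq_in_l1[of n "grid_floor n a"] by simp
  qed
  have "(\<lambda>n. 2 * inverse (real (Suc n))) \<longlonglongrightarrow> 2 * 0"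
    by (intro tendsto_mult tendsto_const LIMSEQ_inverse_real_of_nat)
  then show "(\<lambda>n. l1_dist a (trunc_seq n a) + 2 / real (Suc n)) \<longlonglongrightarrow> 0"
    using tendsto_add[OF trunc_seq_tendsto[OF a]] by (simp add: divide_inverse)
qed

text \<open>An open set is recovered from rounded sequences: a summable \<open>a\<close> lies in
  \<open>V\<close> exactly if, for some \<open>q\<close>, the balls of radius
  \<open>1 / (q + 1)\<close> around all late roundings of \<open>a\<close> stay in \<open>V\<close>.
  Each rounding takes countably many values, so the condition is measurable although it quantifies
  over balls in an infinite-dimensional space.\<close>

lemma sets_l1_open:
  assumes V: "l1_open V" shows "V \<in> sets seq_space"
proof -
  define good where "good q c \<longleftrightarrow> (\<forall>b\<in>l1_seq. l1_dist c b < 1 / real (Suc q) \<longrightarrow> b \<in> V)" for q c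
  have "V = l1_seq \<inter> (\<Union>q. \<Union>m. \<Inter>n\<in>{m..}. {a \<in> space seq_space. good q (grid_seq n (grid_floor n a))})"
  proof (intro set_eqI iffI)
    fix a assume aV: "a \<in> V"
    then have a: "a \<in> l1_seq" using V by (auto simp: l1_open_def)
    obtain e where e: "e > 0" "\<And>b. b \<in> l1_seq \<Longrightarrow> l1_dist a b < e \<Longrightarrow> b \<in> V"
      using V aV unfolding l1_open_def by blast
    obtain q where q: "1 / real (Suc q) < e / 2" using nat_approx_posE[of "e / 2"] e by auto
    obtain m where m: "\<And>n. n \<ge> m \<Longrightarrow> l1_dist a (grid_seq n (grid_floor n a)) < e / 2"
      using LIMSEQ_D[OF grid_seq_tendsto[OF a], of "e / 2"] e(1) by (force simp: l1_dist_nonneg)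
    have "good q (grid_seq n (grid_floor n a))" if "n \<ge> m" for n
      unfolding good_def
    proof (intro ballI impI)
      fix b assume b: "b \<in> l1_seq" "l1_dist (grid_seq n (grid_floor n a)) b < 1 / real (Suc q)"
      show "b \<in> V"
        using l1_dist_triangle[OF a grid_seq_in_l1 b(1), of n "grid_floor n a"] m[OF that] b(2) q
        by (intro e(2) b(1)) linarith
    qed
    then show "a \<in> l1_seq \<inter> (\<Union>q. \<Union>m. \<Inter>n\<in>{m..}. {a \<in> space seq_space. good q (grid_seq n (grid_floor n a))})"
      using a l1_seq_subset by blast
  next
    fix a assume "a \<in> l1_seq \<inter> (\<Union>q. \<Union>m. \<Inter>n\<in>{m..}. {a \<in> space seq_space. good q (grid_seq n (grid_floor n a))})"
    then obtain q m where a: "a \<in> l1_seq" and g: "\<And>n. n \<ge> m \<Longrightarrow> good q (grid_seq n (grid_floor n a))" by auto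
    obtain n0 where n0: "\<And>n. n \<ge> n0 \<Longrightarrow> l1_dist a (grid_seq n (grid_floor n a)) < 1 / real (Suc q)"
      using LIMSEQ_D[OF grid_seq_tendsto[OF a], of "1 / real (Suc q)"] by (force simp: l1_dist_nonneg)
    show "a \<in> V"
      using g[of "max m n0"] n0[of "max m n0"] a by (auto simp: good_def l1_dist_commute)
  qed
  also have "\<dots> \<in> sets seq_space"
    by (intro sets.Int sets_l1_seq sets.countable_UN sets.countable_INT' image_subsetI sets_grid_property) auto
  finally show ?thesis .
qed

section \<open>Densities and measures with given coefficients\<close>

definition fourier_density :: "(('d::{finite,linorder}) freq \<Rightarrow> complex) \<Rightarrow> 'd torus \<Rightarrow> real" where
  "fourier_density a x = 1 + 2 * (\<Sum>\<^sub>\<infinity>k\<in>half_space. Re (a k * fourier_char (- k) x))"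

definition seq_measure :: "(('d::{finite,linorder}) freq \<Rightarrow> complex) \<Rightarrow> 'd torus measure" where
  "seq_measure a = density torus_vol (\<lambda>x. ennreal (fourier_density a x))"

text \<open>The uniform lower bound is what survives a small change in the \<open>l1\<close>
  distance, so this set is open.\<close>

definition pos_seq :: "(('d::{finite,linorder}) freq \<Rightarrow> complex) set" where
  "pos_seq = {a \<in> l1_seq. \<exists>e>0. \<forall>x. e \<le> fourier_density a x}"

lemma abs_Re_fourier_term: "\<bar>Re (z * fourier_char k x)\<bar> \<le> norm z"
  using abs_Re_le_cmod[of "z * fourier_char k x"] by (simp add: norm_mult)

lemma fourier_density_summable:
  assumes "a \<in> l1_seq" shows "(\<lambda>k. Re (a k * fourier_char (- k) x)) summable_on half_space"
proof -
  have "(\<lambda>k. norm (Re (a k * fourier_char (- k) x))) summable_on half_space"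
    by (rule Infinite_Sum.abs_summable_on_comparison_test'[where g="\<lambda>k. norm (a k)"])
       (use assms abs_Re_fourier_term in \<open>auto simp: l1_seq_def\<close>)
  then show ?thesis by (rule abs_summable_summable)
qed

lemma fourier_density_diff:
  assumes "a \<in> l1_seq" "b \<in> l1_seq"
  shows "\<bar>fourier_density a x - fourier_density b x\<bar> \<le> 2 * l1_dist a b"
proof -
  let ?t = "\<lambda>a k. Re (a k * fourier_char (- k) x)"
  have "fourier_density a x - fourier_density b x = 2 * ((\<Sum>\<^sub>\<infinity>k\<in>half_space. ?t a k) + (\<Sum>\<^sub>\<infinity>k\<in>half_space. - ?t b k))"
    by (simp only: fourier_density_def infsum_uminus) simp
  also have "(\<Sum>\<^sub>\<infinity>k\<in>half_space. ?t a k) + (\<Sum>\<^sub>\<infinity>k\<in>half_space. - ?t b k) = (\<Sum>\<^sub>\<infinity>k\<in>half_space. Re ((a k - b k) * fourier_char (- k) x))"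
    using infsum_add[OF fourier_density_summable[OF assms(1), of x] summable_on_uminus[THEN iffD2, OF fourier_density_summable[OF assms(2), of x]]]
    by (simp add: algebra_simps)
  finally have eq: "fourier_density a x - fourier_density b x = 2 * (\<Sum>\<^sub>\<infinity>k\<in>half_space. Re ((a k - b k) * fourier_char (- k) x))" .
  have s: "(\<lambda>k. norm (Re ((a k - b k) * fourier_char (- k) x))) summable_on half_space"
    by (rule Infinite_Sum.abs_summable_on_comparison_test'[OF l1_diff_summable[OF assms]])
       (simp only: real_norm_def abs_Re_fourier_term)
  have "\<bar>\<Sum>\<^sub>\<infinity>k\<in>half_space. Re ((a k - b k) * fourier_char (- k) x)\<bar> \<le> (\<Sum>\<^sub>\<infinity>k\<in>half_space. norm (Re ((a k - b k) * fourier_char (- k) x)))"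
    using norm_infsum_bound[OF s] by simp
  also have "\<dots> \<le> l1_dist a b"
    unfolding l1_dist_def
    by (rule infsum_mono[OF s l1_diff_summable[OF assms]]) (simp only: real_norm_def abs_Re_fourier_term)
  finally show ?thesis using eq by (simp add: abs_mult)
qed

lemma fourier_density_trunc: "fourier_density (trunc_seq N a) x = trig_density N a x"
proof -
  have "(\<Sum>\<^sub>\<infinity>k\<in>half_space. Re (trunc_seq N a k * fourier_char (- k) x)) = (\<Sum>\<^sub>\<infinity>k\<in>F_plus N. Re (a k * fourier_char (- k) x))"
    by (rule infsum_cong_neutral) (use F_plus_subset in \<open>auto simp: trunc_seq_def\<close>)
  then show ?thesis by (simp add: fourier_density_def trig_density_def)
qed

lemma I_map_eq: "I_map N a = seq_measure (trunc_seq N a)"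
  by (simp add: I_map_def seq_measure_def fourier_density_trunc)

lemma fourier_density_tendsto:
  assumes "a \<in> l1_seq" "\<And>n. b n \<in> l1_seq" "(\<lambda>n. l1_dist a (b n)) \<longlonglongrightarrow> 0"
  shows "(\<lambda>n. fourier_density (b n) x) \<longlonglongrightarrow> fourier_density a x"
proof -
  have lim: "(\<lambda>n. 2 * l1_dist a (b n)) \<longlonglongrightarrow> 2 * 0" by (intro tendsto_mult tendsto_const assms)
  have "(\<lambda>n. fourier_density (b n) x - fourier_density a x) \<longlonglongrightarrow> 0"
  proof (rule Lim_null_comparison[OF always_eventually, rule_format])
    show "norm (fourier_density (b n) x - fourier_density a x) \<le> 2 * l1_dist a (b n)" for n
      unfolding l1_dist_commute[of a] real_norm_def by (rule fourier_density_diff[OF assms(2,1)])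
    show "(\<lambda>n. 2 * l1_dist a (b n)) \<longlonglongrightarrow> 0" using lim by simp
  qed
  then show ?thesis by (rule LIM_zero_cancel)
qed

lemma borel_measurable_trig_density [measurable]: "trig_density N a \<in> borel_measurable borel"
  unfolding trig_density_def[abs_def] by measurable

lemma borel_measurable_fourier_density:
  assumes "a \<in> l1_seq" shows "fourier_density a \<in> borel_measurable borel"
proof (rule borel_measurable_LIMSEQ_real)
  show "(\<lambda>N. trig_density N a x) \<longlonglongrightarrow> fourier_density a x" for x
    using fourier_density_tendsto[OF assms trunc_seq_in_l1 trunc_seq_tendsto[OF assms], of x]
    by (simp add: fourier_density_trunc)
qed simp

lemma fourier_density_bounded:
  assumes "a \<in> l1_seq" shows "\<exists>B\<ge>0. \<forall>x. \<bar>fourier_density a x\<bar> \<le> B"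
proof (intro exI conjI allI)
  let ?z = "trunc_seq 0 a"
  have z: "fourier_density ?z x = 1" for x
    by (simp add: fourier_density_trunc trig_density_def F_plus_def F_set_def)
  show "\<bar>fourier_density a x\<bar> \<le> 1 + 2 * l1_dist a ?z" for x
    using fourier_density_diff[OF assms trunc_seq_in_l1, of x 0 a] z[of x] by linarith
  show "0 \<le> 1 + 2 * l1_dist a ?z" using l1_dist_nonneg[of a ?z] by linarith
qed

lemma integrable_torus_vol_bounded:
  fixes f :: "('d::finite) torus \<Rightarrow> 'b::{banach,second_countable_topology}"
  assumes "f \<in> borel_measurable borel" "\<And>x. norm (f x) \<le> B"
  shows "integrable torus_vol f"
  by (rule torus_vol.integrable_const_bound[where B=B]) (use assms in auto)

lemma complex_of_trig_density:
  "complex_of_real (trig_density N a x)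
     = 1 + (\<Sum>k\<in>F_plus N. a k * fourier_char (- k) x + cnj (a k) * fourier_char k x)"
proof -
  have "complex_of_real (2 * Re z) = z + cnj z" for z by (simp add: complex_eq_iff)
  then have "complex_of_real (2 * (\<Sum>k\<in>F_plus N. Re (a k * fourier_char (- k) x)))
    = (\<Sum>k\<in>F_plus N. a k * fourier_char (- k) x + cnj (a k) * fourier_char k x)"
    by (simp only: sum_distrib_left of_real_sum) (simp add: fourier_char_uminus)
  then show ?thesis by (simp add: trig_density_def)
qed

text \<open>The full family of Fourier coefficients of the density: mass one at frequency zero, and
  conjugate symmetry because the density is real.\<close>

definition hermitian_ext :: "(('d::{finite,linorder}) freq \<Rightarrow> complex) \<Rightarrow> 'd freq \<Rightarrow> complex" where
  "hermitian_ext a l = (if l = 0 then 1 else if l \<in> half_space then a l else cnj (a (- l)))"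

text \<open>In the density, \<open>a k\<close> multiplies the character of \<open>- k\<close>, so
  orthogonality returns it at frequency \<open>k\<close>.\<close>

lemma integral_trig_density:
  fixes a :: "('d::{finite,linorder}) freq \<Rightarrow> complex"
  assumes l: "l \<in> F_set N"
  shows "(\<integral>x. complex_of_real (trig_density N a x) * fourier_char l x \<partial>torus_vol) = hermitian_ext a l"
proof -
  have int: "integrable torus_vol (fourier_char k)" for k :: "'d freq"
    by (rule integrable_torus_vol_bounded[where B=1]) auto
  have "(\<integral>x. complex_of_real (trig_density N a x) * fourier_char l x \<partial>torus_vol)
    = (\<integral>x. fourier_char l x + (\<Sum>k\<in>F_plus N. a k * fourier_char (l - k) x + cnj (a k) * fourier_char (l + k) x) \<partial>torus_vol)"
    unfolding complex_of_trig_density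
    by (intro Bochner_Integration.integral_cong refl)
       (simp add: distrib_right sum_distrib_right mult.assoc fourier_char_add[symmetric] add.commute)
  also have "\<dots> = (\<integral>x. fourier_char l x \<partial>torus_vol) + (\<Sum>k\<in>F_plus N. a k * (\<integral>x. fourier_char (l - k) x \<partial>torus_vol) + cnj (a k) * (\<integral>x. fourier_char (l + k) x \<partial>torus_vol))"
    using int by simp
  also have "\<dots> = (if l = 0 then 1 else 0) + (\<Sum>k\<in>F_plus N. (if k = l then a l else 0) + (if k = - l then cnj (a (- l)) else 0))"
  proof -
    have "l + k = 0 \<longleftrightarrow> k = - l" "l - k = 0 \<longleftrightarrow> k = l" for k :: "'d freq"
      by (auto simp: add_eq_0_iff)
    then show ?thesis
      unfolding integral_fourier_char by (intro arg_cong2[where f="(+)"] refl sum.cong) auto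
  qed
  also have "\<dots> = (if l = 0 then 1 else 0) + (if l \<in> F_plus N then a l else 0) + (if - l \<in> F_plus N then cnj (a (- l)) else 0)"
    by (simp add: sum.distrib)
  also have "\<dots> = hermitian_ext a l"
  proof (cases "l = 0")
    case True
    have "(0 :: 'd freq) \<notin> F_plus N" by (simp add: F_plus_eq)
    then show ?thesis using True by (simp add: hermitian_ext_def)
  next
    case False
    have ml: "- l \<in> F_set N" using l by (simp add: F_set_def)
    show ?thesis
      using False l ml uminus_notin_half_space[of l] uminus_notin_half_space[of "- l"]
      by (cases rule: half_space_cases[OF False]) (auto simp: hermitian_ext_def F_plus_eq)
  qed
  finally show ?thesis .
qed

lemma integral_fourier_density:
  fixes a :: "('d::{finite,linorder}) freq \<Rightarrow> complex"
  assumes a: "a \<in> l1_seq"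
  shows "(\<integral>x. complex_of_real (fourier_density a x) * fourier_char l x \<partial>torus_vol) = hermitian_ext a l"
proof (rule LIMSEQ_unique)
  obtain B where B: "B \<ge> 0" "\<And>x. \<bar>fourier_density a x\<bar> \<le> B" using fourier_density_bounded[OF a] by blast
  have [measurable]: "fourier_density a \<in> borel_measurable borel" by (rule borel_measurable_fourier_density[OF a])
  let ?L = "\<lambda>N. \<integral>x. complex_of_real (trig_density N a x) * fourier_char l x \<partial>torus_vol"
  obtain N0 where N0: "l \<in> F_set N0" using F_set_covers by blast
  have "?L N = hermitian_ext a l" if "N \<ge> N0" for N
    by (rule integral_trig_density) (use that F_set_mono N0 in blast)
  then show "?L \<longlonglongrightarrow> hermitian_ext a l"
    by (intro tendsto_eventually eventually_sequentiallyI[of N0])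
  have conv: "(\<lambda>N. trig_density N a x) \<longlonglongrightarrow> fourier_density a x" for x
    using fourier_density_tendsto[OF a trunc_seq_in_l1 trunc_seq_tendsto[OF a], of x]
    by (simp add: fourier_density_trunc)
  obtain K where K: "\<And>N. norm (l1_dist a (trunc_seq N a)) \<le> K"
    using Bseq_def[THEN iffD1, OF convergent_imp_Bseq[OF convergentI[OF trunc_seq_tendsto[OF a]]]] by blast
  show "?L \<longlonglongrightarrow> (\<integral>x. complex_of_real (fourier_density a x) * fourier_char l x \<partial>torus_vol)"
  proof (rule integral_dominated_convergence[where w="\<lambda>_. B + 2 * K"])
    show "AE x in torus_vol. norm (complex_of_real (trig_density N a x) * fourier_char l x) \<le> B + 2 * K" for N
    proof (rule AE_I2)
      fix x
      have "\<bar>trig_density N a x\<bar> \<le> B + 2 * K"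
        using fourier_density_diff[OF a trunc_seq_in_l1, of x N a] B(2)[of x] K[of N]
        by (simp add: fourier_density_trunc)
      then show "norm (complex_of_real (trig_density N a x) * fourier_char l x) \<le> B + 2 * K"
        by (simp add: norm_mult)
    qed
  qed (auto intro!: tendsto_intros conv)
qed

lemma pos_seq_subset: "pos_seq \<subseteq> l1_seq"
  by (auto simp: pos_seq_def)

lemma integral_fourier_density_1:
  fixes a :: "('d::{finite,linorder}) freq \<Rightarrow> complex"
  assumes "a \<in> l1_seq" shows "(\<integral>x. fourier_density a x \<partial>torus_vol) = 1"
proof -
  have "complex_of_real (\<integral>x. fourier_density a x \<partial>torus_vol) = 1"
    using integral_fourier_density[OF assms, of 0] by (simp add: hermitian_ext_def)
  then show ?thesis by (simp only: of_real_eq_1_iff)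
qed

lemma seq_measure_torus_probs:
  assumes "a \<in> pos_seq" shows "seq_measure a \<in> torus_probs"
proof -
  have a: "a \<in> l1_seq" using assms pos_seq_subset by blast
  obtain e where e: "e > 0" "\<And>x. e \<le> fourier_density a x" using assms by (auto simp: pos_seq_def)
  obtain B where B: "B \<ge> 0" "\<And>x. \<bar>fourier_density a x\<bar> \<le> B" using fourier_density_bounded[OF a] by blast
  show ?thesis
    unfolding seq_measure_def
  proof (rule density_torus_probs[where B=B])
    show "0 \<le> fourier_density a x" "fourier_density a x \<le> B" for x
      using e(1) e(2)[of x] B(2)[of x] by linarith+
  qed (use a borel_measurable_fourier_density integral_fourier_density_1 in auto)
qed

lemma fourier_coeff_seq_measure:
  assumes "a \<in> pos_seq" shows "fourier_coeff (seq_measure a) k = hermitian_ext a k"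
proof -
  have a: "a \<in> l1_seq" using assms pos_seq_subset by blast
  obtain e where e: "e > 0" "\<And>x. e \<le> fourier_density a x" using assms by (auto simp: pos_seq_def)
  have [measurable]: "fourier_density a \<in> borel_measurable borel" by (rule borel_measurable_fourier_density[OF a])
  have "fourier_coeff (seq_measure a) k = (\<integral>x. fourier_density a x *\<^sub>R fourier_char k x \<partial>torus_vol)"
    unfolding fourier_coeff_def seq_measure_def
    by (rule integral_density) (use e in \<open>auto intro: order_trans less_imp_le\<close>)
  also have "\<dots> = hermitian_ext a k"
    using integral_fourier_density[OF a, of k] by (simp add: scaleR_conv_of_real)
  finally show ?thesis .
qed

text \<open>Both measures have the same coefficients at all frequencies, those outside
  \<open>half_space\<close> by conjugation, and the coefficients determine a probability
  measure.\<close>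

lemma seq_measure_fourier_coeff:
  assumes m: "m \<in> torus_probs" and a: "restrict (fourier_coeff m) half_space \<in> pos_seq"
  shows "m = seq_measure (restrict (fourier_coeff m) half_space)"
proof (rule torus_probs_eqI_fourier_coeff[OF m seq_measure_torus_probs[OF a]])
  fix k
  have "hermitian_ext (restrict (fourier_coeff m) half_space) k = fourier_coeff m k"
  proof (cases "k = 0")
    case False
    then show ?thesis
      by (cases rule: half_space_cases)
         (auto simp: hermitian_ext_def fourier_coeff_uminus dest: uminus_notin_half_space)
  qed (simp add: hermitian_ext_def fourier_coeff_0[OF m])
  then show "fourier_coeff m k = fourier_coeff (seq_measure (restrict (fourier_coeff m) half_space)) k"
    by (simp add: fourier_coeff_seq_measure[OF a])
qed

lemma pos_seq_close:
  assumes "a \<in> l1_seq" "b \<in> l1_seq" "\<And>x. e \<le> fourier_density a x" "2 * l1_dist a b < e"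
  shows "b \<in> pos_seq"
proof -
  have "e - 2 * l1_dist a b \<le> fourier_density b x" for x
    using fourier_density_diff[OF assms(1,2), of x] assms(3)[of x] by linarith
  then show ?thesis using assms(2,4) by (auto simp: pos_seq_def intro!: exI[of _ "e - 2 * l1_dist a b"])
qed

lemma l1_open_pos_seq: "l1_open pos_seq"
  unfolding l1_open_def
proof (intro conjI ballI pos_seq_subset)
  fix a :: "'a freq \<Rightarrow> complex" assume "a \<in> pos_seq"
  then obtain e where a: "a \<in> l1_seq" "e > 0" "\<And>x. e \<le> fourier_density a x" by (auto simp: pos_seq_def)
  then show "\<exists>e>0. \<forall>b\<in>l1_seq. l1_dist a b < e \<longrightarrow> b \<in> pos_seq"
    by (intro exI[of _ "e / 2"]) (auto intro!: pos_seq_close[of a _ e])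
qed

lemma sets_pos_seq: "pos_seq \<in> sets seq_space"
  by (rule sets_l1_open[OF l1_open_pos_seq])

lemma tv_dist_seq_measure_le:
  assumes "a \<in> pos_seq" "b \<in> pos_seq"
  shows "tv_dist (seq_measure a) (seq_measure b) \<le> 2 * l1_dist a b"
proof -
  have ab: "a \<in> l1_seq" "b \<in> l1_seq" using assms pos_seq_subset by auto
  obtain e1 where e1: "e1 > 0" "\<And>x. e1 \<le> fourier_density a x" using assms by (auto simp: pos_seq_def)
  obtain e2 where e2: "e2 > 0" "\<And>x. e2 \<le> fourier_density b x" using assms by (auto simp: pos_seq_def)
  obtain A where A: "A \<ge> 0" "\<And>x. \<bar>fourier_density a x\<bar> \<le> A" using fourier_density_bounded[OF ab(1)] by blast
  obtain B where B: "B \<ge> 0" "\<And>x. \<bar>fourier_density b x\<bar> \<le> B" using fourier_density_bounded[OF ab(2)] by blast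
  show ?thesis
    unfolding seq_measure_def
  proof (rule tv_dist_density_le[where B="max A B"])
    fix x
    show "0 \<le> fourier_density a x" "fourier_density a x \<le> max A B"
      using e1(1) e1(2)[of x] A(2)[of x] by linarith+
    show "0 \<le> fourier_density b x" "fourier_density b x \<le> max A B"
      using e2(1) e2(2)[of x] B(2)[of x] by linarith+
  qed (use ab borel_measurable_fourier_density fourier_density_diff in auto)
qed

text \<open>A lower bound \<open>e\<close> turns a small uniform error into a relative one:
  densities \<open>f \<ge> e\<close> and \<open>g\<close> that differ by at most
  \<open>t * e\<close> satisfy \<open>(1 - t) * f \<le> g\<close>, and the coin coupling then costs
  at most \<open>t * R\<close>.\<close>

lemma wasserstein_seq_measure:
  fixes a :: "('d::{finite,linorder}) freq \<Rightarrow> complex"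
  assumes a: "a \<in> pos_seq" and r: "r > 0"
  shows "\<exists>d>0. \<forall>b\<in>l1_seq. l1_dist a b < d \<longrightarrow> b \<in> pos_seq \<and> wasserstein (seq_measure a) (seq_measure b) < r"
proof -
  have al: "a \<in> l1_seq" using a pos_seq_subset by auto
  obtain e where e: "e > 0" "\<And>x. e \<le> fourier_density a x" using a by (auto simp: pos_seq_def)
  obtain R where R: "R > 0" "\<And>x y :: 'd torus. dist x y \<le> R" using torus_dist_bounded by blast
  define t where "t = min 1 (r / (2 * R))"
  have t: "0 < t" "t \<le> 1" "t * R < r"
  proof -
    show "0 < t" "t \<le> 1" using r R by (auto simp: t_def)
    have "t * R \<le> r / (2 * R) * R" using R by (intro mult_right_mono) (auto simp: t_def)
    also have "\<dots> < r" using r R by simp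
    finally show "t * R < r" .
  qed
  show ?thesis
  \<comment> \<open>With this radius the densities differ by at most \<open>t * e / 2\<close>, which
    is below \<open>e\<close>, for positivity of the density of \<open>b\<close>, and below
    \<open>t * e\<close>, for the coupling.\<close>
  proof (intro exI[of _ "t * e / 4"] conjI ballI impI)
    show "t * e / 4 > 0" using t e by simp
    fix b assume b: "b \<in> l1_seq" "l1_dist a b < t * e / 4"
    have "t * e \<le> e" using t e by simp
    then show bp: "b \<in> pos_seq" using b e(1) by (intro pos_seq_close[OF al b(1) e(2)]) linarith
    obtain A where A: "A \<ge> 0" "\<And>x. \<bar>fourier_density a x\<bar> \<le> A" using fourier_density_bounded[OF al] by blast
    obtain B where B: "B \<ge> 0" "\<And>x. \<bar>fourier_density b x\<bar> \<le> B" using fourier_density_bounded[OF b(1)] by blast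
    obtain e2 where e2: "e2 > 0" "\<And>x. e2 \<le> fourier_density b x" using bp by (auto simp: pos_seq_def)
    have "wasserstein (seq_measure a) (seq_measure b) \<le> t * R"
      unfolding seq_measure_def
    proof (rule wasserstein_density_le[where B="max A B"])
      fix x
      show "0 \<le> fourier_density a x" "fourier_density a x \<le> max A B"
        using e(1) e(2)[of x] A(2)[of x] by linarith+
      show "0 \<le> fourier_density b x" "fourier_density b x \<le> max A B"
        using e2(1) e2(2)[of x] B(2)[of x] by linarith+
      have "t * e \<le> t * fourier_density a x" using e(2)[of x] t by (intro mult_left_mono) auto
      then show "(1 - t) * fourier_density a x \<le> fourier_density b x"
        using fourier_density_diff[OF al b(1), of x] b(2) l1_dist_nonneg[of a b] by (simp add: algebra_simps)
    qed (use al b t R borel_measurable_fourier_density integral_fourier_density_1 in auto)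
    then show "wasserstein (seq_measure a) (seq_measure b) < r" using t by linarith
  qed
qed

lemma l1_open_vimage_seq_measure:
  assumes "openin wasserstein_topology U"
  shows "l1_open {a \<in> pos_seq. seq_measure a \<in> U}"
  unfolding l1_open_def
proof (intro conjI ballI)
  show "{a \<in> pos_seq. seq_measure a \<in> U} \<subseteq> l1_seq" using pos_seq_subset by blast
  fix a assume a: "a \<in> {a \<in> pos_seq. seq_measure a \<in> U}"
  then obtain r where r: "r > 0" "\<And>m'. m' \<in> torus_probs \<Longrightarrow> wasserstein (seq_measure a) m' < r \<Longrightarrow> m' \<in> U"
    using assms unfolding openin_wasserstein_topology by blast
  obtain d where "d > 0" "\<forall>b\<in>l1_seq. l1_dist a b < d \<longrightarrow> b \<in> pos_seq \<and> wasserstein (seq_measure a) (seq_measure b) < r"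
    using wasserstein_seq_measure[of a r] a r(1) by blast
  then show "\<exists>e>0. \<forall>b\<in>l1_seq. l1_dist a b < e \<longrightarrow> b \<in> {a \<in> pos_seq. seq_measure a \<in> U}"
    by (intro exI[of _ d]) (auto intro!: r(2) seq_measure_torus_probs)
qed

text \<open>Preimages of Wasserstein-open sets are open for \<open>l1_dist\<close>, and those sets
  are measurable for the product sigma-algebra.\<close>

lemma measurable_seq_measure [measurable]:
  "(seq_measure :: (('d::{finite,linorder}) freq \<Rightarrow> complex) \<Rightarrow> 'd torus measure)
     \<in> restrict_space seq_space pos_seq \<rightarrow>\<^sub>M probs_borel"
proof (rule measurable_probs_borelI)
  have *: "space (restrict_space seq_space pos_seq) = (pos_seq :: ('d freq \<Rightarrow> complex) set)"
    using pos_seq_subset l1_seq_subset by (auto simp: space_restrict_space)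
  show "seq_measure a \<in> torus_probs" if "a \<in> space (restrict_space seq_space pos_seq)" for a :: "'d freq \<Rightarrow> complex"
    using that unfolding * by (rule seq_measure_torus_probs)
  fix U :: "'d torus measure set" assume U: "openin wasserstein_topology U"
  have "seq_measure -` U \<inter> space (restrict_space seq_space pos_seq) = {a \<in> pos_seq. seq_measure a \<in> U}"
    unfolding * by auto
  moreover have "{a \<in> pos_seq. seq_measure a \<in> U} \<in> sets seq_space"
    by (rule sets_l1_open[OF l1_open_vimage_seq_measure[OF U]])
  ultimately show "seq_measure -` U \<inter> space (restrict_space seq_space pos_seq) \<in> sets (restrict_space seq_space pos_seq)"
    using sets_pos_seq by (subst sets_restrict_space_iff) auto
qed

section \<open>Gaussian coefficient sequences\<close>

text \<open>Density of the centred complex Gaussian law with mean square modulus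
  \<open>1 / r\<close>.\<close>

definition cgauss :: "real \<Rightarrow> complex \<Rightarrow> real" where
  "cgauss r z = r / pi * exp (- r * (norm z)\<^sup>2)"

lemma cgauss_pos: "r > 0 \<Longrightarrow> 0 < cgauss r z"
  by (simp add: cgauss_def)

lemma borel_measurable_cgauss [measurable]: "cgauss r \<in> borel_measurable borel"
  unfolding cgauss_def[abs_def] by measurable

lemma nn_integral_cgauss:
  assumes r: "r > 0" shows "(\<integral>\<^sup>+z. ennreal (cgauss r z) \<partial>lborel) = 1"
proof -
  \<comment> \<open>Real and imaginary part are independent normal variables of variance
    \<open>1 / (2 * r)\<close>.\<close>
  define s where "s = sqrt (1 / (2 * r))"
  have s: "s > 0" "s\<^sup>2 = 1 / (2 * r)" using r by (auto simp: s_def)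
  have "cgauss r z = (\<Prod>b\<in>Basis. normal_density 0 s (z \<bullet> b))" for z
  proof -
    have n: "normal_density 0 s x = 1 / sqrt (pi / r) * exp (- x\<^sup>2 * r)" for x
      using r by (simp add: normal_density_def s(2))
    have "(\<Prod>b\<in>Basis. normal_density 0 s (z \<bullet> b)) = normal_density 0 s (Re z) * normal_density 0 s (Im z)"
      by (simp add: Basis_complex_def inner_complex_def)
    also have "\<dots> = 1 / (sqrt (pi / r))\<^sup>2 * (exp (- (Re z)\<^sup>2 * r) * exp (- (Im z)\<^sup>2 * r))"
      unfolding n by (simp add: power2_eq_square)
    also have "\<dots> = r / pi * exp (- r * ((Re z)\<^sup>2 + (Im z)\<^sup>2))"
      using r by (simp add: exp_add[symmetric] algebra_simps)
    finally show ?thesis by (simp add: cgauss_def cmod_power2)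
  qed
  then have "(\<integral>\<^sup>+z. ennreal (cgauss r z) \<partial>lborel) = (\<integral>\<^sup>+z. (\<Prod>b\<in>Basis. ennreal (normal_density 0 s (z \<bullet> b))) \<partial>(lborel :: complex measure))"
    by (intro nn_integral_cong) (simp add: prod_ennreal)
  also have "\<dots> = (\<Prod>b\<in>(Basis :: complex set). (\<integral>\<^sup>+x. ennreal (normal_density 0 s x) \<partial>lborel))"
    by (rule nn_integral_lborel_prod) auto
  also have "(\<integral>\<^sup>+x. ennreal (normal_density 0 s x) \<partial>lborel) = 1"
    using s by (subst nn_integral_eq_integral) auto
  finally show ?thesis by simp
qed

text \<open>The factor \<open>norm z\<close> is absorbed by half of the exponent, as
  \<open>x \<le> exp (x\<^sup>2 / 2)\<close>. What remains is a multiple of \<open>cgauss\<close> at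
  rate \<open>r / 2\<close>, whose smaller normalising constant produces the
  \<open>2\<close>.\<close>

lemma nn_integral_norm_cgauss:
  assumes r: "r > 0" shows "(\<integral>\<^sup>+z. ennreal (norm z * cgauss r z) \<partial>lborel) \<le> ennreal (2 / sqrt r)"
proof -
  have ineq: "norm z * cgauss r z \<le> 2 / sqrt r * cgauss (r / 2) z" for z
  proof -
    let ?x = "sqrt r * norm z"
    have "?x \<le> 1 + ?x\<^sup>2 / 2" using zero_le_power2[of "?x - 1"] by (simp add: power2_diff)
    also have "\<dots> \<le> exp (?x\<^sup>2 / 2)" by (rule exp_ge_add_one_self)
    also have "?x\<^sup>2 = r * (norm z)\<^sup>2" using r by (simp add: power_mult_distrib)
    finally have "norm z \<le> exp (r * (norm z)\<^sup>2 / 2) / sqrt r" using r by (simp add: field_simps)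
    then have "norm z * cgauss r z \<le> exp (r * (norm z)\<^sup>2 / 2) / sqrt r * cgauss r z"
      using cgauss_pos[OF r] by (intro mult_right_mono) (auto intro: less_imp_le)
    also have "\<dots> = 2 / sqrt r * (r / 2 / pi * (exp (r * (norm z)\<^sup>2 / 2) * exp (- r * (norm z)\<^sup>2)))"
      by (simp add: cgauss_def)
    also have "exp (r * (norm z)\<^sup>2 / 2) * exp (- r * (norm z)\<^sup>2) = exp (- (r / 2) * (norm z)\<^sup>2)"
      by (simp add: exp_add[symmetric])
    finally show ?thesis by (simp add: cgauss_def)
  qed
  have "(\<integral>\<^sup>+z. ennreal (norm z * cgauss r z) \<partial>lborel) \<le> (\<integral>\<^sup>+z. ennreal (2 / sqrt r) * ennreal (cgauss (r / 2) z) \<partial>lborel)"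
    using r cgauss_pos[of "r / 2"] ineq
    by (intro nn_integral_mono) (auto simp: ennreal_mult[symmetric] less_imp_le intro!: ennreal_leI)
  also have "\<dots> = ennreal (2 / sqrt r)"
    using nn_integral_cgauss[of "r / 2"] r by (simp add: nn_integral_cmult)
  finally show ?thesis .
qed

definition coef_rate :: "real \<Rightarrow> ('d::finite) freq \<Rightarrow> real" where
  "coef_rate p k = norm (fvec k) powr (2 * p * real CARD('d))"

definition gauss_coef :: "real \<Rightarrow> ('d::finite) freq \<Rightarrow> complex measure" where
  "gauss_coef p k = density lborel (\<lambda>z. ennreal (cgauss (coef_rate p k) z))"

definition gauss_seq :: "real \<Rightarrow> (('d::{finite,linorder}) freq \<Rightarrow> complex) measure" where
  "gauss_seq p = PiM half_space (gauss_coef p)"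

lemma fvec_eq_0_iff: "fvec k = 0 \<longleftrightarrow> k = 0"
  by (simp add: fvec_def vec_eq_iff)

lemma coef_rate_pos: "k \<in> half_space \<Longrightarrow> coef_rate p k > 0"
  by (auto simp: coef_rate_def fvec_eq_0_iff)

lemma sets_gauss_coef [simp, measurable_cong]: "sets (gauss_coef p k) = sets borel"
  by (simp add: gauss_coef_def)

lemma sets_gauss_seq [simp, measurable_cong]: "sets (gauss_seq p) = sets seq_space"
  unfolding gauss_seq_def by (intro sets_PiM_cong) auto

lemma space_gauss_seq: "space (gauss_seq p) = space seq_space"
  by (rule sets_eq_imp_space_eq) simp

lemma prob_space_gauss_coef: "k \<in> half_space \<Longrightarrow> prob_space (gauss_coef p k)"
  by (rule prob_spaceI) (simp add: gauss_coef_def emeasure_density nn_integral_cgauss coef_rate_pos)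

lemma prob_space_gauss_seq: "prob_space (gauss_seq p)"
  unfolding gauss_seq_def by (rule prob_space_PiM) (rule prob_space_gauss_coef)

lemma measurable_coord_upd [measurable]:
  assumes "k \<in> half_space" "f \<in> M \<rightarrow>\<^sub>M seq_space" "h \<in> borel_measurable M"
  shows "(\<lambda>x. (f x)(k := h x)) \<in> M \<rightarrow>\<^sub>M seq_space"
  by (rule measurable_fun_upd[OF _ assms(2)]) (use assms in auto)

section \<open>Drawing one coordinate again\<close>

text \<open>The product measure is split into coordinate \<open>k\<close> and the others. Since
  \<open>a(k := z)\<close> overwrites the old coordinate, the outer integral may run over all of
  \<open>gauss_seq p\<close>, and no smaller product space appears in the statement.\<close>

lemma gauss_seq_resample:
  fixes k :: "('d::{finite,linorder}) freq"
  assumes k: "k \<in> half_space" and [measurable]: "F \<in> borel_measurable seq_space"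
  shows "(\<integral>\<^sup>+a. F a \<partial>gauss_seq p)
    = (\<integral>\<^sup>+a. \<integral>\<^sup>+z. F (a(k := z)) * ennreal (cgauss (coef_rate p k) z) \<partial>lborel \<partial>gauss_seq p)"
proof -
  let ?K = "half_space - {k}" and ?N = "gauss_coef p"
  have H: "insert k ?K = half_space" using k by auto
  interpret K: prob_space "PiM ?K ?N" by (rule prob_space_PiM) (simp add: prob_space_gauss_coef)
  interpret Nk: prob_space "?N k" by (rule prob_space_gauss_coef[OF k])
  interpret P: pair_prob_space "?N k" "PiM ?K ?N" ..
  have sK: "sets (PiM ?K ?N) = sets (PiM ?K (\<lambda>_. borel))" by (rule sets_PiM_cong) auto
  have upd: "(\<lambda>(x, X). X(k := x)) \<in> ?N k \<Otimes>\<^sub>M PiM ?K ?N \<rightarrow>\<^sub>M seq_space"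
    unfolding split_beta
    by (rule measurable_fun_upd[where J="?K"]) (use H in \<open>auto simp: measurable_cong_sets[OF refl sK[symmetric]]\<close>)
  have G: "gauss_seq p = distr (?N k \<Otimes>\<^sub>M PiM ?K ?N) seq_space (\<lambda>(x, X). X(k := x))"
  proof -
    have "distr (?N k \<Otimes>\<^sub>M PiM ?K ?N) (PiM (insert k ?K) ?N) (\<lambda>(x, X). X(k := x)) = PiM (insert k ?K) ?N"
      by (rule distr_pair_PiM_eq_PiM) (use k in \<open>auto intro: prob_space_gauss_coef\<close>)
    then show ?thesis unfolding H gauss_seq_def[symmetric]
      by (metis (mono_tags, lifting) distr_cong sets_gauss_seq)
  qed
  have "distr (PiM half_space ?N) (PiM ?K ?N) (\<lambda>a. \<lambda>n\<in>?K. a n) = PiM ?K ?N"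
    by (rule distr_PiM_reindex[where f="\<lambda>x. x"]) (auto intro: prob_space_gauss_coef)
  then have GK: "distr (gauss_seq p) (PiM ?K ?N) (\<lambda>a. restrict a ?K) = PiM ?K ?N"
    by (simp add: gauss_seq_def)
  have restr: "(\<lambda>a. restrict a ?K) \<in> gauss_seq p \<rightarrow>\<^sub>M PiM ?K ?N"
    unfolding gauss_seq_def by (rule measurable_restrict_subset) auto
  have "(\<integral>\<^sup>+a. F a \<partial>gauss_seq p) = (\<integral>\<^sup>+w. F ((snd w)(k := fst w)) \<partial>(?N k \<Otimes>\<^sub>M PiM ?K ?N))"
    by (subst G, subst nn_integral_distr[OF upd]) (auto simp: split_beta)
  also have "\<dots> = (\<integral>\<^sup>+X. \<integral>\<^sup>+z. F (X(k := z)) \<partial>?N k \<partial>PiM ?K ?N)"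
    using upd by (subst P.nn_integral_snd[symmetric]) (auto simp: split_beta)
  also have "\<dots> = (\<integral>\<^sup>+a. \<integral>\<^sup>+z. F ((restrict a ?K)(k := z)) \<partial>?N k \<partial>gauss_seq p)"
  proof -
    have "(\<lambda>(X, z). X(k := z)) \<in> PiM ?K ?N \<Otimes>\<^sub>M ?N k \<rightarrow>\<^sub>M seq_space"
      unfolding split_beta
      by (rule measurable_fun_upd[where J="?K"]) (use H in \<open>auto simp: measurable_cong_sets[OF refl sK[symmetric]]\<close>)
    then have "(\<lambda>(X, z). F (X(k := z))) \<in> borel_measurable (PiM ?K ?N \<Otimes>\<^sub>M ?N k)"
      unfolding split_beta by (rule measurable_compose) simp
    then have m: "(\<lambda>X. \<integral>\<^sup>+z. F (X(k := z)) \<partial>?N k) \<in> borel_measurable (PiM ?K ?N)"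
      by (rule Nk.borel_measurable_nn_integral)
    show ?thesis
      by (subst GK[symmetric], rule nn_integral_distr[OF restr]) (simp add: m)
  qed
  also have "\<dots> = (\<integral>\<^sup>+a. \<integral>\<^sup>+z. F (a(k := z)) * ennreal (cgauss (coef_rate p k) z) \<partial>lborel \<partial>gauss_seq p)"
  proof (rule nn_integral_cong)
    fix a :: "'d freq \<Rightarrow> complex" assume "a \<in> space (gauss_seq p)"
    then have a: "a \<in> space seq_space" by (simp add: space_gauss_seq)
    then have "(restrict a ?K)(k := z) = a(k := z)" for z
      by (auto simp: fun_eq_iff space_seq_space PiE_def extensional_def)
    moreover have "(\<lambda>z. F (a(k := z))) \<in> borel_measurable lborel"
      by (rule measurable_compose[OF measurable_coord_upd[OF k measurable_const[OF a]]]) auto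
    ultimately show "(\<integral>\<^sup>+z. F ((restrict a ?K)(k := z)) \<partial>?N k) = (\<integral>\<^sup>+z. F (a(k := z)) * ennreal (cgauss (coef_rate p k) z) \<partial>lborel)"
      unfolding gauss_coef_def by (subst nn_integral_density) (auto simp: mult.commute)
  qed
  finally show ?thesis .
qed

text \<open>The Gaussian density is strictly positive, so the null sets of the new coordinate are
  those of Lebesgue measure.\<close>

lemma AE_gauss_seq_resample:
  fixes k :: "('d::{finite,linorder}) freq"
  assumes k: "k \<in> half_space" and [measurable]: "Measurable.pred seq_space Q"
  shows "(AE a in gauss_seq p. Q a) \<longleftrightarrow> (AE a in gauss_seq p. AE z in lborel. Q (a(k := z)))"
proof -
  let ?F = "\<lambda>a. indicator {a \<in> space seq_space. \<not> Q a} a :: ennreal"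
  have m: "(\<lambda>a. \<integral>\<^sup>+z. ?F (a(k := z)) * ennreal (cgauss (coef_rate p k) z) \<partial>lborel) \<in> borel_measurable (gauss_seq p)"
    using k by (intro lborel.borel_measurable_nn_integral) measurable
  have "(AE a in gauss_seq p. Q a) \<longleftrightarrow> (\<integral>\<^sup>+a. ?F a \<partial>gauss_seq p) = 0"
    by (subst nn_integral_0_iff_AE) (auto simp: indicator_def space_gauss_seq intro!: AE_cong)
  also have "(\<integral>\<^sup>+a. ?F a \<partial>gauss_seq p)
    = (\<integral>\<^sup>+a. \<integral>\<^sup>+z. ?F (a(k := z)) * ennreal (cgauss (coef_rate p k) z) \<partial>lborel \<partial>gauss_seq p)"
    by (rule gauss_seq_resample[OF k]) measurable
  also have "\<dots> = 0 \<longleftrightarrow> (AE a in gauss_seq p. (\<integral>\<^sup>+z. ?F (a(k := z)) * ennreal (cgauss (coef_rate p k) z) \<partial>lborel) = 0)"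
    by (rule nn_integral_0_iff_AE[OF m])
  also have "\<dots> \<longleftrightarrow> (AE a in gauss_seq p. AE z in lborel. Q (a(k := z)))"
  proof (rule AE_cong)
    fix a :: "'d freq \<Rightarrow> complex" assume "a \<in> space (gauss_seq p)"
    then have a [measurable]: "a \<in> space seq_space" by (simp add: space_gauss_seq)
    have u: "(\<lambda>z. a(k := z)) \<in> lborel \<rightarrow>\<^sub>M seq_space"
      by (rule measurable_coord_upd[OF k measurable_const[OF a]]) simp
    have sp: "a(k := z) \<in> space seq_space" for z using measurable_space[OF u, of z] by simp
    have "(\<lambda>z. ?F (a(k := z))) \<in> borel_measurable lborel"
      by (rule measurable_compose[OF u]) measurable
    then have "(\<lambda>z. ?F (a(k := z)) * ennreal (cgauss (coef_rate p k) z)) \<in> borel_measurable lborel"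
      by (rule borel_measurable_times_ennreal) simp
    then have "((\<integral>\<^sup>+z. ?F (a(k := z)) * ennreal (cgauss (coef_rate p k) z) \<partial>lborel) = 0)
      = (AE z in lborel. ?F (a(k := z)) * ennreal (cgauss (coef_rate p k) z) = 0)"
      by (rule nn_integral_0_iff_AE)
    also have "\<dots> = (AE z in lborel. Q (a(k := z)))"
    proof (rule AE_cong)
      fix z
      have "ennreal (cgauss (coef_rate p k) z) \<noteq> 0"
        using cgauss_pos[OF coef_rate_pos[OF k], of p z] by (simp add: ennreal_eq_0_iff)
      then show "(?F (a(k := z)) * ennreal (cgauss (coef_rate p k) z) = 0) = Q (a(k := z))"
        using sp by (auto simp: indicator_def)
    qed
    finally show "((\<integral>\<^sup>+z. ?F (a(k := z)) * ennreal (cgauss (coef_rate p k) z) \<partial>lborel) = 0) = (AE z in lborel. Q (a(k := z)))" .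
  qed
  finally show ?thesis .
qed

text \<open>Averaging over the translates by \<open>t v\<close>, \<open>0 \<le> t \<le> 1\<close>, of the coordinate that is drawn again
  turns statements on lines into statements on Gaussian sequences.\<close>

definition line_weight :: "real \<Rightarrow> ('d::finite) freq \<Rightarrow> complex \<Rightarrow> complex \<Rightarrow> real \<Rightarrow> real" where
  "line_weight p k v z t = indicator {0..1} t * cgauss (coef_rate p k) (z + of_real t * v)"

lemma line_weight_nonneg: "0 \<le> line_weight p k v z t"
  by (simp add: line_weight_def cgauss_def coef_rate_def)

lemma borel_measurable_line_weight [measurable]:
  "(\<lambda>w. line_weight p k v (snd (fst w)) (snd w)) \<in> borel_measurable ((gauss_seq p \<Otimes>\<^sub>M lborel) \<Otimes>\<^sub>M lborel)"
  unfolding line_weight_def by measurable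

text \<open>By translation invariance of Lebesgue measure, \<open>z\<close> may be replaced by
  \<open>z + t * v\<close> for each \<open>t\<close>; averaging over \<open>t\<close> in
  \<open>{0..1}\<close> and exchanging integrals leaves integrals along lines. The Gaussian density
  is translated together with the integrand, which is why \<open>line_weight\<close> takes it at the
  shifted point.\<close>

lemma gauss_seq_line_average:
  fixes k :: "('d::{finite,linorder}) freq"
  assumes k: "k \<in> half_space" and [measurable]: "F \<in> borel_measurable seq_space"
  shows "(\<integral>\<^sup>+a. F a \<partial>gauss_seq p)
    = (\<integral>\<^sup>+a. \<integral>\<^sup>+z. \<integral>\<^sup>+t. F (a(k := z + of_real t * v)) * ennreal (line_weight p k v z t) \<partial>lborel \<partial>lborel \<partial>gauss_seq p)"
  unfolding gauss_seq_resample[OF k assms(2)]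
proof (rule nn_integral_cong)
  fix a :: "'d freq \<Rightarrow> complex" assume "a \<in> space (gauss_seq p)"
  then have a: "a \<in> space seq_space" by (simp add: space_gauss_seq)
  define h where "h z = F (a(k := z)) * ennreal (cgauss (coef_rate p k) z)" for z
  have [measurable]: "h \<in> borel_measurable borel"
    unfolding h_def
    by (intro borel_measurable_times_ennreal measurable_compose[OF measurable_coord_upd[OF k measurable_const[OF a]] assms(2)]) auto
  have shift: "(\<integral>\<^sup>+z. h (z + of_real t * v) \<partial>lborel) = (\<integral>\<^sup>+z. h z \<partial>lborel)" for t :: real
  proof -
    have "(\<integral>\<^sup>+z. h z \<partial>lborel) = (\<integral>\<^sup>+z. h z \<partial>distr lborel borel ((+) (of_real t * v)))"
      by (simp only: lborel_distr_plus)
    also have "\<dots> = (\<integral>\<^sup>+z. h (of_real t * v + z) \<partial>lborel)" by (rule nn_integral_distr) auto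
    finally show ?thesis by (simp add: add.commute)
  qed
  have "(\<integral>\<^sup>+z. h z \<partial>lborel) = (\<integral>\<^sup>+t. indicator {0..1::real} t * (\<integral>\<^sup>+z. h z \<partial>lborel) \<partial>lborel)"
    by (simp add: nn_integral_multc)
  also have "\<dots> = (\<integral>\<^sup>+t. \<integral>\<^sup>+z. h (z + of_real t * v) * indicator {0..1::real} t \<partial>lborel \<partial>lborel)"
  proof (rule nn_integral_cong)
    fix t :: real
    have "(\<integral>\<^sup>+z. h (z + of_real t * v) * indicator {0..1} t \<partial>lborel)
      = (\<integral>\<^sup>+z. h (z + of_real t * v) \<partial>lborel) * indicator {0..1} t"
      by (rule nn_integral_multc) simp
    then show "indicator {0..1} t * (\<integral>\<^sup>+z. h z \<partial>lborel) = (\<integral>\<^sup>+z. h (z + of_real t * v) * indicator {0..1} t \<partial>lborel)"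
      unfolding shift by (simp only: mult.commute[of "indicator {0..1} t"])
  qed
  also have "\<dots> = (\<integral>\<^sup>+z. \<integral>\<^sup>+t. h (z + of_real t * v) * indicator {0..1::real} t \<partial>lborel \<partial>lborel)"
    by (rule lborel_pair.Fubini') measurable
  also have "\<dots> = (\<integral>\<^sup>+z. \<integral>\<^sup>+t. F (a(k := z + of_real t * v)) * ennreal (line_weight p k v z t) \<partial>lborel \<partial>lborel)"
    by (intro nn_integral_cong) (auto simp: h_def line_weight_def indicator_def)
  finally show "(\<integral>\<^sup>+z. F (a(k := z)) * ennreal (cgauss (coef_rate p k) z) \<partial>lborel) = \<dots>"
    by (simp add: h_def)
qed

lemma measurable_line_point:
  assumes "k \<in> half_space"
  shows "(\<lambda>w. (fst (fst w))(k := snd (fst w) + of_real (snd w) * v)) \<in> (gauss_seq p \<Otimes>\<^sub>M lborel) \<Otimes>\<^sub>M lborel \<rightarrow>\<^sub>M seq_space"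
  using assms by measurable

text \<open>The averaging identity as an equality of laws, the form in which almost-everywhere
  statements and Bochner integrals are transported.\<close>

lemma distr_line_average:
  fixes k :: "('d::{finite,linorder}) freq"
  assumes k: "k \<in> half_space"
  shows "distr (density ((gauss_seq p \<Otimes>\<^sub>M lborel) \<Otimes>\<^sub>M lborel) (\<lambda>w. ennreal (line_weight p k v (snd (fst w)) (snd w))))
      seq_space (\<lambda>w. (fst (fst w))(k := snd (fst w) + of_real (snd w) * v)) = gauss_seq p"
    (is "distr (density ?X ?W) _ ?T = _")
proof (rule measure_eqI)
  interpret G: prob_space "gauss_seq p" by (rule prob_space_gauss_seq)
  note T[measurable] = measurable_line_point[OF k, of v p]
  fix A :: "('d freq \<Rightarrow> complex) set" assume "A \<in> sets (distr (density ?X ?W) seq_space ?T)"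
  then have A[measurable]: "A \<in> sets seq_space" by simp
  have "emeasure (distr (density ?X ?W) seq_space ?T) A = (\<integral>\<^sup>+w. indicator A w \<partial>distr (density ?X ?W) seq_space ?T)"
    by simp
  also have "\<dots> = (\<integral>\<^sup>+w. indicator A (?T w) \<partial>density ?X ?W)"
    by (rule nn_integral_distr) auto
  also have "\<dots> = (\<integral>\<^sup>+w. ?W w * indicator A (?T w) \<partial>?X)"
    by (rule nn_integral_density) auto
  also have "\<dots> = (\<integral>\<^sup>+x. \<integral>\<^sup>+t. ?W (x, t) * indicator A (?T (x, t)) \<partial>lborel \<partial>(gauss_seq p \<Otimes>\<^sub>M lborel))"
    by (rule lborel.nn_integral_fst[symmetric]) measurable
  also have "\<dots> = (\<integral>\<^sup>+a. \<integral>\<^sup>+z. \<integral>\<^sup>+t. ?W ((a, z), t) * indicator A (?T ((a, z), t)) \<partial>lborel \<partial>lborel \<partial>gauss_seq p)"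
    by (rule lborel.nn_integral_fst[symmetric])
       (rule lborel.borel_measurable_nn_integral, simp add: split_beta)
  also have "\<dots> = (\<integral>\<^sup>+a. indicator A a \<partial>gauss_seq p)"
    by (subst gauss_seq_line_average[OF k, where v=v]) (auto simp: mult.commute)
  finally show "emeasure (distr (density ?X ?W) seq_space ?T) A = emeasure (gauss_seq p) A" by simp
qed simp

section \<open>Almost sure summability of Gaussian sequences\<close>

text \<open>The terms at \<open>-1\<close>, \<open>0\<close> and \<open>1\<close> contribute
  \<open>3\<close>; the others telescope through
  \<open>1 / (n + 1)\<^sup>2 \<le> 1 / n - 1 / (n + 1)\<close> on both sides and contribute at most
  \<open>2\<close>.\<close>

lemma sum_inverse_squares_le:
  "(\<Sum>j\<in>{- int (Suc M)..int (Suc M)}. 1 / (max 1 (real_of_int \<bar>j\<bar>))\<^sup>2) \<le> 5 - 2 / real (Suc M)"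
proof (induction M)
  case 0
  have "{- int (Suc 0)..int (Suc 0)} = {-1, 0, 1}" by auto
  then show ?case by simp
next
  case (Suc M)
  let ?N = "real (Suc M)"
  have eq: "{- int (Suc (Suc M))..int (Suc (Suc M))}
    = insert (int (Suc (Suc M))) (insert (- int (Suc (Suc M))) {- int (Suc M)..int (Suc M)})"
    by auto
  have "(\<Sum>j\<in>{- int (Suc (Suc M))..int (Suc (Suc M))}. 1 / (max 1 (real_of_int \<bar>j\<bar>))\<^sup>2)
     = 2 / (?N + 1)\<^sup>2 + (\<Sum>j\<in>{- int (Suc M)..int (Suc M)}. 1 / (max 1 (real_of_int \<bar>j\<bar>))\<^sup>2)"
    unfolding eq by (simp add: add.commute)
  also have "\<dots> \<le> 2 / (?N + 1)\<^sup>2 + (5 - 2 / ?N)" using Suc by simp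
  also have "2 / (?N + 1)\<^sup>2 \<le> 2 / (?N * (?N + 1))"
    by (intro divide_left_mono) (auto simp: power2_eq_square intro!: mult_pos_pos mult_right_mono)
  also have "2 / (?N * (?N + 1)) = 2 / ?N - 2 / (?N + 1)" by (simp add: field_simps)
  finally show ?case by (simp add: add.commute)
qed

lemma sum_F_set_le:
  "(\<Sum>k\<in>(F_set N :: ('d::finite) freq set). \<Prod>i\<in>UNIV. 1 / (max 1 (real_of_int \<bar>k $ i\<bar>))\<^sup>2) \<le> 5 ^ CARD('d)"
proof -
  let ?g = "\<lambda>j::int. 1 / (max 1 (real_of_int \<bar>j\<bar>))\<^sup>2"
  let ?P = "PiE UNIV (\<lambda>_::'d. {- int (Suc N)..int (Suc N)})"
  have sub: "F_set N \<subseteq> vec_lambda ` ?P"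
  proof
    fix k :: "'d freq" assume k: "k \<in> F_set N"
    have "vec_nth k \<in> ?P"
    proof (rule PiE_I)
      fix i show "k $ i \<in> {- int (Suc N)..int (Suc N)}"
        using k by (auto simp: F_set_def abs_less_iff dest!: spec[of _ i])
    qed simp
    then show "k \<in> vec_lambda ` ?P" by (metis imageI vec_nth_inverse)
  qed
  have "(\<Sum>k\<in>(F_set N :: 'd freq set). \<Prod>i\<in>UNIV. ?g (k $ i)) \<le> (\<Sum>k\<in>vec_lambda ` ?P. \<Prod>i\<in>UNIV. ?g (k $ i))"
    by (rule sum_mono2) (use sub in \<open>auto intro!: finite_imageI finite_PiE prod_nonneg\<close>)
  also have "\<dots> = (\<Sum>u\<in>?P. \<Prod>i\<in>UNIV. ?g (u i))"
    by (subst sum.reindex) (auto simp: inj_on_def vec_lambda_inject)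
  also have "\<dots> = (\<Prod>i\<in>(UNIV :: 'd set). \<Sum>j\<in>{- int (Suc N)..int (Suc N)}. ?g j)"
    by (rule prod_sum_PiE[symmetric]) auto
  also have "\<dots> \<le> (\<Prod>i\<in>(UNIV :: 'd set). 5)"
  proof (rule prod_mono, intro conjI)
    have "0 \<le> 2 / real (Suc N)" by simp
    then show "(\<Sum>j\<in>{- int (Suc N)..int (Suc N)}. ?g j) \<le> 5" using sum_inverse_squares_le[of N] by linarith
  qed (auto intro!: sum_nonneg)
  finally show ?thesis by simp
qed

text \<open>Every coordinate is at most the norm and the norm is at least \<open>1\<close>, so the
  product of the squares is at most the norm to the power \<open>2 * CARD('d)\<close>, hence at most
  \<open>sqrt (coef_rate p k)\<close> for \<open>p \<ge> 2\<close>. The resulting bound factors over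
  the coordinates, which makes it summable over boxes.\<close>

lemma inverse_sqrt_coef_rate_le:
  fixes k :: "('d::finite) freq"
  assumes "k \<noteq> 0" "p \<ge> 2"
  shows "1 / sqrt (coef_rate p k) \<le> (\<Prod>i\<in>UNIV. 1 / (max 1 (real_of_int \<bar>k $ i\<bar>))\<^sup>2)"
proof -
  let ?n = "norm (fvec k)"
  obtain i where i: "k $ i \<noteq> 0" using assms by (auto simp: vec_eq_iff)
  have comp: "real_of_int \<bar>k $ j\<bar> \<le> ?n" for j
    using component_le_norm_cart[of "fvec k" j] by (simp add: fvec_def)
  have "1 \<le> \<bar>k $ i\<bar>" using i by simp
  then have n1: "1 \<le> ?n" using comp[of i] by linarith
  have f0: "fvec k \<noteq> 0" using n1 by auto
  have "(\<Prod>i\<in>(UNIV::'d set). (max 1 (real_of_int \<bar>k $ i\<bar>))\<^sup>2) \<le> (\<Prod>i\<in>(UNIV::'d set). ?n\<^sup>2)"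
    by (rule prod_mono) (use comp n1 in \<open>auto intro!: power_mono\<close>)
  also have "\<dots> = ?n powr (2 * real CARD('d))"
    using powr_realpow[of ?n "2 * CARD('d)"] f0 by (simp add: power_mult)
  also have "\<dots> \<le> ?n powr (p * real CARD('d))"
    using n1 assms by (intro powr_mono mult_right_mono) auto
  also have "\<dots> = sqrt (coef_rate p k)"
    using n1 by (simp add: coef_rate_def powr_half_sqrt[symmetric] powr_powr)
  finally have "(\<Prod>i\<in>(UNIV::'d set). (max 1 (real_of_int \<bar>k $ i\<bar>))\<^sup>2) \<le> sqrt (coef_rate p k)" .
  moreover have "0 < (\<Prod>i\<in>(UNIV::'d set). (max 1 (real_of_int \<bar>k $ i\<bar>))\<^sup>2)"
    by (rule prod_pos) (auto intro!: zero_less_power)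
  ultimately show ?thesis by (simp add: prod_dividef frac_le)
qed

lemma nn_integral_norm_coord:
  assumes k: "k \<in> half_space"
  shows "(\<integral>\<^sup>+a. ennreal (norm (a k)) \<partial>gauss_seq p) \<le> ennreal (2 / sqrt (coef_rate p k))"
proof -
  have "(\<integral>\<^sup>+a. ennreal (norm (a k)) \<partial>gauss_seq p) = (\<integral>\<^sup>+z. ennreal (norm z) \<partial>distr (gauss_seq p) (gauss_coef p k) (\<lambda>a. a k))"
    by (rule nn_integral_distr[symmetric]) (use k in \<open>auto simp: gauss_seq_def measurable_cong_sets[OF sets_gauss_coef refl]\<close>)
  also have "distr (gauss_seq p) (gauss_coef p k) (\<lambda>a. a k) = gauss_coef p k"
    unfolding gauss_seq_def by (rule distr_PiM_component) (use k prob_space_gauss_coef in auto)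
  also have "(\<integral>\<^sup>+z. ennreal (norm z) \<partial>gauss_coef p k) = (\<integral>\<^sup>+z. ennreal (norm z * cgauss (coef_rate p k) z) \<partial>lborel)"
    unfolding gauss_coef_def
    by (subst nn_integral_density) (auto simp: ennreal_mult' mult.commute intro!: nn_integral_cong)
  also have "\<dots> \<le> ennreal (2 / sqrt (coef_rate p k))"
    by (rule nn_integral_norm_cgauss[OF coef_rate_pos[OF k]])
  finally show ?thesis .
qed

text \<open>The expected sum of the moduli is finite: the term at \<open>k\<close> is at most
  \<open>2 / sqrt (coef_rate p k)\<close>, and the sums over boxes are bounded uniformly by
  \<open>2 * 5 ^ CARD('d)\<close>.\<close>

lemma AE_gauss_seq_l1:
  assumes p: "p \<ge> 2"
  shows "AE a in gauss_seq p. (a :: ('d::{finite,linorder}) freq \<Rightarrow> complex) \<in> l1_seq"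
proof -
  let ?S = "\<lambda>N (a :: 'd freq \<Rightarrow> complex). \<Sum>k\<in>F_plus N. ennreal (norm (a k))"
  have Sm: "?S N \<in> borel_measurable (gauss_seq p)" for N
  proof (rule borel_measurable_sum)
    fix k :: "'d freq" assume "k \<in> F_plus N"
    then have [measurable]: "k \<in> half_space" using F_plus_subset by blast
    show "(\<lambda>a. ennreal (norm (a k))) \<in> borel_measurable (gauss_seq p)" by measurable
  qed
  have bound: "(\<integral>\<^sup>+a. ?S N a \<partial>gauss_seq p) \<le> ennreal (2 * 5 ^ CARD('d))" for N
  proof -
    have "(\<integral>\<^sup>+a. ?S N a \<partial>gauss_seq p) = (\<Sum>k\<in>(F_plus N :: 'd freq set). \<integral>\<^sup>+a. ennreal (norm (a k)) \<partial>gauss_seq p)"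
    proof (rule nn_integral_sum)
      fix k :: "'d freq" assume "k \<in> F_plus N"
      then have [measurable]: "k \<in> half_space" using F_plus_subset by blast
      show "(\<lambda>a. ennreal (norm (a k))) \<in> borel_measurable (gauss_seq p)" by measurable
    qed
    also have "\<dots> \<le> (\<Sum>k\<in>(F_plus N :: 'd freq set). ennreal (2 / sqrt (coef_rate p k)))"
      by (intro sum_mono nn_integral_norm_coord) (use F_plus_subset in blast)
    also have "\<dots> = ennreal (\<Sum>k\<in>(F_plus N :: 'd freq set). 2 / sqrt (coef_rate p k))"
      by (rule sum_ennreal) (auto simp: coef_rate_def)
    also have "\<dots> \<le> ennreal (2 * 5 ^ CARD('d))"
    proof (rule ennreal_leI)
      let ?f = "\<lambda>k::'d freq. \<Prod>i\<in>UNIV. 1 / (max 1 (real_of_int \<bar>k $ i\<bar>))\<^sup>2"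
      have "(\<Sum>k\<in>(F_plus N :: 'd freq set). 2 / sqrt (coef_rate p k)) \<le> (\<Sum>k\<in>F_plus N. 2 * ?f k)"
      proof (rule sum_mono)
        fix k :: "'d freq" assume "k \<in> F_plus N"
        then have "k \<noteq> 0" using F_plus_subset zero_notin_half_space by blast
        then show "2 / sqrt (coef_rate p k) \<le> 2 * ?f k"
          using inverse_sqrt_coef_rate_le[OF _ p, of k] by simp
      qed
      also have "\<dots> \<le> (\<Sum>k\<in>F_set N. 2 * ?f k)"
        by (rule sum_mono2) (auto simp: finite_F_set F_plus_eq intro!: prod_nonneg)
      also have "\<dots> \<le> 2 * 5 ^ CARD('d)"
        using sum_F_set_le[of N, where 'd='d] by (simp add: sum_distrib_left[symmetric])
      finally show "(\<Sum>k\<in>(F_plus N :: 'd freq set). 2 / sqrt (coef_rate p k)) \<le> 2 * 5 ^ CARD('d)" .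
    qed
    finally show ?thesis .
  qed
  have inc: "incseq ?S"
    unfolding incseq_def le_fun_def by (intro allI impI sum_mono2) (auto intro: F_plus_mono[THEN subsetD])
  have "(\<integral>\<^sup>+a. (SUP N. ?S N a) \<partial>gauss_seq p) = (SUP N. \<integral>\<^sup>+a. ?S N a \<partial>gauss_seq p)"
    by (rule nn_integral_monotone_convergence_SUP[OF inc Sm])
  also have "\<dots> \<le> ennreal (2 * 5 ^ CARD('d))" by (rule SUP_least) (rule bound)
  finally have "(\<integral>\<^sup>+a. (SUP N. ?S N a) \<partial>gauss_seq p) \<noteq> \<infinity>" by (auto simp: top_unique)
  then have "AE a in gauss_seq p. (SUP N. ?S N a) \<noteq> \<infinity>"
    by (intro nn_integral_PInf_AE borel_measurable_SUP Sm) auto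
  then show ?thesis
  proof (rule AE_mp[OF _ AE_I2[OF impI]])
    fix a :: "'d freq \<Rightarrow> complex" assume a: "a \<in> space (gauss_seq p)" and fin: "(SUP N. ?S N a) \<noteq> \<infinity>"
    obtain C where C: "(SUP N. ?S N a) = ennreal C" "C \<ge> 0" using fin by (cases "SUP N. ?S N a") auto
    obtain n :: nat where n: "C \<le> real n" using real_arch_simple by blast
    have "(\<Sum>k\<in>F_plus N. norm (a k)) \<le> real n" for N
    proof -
      have "ennreal (\<Sum>k\<in>F_plus N. norm (a k)) = ?S N a" by (simp add: sum_ennreal)
      also have "\<dots> \<le> ennreal C" unfolding C(1)[symmetric] by (rule SUP_upper) simp
      finally show ?thesis using C(2) n by simp
    qed
    then show "a \<in> l1_seq" using a unfolding l1_seq_eq space_gauss_seq by blast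
  qed
qed

section \<open>Scaling finite blocks of coordinates\<close>

lemma scale_seq_upd:
  assumes "k \<in> half_space" "a \<in> space seq_space"
  shows "scale_seq (\<lambda>l. if l = k then s else 1) a = a(k := of_real s * a k)"
  using assms by (auto simp: scale_seq_def fun_eq_iff space_seq_space PiE_def extensional_def)

lemma measurable_scale_seq [measurable]: "scale_seq w \<in> seq_space \<rightarrow>\<^sub>M seq_space"
  unfolding scale_seq_def[abs_def]
proof (rule measurable_restrict)
  fix k :: "'a freq" assume [measurable]: "k \<in> half_space"
  show "(\<lambda>a. complex_of_real (w k) * a k) \<in> borel_measurable seq_space" by measurable
qed

lemma AE_lborel_scale:
  assumes s: "s \<noteq> 0" and [measurable]: "Measurable.pred borel P"
    and ae: "AE z in lborel. P (of_real s * (z :: complex))"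
  shows "AE z in lborel. P z"
proof -
  have "AE z in distr lborel borel (\<lambda>z. 0 + s *\<^sub>R z). P (z :: complex)"
    by (subst AE_distr_iff) (use ae in \<open>auto simp: scaleR_conv_of_real\<close>)
  then have "AE z in density (distr lborel borel (\<lambda>z. 0 + s *\<^sub>R z)) (\<lambda>_. \<bar>s\<bar> ^ DIM(complex)). P z"
    by (subst AE_density) auto
  then show ?thesis using lborel_affine[of s "0::complex"] s by (simp only: not_False_eq_True)
qed

text \<open>After coordinate \<open>k\<close> is drawn again, the claim concerns Lebesgue measure on
  the plane, whose null sets are preserved by nonzero scaling, whereas the Gaussian law itself
  changes.\<close>

lemma AE_gauss_seq_scale_coord:
  fixes k :: "('d::{finite,linorder}) freq"
  assumes k: "k \<in> half_space" and s: "s \<noteq> 0" and [measurable]: "Measurable.pred seq_space Q"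
    and ae: "AE a in gauss_seq p. Q (scale_seq (\<lambda>l. if l = k then s else 1) a)"
  shows "AE a in gauss_seq p. Q a"
proof -
  have "AE a in gauss_seq p. AE z in lborel. Q (scale_seq (\<lambda>l. if l = k then s else 1) (a(k := z)))"
    using ae by (subst (asm) AE_gauss_seq_resample[OF k]) auto
  then have "AE a in gauss_seq p. AE z in lborel. Q (a(k := z))"
  proof (rule AE_mp[OF _ AE_I2[OF impI]])
    fix a :: "'d freq \<Rightarrow> complex" assume "a \<in> space (gauss_seq p)"
    then have a: "a \<in> space seq_space" by (simp add: space_gauss_seq)
    assume ae: "AE z in lborel. Q (scale_seq (\<lambda>l. if l = k then s else 1) (a(k := z)))"
    have u: "(\<lambda>z. a(k := z)) \<in> borel \<rightarrow>\<^sub>M seq_space"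
      by (rule measurable_coord_upd[OF k measurable_const[OF a]]) simp
    have sp: "a(k := z) \<in> space seq_space" for z using measurable_space[OF u, of z] by simp
    have "scale_seq (\<lambda>l. if l = k then s else 1) (a(k := z)) = a(k := of_real s * z)" for z
      using scale_seq_upd[OF k sp, of s z] by simp
    then have "AE z in lborel. Q (a(k := of_real s * z))" using ae by simp
    then show "AE z in lborel. Q (a(k := z))"
      by (rule AE_lborel_scale[OF s measurable_compose[OF u assms(3)]])
  qed
  then show ?thesis by (subst AE_gauss_seq_resample[OF k]) auto
qed

text \<open>One coordinate is scaled at a time, so \<open>J\<close> has to be finite: scaling
  infinitely many coordinates by a factor of modulus other than \<open>1\<close> would give a law
  singular to the original one.\<close>

lemma AE_gauss_seq_scale_block:
  fixes J :: "('d::{finite,linorder}) freq set"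
  assumes "finite J" "J \<subseteq> half_space" and s: "s \<noteq> 0" and "Measurable.pred seq_space Q"
    and "AE a in gauss_seq p. Q (scale_seq (\<lambda>l. if l \<in> J then s else 1) a)"
  shows "AE a in gauss_seq p. Q a"
  using assms(1,2,4,5)
proof (induction J arbitrary: Q)
  case empty
  have "scale_seq (\<lambda>l. if l \<in> {} then s else 1) a = a" if "a \<in> space (gauss_seq p)" for a :: "'d freq \<Rightarrow> complex"
    using that by (auto simp: space_gauss_seq space_seq_space scale_seq_def fun_eq_iff PiE_def extensional_def)
  then show ?case using empty(3) by (simp cong: AE_cong)
next
  case (insert k J)
  note [measurable] = insert.prems(2)
  have eq: "scale_seq (\<lambda>l. if l \<in> insert k J then s else 1) a
     = scale_seq (\<lambda>l. if l \<in> J then s else 1) (scale_seq (\<lambda>l. if l = k then s else 1) a)" for a :: "'d freq \<Rightarrow> complex"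
    using insert.hyps by (auto simp: scale_seq_def fun_eq_iff)
  have ae: "AE a in gauss_seq p. Q (scale_seq (\<lambda>l. if l \<in> J then s else 1) a)"
  proof (rule AE_gauss_seq_scale_coord[OF _ s])
    show "k \<in> half_space" using insert.prems by simp
    show "Measurable.pred seq_space (\<lambda>a. Q (scale_seq (\<lambda>l. if l \<in> J then s else 1) a))" by measurable
    show "AE a in gauss_seq p. Q (scale_seq (\<lambda>l. if l \<in> J then s else 1) (scale_seq (\<lambda>l. if l = k then s else 1) a))"
      using insert.prems(3) unfolding eq .
  qed
  have "J \<subseteq> half_space" using insert.prems(1) by blast
  then show ?case using insert.prems(2) ae by (rule insert.IH)
qed


section \<open>The boundary of the set of positive densities\<close>

lemma l1_tail_le:
  assumes "a \<in> l1_seq" "b \<in> l1_seq"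
  shows "l1_tail n b \<le> l1_tail n a + l1_dist a b"
proof -
  have s: "(\<lambda>k. norm (a k)) summable_on half_space - F_plus n" "(\<lambda>k. norm (b k)) summable_on half_space - F_plus n"
    by (rule summable_on_subset[of _ half_space]; use assms in \<open>auto simp: l1_seq_def\<close>)+
  have d: "(\<lambda>k. norm (a k - b k)) summable_on half_space - F_plus n"
    by (rule summable_on_subset[OF l1_diff_summable[OF assms]]) auto
  have "l1_tail n b \<le> (\<Sum>\<^sub>\<infinity>k\<in>half_space - F_plus n. norm (a k) + norm (a k - b k))"
    unfolding l1_tail_def
  proof (rule infsum_mono[OF s(2) summable_on_add[OF s(1) d]])
    show "norm (b k) \<le> norm (a k) + norm (a k - b k)" for k
      using norm_triangle_ineq4[of "a k" "a k - b k"] by simp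
  qed
  also have "\<dots> = l1_tail n a + (\<Sum>\<^sub>\<infinity>k\<in>half_space - F_plus n. norm (a k - b k))"
    unfolding l1_tail_def by (rule infsum_add[OF s(1) d])
  also have "(\<Sum>\<^sub>\<infinity>k\<in>half_space - F_plus n. norm (a k - b k)) \<le> l1_dist a b"
    unfolding l1_dist_def by (rule infsum_mono2[OF d l1_diff_summable[OF assms]]) auto
  finally show ?thesis by simp
qed

lemma l1_open_tail: "l1_open {a \<in> l1_seq. l1_tail n a < c}"
  unfolding l1_open_def
proof (intro conjI ballI)
  fix a :: "'a freq \<Rightarrow> complex" assume a: "a \<in> {a \<in> l1_seq. l1_tail n a < c}"
  show "\<exists>e>0. \<forall>b\<in>l1_seq. l1_dist a b < e \<longrightarrow> b \<in> {a \<in> l1_seq. l1_tail n a < c}"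
    using a l1_tail_le[of a _ n] by (intro exI[of _ "c - l1_tail n a"]) fastforce
qed auto

lemma l1_open_neg: "l1_open {a \<in> l1_seq. \<exists>x. fourier_density a x < 0}"
  unfolding l1_open_def
proof (intro conjI ballI)
  fix a :: "'a freq \<Rightarrow> complex" assume "a \<in> {a \<in> l1_seq. \<exists>x. fourier_density a x < 0}"
  then obtain x where a: "a \<in> l1_seq" "fourier_density a x < 0" by auto
  show "\<exists>e>0. \<forall>b\<in>l1_seq. l1_dist a b < e \<longrightarrow> b \<in> {a \<in> l1_seq. \<exists>x. fourier_density a x < 0}"
  proof (intro exI[of _ "- fourier_density a x / 2"] conjI ballI impI)
    fix b assume "b \<in> l1_seq" "l1_dist a b < - fourier_density a x / 2"
    then show "b \<in> {a \<in> l1_seq. \<exists>x. fourier_density a x < 0}"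
      using fourier_density_diff[OF a(1), of b x] by (auto intro!: exI[of _ x])
  qed (use a in auto)
qed auto

lemma fourier_density_affine:
  fixes a b c :: "('d::{finite,linorder}) freq \<Rightarrow> complex"
  assumes a: "a \<in> l1_seq" and b: "b \<in> l1_seq" and c: "\<And>k. k \<in> half_space \<Longrightarrow> c k = of_real s * a k + of_real (1 - s) * b k"
  shows "fourier_density c x = s * fourier_density a x + (1 - s) * fourier_density b x"
proof -
  let ?t = "\<lambda>a k. Re (a k * fourier_char (- k) x)"
  have "(\<Sum>\<^sub>\<infinity>k\<in>half_space. ?t c k) = (\<Sum>\<^sub>\<infinity>k\<in>half_space. s * ?t a k + (1 - s) * ?t b k)"
    by (rule infsum_cong) (simp add: c algebra_simps)
  also have "\<dots> = (\<Sum>\<^sub>\<infinity>k\<in>half_space. s * ?t a k) + (\<Sum>\<^sub>\<infinity>k\<in>half_space. (1 - s) * ?t b k)"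
    by (intro infsum_add summable_on_cmult_right fourier_density_summable a b)
  also have "\<dots> = s * (\<Sum>\<^sub>\<infinity>k\<in>half_space. ?t a k) + (1 - s) * (\<Sum>\<^sub>\<infinity>k\<in>half_space. ?t b k)"
    by (simp only: infsum_cmult_right')
  finally show ?thesis unfolding fourier_density_def by (simp add: algebra_simps)
qed

abbreviation block_scale :: "nat \<Rightarrow> real \<Rightarrow> (('d::{finite,linorder}) freq \<Rightarrow> complex) \<Rightarrow> 'd freq \<Rightarrow> complex" where
  "block_scale n s \<equiv> scale_seq (\<lambda>l. if l \<in> F_plus n then s else 1)"

text \<open>Factors larger than \<open>1\<close> are allowed, so summability is checked separately
  on the finite block and on the unchanged rest.\<close>

lemma block_scale_in_l1:
  assumes "a \<in> l1_seq" shows "block_scale n s a \<in> l1_seq"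
proof -
  have f: "(\<lambda>k. norm (block_scale n s a k)) summable_on F_plus n" by simp
  have "(\<lambda>k. norm (block_scale n s a k)) summable_on half_space - F_plus n"
  proof (subst summable_on_cong)
    show "norm (block_scale n s a k) = norm (a k)" if "k \<in> half_space - F_plus n" for k using that by simp
    show "(\<lambda>k. norm (a k)) summable_on half_space - F_plus n"
      by (rule summable_on_subset[of _ half_space]) (use assms in \<open>auto simp: l1_seq_def\<close>)
  qed
  from summable_on_Un_disjoint[OF f this]
  have "(\<lambda>k. norm (block_scale n s a k)) summable_on F_plus n \<union> (half_space - F_plus n)" by simp
  also have "F_plus n \<union> (half_space - F_plus n) = half_space" using F_plus_subset by blast
  finally have "(\<lambda>k. norm (block_scale n s a k)) summable_on half_space" .
  then show ?thesis by (auto simp: l1_seq_def scale_seq_def)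
qed

lemma l1_tail_block_scale: "l1_tail n (block_scale n s a) = l1_tail n a"
  unfolding l1_tail_def by (rule infsum_cong) simp

lemma fourier_density_block_scale_ge:
  assumes a: "a \<in> l1_seq" and s: "0 \<le> s"
  shows "1 - 2 * s * (\<Sum>k\<in>F_plus n. norm (a k)) - 2 * l1_tail n a \<le> fourier_density (block_scale n s a) x"
proof -
  \<comment> \<open>\<open>?z\<close> is the zero sequence, as \<open>F_plus 0\<close> is empty, and
    its density is the constant \<open>1\<close>.\<close>
  let ?b = "block_scale n s a" and ?z = "trunc_seq 0 a"
  have b: "?b \<in> l1_seq" by (rule block_scale_in_l1[OF a])
  have z: "fourier_density ?z x = 1" "\<And>k. k \<in> half_space \<Longrightarrow> ?z k = 0"
  proof -
    have e: "F_plus 0 = {}" by (auto simp: F_plus_def F_set_def)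
    show "fourier_density ?z x = 1" by (simp add: fourier_density_trunc trig_density_def e)
    show "?z k = 0" if "k \<in> half_space" for k using that by (simp add: trunc_seq_def e)
  qed
  have sb: "(\<lambda>k. norm (?b k)) summable_on half_space" using b by (simp add: l1_seq_def)
  have "l1_dist ?b ?z = (\<Sum>\<^sub>\<infinity>k\<in>F_plus n \<union> (half_space - F_plus n). norm (?b k))"
    unfolding l1_dist_def by (rule infsum_cong_neutral) (use F_plus_subset z(2) in auto)
  also have "\<dots> = (\<Sum>k\<in>F_plus n. norm (?b k)) + l1_tail n ?b"
    unfolding l1_tail_def by (subst infsum_Un_disjoint) (auto intro!: summable_on_subset[OF sb])
  also have "(\<Sum>k\<in>F_plus n. norm (?b k)) = s * (\<Sum>k\<in>F_plus n. norm (a k))"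
    unfolding sum_distrib_left using F_plus_subset[of n] s by (intro sum.cong) (auto simp: norm_mult subset_iff)
  finally show ?thesis
    using fourier_density_diff[OF b trunc_seq_in_l1, of x 0 a] z(1) l1_tail_block_scale[of n s a] by simp
qed

lemma sets_boundary:
  "{a :: ('d::{finite,linorder}) freq \<Rightarrow> complex. a \<in> l1_seq \<and> (\<forall>x. 0 \<le> fourier_density a x) \<and> a \<notin> pos_seq} \<in> sets seq_space"
proof -
  have "{a :: 'd freq \<Rightarrow> complex. a \<in> l1_seq \<and> (\<forall>x. 0 \<le> fourier_density a x) \<and> a \<notin> pos_seq}
     = l1_seq - pos_seq - {a \<in> l1_seq. \<exists>x. fourier_density a x < (0::real)}"
    by (auto simp: not_less[symmetric])
  then show ?thesis using sets_l1_seq sets_pos_seq sets_l1_open[OF l1_open_neg] by auto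
qed

text \<open>On a ray in finitely many coordinates, with small remaining coordinates, the minimum of the density
  vanishes for at most one scale, because the density is affine in the scale and positive at scale \<open>0\<close>.\<close>

lemma boundary_scale_unique:
  fixes a :: "('d::{finite,linorder}) freq \<Rightarrow> complex"
  assumes a: "a \<in> l1_seq" "l1_tail n a < 1 / 2" and s: "0 < s" "s < s'"
    and pos: "\<And>x. 0 \<le> fourier_density (block_scale n s' a) x"
  shows "block_scale n s a \<in> pos_seq"
proof -
  \<comment> \<open>Scale \<open>s\<close> is a convex combination of scale \<open>s'\<close>, with
    weight \<open>s / s'\<close>, and scale \<open>0\<close>; at scale \<open>0\<close> the density
    is at least \<open>1 - 2 * l1_tail n a\<close>, which is positive.\<close>
  let ?t = "s / s'"
  have t: "0 < ?t" "?t < 1" using s by auto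
  have "fourier_density (block_scale n s a) x = ?t * fourier_density (block_scale n s' a) x + (1 - ?t) * fourier_density (block_scale n 0 a) x" for x
  proof (rule fourier_density_affine[OF block_scale_in_l1 block_scale_in_l1, OF a(1) a(1)])
    fix k :: "'d freq" assume "k \<in> half_space"
    moreover have "complex_of_real s = of_real ?t * of_real s'"
      using s unfolding of_real_mult[symmetric] by simp
    moreover have "s' \<noteq> 0" using s by simp
    ultimately show "block_scale n s a k = of_real ?t * block_scale n s' a k + of_real (1 - ?t) * block_scale n 0 a k"
      by (simp add: algebra_simps)
  qed
  moreover have "(1 - ?t) * (1 - 2 * l1_tail n a) \<le> (1 - ?t) * fourier_density (block_scale n 0 a) x" for x
    using fourier_density_block_scale_ge[OF a(1), of 0 n x] t by (intro mult_left_mono) auto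
  moreover have "0 \<le> ?t * fourier_density (block_scale n s' a) x" for x
    using t pos by (intro mult_nonneg_nonneg) auto
  ultimately have "(1 - ?t) * (1 - 2 * l1_tail n a) \<le> fourier_density (block_scale n s a) x" for x
    by (smt (verit))
  moreover have "0 < (1 - ?t) * (1 - 2 * l1_tail n a)" using t a by (intro mult_pos_pos) auto
  ultimately show ?thesis using block_scale_in_l1[OF a(1)] by (auto simp: pos_seq_def)
qed

lemma AE_lborel_at_most_one:
  fixes P :: "real \<Rightarrow> bool"
  assumes "\<And>s t. s < t \<Longrightarrow> P s \<Longrightarrow> P t \<Longrightarrow> False"
  shows "AE s in lborel. \<not> P s"
proof (cases "\<exists>s. P s")
  case True
  then obtain s0 where "P s0" by blast
  then have "P s \<Longrightarrow> s = s0" for s using assms by (metis linorder_neqE)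
  moreover have "AE s in lborel. s \<noteq> s0" by (rule AE_lborel_singleton)
  ultimately show ?thesis by (auto elim!: eventually_mono)
qed auto

lemma measurable_block_scale_pair:
  "(\<lambda>w. block_scale n (snd w) (fst w)) \<in> seq_space \<Otimes>\<^sub>M borel \<rightarrow>\<^sub>M seq_space"
  unfolding scale_seq_def
proof (rule measurable_restrict)
  fix k :: "'a freq" assume [measurable]: "k \<in> half_space"
  show "(\<lambda>w. complex_of_real (if k \<in> F_plus n then snd w else 1) * fst w k) \<in> borel_measurable (seq_space \<Otimes>\<^sub>M borel)"
    by measurable
qed

text \<open>For a fixed sequence the rescaled one meets the boundary at no more than one scale. By
  Fubini some scale in \<open>{1..2}\<close> avoids it for almost every sequence, and rescaling a
  finite block respects null sets. The sets \<open>S n\<close> sort the sequences by a block beyond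
  which the tail is below \<open>1 / 2\<close>.\<close>

lemma AE_gauss_seq_not_boundary:
  "AE a in gauss_seq p. \<not> (a \<in> l1_seq \<and> (\<forall>x. 0 \<le> fourier_density (a :: ('d::{finite,linorder}) freq \<Rightarrow> complex) x) \<and> a \<notin> pos_seq)"
proof -
  interpret G: prob_space "gauss_seq p :: ('d freq \<Rightarrow> complex) measure" by (rule prob_space_gauss_seq)
  interpret P: pair_sigma_finite "gauss_seq p :: ('d freq \<Rightarrow> complex) measure" "lborel :: real measure" ..
  define S :: "nat \<Rightarrow> ('d freq \<Rightarrow> complex) set" where
    "S n = {a \<in> l1_seq. (\<forall>x. 0 \<le> fourier_density a x) \<and> a \<notin> pos_seq} \<inter> {a \<in> l1_seq. l1_tail n a < 1 / 2}" for n
  have S[measurable]: "S n \<in> sets seq_space" for n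
    unfolding S_def by (intro sets.Int sets_boundary sets_l1_open l1_open_tail)
  have "AE a in gauss_seq p. a \<notin> S n" for n
  proof -
    have [measurable]: "(\<lambda>w. block_scale n (snd w) (fst w)) \<in> gauss_seq p \<Otimes>\<^sub>M lborel \<rightarrow>\<^sub>M seq_space"
      using measurable_block_scale_pair[of n]
      by (simp add: measurable_cong_sets[OF sets_pair_measure_cong[OF sets_gauss_seq sets_lborel] refl])
    have "AE a in gauss_seq p. AE s in lborel. s \<in> {1..2} \<longrightarrow> block_scale n s a \<notin> S n"
    proof (rule AE_I2)
      fix a :: "'d freq \<Rightarrow> complex"
      have "AE s in lborel. \<not> (s \<in> {1..2} \<and> block_scale n s a \<in> S n)"
      proof (rule AE_lborel_at_most_one)
        fix s t :: real assume st: "s < t" "s \<in> {1..2} \<and> block_scale n s a \<in> S n" "t \<in> {1..2} \<and> block_scale n t a \<in> S n"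
        \<comment> \<open>The sequence at scale \<open>s\<close> becomes the base point, so that the
          two scales to be compared are \<open>1\<close> and \<open>t / s\<close>.\<close>
        let ?b = "block_scale n s a"
        have b: "?b \<in> l1_seq" "l1_tail n ?b < 1 / 2" "?b \<notin> pos_seq" using st by (auto simp: S_def)
        have "block_scale n r (block_scale n s a) = block_scale n (r * s) a" for r
          by (auto simp: scale_seq_def fun_eq_iff)
        moreover have "t / s * s = t" using st by auto
        ultimately have e: "block_scale n (t / s) ?b = block_scale n t a" "block_scale n 1 ?b = ?b"
          by (metis, auto simp: scale_seq_def fun_eq_iff)
        have "?b \<in> pos_seq"
          using boundary_scale_unique[OF b(1,2), of 1 "t / s"] st unfolding e by (auto simp: S_def)
        with b show False by simp
      qed
      then show "AE s in lborel. s \<in> {1..2} \<longrightarrow> block_scale n s a \<notin> S n" by eventually_elim auto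
    qed
    then have "AE s in lborel. AE a in gauss_seq p. (s::real) \<in> {1..2} \<longrightarrow> block_scale n s a \<notin> S n"
      by (subst (asm) P.AE_commute) measurable
    \<comment> \<open>The interval has positive length, so a statement valid for almost every
      \<open>s\<close> has a witness in it.\<close>
    then have "\<exists>s\<in>{1..2::real}. AE a in gauss_seq p. block_scale n s a \<notin> S n"
    proof (rule contrapos_pp)
      assume "\<not> (\<exists>s\<in>{1..2::real}. AE a in gauss_seq p. block_scale n s a \<notin> S n)"
      then have imp: "(AE a in gauss_seq p. s \<in> {1..2} \<longrightarrow> block_scale n s a \<notin> S n) \<Longrightarrow> s \<notin> {1..2}" for s :: real
        by (cases "s \<in> {1..2}") auto
      show "\<not> (AE s in lborel. AE a in gauss_seq p. (s::real) \<in> {1..2} \<longrightarrow> block_scale n s a \<notin> S n)"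
      proof
        assume "AE s in lborel. AE a in gauss_seq p. (s::real) \<in> {1..2} \<longrightarrow> block_scale n s a \<notin> S n"
        then have "AE s in lborel. (s::real) \<notin> {1..2}" by eventually_elim (rule imp)
        moreover have "{s \<in> space lborel. \<not> (s::real) \<notin> {1..2}} = {1..2}" by auto
        ultimately have "emeasure lborel {1..2::real} = 0"
          using AE_iff_measurable[of "{1..2::real}" lborel "\<lambda>s. s \<notin> {1..2}"] by simp
        then show False by simp
      qed
    qed
    then obtain s :: real where s: "s \<in> {1..2}" "AE a in gauss_seq p. block_scale n s a \<notin> S n" by blast
    show ?thesis
      by (rule AE_gauss_seq_scale_block[OF finite_F_plus F_plus_subset _ _ s(2)]) (use s in auto)
  qed
  then have "AE a in gauss_seq p. \<forall>n. a \<notin> S n" by (simp add: AE_all_countable)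
  then show ?thesis
  proof eventually_elim
    case (elim a)
    show ?case
    proof
      assume a: "a \<in> l1_seq \<and> (\<forall>x. 0 \<le> fourier_density a x) \<and> a \<notin> pos_seq"
      then obtain n where "l1_tail n a < 1 / 2"
        using LIMSEQ_D[OF l1_tail_tendsto[of a], of "1 / 2"] l1_tail_nonneg[of _ a] by force
      then have "a \<in> S n" using a by (auto simp: S_def)
      with elim show False by blast
    qed
  qed
qed

text \<open>If \<open>pos_seq\<close> were null, almost every sequence would still avoid it after
  shrinking any finite block by any factor \<open>1 / (m + 1)\<close>. But a summable sequence
  enters it once a large enough block is shrunk enough.\<close>

lemma prob_pos_seq:
  assumes p: "p \<ge> 2"
  shows "measure (gauss_seq p) (pos_seq :: (('d::{finite,linorder}) freq \<Rightarrow> complex) set) > 0"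
proof (rule ccontr)
  let ?E = "pos_seq :: ('d freq \<Rightarrow> complex) set"
  interpret G: prob_space "gauss_seq p :: ('d freq \<Rightarrow> complex) measure" by (rule prob_space_gauss_seq)
  note [measurable] = sets_pos_seq
  assume "\<not> measure (gauss_seq p) ?E > 0"
  then have "measure (gauss_seq p) ?E = 0" by (simp add: zero_less_measure_iff)
  then have "?E \<in> null_sets (gauss_seq p)" by (simp add: null_sets_def G.emeasure_eq_measure sets_pos_seq)
  then have not_pos: "AE a in gauss_seq p. a \<notin> ?E" by (rule AE_not_in)
  have "AE a in gauss_seq p. block_scale n (1 / real (Suc m)) a \<notin> ?E" for n m
  proof (rule AE_gauss_seq_scale_block[OF finite_F_plus F_plus_subset, of "real (Suc m)"])
    show "Measurable.pred seq_space (\<lambda>a. block_scale n (1 / real (Suc m)) a \<notin> ?E)" by measurable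
    have "block_scale n (1 / real (Suc m)) (block_scale n (real (Suc m)) a) = a" if "a \<in> space (gauss_seq p)" for a :: "'d freq \<Rightarrow> complex"
      using that by (auto simp: scale_seq_def fun_eq_iff space_gauss_seq space_seq_space PiE_def extensional_def simp del: of_nat_Suc)
    then show "AE a in gauss_seq p. block_scale n (1 / real (Suc m)) (block_scale n (real (Suc m)) a) \<notin> ?E"
      using not_pos by (subst AE_cong[where Q="\<lambda>a. a \<notin> ?E"]) auto
  qed auto
  then have "AE a in gauss_seq p. \<forall>n m. block_scale n (1 / real (Suc m)) a \<notin> ?E" by (simp add: AE_all_countable)
  then have "AE a in (gauss_seq p :: ('d freq \<Rightarrow> complex) measure). False"
    using AE_gauss_seq_l1[OF p, where 'd='d]
  proof eventually_elim
    case (elim a)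
    \<comment> \<open>A tail below \<open>1 / 8\<close> and a shrunken block sum of at most
      \<open>1 / 8\<close> cost at most \<open>1 / 4\<close> each and leave a density of at least
      \<open>1 / 2\<close>.\<close>
    obtain n where n: "l1_tail n a < 1 / 8"
      using LIMSEQ_D[OF l1_tail_tendsto[OF elim(2)], of "1 / 8"] l1_tail_nonneg[of _ a] by force
    let ?s = "\<Sum>k\<in>F_plus n. norm (a k)"
    obtain m :: nat where m: "8 * ?s < real m" using reals_Archimedean2 by blast
    have h: "2 * (1 / real (Suc m)) * ?s \<le> 1 / 4" using m by (simp add: field_simps)
    have ge: "1 - 2 * (1 / real (Suc m)) * ?s - 2 * l1_tail n a \<le> fourier_density (block_scale n (1 / real (Suc m)) a) x" for x
      by (rule fourier_density_block_scale_ge[OF elim(2)]) simp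
    then have "1 / 2 \<le> fourier_density (block_scale n (1 / real (Suc m)) a) x" for x
      using ge[of x] h n by linarith
    then have "block_scale n (1 / real (Suc m)) a \<in> ?E"
      using block_scale_in_l1[OF elim(2)] by (auto simp: pos_seq_def intro!: exI[of _ "1 / 2"])
    with elim(1) show False by blast
  qed
  then show False by simp
qed

section \<open>The law of the coefficients under the weak limit\<close>

lemma PiM_density_finite:
  fixes f :: "'i \<Rightarrow> 'a \<Rightarrow> ennreal"
  assumes I: "finite I" and M: "\<And>i. sigma_finite_measure (M i)"
    and f: "\<And>i. i \<in> I \<Longrightarrow> f i \<in> borel_measurable (M i)"
    and d: "\<And>i. sigma_finite_measure (density (M i) (f i))"
  shows "PiM I (\<lambda>i. density (M i) (f i)) = density (PiM I M) (\<lambda>x. \<Prod>i\<in>I. f i (x i))"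
proof -
  interpret M: product_sigma_finite M by (simp add: product_sigma_finite_def M)
  interpret D: product_sigma_finite "\<lambda>i. density (M i) (f i)" by (simp add: product_sigma_finite_def d)
  have [measurable]: "(\<lambda>x. \<Prod>i\<in>I. f i (x i)) \<in> borel_measurable (PiM I M)"
    using f by (intro borel_measurable_prod_ennreal measurable_compose[OF measurable_component_singleton]) auto
  show ?thesis
  proof (rule D.PiM_eqI[OF I, symmetric])
    show "sets (density (PiM I M) (\<lambda>x. \<Prod>i\<in>I. f i (x i))) = sets (PiM I (\<lambda>i. density (M i) (f i)))"
      by (simp cong: sets_PiM_cong)
    fix A assume A: "\<And>i. i \<in> I \<Longrightarrow> A i \<in> sets (density (M i) (f i))"
    have "emeasure (density (PiM I M) (\<lambda>x. \<Prod>i\<in>I. f i (x i))) (PiE I A)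
      = (\<integral>\<^sup>+x. (\<Prod>i\<in>I. f i (x i)) * indicator (PiE I A) x \<partial>PiM I M)"
      using A I by (intro emeasure_density) (auto intro!: sets_PiM_I_finite)
    also have "\<dots> = (\<integral>\<^sup>+x. (\<Prod>i\<in>I. f i (x i) * indicator (A i) (x i)) \<partial>PiM I M)"
    proof (rule nn_integral_cong)
      fix x assume x: "x \<in> space (PiM I M)"
      have "indicator (PiE I A) x = (\<Prod>i\<in>I. indicator (A i) (x i) :: ennreal)"
      proof (cases "x \<in> PiE I A")
        case True
        then show ?thesis by (simp add: PiE_mem)
      next
        case False
        then obtain i where "i \<in> I" "x i \<notin> A i" using x by (auto simp: space_PiM PiE_iff)
        then have "(\<Prod>i\<in>I. indicator (A i) (x i) :: ennreal) = 0" using I by (intro prod_zero bexI[of _ i]) auto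
        then show ?thesis using False by simp
      qed
      then show "(\<Prod>i\<in>I. f i (x i)) * indicator (PiE I A) x = (\<Prod>i\<in>I. f i (x i) * indicator (A i) (x i))"
        by (simp add: prod.distrib)
    qed
    also have "\<dots> = (\<Prod>i\<in>I. \<integral>\<^sup>+x. f i x * indicator (A i) x \<partial>M i)"
      using I f A by (intro M.product_nn_integral_prod) auto
    also have "\<dots> = (\<Prod>i\<in>I. emeasure (density (M i) (f i)) (A i))"
      using A f by (intro prod.cong refl emeasure_density[symmetric]) auto
    finally show "emeasure (density (PiM I M) (\<lambda>x. \<Prod>i\<in>I. f i (x i))) (PiE I A) = \<dots>" .
  qed
qed

section \<open>The finite-dimensional measures as conditioned Gaussian laws\<close>

abbreviation block_space :: "nat \<Rightarrow> (('d::{finite,linorder}) freq \<Rightarrow> complex) measure" where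
  "block_space N \<equiv> PiM (F_plus N) (\<lambda>_. lborel)"

lemma sets_block_space: "sets (block_space N) = sets (PiM (F_plus N) (\<lambda>_. borel))"
  by (rule sets_PiM_cong) auto

lemma space_block_space: "space (block_space N) = (F_plus N \<rightarrow>\<^sub>E UNIV)"
  by (simp add: space_PiM)

lemma borel_measurable_gamma_weight [measurable]: "gamma_weight p N \<in> borel_measurable (block_space N)"
proof -
  have S: "(\<lambda>a. \<Sum>k\<in>F_plus N. norm (fvec k) powr (2 * p * real CARD('a)) * (cmod (a k))\<^sup>2) \<in> borel_measurable (block_space N :: ('a freq \<Rightarrow> complex) measure)"
  proof (rule borel_measurable_sum)
    fix k :: "'a freq" assume "k \<in> F_plus N"
    then have [measurable]: "(\<lambda>a. a k) \<in> borel_measurable (block_space N)"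
      using measurable_component_singleton[of k "F_plus N" "\<lambda>_. lborel"] by simp
    show "(\<lambda>a. norm (fvec k) powr (2 * p * real CARD('a)) * (cmod (a k))\<^sup>2) \<in> borel_measurable (block_space N)" by measurable
  qed
  show ?thesis
    unfolding gamma_weight_def[abs_def]
    by (rule measurable_compose[OF borel_measurable_uminus[OF S]]) simp
qed

definition gamma_const :: "real \<Rightarrow> nat \<Rightarrow> ('d::{finite,linorder}) itself \<Rightarrow> real" where
  "gamma_const p N _ = (\<Prod>k\<in>(F_plus N :: 'd freq set). coef_rate p k / pi)"

lemma gamma_const_pos: "0 < gamma_const p N TYPE('d::{finite,linorder})"
  unfolding gamma_const_def
  by (intro prod_pos divide_pos_pos coef_rate_pos) (use F_plus_subset in auto)

text \<open>Up to the constant \<open>gamma_const\<close>, the weight in \<open>gamma_meas\<close>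
  is the Gaussian density on the block; the finite-dimensional measures are therefore conditioned
  marginals of one Gaussian law.\<close>

lemma block_marginal:
  "distr (gauss_seq p) (block_space N) (\<lambda>a. restrict a (F_plus N))
     = density (block_space N) (\<lambda>a. ennreal (gamma_const p N TYPE('d::{finite,linorder}) * gamma_weight p N (a :: 'd freq \<Rightarrow> complex)))"
proof -
  let ?F = "F_plus N :: 'd freq set"
  \<comment> \<open>Outside the block the rate is set to \<open>1\<close>: the product formula asks
    for sigma-finite factors at every index, and \<open>coef_rate p\<close> vanishes at the zero
    frequency.\<close>
  define f where "f k = (\<lambda>z. ennreal (cgauss (if k \<in> ?F then coef_rate p k else 1) z))" for k
  have "distr (gauss_seq p) (PiM ?F (gauss_coef p)) (\<lambda>a. restrict a ?F) = PiM ?F (gauss_coef p)"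
    unfolding gauss_seq_def
    using distr_PiM_reindex[of half_space "gauss_coef p" "\<lambda>x. x" ?F] F_plus_subset[of N] prob_space_gauss_coef by auto
  also have "\<dots> = PiM ?F (\<lambda>k. density lborel (f k))"
    by (rule PiM_cong) (auto simp: gauss_coef_def f_def)
  also have "\<dots> = density (block_space N) (\<lambda>a. \<Prod>k\<in>?F. f k (a k))"
  proof (rule PiM_density_finite)
    fix k
    have "0 < (if k \<in> ?F then coef_rate p k else 1)" using coef_rate_pos[of k p] F_plus_subset by auto
    then have "prob_space (density lborel (f k))"
      by (intro prob_spaceI) (simp add: f_def emeasure_density nn_integral_cgauss)
    then show "sigma_finite_measure (density lborel (f k))"
      by (rule prob_space_imp_sigma_finite)
  qed (auto simp: f_def lborel.sigma_finite_measure_axioms)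
  also have "\<dots> = density (block_space N) (\<lambda>a. ennreal (gamma_const p N TYPE('d) * gamma_weight p N a))"
  proof (rule density_cong)
    show "AE a in block_space N. (\<Prod>k\<in>?F. f k (a k)) = ennreal (gamma_const p N TYPE('d) * gamma_weight p N a)"
    proof (rule AE_I2)
      fix a :: "'d freq \<Rightarrow> complex"
      have "0 \<le> cgauss (coef_rate p k) (a k)" for k by (simp add: cgauss_def coef_rate_def)
      then have "(\<Prod>k\<in>?F. f k (a k)) = ennreal (\<Prod>k\<in>?F. cgauss (coef_rate p k) (a k))"
        by (subst prod_ennreal[symmetric]) (auto simp: f_def intro!: prod.cong)
      also have "(\<Prod>k\<in>?F. cgauss (coef_rate p k) (a k)) = gamma_const p N TYPE('d) * gamma_weight p N a"
        unfolding cgauss_def prod.distrib gamma_const_def gamma_weight_def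
        by (simp add: exp_sum sum_negf[symmetric] coef_rate_def)
      finally show "(\<Prod>k\<in>?F. f k (a k)) = ennreal (gamma_const p N TYPE('d) * gamma_weight p N a)" .
    qed
    show "(\<lambda>a. \<Prod>k\<in>?F. f k (a k)) \<in> borel_measurable (block_space N)"
    proof (rule borel_measurable_prod_ennreal)
      fix k assume "k \<in> ?F"
      then have [measurable]: "(\<lambda>a. a k) \<in> borel_measurable (block_space N)"
        using measurable_component_singleton[of k "F_plus N" "\<lambda>_. lborel"] by simp
      show "(\<lambda>a. f k (a k)) \<in> borel_measurable (block_space N)" unfolding f_def by measurable
    qed
  qed measurable
  finally show ?thesis
    by (metis (no_types, lifting) distr_cong sets_PiM_cong sets_gauss_coef sets_lborel)
qed

lemma measurable_trunc_block [measurable]: "trunc_seq N \<in> block_space N \<rightarrow>\<^sub>M seq_space"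
  unfolding trunc_seq_def[abs_def]
proof (rule measurable_restrict)
  fix k :: "'a freq" assume "k \<in> half_space"
  show "(\<lambda>a. if k \<in> F_plus N then a k else 0) \<in> borel_measurable (block_space N)"
    by (cases "k \<in> F_plus N") (use measurable_component_singleton[of k "F_plus N" "\<lambda>_. lborel"] in auto)
qed

lemma measurable_trunc_seq [measurable]: "trunc_seq N \<in> seq_space \<rightarrow>\<^sub>M seq_space"
  unfolding trunc_seq_eq by measurable

lemma trunc_seq_restrict: "trunc_seq N (restrict a (F_plus N)) = trunc_seq N a"
  by (auto simp: trunc_seq_def fun_eq_iff)

lemma trunc_pos_seq_iff: "trunc_seq N a \<in> pos_seq \<longleftrightarrow> (INF x. trig_density N a x) > 0"
proof -
  have bd: "bdd_below (range (trig_density N a))"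
  proof -
    obtain B where B: "\<And>x. \<bar>fourier_density (trunc_seq N a) x\<bar> \<le> B"
      using fourier_density_bounded[OF trunc_seq_in_l1, of N a] by blast
    have "- B \<le> trig_density N a x" for x
      using B[of x] unfolding fourier_density_trunc by linarith
    then show ?thesis by (rule bdd_belowI2)
  qed
  show ?thesis
  proof
    assume "trunc_seq N a \<in> pos_seq"
    then obtain e where "e > 0" "\<And>x. e \<le> trig_density N a x" by (auto simp: pos_seq_def fourier_density_trunc)
    then have "e \<le> (INF x. trig_density N a x)" by (intro cINF_greatest) auto
    with \<open>e > 0\<close> show "(INF x. trig_density N a x) > 0" by linarith
  next
    assume *: "(INF x. trig_density N a x) > 0"
    have "(INF x. trig_density N a x) \<le> trig_density N a x" for x by (rule cINF_lower[OF bd]) simp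
    then show "trunc_seq N a \<in> pos_seq"
      using * trunc_seq_in_l1 by (auto simp: pos_seq_def fourier_density_trunc)
  qed
qed

lemma O_set_eq: "O_set N = {a \<in> space (block_space N). trunc_seq N a \<in> pos_seq}"
  by (simp add: O_set_def trunc_pos_seq_iff space_block_space)

lemma sets_O_set [measurable]:
  "(O_set N :: (('d::{finite,linorder}) freq \<Rightarrow> complex) set) \<in> sets (block_space N)"
proof -
  have "(O_set N :: ('d freq \<Rightarrow> complex) set) = trunc_seq N -` pos_seq \<inter> space (block_space N)" by (auto simp: O_set_eq)
  then show ?thesis using measurable_sets[OF measurable_trunc_block sets_pos_seq] by simp
qed

lemma measurable_I_map: "I_map N \<in> restrict_space (block_space N) (O_set N) \<rightarrow>\<^sub>M probs_borel"
proof -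
  have "trunc_seq N \<in> restrict_space (block_space N) (O_set N) \<rightarrow>\<^sub>M restrict_space seq_space pos_seq"
    by (rule measurable_restrict_space3[OF measurable_trunc_block]) (auto simp: O_set_eq)
  then have "(\<lambda>a. seq_measure (trunc_seq N a)) \<in> restrict_space (block_space N) (O_set N) \<rightarrow>\<^sub>M probs_borel"
    by (rule measurable_compose[OF _ measurable_seq_measure])
  then show ?thesis by (simp add: I_map_eq[abs_def])
qed

text \<open>All \<open>P_meas p N\<close> are read on one probability space: each is the law of the
  measure of a truncated Gaussian sequence, conditioned on the truncation being positive. The weak
  limit thus becomes a matter of dominated convergence in \<open>N\<close>.\<close>

lemma integral_P_meas:
  fixes F :: "('d::{finite,linorder}) torus measure \<Rightarrow> real"
  assumes F[measurable]: "F \<in> borel_measurable probs_borel"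
  shows "(\<integral>m. F m \<partial>P_meas p N)
    = (\<integral>a. indicator pos_seq (trunc_seq N a) * F (seq_measure (trunc_seq N a)) \<partial>gauss_seq p)
      / measure (gauss_seq p) {a \<in> space seq_space. trunc_seq N (a :: 'd freq \<Rightarrow> complex) \<in> pos_seq}"
proof -
  let ?B = "block_space N :: ('d freq \<Rightarrow> complex) measure"
  let ?L = "restrict_space ?B (O_set N)"
  let ?w = "gamma_weight p N :: ('d freq \<Rightarrow> complex) \<Rightarrow> real"
  let ?c = "gamma_const p N TYPE('d)"
  define Z where "Z = (\<integral>a. ?w a \<partial>?L)"
  interpret G: prob_space "gauss_seq p :: ('d freq \<Rightarrow> complex) measure" by (rule prob_space_gauss_seq)
  have w0: "0 \<le> ?w a" for a by (simp add: gamma_weight_def)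
  have Z0: "0 \<le> Z" unfolding Z_def using w0 by (intro integral_nonneg_AE) auto
  have c: "?c > 0" by (rule gamma_const_pos)
  have Oint: "O_set N \<inter> space ?B \<in> sets ?B" by simp
  have wL[measurable]: "?w \<in> borel_measurable ?L" by (rule measurable_restrict_space1) simp
  note IL[measurable] = measurable_I_map[of N, where 'a='d]
  have gam: "gamma_meas p N = density ?L (\<lambda>a. ennreal (?w a / Z))"
    by (simp add: gamma_meas_def Let_def Z_def)
  \<comment> \<open>Taken with \<open>F\<close> for the numerator and with \<open>1\<close> for the
    denominator; the constant \<open>?c\<close> cancels in the quotient.\<close>
  have key: "(\<integral>a. indicator pos_seq (trunc_seq N a) * h (seq_measure (trunc_seq N a)) \<partial>gauss_seq p) = ?c * (\<integral>a. ?w a * h (I_map N a) \<partial>?L)"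
    if [measurable]: "h \<in> borel_measurable probs_borel" for h :: "'d torus measure \<Rightarrow> real"
  proof -
    define g where "g a = indicator (O_set N) a * h (I_map N a)" for a
    have g: "g \<in> borel_measurable ?B"
    proof -
      have "(\<lambda>a. h (I_map N a)) \<in> borel_measurable ?L" by measurable
      then have "(\<lambda>a. indicator (O_set N) a *\<^sub>R h (I_map N a)) \<in> borel_measurable ?B"
        by (subst (asm) borel_measurable_restrict_space_iff) auto
      then show ?thesis by (simp add: g_def[abs_def])
    qed
    have "(\<integral>a. indicator pos_seq (trunc_seq N a) * h (seq_measure (trunc_seq N a)) \<partial>gauss_seq p) = (\<integral>a. g (restrict a (F_plus N)) \<partial>gauss_seq p)"
      by (intro Bochner_Integration.integral_cong refl)
         (auto simp: g_def indicator_def O_set_eq trunc_seq_restrict I_map_eq space_block_space)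
    also have "\<dots> = (\<integral>a. g a \<partial>distr (gauss_seq p) ?B (\<lambda>a. restrict a (F_plus N)))"
    proof (rule integral_distr[symmetric, OF _ g])
      have "(\<lambda>a. restrict a (F_plus N)) \<in> seq_space \<rightarrow>\<^sub>M PiM (F_plus N :: 'd freq set) (\<lambda>_. borel :: complex measure)"
        by (rule measurable_restrict_subset[OF F_plus_subset])
      then show "(\<lambda>a. restrict a (F_plus N)) \<in> gauss_seq p \<rightarrow>\<^sub>M ?B"
        by (simp add: measurable_cong_sets[OF sets_gauss_seq sets_block_space])
    qed
    also have "\<dots> = (\<integral>a. (?c * ?w a) *\<^sub>R g a \<partial>?B)"
      unfolding block_marginal by (rule integral_density) (use g w0 c in \<open>auto intro!: mult_nonneg_nonneg less_imp_le\<close>)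
    also have "\<dots> = ?c * (\<integral>a. indicator (O_set N) a *\<^sub>R (?w a * h (I_map N a)) \<partial>?B)"
      by (subst integral_mult_right_zero[symmetric], intro Bochner_Integration.integral_cong) (auto simp: g_def)
    also have "(\<integral>a. indicator (O_set N) a *\<^sub>R (?w a * h (I_map N a)) \<partial>?B) = (\<integral>a. ?w a * h (I_map N a) \<partial>?L)"
      by (rule integral_restrict_space[symmetric, OF Oint])
    finally show ?thesis .
  qed
  have "(\<integral>m. F m \<partial>P_meas p N) = (\<integral>a. F (I_map N a) \<partial>gamma_meas p N)"
    unfolding P_meas_def by (rule integral_distr) (simp_all add: gam)
  also have "\<dots> = (\<integral>a. (?w a / Z) *\<^sub>R F (I_map N a) \<partial>?L)"
    unfolding gam by (rule integral_density) (use w0 Z0 in auto)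
  also have "\<dots> = (\<integral>a. ?w a * F (I_map N a) \<partial>?L) / Z" by simp
  also have "\<dots> = (?c * (\<integral>a. ?w a * F (I_map N a) \<partial>?L)) / (?c * (\<integral>a. ?w a * 1 \<partial>?L))"
    using c by (simp add: Z_def)
  also have "\<dots> = (\<integral>a. indicator pos_seq (trunc_seq N a) * F (seq_measure (trunc_seq N a)) \<partial>gauss_seq p)
      / (\<integral>a. indicator pos_seq (trunc_seq N (a :: 'd freq \<Rightarrow> complex)) * 1 \<partial>gauss_seq p)"
    using key[OF F] key[of "\<lambda>_. 1"] by simp
  also have "(\<integral>a. indicator pos_seq (trunc_seq N (a :: 'd freq \<Rightarrow> complex)) * 1 \<partial>gauss_seq p)
     = (\<integral>a. indicat_real {a \<in> space seq_space. trunc_seq N (a :: 'd freq \<Rightarrow> complex) \<in> pos_seq} a \<partial>gauss_seq p)"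
    by (intro Bochner_Integration.integral_cong) (auto simp: indicator_def space_gauss_seq)
  also have "\<dots> = measure (gauss_seq p) {a \<in> space seq_space. trunc_seq N (a :: 'd freq \<Rightarrow> complex) \<in> pos_seq}"
    by (simp add: space_gauss_seq Int_absorb2 subset_iff)
  finally show ?thesis .
qed

section \<open>Passage to the limit and the law of all coefficients\<close>

definition gauss_pos :: "real \<Rightarrow> (('d::{finite,linorder}) freq \<Rightarrow> complex) measure" where
  "gauss_pos p = density (gauss_seq p)
     (\<lambda>a. ennreal (indicator pos_seq a / measure (gauss_seq p) (pos_seq :: ('d freq \<Rightarrow> complex) set)))"

lemma sets_gauss_pos [simp, measurable_cong]: "sets (gauss_pos p) = sets seq_space"
  by (simp add: gauss_pos_def)

lemma prob_space_gauss_pos: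
  assumes p: "p \<ge> 2" shows "prob_space (gauss_pos p :: (('d::{finite,linorder}) freq \<Rightarrow> complex) measure)"
proof (rule prob_spaceI)
  let ?E = "pos_seq :: ('d freq \<Rightarrow> complex) set"
  interpret G: prob_space "gauss_seq p :: ('d freq \<Rightarrow> complex) measure" by (rule prob_space_gauss_seq)
  note [measurable] = sets_pos_seq
  have "emeasure (gauss_pos p) (space (gauss_pos p :: ('d freq \<Rightarrow> complex) measure))
    = (\<integral>\<^sup>+a. ennreal (indicator ?E a / measure (gauss_seq p) ?E) * indicator (space (gauss_seq p)) a \<partial>gauss_seq p)"
    unfolding gauss_pos_def by (subst space_density, rule emeasure_density) (auto simp del: sets_gauss_seq)
  also have "\<dots> = (\<integral>\<^sup>+a. ennreal (1 / measure (gauss_seq p) ?E) * indicator ?E a \<partial>gauss_seq p)"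
    by (intro nn_integral_cong) (auto simp: indicator_def)
  also have "\<dots> = ennreal (1 / measure (gauss_seq p) ?E) * ennreal (measure (gauss_seq p) ?E)"
    by (subst nn_integral_cmult_indicator) (auto simp: G.emeasure_eq_measure sets_pos_seq)
  also have "\<dots> = 1" using prob_pos_seq[OF p, where 'd='d] by (simp add: ennreal_mult[symmetric])
  finally show "emeasure (gauss_pos p) (space (gauss_pos p :: ('d freq \<Rightarrow> complex) measure)) = 1" .
qed

lemma integral_gauss_pos:
  fixes f :: "(('d::{finite,linorder}) freq \<Rightarrow> complex) \<Rightarrow> 'b::{banach,second_countable_topology}"
  assumes [measurable]: "f \<in> borel_measurable seq_space"
  shows "(\<integral>a. f a \<partial>gauss_pos p) = (\<integral>a. (indicator pos_seq a / measure (gauss_seq p) (pos_seq :: ('d freq \<Rightarrow> complex) set)) *\<^sub>R f a \<partial>gauss_seq p)"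
proof -
  note [measurable] = sets_pos_seq
  show ?thesis unfolding gauss_pos_def by (rule integral_density) auto
qed

lemma AE_gauss_posI:
  assumes "AE a in gauss_seq p. a \<in> pos_seq \<longrightarrow> Q a"
  shows "AE a in gauss_pos p. Q a"
proof -
  note [measurable] = sets_pos_seq
  show ?thesis unfolding gauss_pos_def
    by (subst AE_density) (use assms in \<open>auto elim!: eventually_mono simp: indicator_def split: if_splits\<close>)
qed

lemma AE_gauss_pos: "AE a in gauss_pos p. a \<in> pos_seq"
  by (rule AE_gauss_posI) simp

text \<open>Off the boundary the event is stable: inside because \<open>pos_seq\<close> is open,
  outside because a negative value of the density persists under small changes. The boundary itself
  is null.\<close>

lemma AE_trunc_pos_seq_tendsto:
  assumes p: "p \<ge> 2"
  shows "AE a in gauss_seq p. (\<lambda>N. indicator pos_seq (trunc_seq N a) :: real) \<longlonglongrightarrow> indicator (pos_seq :: (('d::{finite,linorder}) freq \<Rightarrow> complex) set) a"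
  using AE_gauss_seq_l1[OF p, where 'd='d] AE_gauss_seq_not_boundary[of p, where 'd='d]
proof eventually_elim
  case (elim a)
  show ?case
  proof (cases "a \<in> pos_seq")
    case True
    then obtain e where e: "e > 0" "\<And>b. b \<in> l1_seq \<Longrightarrow> l1_dist a b < e \<Longrightarrow> b \<in> pos_seq"
      using l1_open_pos_seq unfolding l1_open_def by blast
    obtain n where n: "\<And>N. N \<ge> n \<Longrightarrow> l1_dist a (trunc_seq N a) < e"
      using LIMSEQ_D[OF trunc_seq_tendsto[OF elim(1)] e(1)] by (auto simp: l1_dist_nonneg)
    show ?thesis
      using True n e(2)[OF trunc_seq_in_l1]
      by (intro tendsto_eventually eventually_sequentiallyI[of n]) (auto simp: indicator_def)
  next
    case False
    then obtain x where x: "fourier_density a x < 0" using elim by (auto simp: not_le)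
    have "\<forall>\<^sub>F N in sequentially. fourier_density (trunc_seq N a) x < 0"
      using order_tendstoD(2)[OF fourier_density_tendsto[OF elim(1) trunc_seq_in_l1 trunc_seq_tendsto[OF elim(1)]] x] .
    then have "\<forall>\<^sub>F N in sequentially. indicator pos_seq (trunc_seq N a) = (indicator pos_seq a :: real)"
    proof eventually_elim
      case (elim N)
      have "trunc_seq N a \<notin> pos_seq"
      proof
        assume "trunc_seq N a \<in> pos_seq"
        then obtain e where "e > 0" "e \<le> fourier_density (trunc_seq N a) x" by (auto simp: pos_seq_def)
        with elim show False by linarith
      qed
      then show ?case using False by simp
    qed
    then show ?thesis by (rule tendsto_eventually)
  qed
qed


definition coef_seq :: "('d::{finite,linorder}) torus measure \<Rightarrow> 'd freq \<Rightarrow> complex" where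
  "coef_seq m = restrict (fourier_coeff m) half_space"

lemma measurable_coef_seq [measurable]: "coef_seq \<in> probs_borel \<rightarrow>\<^sub>M seq_space"
  unfolding coef_seq_def[abs_def] by (rule measurable_restrict) (rule borel_measurable_fourier_coeff)

lemma continuous_map_prod_fourier_coeff:
  assumes "\<And>k. k \<in> J \<Longrightarrow> continuous_on UNIV (f k)" "finite J"
  shows "continuous_map wasserstein_topology euclideanreal (\<lambda>m. \<Prod>k\<in>J. f k (fourier_coeff m k) :: real)"
proof (rule continuous_map_prod[OF assms(2)])
  fix k assume "k \<in> J"
  then have "continuous_map euclidean euclideanreal (f k)" using assms(1) by simp
  then show "continuous_map wasserstein_topology euclideanreal (\<lambda>m. f k (fourier_coeff m k))"
    using continuous_map_compose[OF continuous_map_fourier_coeff, of euclideanreal "f k" k] by (simp add: comp_def)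
qed

text \<open>Once \<open>J \<subseteq> F_plus N\<close>, truncation leaves the tested coefficients
  unchanged, so only the indicator of positivity depends on \<open>N\<close>; it converges almost
  surely, in the numerator and in the denominator.\<close>

lemma integral_prod_coeff_limit:
  fixes \<P> :: "('d::{finite,linorder}) torus measure measure" and f :: "'d freq \<Rightarrow> complex \<Rightarrow> real"
  assumes p: "p \<ge> 2" and lim: "weak_limit (P_meas p) \<P>"
    and J: "finite J" "J \<subseteq> half_space"
    and f: "\<And>k. k \<in> J \<Longrightarrow> continuous_on UNIV (f k)" "\<And>k z. k \<in> J \<Longrightarrow> 0 \<le> f k z" "\<And>k z. k \<in> J \<Longrightarrow> f k z \<le> 1"
  shows "(\<integral>m. (\<Prod>k\<in>J. f k (coef_seq m k)) \<partial>\<P>) = (\<integral>a. (\<Prod>k\<in>J. f k (a k)) \<partial>gauss_pos p)"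
proof -
  let ?E = "pos_seq :: ('d freq \<Rightarrow> complex) set"
  interpret G: prob_space "gauss_seq p :: ('d freq \<Rightarrow> complex) measure" by (rule prob_space_gauss_seq)
  note [measurable] = sets_pos_seq
  define F where "F m = (\<Prod>k\<in>J. f k (fourier_coeff m k))" for m :: "'d torus measure"
  have Fcont: "continuous_map wasserstein_topology euclideanreal F"
    unfolding F_def[abs_def] by (rule continuous_map_prod_fourier_coeff[OF f(1) J(1)])
  have fm: "f k \<in> borel_measurable borel" if "k \<in> J" for k by (rule borel_measurable_continuous_onI[OF f(1)[OF that]])
  have F01: "0 \<le> F m" "F m \<le> 1" for m
    unfolding F_def using f by (auto intro!: prod_nonneg prod_le_1)
  have [measurable]: "F \<in> borel_measurable probs_borel"
    unfolding F_def[abs_def]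
    by (rule borel_measurable_prod) (rule measurable_compose[OF borel_measurable_fourier_coeff fm])
  have conv: "(\<lambda>N. \<integral>m. F m \<partial>P_meas p N) \<longlonglongrightarrow> (\<integral>m. F m \<partial>\<P>)"
    using lim Fcont F01 unfolding weak_limit_def by (auto simp: bounded_iff intro!: exI[of _ 1])
  define g where "g a = (\<Prod>k\<in>J. f k (a k))" for a :: "'d freq \<Rightarrow> complex"
  have [measurable]: "g \<in> borel_measurable seq_space"
    unfolding g_def[abs_def]
    by (rule borel_measurable_prod) (use J(2) in \<open>auto intro!: measurable_compose[OF borel_measurable_coord fm]\<close>)
  have g01: "0 \<le> g a" "g a \<le> 1" for a
    unfolding g_def using f by (auto intro!: prod_nonneg prod_le_1)
  have "\<forall>\<^sub>F N in sequentially. J \<subseteq> F_plus N"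
    using filterlim_F_plus[where 'a='d, unfolded filterlim_finite_subsets_at_top, rule_format, of J] J
    by (auto elim: eventually_mono)
  then have ev: "\<forall>\<^sub>F N in sequentially. (\<integral>a. indicator ?E (trunc_seq N a) * g a \<partial>gauss_seq p)
       = (\<integral>a. indicator ?E (trunc_seq N a) * F (seq_measure (trunc_seq N a)) \<partial>gauss_seq p)"
  proof eventually_elim
    case (elim N)
    have "F (seq_measure (trunc_seq N a)) = g a" if "trunc_seq N a \<in> ?E" for a
      unfolding F_def g_def
    proof (rule prod.cong)
      fix k assume "k \<in> J"
      then have k: "k \<in> half_space" "k \<in> F_plus N" "k \<noteq> 0" using J elim by auto
      then show "f k (fourier_coeff (seq_measure (trunc_seq N a)) k) = f k (a k)"
        unfolding fourier_coeff_seq_measure[OF that] by (simp add: hermitian_ext_def trunc_seq_def)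
    qed simp
    then show ?case by (intro Bochner_Integration.integral_cong) (auto simp: indicator_def)
  qed
  have num: "(\<lambda>N. \<integral>a. indicator ?E (trunc_seq N a) * g a \<partial>gauss_seq p) \<longlonglongrightarrow> (\<integral>a. indicator ?E a * g a \<partial>gauss_seq p)"
  proof (rule integral_dominated_convergence[where w="\<lambda>_. 1"])
    show "AE a in gauss_seq p. (\<lambda>N. indicator ?E (trunc_seq N a) * g a) \<longlonglongrightarrow> indicator ?E a * g a"
      using AE_trunc_pos_seq_tendsto[OF p, where 'd='d] by eventually_elim (intro tendsto_intros)
    show "AE a in gauss_seq p. norm (indicator ?E (trunc_seq N a) * g a) \<le> 1" for N
      using g01 by (auto simp: indicator_def)
  qed auto
  have den: "(\<lambda>N. measure (gauss_seq p) {a \<in> space seq_space. trunc_seq N a \<in> ?E}) \<longlonglongrightarrow> measure (gauss_seq p) ?E"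
  proof -
    have "(\<lambda>N. \<integral>a. indicator ?E (trunc_seq N a) \<partial>gauss_seq p) \<longlonglongrightarrow> (\<integral>a. indicat_real ?E a \<partial>gauss_seq p)"
      by (rule integral_dominated_convergence[where w="\<lambda>_. 1"])
         (use AE_trunc_pos_seq_tendsto[OF p, where 'd='d] in \<open>auto simp: indicator_def\<close>)
    moreover have "(\<integral>a. indicat_real ?E (trunc_seq N a) \<partial>gauss_seq p) = measure (gauss_seq p) {a \<in> space seq_space. trunc_seq N a \<in> ?E}" for N
    proof -
      have "(\<integral>a. indicat_real ?E (trunc_seq N a) \<partial>gauss_seq p) = (\<integral>a. indicat_real {a \<in> space seq_space. trunc_seq N a \<in> ?E} a \<partial>gauss_seq p)"
        by (intro Bochner_Integration.integral_cong) (auto simp: indicator_def space_gauss_seq)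
      then show ?thesis by (simp add: space_gauss_seq Int_absorb2 subset_iff)
    qed
    moreover have "(\<integral>a. indicat_real ?E a \<partial>gauss_seq p) = measure (gauss_seq p) ?E"
      using sets.sets_into_space[OF sets_pos_seq[where 'a='d]] by (simp add: space_gauss_seq Int_absorb2)
    ultimately show ?thesis by simp
  qed
  have "(\<lambda>N. \<integral>m. F m \<partial>P_meas p N) \<longlonglongrightarrow> (\<integral>a. indicator ?E a * g a \<partial>gauss_seq p) / measure (gauss_seq p) ?E"
    unfolding integral_P_meas[OF \<open>F \<in> borel_measurable probs_borel\<close>]
  proof (intro tendsto_divide den)
    show "(\<lambda>N. \<integral>a. indicator ?E (trunc_seq N a) * F (seq_measure (trunc_seq N a)) \<partial>gauss_seq p) \<longlonglongrightarrow> (\<integral>a. indicator ?E a * g a \<partial>gauss_seq p)"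
      using num ev by (rule Lim_transform_eventually)
    show "measure (gauss_seq p) ?E \<noteq> 0" using prob_pos_seq[OF p, where 'd='d] by simp
  qed
  then have "(\<integral>m. F m \<partial>\<P>) = (\<integral>a. indicator ?E a * g a \<partial>gauss_seq p) / measure (gauss_seq p) ?E"
    using conv LIMSEQ_unique by blast
  also have "\<dots> = (\<integral>a. g a \<partial>gauss_pos p)"
    by (subst integral_gauss_pos) (auto simp: field_simps)
  also have "(\<integral>m. F m \<partial>\<P>) = (\<integral>m. (\<Prod>k\<in>J. f k (coef_seq m k)) \<partial>\<P>)"
    unfolding F_def coef_seq_def using J(2) by (intro Bochner_Integration.integral_cong prod.cong refl) auto
  finally show ?thesis by (simp add: g_def)
qed

text \<open>\<open>K\<close> collects the indices whose factors may be discontinuous. To free one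
  more index \<open>l\<close>, the other factors are absorbed into two finite measures on the values
  of coefficient \<open>l\<close>; these agree on continuous functions and are therefore
  equal.\<close>

lemma integral_prod_coeff_limit_borel:
  fixes \<P> :: "('d::{finite,linorder}) torus measure measure" and f :: "'d freq \<Rightarrow> complex \<Rightarrow> real"
  assumes p: "p \<ge> 2" and lim: "weak_limit (P_meas p) \<P>"
    and J: "finite J" "J \<subseteq> half_space" and "K \<subseteq> J"
    and "\<And>k. k \<in> J \<Longrightarrow> f k \<in> borel_measurable borel"
    and "\<And>k. k \<in> J - K \<Longrightarrow> continuous_on UNIV (f k)" "\<And>k z. k \<in> J \<Longrightarrow> 0 \<le> f k z" "\<And>k z. k \<in> J \<Longrightarrow> f k z \<le> 1"
  shows "(\<integral>m. (\<Prod>k\<in>J. f k (coef_seq m k)) \<partial>\<P>) = (\<integral>a. (\<Prod>k\<in>J. f k (a k)) \<partial>gauss_pos p)"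
  using finite_subset[OF \<open>K \<subseteq> J\<close> J(1)] assms(5-9)
proof (induction K arbitrary: f)
  case empty
  show ?case by (rule integral_prod_coeff_limit[OF p lim J]) (use empty in auto)
next
  case (insert l K)
  interpret P: prob_space \<P> using lim by (simp add: weak_limit_def)
  interpret G: prob_space "gauss_pos p :: ('d freq \<Rightarrow> complex) measure" by (rule prob_space_gauss_pos[OF p])
  have [measurable_cong]: "sets \<P> = sets probs_borel" using lim by (simp add: weak_limit_def)
  have l: "l \<in> J" "l \<in> half_space" using insert.prems(1) J by auto
  define R where "R a = (\<Prod>k\<in>J - {l}. f k (a k))" for a :: "'d freq \<Rightarrow> complex"
  have Rm[measurable]: "R \<in> borel_measurable seq_space"
    unfolding R_def[abs_def]
  proof (rule borel_measurable_prod)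
    fix k assume "k \<in> J - {l}"
    then show "(\<lambda>a. f k (a k)) \<in> borel_measurable seq_space"
      using J(2) insert.prems(2) by (intro measurable_compose[OF borel_measurable_coord]) auto
  qed
  have R01: "0 \<le> R a" "R a \<le> 1" for a
    unfolding R_def using insert.prems by (auto intro!: prod_nonneg prod_le_1)
  have cl[measurable]: "(\<lambda>a. a l) \<in> borel_measurable seq_space" by (rule borel_measurable_coord[OF l(2)])
  define \<mu> where "\<mu> = distr (density \<P> (\<lambda>m. ennreal (R (coef_seq m)))) borel (\<lambda>m. coef_seq m l)"
  define \<nu> where "\<nu> = distr (density (gauss_pos p) (\<lambda>a. ennreal (R a))) borel (\<lambda>a. a l)"
  have c\<P>[measurable]: "coef_seq \<in> \<P> \<rightarrow>\<^sub>M seq_space" by measurable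
  have c\<P>l[measurable]: "(\<lambda>m. coef_seq m l) \<in> borel_measurable \<P>" by (rule measurable_compose[OF c\<P> cl])
  have R\<P>[measurable]: "(\<lambda>m. R (coef_seq m)) \<in> borel_measurable \<P>" by (rule measurable_compose[OF c\<P> Rm])
  have int\<mu>: "(\<integral>z. h z \<partial>\<mu>) = (\<integral>m. R (coef_seq m) * h (coef_seq m l) \<partial>\<P>)"
    if [measurable]: "h \<in> borel_measurable borel" for h :: "complex \<Rightarrow> real"
  proof -
    have "(\<integral>z. h z \<partial>\<mu>) = (\<integral>m. h (coef_seq m l) \<partial>density \<P> (\<lambda>m. ennreal (R (coef_seq m))))"
      unfolding \<mu>_def by (rule integral_distr) auto
    also have "\<dots> = (\<integral>m. R (coef_seq m) *\<^sub>R h (coef_seq m l) \<partial>\<P>)"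
      by (rule integral_density) (use R01 in auto)
    finally show ?thesis by simp
  qed
  have int\<nu>: "(\<integral>z. h z \<partial>\<nu>) = (\<integral>a. R a * h (a l) \<partial>gauss_pos p)"
    if [measurable]: "h \<in> borel_measurable borel" for h :: "complex \<Rightarrow> real"
  proof -
    have "(\<integral>z. h z \<partial>\<nu>) = (\<integral>a. h (a l) \<partial>density (gauss_pos p) (\<lambda>a. ennreal (R a)))"
      unfolding \<nu>_def by (rule integral_distr) auto
    also have "\<dots> = (\<integral>a. R a *\<^sub>R h (a l) \<partial>gauss_pos p)"
      by (rule integral_density) (use R01 in auto)
    finally show ?thesis by simp
  qed
  \<comment> \<open>Replacing factor \<open>l\<close> by \<open>h\<close> leaves the product
    \<open>R\<close> of the others untouched, so the induction hypothesis becomes a statement on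
    \<open>\<mu>\<close> and \<open>\<nu>\<close>.\<close>
  have split: "(\<Prod>k\<in>J. (f(l := h)) k (a k)) = R a * h (a l)" for h a
    unfolding R_def using l(1) J(1) by (simp add: prod.remove[of J l] mult.commute)
  have "\<mu> = \<nu>"
  proof (rule measure_eqI_continuous)
    show "finite_measure \<mu>"
    proof
      have "emeasure \<mu> (space \<mu>) = (\<integral>\<^sup>+m. ennreal (R (coef_seq m)) \<partial>\<P>)"
        unfolding \<mu>_def by (subst emeasure_distr) (auto simp: emeasure_density intro!: nn_integral_cong)
      also have "\<dots> \<le> (\<integral>\<^sup>+m. 1 \<partial>\<P>)" using R01 by (intro nn_integral_mono) (simp add: ennreal_le_1)
      finally show "emeasure \<mu> (space \<mu>) \<noteq> \<infinity>" using P.emeasure_space_1 by (auto simp: top_unique)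
    qed
    show "finite_measure \<nu>"
    proof
      have "emeasure \<nu> (space \<nu>) = (\<integral>\<^sup>+a. ennreal (R a) \<partial>gauss_pos p)"
        unfolding \<nu>_def
        by (subst emeasure_distr) (auto simp: emeasure_density sets_eq_imp_space_eq[OF sets_gauss_pos] intro!: nn_integral_cong)
      also have "\<dots> \<le> (\<integral>\<^sup>+a. 1 \<partial>(gauss_pos p :: ('d freq \<Rightarrow> complex) measure))" using R01 by (intro nn_integral_mono) (simp add: ennreal_le_1)
      finally show "emeasure \<nu> (space \<nu>) \<noteq> \<infinity>" using G.emeasure_space_1 by (auto simp: top_unique)
    qed
    show "sets \<mu> = sets borel" "sets \<nu> = sets borel" by (simp_all add: \<mu>_def \<nu>_def)
    fix h :: "complex \<Rightarrow> real" assume h: "continuous_on UNIV h" "\<And>x. 0 \<le> h x" "\<And>x. h x \<le> 1"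
    have hm: "h \<in> borel_measurable borel" by (rule borel_measurable_continuous_onI[OF h(1)])
    have "(\<integral>m. (\<Prod>k\<in>J. (f(l := h)) k (coef_seq m k)) \<partial>\<P>) = (\<integral>a. (\<Prod>k\<in>J. (f(l := h)) k (a k)) \<partial>gauss_pos p)"
      by (rule insert.IH) (use insert.prems h hm in \<open>auto simp del: fun_upd_apply simp: fun_upd_def split: if_splits\<close>)
    then show "(\<integral>z. h z \<partial>\<mu>) = (\<integral>z. h z \<partial>\<nu>)" unfolding split int\<mu>[OF hm] int\<nu>[OF hm] .
  qed
  then have "(\<integral>z. f l z \<partial>\<mu>) = (\<integral>z. f l z \<partial>\<nu>)" by simp
  then show ?case
    using split[of "f l"] int\<mu>[of "f l"] int\<nu>[of "f l"] insert.prems(2)[OF l(1)] by simp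
qed

text \<open>Indicators of boxes in finitely many coordinates are products of Borel functions of
  single coordinates, and such boxes determine a law on the product space.\<close>

theorem distr_coef_seq:
  fixes \<P> :: "('d::{finite,linorder}) torus measure measure"
  assumes p: "p \<ge> 2" and lim: "weak_limit (P_meas p) \<P>"
  shows "distr \<P> seq_space coef_seq = gauss_pos p"
proof (rule measure_eqI_PiM_infinite[where I=half_space and M="\<lambda>_. borel"])
  interpret P: prob_space \<P> using lim by (simp add: weak_limit_def)
  interpret G: prob_space "gauss_pos p :: ('d freq \<Rightarrow> complex) measure" by (rule prob_space_gauss_pos[OF p])
  have [measurable_cong]: "sets \<P> = sets probs_borel" using lim by (simp add: weak_limit_def)
  have c\<P>[measurable]: "coef_seq \<in> \<P> \<rightarrow>\<^sub>M seq_space" by measurable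
  interpret D: prob_space "distr \<P> seq_space coef_seq" by (rule P.prob_space_distr[OF c\<P>])
  show "finite_measure (distr \<P> seq_space coef_seq)" by (rule D.finite_measure_axioms)
  show "sets (distr \<P> seq_space coef_seq) = sets seq_space" "sets (gauss_pos p) = sets seq_space" by simp_all
  fix A and J :: "'d freq set" assume J: "finite J" "J \<subseteq> half_space" and A: "\<And>i. i \<in> J \<Longrightarrow> A i \<in> sets (borel :: complex measure)"
  let ?X = "prod_emb half_space (\<lambda>_. borel) J (PiE J A) :: ('d freq \<Rightarrow> complex) set"
  have X[measurable]: "?X \<in> sets seq_space" using J A by (intro sets_PiM_I) auto
  have ind: "indicat_real ?X a = (\<Prod>k\<in>J. indicator (A k) (a k))" if asp: "a \<in> space seq_space" for a
  proof (cases "a \<in> ?X")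
    case True
    then have "a k \<in> A k" if "k \<in> J" for k using that by (auto simp: prod_emb_def)
    then show ?thesis using True by simp
  next
    case False
    then obtain k where "k \<in> J" "a k \<notin> A k" using asp J by (auto simp: prod_emb_def space_PiM PiE_iff)
    then have "(\<Prod>k\<in>J. indicator (A k) (a k) :: real) = 0" using J(1) by (intro prod_zero bexI[of _ k]) auto
    then show ?thesis using False by simp
  qed
  have "measure (distr \<P> seq_space coef_seq) ?X = (\<integral>a. indicator ?X a \<partial>distr \<P> seq_space coef_seq)"
    using sets.sets_into_space[OF X] by (simp add: Int_absorb2)
  also have "\<dots> = (\<integral>m. indicator ?X (coef_seq m) \<partial>\<P>)" by (rule integral_distr[OF c\<P>]) measurable
  also have "\<dots> = (\<integral>m. (\<Prod>k\<in>J. indicator (A k) (coef_seq m k)) \<partial>\<P>)"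
    by (intro Bochner_Integration.integral_cong refl ind measurable_space[OF c\<P>])
  also have "\<dots> = (\<integral>a. (\<Prod>k\<in>J. indicator (A k) (a k)) \<partial>gauss_pos p)"
    by (rule integral_prod_coeff_limit_borel[OF p lim J order_refl]) (use A in \<open>auto simp: indicator_def\<close>)
  also have "\<dots> = (\<integral>a. indicator ?X a \<partial>gauss_pos p)"
    by (intro Bochner_Integration.integral_cong refl ind[symmetric]) (simp add: sets_eq_imp_space_eq[OF sets_gauss_pos])
  also have "\<dots> = measure (gauss_pos p) ?X"
    using sets.sets_into_space[OF X] by (simp add: Int_absorb2 sets_eq_imp_space_eq[OF sets_gauss_pos])
  finally show "emeasure (distr \<P> seq_space coef_seq) ?X = emeasure (gauss_pos p) ?X"
    by (simp add: D.emeasure_eq_measure G.emeasure_eq_measure)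
qed

text \<open>The gateway from sequences to measures: a Gaussian null set inside
  \<open>pos_seq\<close> is negligible for \<open>\<P>\<close>, and almost every \<open>m\<close> is
  recovered from its coefficients.\<close>

lemma AE_seq_measure_coef_seq:
  fixes \<P> :: "('d::{finite,linorder}) torus measure measure"
  assumes p: "p \<ge> 2" and lim: "weak_limit (P_meas p) \<P>"
    and ae: "AE a in gauss_seq p. a \<in> pos_seq \<longrightarrow> Q a"
  shows "AE m in \<P>. coef_seq m \<in> pos_seq \<and> m = seq_measure (coef_seq m) \<and> Q (coef_seq m)"
proof -
  have s\<P>[measurable_cong]: "sets \<P> = sets probs_borel" using lim by (simp add: weak_limit_def)
  have sp: "space \<P> = torus_probs" using sets_eq_imp_space_eq[OF s\<P>] by simp
  have c\<P>[measurable]: "coef_seq \<in> \<P> \<rightarrow>\<^sub>M seq_space" by measurable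
  have "AE a in gauss_pos p. a \<in> pos_seq \<and> Q a"
    using AE_gauss_pos AE_gauss_posI[OF ae] by eventually_elim auto
  then have "AE a in distr \<P> seq_space coef_seq. a \<in> pos_seq \<and> Q a" unfolding distr_coef_seq[OF p lim] .
  then have "AE m in \<P>. coef_seq m \<in> pos_seq \<and> Q (coef_seq m)" by (rule AE_distrD[OF c\<P>])
  then show ?thesis
    using AE_space
  proof eventually_elim
    case (elim m)
    then show ?case using seq_measure_fourier_coeff[of m] by (auto simp: coef_seq_def sp)
  qed
qed

section \<open>Differentiation along coordinates\<close>

definition shift_coord :: "('d::finite) freq \<Rightarrow> complex \<Rightarrow> ('d freq \<Rightarrow> complex) \<Rightarrow> real \<Rightarrow> 'd freq \<Rightarrow> complex" where
  "shift_coord k v a t = a(k := a k + of_real t * v)"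

lemma shift_coord_0 [simp]: "shift_coord k v a 0 = a"
  by (simp add: shift_coord_def)

lemma upd_in_l1_iff:
  assumes k: "k \<in> half_space" shows "a(k := z) \<in> l1_seq \<longleftrightarrow> a \<in> l1_seq"
proof -
  have imp: "a(k := z) \<in> l1_seq" if "a \<in> l1_seq" for a :: "'a freq \<Rightarrow> complex" and z
  proof -
    have "(\<lambda>l. norm (a l) + (if l = k then norm z else 0)) summable_on half_space"
    proof (rule summable_on_add)
      show "(\<lambda>l. norm (a l)) summable_on half_space" using that by (simp add: l1_seq_def)
      show "(\<lambda>l. if l = k then norm z else 0) summable_on half_space"
        by (rule finite_nonzero_values_imp_summable_on) (rule finite_subset[of _ "{k}"], auto)
    qed
    then have "(\<lambda>l. norm ((a(k := z)) l)) summable_on half_space"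
      by (rule Infinite_Sum.abs_summable_on_comparison_test') auto
    then show ?thesis using that k by (auto simp: l1_seq_def PiE_def extensional_def)
  qed
  have "a = (a(k := z))(k := a k)" by auto
  then show ?thesis using imp[of a z] imp[of "a(k := z)" "a k"] by metis
qed

lemma shift_coord_in_l1: "k \<in> half_space \<Longrightarrow> a \<in> l1_seq \<Longrightarrow> shift_coord k v a t \<in> l1_seq"
  by (simp add: shift_coord_def upd_in_l1_iff)

lemma l1_dist_upd:
  assumes k: "k \<in> half_space" shows "l1_dist (a(k := y)) (a(k := z)) = norm (y - z)"
proof -
  have "l1_dist (a(k := y)) (a(k := z)) = (\<Sum>\<^sub>\<infinity>l\<in>{k}. norm (y - z))"
    unfolding l1_dist_def by (rule infsum_cong_neutral) (use k in auto)
  then show ?thesis by simp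
qed

lemma scale_seq_upd_coord:
  assumes k: "k \<in> half_space" shows "scale_seq w (a(k := z)) = (scale_seq w a)(k := of_real (w k) * z)"
  using k by (auto simp: scale_seq_def fun_eq_iff)

text \<open>The McShane extension of a Lipschitz function from \<^term>\<open>pos_seq\<close> to \<^term>\<open>l1_seq\<close> frees the
  analysis on lines from the domain.\<close>

lemma mcshane_extension:
  fixes \<psi> :: "(('d::{finite,linorder}) freq \<Rightarrow> complex) \<Rightarrow> real"
  assumes lip: "\<And>a b. a \<in> pos_seq \<Longrightarrow> b \<in> pos_seq \<Longrightarrow> \<bar>\<psi> a - \<psi> b\<bar> \<le> C * l1_dist a b" and "0 \<le> C"
  obtains \<Psi> where "\<And>a. a \<in> pos_seq \<Longrightarrow> \<Psi> a = \<psi> a"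
    "\<And>a b. a \<in> l1_seq \<Longrightarrow> b \<in> l1_seq \<Longrightarrow> \<bar>\<Psi> a - \<Psi> b\<bar> \<le> C * l1_dist a b"
proof -
  let ?E = "pos_seq :: ('d freq \<Rightarrow> complex) set"
  define \<Psi> where "\<Psi> a = (INF b\<in>?E. \<psi> b + C * l1_dist a b)" for a
  obtain e where e: "e \<in> ?E"
  proof -
    \<comment> \<open>The zero sequence has density \<open>1\<close>, so the infimum in the
      extension runs over a non-empty set.\<close>
    have "trunc_seq 0 (\<lambda>_. 0) \<in> ?E"
      using trunc_seq_in_l1 by (auto simp: pos_seq_def fourier_density_trunc trig_density_def intro!: exI[of _ 1])
    then show thesis using that by blast
  qed
  have El: "b \<in> l1_seq" if "b \<in> ?E" for b using that pos_seq_subset by blast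
  have tri: "C * l1_dist a c \<le> C * l1_dist a b + C * l1_dist b c" if "a \<in> l1_seq" "b \<in> l1_seq" "c \<in> l1_seq" for a b c :: "'d freq \<Rightarrow> complex"
    using mult_left_mono[OF l1_dist_triangle[OF that] \<open>0 \<le> C\<close>] by (simp add: distrib_left)
  have bd: "bdd_below ((\<lambda>b. \<psi> b + C * l1_dist a b) ` ?E)" if "a \<in> l1_seq" for a
  proof (rule bdd_belowI2)
    fix b assume b: "b \<in> ?E"
    have "\<psi> e - \<psi> b \<le> C * l1_dist e b" using lip[OF e b] by simp
    also have "\<dots> \<le> C * l1_dist e a + C * l1_dist a b" using tri[OF El[OF e] that El[OF b]] .
    finally show "\<psi> e - C * l1_dist e a \<le> \<psi> b + C * l1_dist a b" by simp
  qed
  have eq: "\<Psi> a = \<psi> a" if a: "a \<in> ?E" for a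
  proof (rule antisym)
    show "\<Psi> a \<le> \<psi> a" unfolding \<Psi>_def using cINF_lower[OF bd[OF El[OF a]] a] by simp
    show "\<psi> a \<le> \<Psi> a" unfolding \<Psi>_def
    proof (rule cINF_greatest)
      fix b assume "b \<in> ?E" then show "\<psi> a \<le> \<psi> b + C * l1_dist a b" using lip[OF a] by (smt (verit))
    qed (use e in auto)
  qed
  have "\<Psi> a \<le> \<Psi> b + C * l1_dist a b" if ab: "a \<in> l1_seq" "b \<in> l1_seq" for a b
  proof -
    have "\<Psi> a - C * l1_dist a b \<le> \<Psi> b"
      unfolding \<Psi>_def[of b]
    proof (rule cINF_greatest)
      fix c assume c: "c \<in> ?E"
      have "\<Psi> a \<le> \<psi> c + C * l1_dist a c" unfolding \<Psi>_def by (rule cINF_lower[OF bd[OF ab(1)] c])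
      then show "\<Psi> a - C * l1_dist a b \<le> \<psi> c + C * l1_dist b c" using tri[OF ab El[OF c]] by simp
    qed (use e in auto)
    then show ?thesis by simp
  qed
  then have "\<bar>\<Psi> a - \<Psi> b\<bar> \<le> C * l1_dist a b" if "a \<in> l1_seq" "b \<in> l1_seq" for a b
    using that l1_dist_commute[of a b] by (smt (verit))
  with eq show thesis by (rule that)
qed

text \<open>Superlevel sets are open for \<open>l1_dist\<close>, hence measurable for the product
  sigma-algebra, although \<open>\<Psi>\<close> is in general not continuous for the product
  topology.\<close>

lemma borel_measurable_l1_lipschitz:
  fixes \<Psi> :: "(('d::{finite,linorder}) freq \<Rightarrow> complex) \<Rightarrow> real"
  assumes lip: "\<And>a b. a \<in> l1_seq \<Longrightarrow> b \<in> l1_seq \<Longrightarrow> \<bar>\<Psi> a - \<Psi> b\<bar> \<le> C * l1_dist a b" and C: "0 \<le> C"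
  shows "(\<lambda>a. if a \<in> l1_seq then \<Psi> a else 0) \<in> borel_measurable seq_space"
proof (rule measurable_If_restrict_space_iff[THEN iffD2, rotated])
  show "{a \<in> space seq_space. a \<in> (l1_seq :: ('d freq \<Rightarrow> complex) set)} \<in> sets seq_space" using sets_l1_seq by measurable
  have "\<Psi> \<in> borel_measurable (restrict_space seq_space {a. a \<in> l1_seq})"
  proof (rule borel_measurableI_greater)
    fix y :: real
    have "l1_open {a \<in> l1_seq. y < \<Psi> a}"
      unfolding l1_open_def
    proof (intro conjI ballI)
      fix a assume a: "a \<in> {a \<in> l1_seq. y < \<Psi> a}"
      show "\<exists>e>0. \<forall>b\<in>l1_seq. l1_dist a b < e \<longrightarrow> b \<in> {a \<in> l1_seq. y < \<Psi> a}"
      proof (intro exI[of _ "(\<Psi> a - y) / (C + 1)"] conjI ballI impI)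
        fix b assume b: "b \<in> l1_seq" "l1_dist a b < (\<Psi> a - y) / (C + 1)"
        then have "C * l1_dist a b + l1_dist a b < \<Psi> a - y" using C by (simp add: field_simps)
        then show "b \<in> {a \<in> l1_seq. y < \<Psi> a}"
          using lip[of a b] a b l1_dist_nonneg[of a b] by auto
      qed (use a C in auto)
    qed auto
    then have "{a \<in> l1_seq. y < \<Psi> a} \<in> sets seq_space" by (rule sets_l1_open)
    moreover have "{a \<in> space (restrict_space seq_space {a. a \<in> l1_seq}). y < \<Psi> a} = {a \<in> l1_seq. y < \<Psi> a}"
      using l1_seq_subset by (auto simp: space_restrict_space)
    ultimately show "{a \<in> space (restrict_space seq_space {a. a \<in> l1_seq}). y < \<Psi> a} \<in> sets (restrict_space seq_space {a. a \<in> l1_seq})"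
      using sets_l1_seq[where 'd='d] by (subst sets_restrict_space_iff) auto
  qed
  then show "\<Psi> \<in> borel_measurable (restrict_space seq_space {a. a \<in> l1_seq}) \<and>
    (\<lambda>a. 0) \<in> borel_measurable (restrict_space seq_space {a. a \<notin> l1_seq})" by simp
qed

text \<open>For continuous \<open>g\<close> this is differentiability at \<open>0\<close>, written with countably many increments so
  that it is a measurable condition on the coefficients.\<close>

definition rational_cauchy_quotient :: "(real \<Rightarrow> real) \<Rightarrow> bool" where
  "rational_cauchy_quotient g \<longleftrightarrow> (\<forall>m::nat. \<exists>n::nat. \<forall>q::rat. \<forall>r::rat.
     q \<noteq> 0 \<longrightarrow> r \<noteq> 0 \<longrightarrow> \<bar>real_of_rat q\<bar> < 1 / real (Suc n) \<longrightarrow> \<bar>real_of_rat r\<bar> < 1 / real (Suc n) \<longrightarrow>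
     \<bar>(g (real_of_rat q) - g 0) / real_of_rat q - (g (real_of_rat r) - g 0) / real_of_rat r\<bar> \<le> 1 / real (Suc m))"

lemma differentiable_imp_rational_cauchy_quotient:
  assumes "g field_differentiable at 0" shows "rational_cauchy_quotient g"
  unfolding rational_cauchy_quotient_def
proof
  fix m :: nat
  obtain D where "(g has_field_derivative D) (at 0)" using assms by (auto simp: field_differentiable_def)
  then have "((\<lambda>h. (g h - g 0) / h) \<longlongrightarrow> D) (at 0)" by (simp add: has_field_derivative_iff)
  moreover have "0 < 1 / (2 * real (Suc m))" by simp
  ultimately obtain d where d: "d > 0" "\<And>h. h \<noteq> 0 \<Longrightarrow> \<bar>h\<bar> < d \<Longrightarrow> \<bar>(g h - g 0) / h - D\<bar> < 1 / (2 * real (Suc m))"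
    unfolding tendsto_iff eventually_at dist_real_def by (metis UNIV_I diff_zero)
  obtain n where n: "1 / real (Suc n) < d" using nat_approx_posE[OF d(1)] by blast
  show "\<exists>n. \<forall>q r. q \<noteq> 0 \<longrightarrow> r \<noteq> 0 \<longrightarrow> \<bar>real_of_rat q\<bar> < 1 / real (Suc n) \<longrightarrow> \<bar>real_of_rat r\<bar> < 1 / real (Suc n) \<longrightarrow>
     \<bar>(g (real_of_rat q) - g 0) / real_of_rat q - (g (real_of_rat r) - g 0) / real_of_rat r\<bar> \<le> 1 / real (Suc m)"
  proof (intro exI[of _ n] allI impI)
    fix q r :: rat assume qr: "q \<noteq> 0" "r \<noteq> 0" "\<bar>real_of_rat q\<bar> < 1 / real (Suc n)" "\<bar>real_of_rat r\<bar> < 1 / real (Suc n)"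
    have "\<bar>(g (real_of_rat q) - g 0) / real_of_rat q - D\<bar> < 1 / (2 * real (Suc m))"
      "\<bar>(g (real_of_rat r) - g 0) / real_of_rat r - D\<bar> < 1 / (2 * real (Suc m))"
      using qr n by (intro d(2); simp)+
    moreover have "1 / (2 * real (Suc m)) + 1 / (2 * real (Suc m)) = 1 / real (Suc m)" by (simp add: field_simps)
    moreover have "\<bar>x - D\<bar> < e \<Longrightarrow> \<bar>y - D\<bar> < e \<Longrightarrow> e + e = e' \<Longrightarrow> \<bar>x - y\<bar> \<le> e'" for x y e e' :: real
      by linarith
    ultimately show "\<bar>(g (real_of_rat q) - g 0) / real_of_rat q - (g (real_of_rat r) - g 0) / real_of_rat r\<bar> \<le> 1 / real (Suc m)"
      by blast
  qed
qed

text \<open>Away from \<open>0\<close> the quotient is continuous, so the Cauchy estimate passes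
  from rational to real increments, and completeness supplies the derivative.\<close>

lemma rational_cauchy_quotient_imp_differentiable:
  assumes cont: "continuous_on UNIV g" and rc: "rational_cauchy_quotient g"
  shows "g field_differentiable at 0"
proof -
  define Q where "Q t = (g t - g 0) / t" for t
  have isc: "isCont g t" for t using cont by (simp add: continuous_on_eq_continuous_at)
  have Qcont: "isCont Q t" if "t \<noteq> 0" for t
    unfolding Q_def using that isc by (intro continuous_intros) auto
  have approx: "\<exists>X. (\<forall>j. X j \<noteq> (0::rat)) \<and> (\<lambda>j. real_of_rat (X j)) \<longlonglongrightarrow> t" if "t \<noteq> 0" for t
  proof -
    have "\<exists>q. real_of_rat q \<noteq> 0 \<and> \<bar>real_of_rat q - t\<bar> < 1 / real (Suc j)" for j
    proof -
      have d: "0 < 1 / real (Suc j)" by simp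
      \<comment> \<open>A rational just below \<open>t\<close> and on the same side of
        \<open>0\<close>, so that the quotient is never taken at increment \<open>0\<close>.\<close>
      have "(if t > 0 then max 0 (t - 1 / real (Suc j)) else t - 1 / real (Suc j)) < t" using d by auto
      then obtain q where q: "(if t > 0 then max 0 (t - 1 / real (Suc j)) else t - 1 / real (Suc j)) < real_of_rat q"
        "real_of_rat q < t"
        using of_rat_dense by blast
      then show ?thesis using that d by (intro exI[of _ q]) (auto split: if_splits simp del: of_nat_Suc)
    qed
    then obtain X where X: "\<And>j. real_of_rat (X j) \<noteq> 0" "\<And>j. \<bar>real_of_rat (X j) - t\<bar> < 1 / real (Suc j)" by metis
    have "(\<lambda>j. real_of_rat (X j) - t) \<longlonglongrightarrow> 0"
      by (rule Lim_null_comparison[OF always_eventually LIMSEQ_inverse_real_of_nat, rule_format])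
         (use X(2) in \<open>auto simp: inverse_eq_divide intro: less_imp_le\<close>)
    then have "(\<lambda>j. real_of_rat (X j)) \<longlonglongrightarrow> t" by (rule LIM_zero_cancel)
    then show ?thesis using X(1) by (intro exI[of _ X]) auto
  qed
  have real_cauchy: "\<exists>n::nat. \<forall>s t. s \<noteq> 0 \<longrightarrow> t \<noteq> 0 \<longrightarrow> \<bar>s\<bar> < 1 / real (Suc n) \<longrightarrow> \<bar>t\<bar> < 1 / real (Suc n) \<longrightarrow> \<bar>Q s - Q t\<bar> \<le> 1 / real (Suc m)" for m
  proof -
    obtain n where n: "\<And>q r::rat. q \<noteq> 0 \<Longrightarrow> r \<noteq> 0 \<Longrightarrow> \<bar>real_of_rat q\<bar> < 1 / real (Suc n) \<Longrightarrow> \<bar>real_of_rat r\<bar> < 1 / real (Suc n) \<Longrightarrow>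
       \<bar>Q (real_of_rat q) - Q (real_of_rat r)\<bar> \<le> 1 / real (Suc m)"
      using rc unfolding rational_cauchy_quotient_def Q_def by meson
    have "\<bar>Q s - Q t\<bar> \<le> 1 / real (Suc m)" if st: "s \<noteq> 0" "t \<noteq> 0" "\<bar>s\<bar> < 1 / real (Suc n)" "\<bar>t\<bar> < 1 / real (Suc n)" for s t
    proof -
      obtain X where X: "\<And>j. X j \<noteq> (0::rat)" "(\<lambda>j. real_of_rat (X j)) \<longlonglongrightarrow> s" using approx[OF st(1)] by blast
      obtain Y where Y: "\<And>j. Y j \<noteq> (0::rat)" "(\<lambda>j. real_of_rat (Y j)) \<longlonglongrightarrow> t" using approx[OF st(2)] by blast
      have eX: "\<forall>\<^sub>F j in sequentially. \<bar>real_of_rat (X j)\<bar> < 1 / real (Suc n)"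
        by (rule order_tendstoD(2)[OF tendsto_rabs[OF X(2)] st(3)])
      have eY: "\<forall>\<^sub>F j in sequentially. \<bar>real_of_rat (Y j)\<bar> < 1 / real (Suc n)"
        by (rule order_tendstoD(2)[OF tendsto_rabs[OF Y(2)] st(4)])
      show ?thesis
      proof (rule tendsto_upperbound)
        show "(\<lambda>j. \<bar>Q (real_of_rat (X j)) - Q (real_of_rat (Y j))\<bar>) \<longlonglongrightarrow> \<bar>Q s - Q t\<bar>"
          by (intro tendsto_rabs tendsto_diff isCont_tendsto_compose[OF Qcont] X Y st)
        show "\<forall>\<^sub>F j in sequentially. \<bar>Q (real_of_rat (X j)) - Q (real_of_rat (Y j))\<bar> \<le> 1 / real (Suc m)"
          using eX eY by eventually_elim (intro n X Y)
      qed simp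
    qed
    then show ?thesis by blast
  qed
  \<comment> \<open>The denominator \<open>j + 2\<close> makes \<open>x j\<close> strictly smaller
    than \<open>1 / (n + 1)\<close> already for \<open>j = n\<close>.\<close>
  define x where "x j = 1 / real (Suc (Suc j))" for j
  have x0: "x j \<noteq> 0" for j by (simp add: x_def)
  have xlt: "\<bar>x j\<bar> < 1 / real (Suc n)" if "n \<le> j" for j n
    using that by (auto simp: x_def intro!: divide_strict_left_mono)
  have "Cauchy (\<lambda>j. Q (x j))"
  proof (rule metric_CauchyI)
    fix e :: real assume "e > 0"
    then obtain m where m: "1 / real (Suc m) < e" using nat_approx_posE by blast
    obtain n where n: "\<And>s t. s \<noteq> 0 \<Longrightarrow> t \<noteq> 0 \<Longrightarrow> \<bar>s\<bar> < 1 / real (Suc n) \<Longrightarrow> \<bar>t\<bar> < 1 / real (Suc n) \<Longrightarrow> \<bar>Q s - Q t\<bar> \<le> 1 / real (Suc m)"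
      using real_cauchy[of m] by blast
    show "\<exists>M. \<forall>i\<ge>M. \<forall>j\<ge>M. dist (Q (x i)) (Q (x j)) < e"
    proof (intro exI[of _ n] allI impI)
      fix i j assume "n \<le> i" "n \<le> j"
      then show "dist (Q (x i)) (Q (x j)) < e"
        using n[OF x0 x0 xlt xlt, of i j] m by (simp add: dist_real_def)
    qed
  qed
  then obtain L where L: "(\<lambda>j. Q (x j)) \<longlonglongrightarrow> L" by (auto simp: Cauchy_convergent_iff convergent_def)
  have "(Q \<longlongrightarrow> L) (at 0)"
  proof (rule tendstoI)
    fix e :: real assume "e > 0"
    then obtain m where m: "1 / real (Suc m) < e" using nat_approx_posE by blast
    obtain n where n: "\<And>s t. s \<noteq> 0 \<Longrightarrow> t \<noteq> 0 \<Longrightarrow> \<bar>s\<bar> < 1 / real (Suc n) \<Longrightarrow> \<bar>t\<bar> < 1 / real (Suc n) \<Longrightarrow> \<bar>Q s - Q t\<bar> \<le> 1 / real (Suc m)"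
      using real_cauchy[of m] by blast
    have "\<bar>Q s - L\<bar> \<le> 1 / real (Suc m)" if "s \<noteq> 0" "\<bar>s\<bar> < 1 / real (Suc n)" for s
    proof (rule tendsto_upperbound)
      show "(\<lambda>j. \<bar>Q s - Q (x j)\<bar>) \<longlonglongrightarrow> \<bar>Q s - L\<bar>" by (intro tendsto_intros L)
      show "\<forall>\<^sub>F j in sequentially. \<bar>Q s - Q (x j)\<bar> \<le> 1 / real (Suc m)"
        by (rule eventually_sequentiallyI[of n]) (rule n[OF that(1) x0 that(2) xlt])
    qed simp
    then show "\<forall>\<^sub>F s in at 0. dist (Q s) L < e"
      unfolding eventually_at using m by (intro exI[of _ "1 / real (Suc n)"]) (force simp: dist_real_def)
  qed
  then have "(g has_field_derivative L) (at 0)" by (simp add: has_field_derivative_iff Q_def[abs_def])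
  then show ?thesis by (auto simp: field_differentiable_def)
qed

section \<open>Derivatives along the lines of one coordinate\<close>

definition line_deriv :: "(('d freq \<Rightarrow> complex) \<Rightarrow> real) \<Rightarrow> ('d::finite) freq \<Rightarrow> complex \<Rightarrow> ('d freq \<Rightarrow> complex) \<Rightarrow> real" where
  "line_deriv \<Psi> k v a = seq_deriv (\<lambda>t. \<Psi> (shift_coord k v a t)) 0"

lemma seq_deriv_shift: "seq_deriv (\<lambda>s. f (t + s)) 0 = seq_deriv f t"
  by (simp add: seq_deriv_def)

lemma shift_coord_line_point:
  "shift_coord k v (a(k := z + of_real t * v)) s = a(k := z + of_real (t + s) * v)"
  by (simp add: shift_coord_def algebra_simps)

text \<open>On a line through the redrawn coordinate, the coordinate derivative is the derivative at
  time \<open>t\<close> of one fixed function of a real variable, to which the one-dimensional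
  results apply.\<close>

lemma line_deriv_line_point:
  "line_deriv \<Psi> k v (a(k := z + of_real t * v)) = seq_deriv (\<lambda>s. \<Psi> (a(k := z + of_real s * v))) t"
  unfolding line_deriv_def shift_coord_line_point by (rule seq_deriv_shift)

lemma measurable_shift_coord [measurable]:
  assumes "k \<in> half_space" shows "(\<lambda>a. shift_coord k v a t) \<in> seq_space \<rightarrow>\<^sub>M seq_space"
  unfolding shift_coord_def using assms by measurable

text \<open>A property valid almost everywhere on each line holds almost everywhere on the product
  of sequence space, plane and line; \<open>distr_line_average\<close> maps this product, suitably
  weighted, back to \<open>gauss_seq p\<close>.\<close>

lemma AE_gauss_seq_lineI:
  fixes k :: "('d::{finite,linorder}) freq"
  assumes k: "k \<in> half_space" and Q[measurable]: "Measurable.pred seq_space Q"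
    and ae: "\<And>a z. a \<in> space seq_space \<Longrightarrow> AE t in lborel. Q (a(k := z + of_real t * v))"
  shows "AE a in gauss_seq p. Q a"
proof -
  interpret G: prob_space "gauss_seq p :: ('d freq \<Rightarrow> complex) measure" by (rule prob_space_gauss_seq)
  interpret GL: pair_sigma_finite "gauss_seq p :: ('d freq \<Rightarrow> complex) measure" "lborel :: complex measure" ..
  interpret P: pair_sigma_finite "gauss_seq p \<Otimes>\<^sub>M lborel :: (('d freq \<Rightarrow> complex) \<times> complex) measure" "lborel :: real measure"
    by standard
  let ?X = "(gauss_seq p \<Otimes>\<^sub>M lborel) \<Otimes>\<^sub>M lborel :: ((('d freq \<Rightarrow> complex) \<times> complex) \<times> real) measure"
  let ?T = "\<lambda>w. (fst (fst w))(k := snd (fst w) + of_real (snd w) * v)"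
  note T[measurable] = measurable_line_point[OF k, of v p]
  have "AE w in ?X. Q (?T w)"
  proof (rule P.AE_pair_measure)
    show "{w \<in> space ?X. Q (?T w)} \<in> sets ?X" by measurable
    show "AE x in gauss_seq p \<Otimes>\<^sub>M lborel. AE t in lborel. Q (?T (x, t))"
    proof (rule AE_I2)
      fix x assume "x \<in> space (gauss_seq p \<Otimes>\<^sub>M lborel :: (('d freq \<Rightarrow> complex) \<times> complex) measure)"
      then have "fst x \<in> space seq_space" by (auto simp: space_pair_measure space_gauss_seq)
      from ae[OF this, of "snd x"] show "AE t in lborel. Q (?T (x, t))" by simp
    qed
  qed
  then have "AE w in density ?X (\<lambda>w. ennreal (line_weight p k v (snd (fst w)) (snd w))). Q (?T w)"
    by (subst AE_density) (auto elim: eventually_mono)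
  then have "AE a in distr (density ?X (\<lambda>w. ennreal (line_weight p k v (snd (fst w)) (snd w)))) seq_space ?T. Q a"
    by (subst AE_distr_iff) auto
  then show ?thesis unfolding distr_line_average[OF k] .
qed

text \<open>The value \<open>0\<close> off \<open>l1_seq\<close> makes \<open>\<Psi>\<close>
  measurable on the whole product space and constant on the lines outside \<open>l1_seq\<close>, so
  that estimates along lines hold at every base point.\<close>

locale l1_lipschitz =
  fixes \<Psi> :: "(('d::{finite,linorder}) freq \<Rightarrow> complex) \<Rightarrow> real" and C :: real
  assumes lipschitz: "\<And>a b. a \<in> l1_seq \<Longrightarrow> b \<in> l1_seq \<Longrightarrow> \<bar>\<Psi> a - \<Psi> b\<bar> \<le> C * l1_dist a b"
    and C_nonneg: "0 \<le> C" and off_l1: "\<And>a. a \<notin> l1_seq \<Longrightarrow> \<Psi> a = 0"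
begin

lemma borel_measurable_Psi [measurable]: "\<Psi> \<in> borel_measurable seq_space"
proof -
  have "(\<lambda>a. if a \<in> l1_seq then \<Psi> a else 0) = \<Psi>" using off_l1 by auto
  then show ?thesis using borel_measurable_l1_lipschitz[OF lipschitz C_nonneg] by simp
qed

lemma lipschitz_line:
  assumes k: "k \<in> half_space"
  shows "\<bar>\<Psi> (a(k := z + of_real s * v)) - \<Psi> (a(k := z + of_real t * v))\<bar> \<le> C * norm v * \<bar>s - t\<bar>"
proof (cases "a \<in> l1_seq")
  case True
  have "\<bar>\<Psi> (a(k := z + of_real s * v)) - \<Psi> (a(k := z + of_real t * v))\<bar> \<le> C * norm (z + of_real s * v - (z + of_real t * v))"
    using lipschitz[of "a(k := z + of_real s * v)" "a(k := z + of_real t * v)"] True k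
    by (simp only: upd_in_l1_iff[OF k] l1_dist_upd[OF k])
  also have "z + of_real s * v - (z + of_real t * v) = of_real (s - t) * v" by (simp add: algebra_simps)
  also have "norm (of_real (s - t) * v) = norm v * \<bar>s - t\<bar>" by (simp only: norm_mult norm_of_real mult.commute)
  finally show ?thesis by (simp only: mult.assoc)
next
  case False
  then show ?thesis using C_nonneg by (simp add: off_l1 upd_in_l1_iff[OF k])
qed

lemma lipschitz_shift_coord:
  "k \<in> half_space \<Longrightarrow> \<bar>\<Psi> (shift_coord k v a s) - \<Psi> (shift_coord k v a t)\<bar> \<le> C * norm v * \<bar>s - t\<bar>"
  unfolding shift_coord_def by (rule lipschitz_line)

text \<open>Lebesgue's theorem gives differentiability on each line; passing from lines to sequences
  requires a measurable condition, hence the detour through rational increments.\<close>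

lemma AE_line_differentiable:
  assumes k: "k \<in> half_space"
  shows "AE a in gauss_seq p. (\<lambda>t. \<Psi> (shift_coord k v a t)) field_differentiable at 0"
proof -
  have meas[measurable]: "(\<lambda>a. \<Psi> (shift_coord k v a t)) \<in> borel_measurable seq_space" for t
    by (rule measurable_compose[OF measurable_shift_coord[OF k]]) measurable
  have "AE a in gauss_seq p. rational_cauchy_quotient (\<lambda>t. \<Psi> (shift_coord k v a t))"
  proof (rule AE_gauss_seq_lineI[OF k, where v=v])
    show "Measurable.pred seq_space (\<lambda>a. rational_cauchy_quotient (\<lambda>t. \<Psi> (shift_coord k v a t)))"
      unfolding rational_cauchy_quotient_def by measurable
    fix a :: "'d freq \<Rightarrow> complex" and z
    have "AE t in lborel. (\<lambda>s. \<Psi> (a(k := z + of_real s * v))) field_differentiable at t"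
      by (rule lipschitz_AE_differentiable[OF lipschitz_line[OF k]])
    then show "AE t in lborel. rational_cauchy_quotient (\<lambda>s. \<Psi> (shift_coord k v (a(k := z + of_real t * v)) s))"
    proof eventually_elim
      case (elim t)
      have "(\<lambda>s. \<Psi> (a(k := z + of_real (t + s) * v))) field_differentiable at 0"
      proof -
        obtain D where "((\<lambda>s. \<Psi> (a(k := z + of_real s * v))) has_field_derivative D) (at (0 + t))"
          using elim by (auto simp: field_differentiable_def)
        then have "((\<lambda>s. \<Psi> (a(k := z + of_real (s + t) * v))) has_field_derivative D) (at 0)"
          by (simp only: DERIV_shift)
        then show ?thesis by (auto simp: field_differentiable_def add.commute)
      qed
      then show ?case
        unfolding shift_coord_line_point by (rule differentiable_imp_rational_cauchy_quotient)
    qed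
  qed
  then show ?thesis
  proof eventually_elim
    case (elim a)
    show ?case
      by (rule rational_cauchy_quotient_imp_differentiable[OF lipschitz_continuous_on[OF lipschitz_shift_coord[OF k]] elim])
  qed
qed

lemma borel_measurable_line_deriv:
  assumes k: "k \<in> half_space" shows "line_deriv \<Psi> k v \<in> borel_measurable seq_space"
proof -
  have meas[measurable]: "(\<lambda>a. \<Psi> (shift_coord k v a t)) \<in> borel_measurable seq_space" for t
    by (rule measurable_compose[OF measurable_shift_coord[OF k]]) measurable
  show ?thesis unfolding line_deriv_def[abs_def] seq_deriv_def by measurable
qed

lemma AE_abs_line_deriv_le:
  assumes k: "k \<in> half_space"
  shows "AE a in gauss_seq p. \<bar>line_deriv \<Psi> k v a\<bar> \<le> C * norm v"
  using AE_line_differentiable[OF k, where p=p and v=v]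
proof eventually_elim
  case (elim a)
  then obtain D where D: "((\<lambda>t. \<Psi> (shift_coord k v a t)) has_real_derivative D) (at 0)" by (auto simp: field_differentiable_def)
  show ?case
    unfolding line_deriv_def seq_deriv_eq(2)[OF D] by (rule abs_deriv_le_lipschitz[OF lipschitz_shift_coord[OF k] D])
qed

lemma integrable_line_deriv:
  fixes h :: "('d freq \<Rightarrow> complex) \<Rightarrow> complex"
  assumes k: "k \<in> half_space" and h: "integrable (gauss_seq p) h"
  shows "integrable (gauss_seq p) (\<lambda>a. line_deriv \<Psi> k v a *\<^sub>R h a)"
proof (rule Bochner_Integration.integrable_bound[where f="\<lambda>a. (C * norm v) *\<^sub>R h a"])
  have [measurable]: "line_deriv \<Psi> k v \<in> borel_measurable (gauss_seq p)" "h \<in> borel_measurable (gauss_seq p)"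
    using borel_measurable_line_deriv[OF k] h by auto
  show "(\<lambda>a. line_deriv \<Psi> k v a *\<^sub>R h a) \<in> borel_measurable (gauss_seq p)" by measurable
  show "AE a in gauss_seq p. norm (line_deriv \<Psi> k v a *\<^sub>R h a) \<le> norm ((C * norm v) *\<^sub>R h a)"
    using AE_abs_line_deriv_le[OF k, where p=p and v=v]
  proof eventually_elim
    case (elim a)
    have "norm (line_deriv \<Psi> k v a *\<^sub>R h a) = \<bar>line_deriv \<Psi> k v a\<bar> * norm (h a)" by simp
    also have "\<dots> \<le> (C * norm v) * norm (h a)" by (rule mult_right_mono[OF elim]) simp
    finally show ?case using C_nonneg by simp
  qed
qed (use h in auto)

end

text \<open>The weighted line average rewrites each integral as an iterated one whose inner integral
  runs along a line. On almost every line the test function is integrable, so the one-dimensional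
  convergence applies there; the outer integrals are dominated by \<open>C * norm v\<close> times
  the line integral of the modulus of \<open>H\<close>.\<close>

lemma tendsto_integral_line_deriv:
  fixes \<Psi> :: "nat \<Rightarrow> (('d::{finite,linorder}) freq \<Rightarrow> complex) \<Rightarrow> real" and h :: "('d freq \<Rightarrow> complex) \<Rightarrow> complex"
  assumes lip: "\<And>n. l1_lipschitz (\<Psi> n) C" and lip0: "l1_lipschitz \<Psi>0 C"
    and lim: "\<And>a. a \<in> l1_seq \<Longrightarrow> (\<lambda>n. \<Psi> n a) \<longlonglongrightarrow> \<Psi>0 a"
    and k: "k \<in> half_space" and h: "integrable (gauss_seq p) h" and p: "p \<ge> 2"
  shows "(\<lambda>n. \<integral>a. line_deriv (\<Psi> n) k v a *\<^sub>R h a \<partial>gauss_seq p) \<longlonglongrightarrow> (\<integral>a. line_deriv \<Psi>0 k v a *\<^sub>R h a \<partial>gauss_seq p)"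
proof -
  interpret G: prob_space "gauss_seq p :: ('d freq \<Rightarrow> complex) measure" by (rule prob_space_gauss_seq)
  interpret GL: pair_sigma_finite "gauss_seq p :: ('d freq \<Rightarrow> complex) measure" "lborel :: complex measure" ..
  interpret P: pair_sigma_finite "gauss_seq p \<Otimes>\<^sub>M lborel :: (('d freq \<Rightarrow> complex) \<times> complex) measure" "lborel :: real measure"
    by standard
  let ?Y = "gauss_seq p \<Otimes>\<^sub>M lborel :: (('d freq \<Rightarrow> complex) \<times> complex) measure"
  let ?X = "?Y \<Otimes>\<^sub>M (lborel :: real measure)"
  let ?T = "\<lambda>w. (fst (fst w))(k := snd (fst w) + of_real (snd w) * v)"
  let ?W = "\<lambda>w :: ((('d freq \<Rightarrow> complex) \<times> complex) \<times> real). line_weight p k v (snd (fst w)) (snd w)"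
  note T[measurable] = measurable_line_point[OF k, of v p]
  have hm[measurable]: "h \<in> borel_measurable seq_space" using h by (simp add: measurable_cong_sets[OF sets_gauss_seq refl] borel_measurable_integrable)
  define H where "H w = ?W w *\<^sub>R h (?T w)" for w
  have Wm[measurable]: "?W \<in> borel_measurable ?X" by measurable
  have hT[measurable]: "(\<lambda>w. h (?T w)) \<in> borel_measurable ?X" by (rule measurable_compose[OF T hm])
  have trans_int: "integrable ?X (\<lambda>w. ?W w *\<^sub>R g (?T w))" "(\<integral>a. g a \<partial>gauss_seq p) = (\<integral>x. \<integral>t. ?W (x, t) *\<^sub>R g (?T (x, t)) \<partial>lborel \<partial>?Y)"
    if g: "integrable (gauss_seq p) g" for g :: "('d freq \<Rightarrow> complex) \<Rightarrow> complex"
  proof -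
    have gm[measurable]: "g \<in> borel_measurable seq_space" using g by (simp add: measurable_cong_sets[OF sets_gauss_seq refl] borel_measurable_integrable)
    have gT: "(\<lambda>w. g (?T w)) \<in> borel_measurable ?X" by (rule measurable_compose[OF T gm])
    have "integrable (distr (density ?X ?W) seq_space ?T) g" using g unfolding distr_line_average[OF k] .
    then have "integrable (density ?X ?W) (\<lambda>w. g (?T w))" by (subst (asm) integrable_distr_eq) auto
    then show int: "integrable ?X (\<lambda>w. ?W w *\<^sub>R g (?T w))"
      by (subst (asm) integrable_density[OF gT]) (auto simp: line_weight_nonneg)
    have "(\<integral>a. g a \<partial>gauss_seq p) = (\<integral>a. g a \<partial>distr (density ?X ?W) seq_space ?T)" unfolding distr_line_average[OF k] ..
    also have "\<dots> = (\<integral>w. g (?T w) \<partial>density ?X ?W)" by (rule integral_distr) auto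
    also have "\<dots> = (\<integral>w. ?W w *\<^sub>R g (?T w) \<partial>?X)" by (rule integral_density[OF gT]) (auto simp: line_weight_nonneg)
    also have "\<dots> = (\<integral>x. \<integral>t. ?W (x, t) *\<^sub>R g (?T (x, t)) \<partial>lborel \<partial>?Y)" by (rule P.integral_fst'[OF int, symmetric])
    finally show "(\<integral>a. g a \<partial>gauss_seq p) = (\<integral>x. \<integral>t. ?W (x, t) *\<^sub>R g (?T (x, t)) \<partial>lborel \<partial>?Y)" .
  qed
  have H: "integrable ?X H" unfolding H_def[abs_def] by (rule trans_int(1)[OF h])
  define J where "J L x = (\<integral>t. seq_deriv (\<lambda>s. L ((fst x)(k := snd x + of_real s * v))) t *\<^sub>R H (x, t) \<partial>lborel)"
    for L :: "('d freq \<Rightarrow> complex) \<Rightarrow> real" and x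
  have eq: "(\<integral>a. line_deriv L k v a *\<^sub>R h a \<partial>gauss_seq p) = (\<integral>x. J L x \<partial>?Y)" "integrable ?Y (J L)"
    if "l1_lipschitz L C" for L
  proof -
    interpret L: l1_lipschitz L C by fact
    have int: "integrable (gauss_seq p) (\<lambda>a. line_deriv L k v a *\<^sub>R h a)" by (rule L.integrable_line_deriv[OF k h])
    have e: "?W (x, t) *\<^sub>R (line_deriv L k v (?T (x, t)) *\<^sub>R h (?T (x, t)))
       = seq_deriv (\<lambda>s. L ((fst x)(k := snd x + of_real s * v))) t *\<^sub>R H (x, t)" for x t
      unfolding H_def fst_conv snd_conv line_deriv_line_point by (simp only: scaleR_scaleR mult.commute)
    show "(\<integral>a. line_deriv L k v a *\<^sub>R h a \<partial>gauss_seq p) = (\<integral>x. J L x \<partial>?Y)"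
      unfolding trans_int(2)[OF int] e J_def ..
    show "integrable ?Y (J L)"
      using P.integrable_fst'[OF trans_int(1)[OF int]] unfolding e J_def[abs_def] .
  qed
  have Hx: "AE x in ?Y. integrable lborel (\<lambda>t. H (x, t))" by (rule P.AE_integrable_fst'[OF H])
  \<comment> \<open>Convergence of \<open>\<Psi> n\<close> is known at summable sequences only; a
    line that starts at one stays within them.\<close>
  have l1: "AE x in ?Y. fst x \<in> l1_seq"
  proof (rule GL.AE_pair_measure)
    have [measurable]: "Measurable.pred (gauss_seq p) (\<lambda>a :: 'd freq \<Rightarrow> complex. a \<in> l1_seq)"
    proof -
      have "{a \<in> space seq_space. a \<in> (l1_seq :: ('d freq \<Rightarrow> complex) set)} = l1_seq"
        using sets.sets_into_space[OF sets_l1_seq] by auto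
      then show ?thesis using sets_l1_seq by (simp add: pred_def space_gauss_seq sets_gauss_seq)
    qed
    show "{x \<in> space ?Y. fst x \<in> l1_seq} \<in> sets ?Y" by measurable
    show "AE a in gauss_seq p. AE z in lborel. fst (a, z :: complex) \<in> l1_seq"
      using AE_gauss_seq_l1[OF p] by eventually_elim simp
  qed
  show ?thesis
    unfolding eq(1)[OF lip] eq(1)[OF lip0]
  proof (rule integral_dominated_convergence[where w="\<lambda>x. C * norm v * (\<integral>t. norm (H (x, t)) \<partial>lborel)"])
    show "J \<Psi>0 \<in> borel_measurable ?Y" "\<And>n. J (\<Psi> n) \<in> borel_measurable ?Y"
      using eq(2)[OF lip] eq(2)[OF lip0] by auto
    show "integrable ?Y (\<lambda>x. C * norm v * (\<integral>t. norm (H (x, t)) \<partial>lborel))"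
      using P.integrable_fst'[OF integrable_norm[OF H]] by (rule integrable_mult_right)
    show "AE x in ?Y. (\<lambda>n. J (\<Psi> n) x) \<longlonglongrightarrow> J \<Psi>0 x"
      using Hx l1
    proof eventually_elim
      case (elim x)
      show ?case
        unfolding J_def
      proof (rule tendsto_integral_seq_deriv[where C="C * norm v"])
        show "\<bar>\<Psi> n ((fst x)(k := snd x + of_real s * v)) - \<Psi> n ((fst x)(k := snd x + of_real t * v))\<bar> \<le> C * norm v * \<bar>s - t\<bar>" for n s t
          by (rule l1_lipschitz.lipschitz_line[OF lip k])
        show "(\<lambda>n. \<Psi> n ((fst x)(k := snd x + of_real s * v))) \<longlonglongrightarrow> \<Psi>0 ((fst x)(k := snd x + of_real s * v))" for s
          by (rule lim) (use elim in \<open>simp add: upd_in_l1_iff[OF k]\<close>)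
      qed (rule elim)
    qed
    show "AE x in ?Y. norm (J (\<Psi> n) x) \<le> C * norm v * (\<integral>t. norm (H (x, t)) \<partial>lborel)" for n
      using Hx
    proof eventually_elim
      case (elim x)
      have l: "\<bar>\<Psi> n ((fst x)(k := snd x + of_real s * v)) - \<Psi> n ((fst x)(k := snd x + of_real t * v))\<bar> \<le> C * norm v * \<bar>s - t\<bar>" for s t
        by (rule l1_lipschitz.lipschitz_line[OF lip k])
      show ?case
        unfolding J_def
        by (rule abs_le_of_AE_le_integral(2)[OF _ AE_abs_seq_deriv_le[OF l] elim])
           (intro borel_measurable_seq_deriv borel_measurable_continuous_onI lipschitz_continuous_on[OF l])
    qed
  qed
qed

section \<open>Fejer means\<close>

text \<open>The Fourier coefficient of the Fejer kernel, a product of one-dimensional triangle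
  functions.\<close>

definition fejer_weight :: "nat \<Rightarrow> ('d::finite) freq \<Rightarrow> real" where
  "fejer_weight N k = (if k \<in> F_set N then \<Prod>i\<in>UNIV. 1 - \<bar>real_of_int (k $ i)\<bar> / real N else 0)"

lemma fejer_weight_factor:
  assumes "k \<in> F_set N" shows "0 < 1 - \<bar>real_of_int (k $ i)\<bar> / real N" "1 - \<bar>real_of_int (k $ i)\<bar> / real N \<le> 1"
proof -
  have "\<bar>k $ i\<bar> < int N" using assms by (simp add: F_set_def)
  then have "\<bar>real_of_int (k $ i)\<bar> < real N" by linarith
  then show "0 < 1 - \<bar>real_of_int (k $ i)\<bar> / real N" "1 - \<bar>real_of_int (k $ i)\<bar> / real N \<le> 1"
    by (simp_all add: divide_less_eq)
qed

lemma fejer_weight_pos: "k \<in> F_set N \<Longrightarrow> 0 < fejer_weight N k"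
  unfolding fejer_weight_def by (simp only: if_True) (intro prod_pos ballI fejer_weight_factor)

lemma fejer_weight_nonneg: "0 \<le> fejer_weight N k"
  using fejer_weight_pos[of k N] by (cases "k \<in> F_set N") (auto simp: fejer_weight_def)

lemma fejer_weight_le_1: "fejer_weight N k \<le> 1"
proof (cases "k \<in> F_set N")
  case True
  have "(\<Prod>i\<in>UNIV. 1 - \<bar>real_of_int (k $ i)\<bar> / real N) \<le> 1"
    using fejer_weight_factor[OF True] by (intro prod_le_1 conjI less_imp_le[OF fejer_weight_factor(1)[OF True]]) blast+
  then show ?thesis by (simp add: fejer_weight_def)
qed (simp add: fejer_weight_def)

lemma abs_fejer_weight_le_1: "\<bar>fejer_weight N k\<bar> \<le> 1"
  using fejer_weight_nonneg[of N k] fejer_weight_le_1[of N k] by simp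

lemma F_set_uminus_iff: "- k \<in> F_set N \<longleftrightarrow> k \<in> F_set N"
  by (simp add: F_set_def)

lemma fejer_weight_uminus: "fejer_weight N (- k) = fejer_weight N k"
  by (simp add: fejer_weight_def F_set_uminus_iff)

lemma fejer_weight_0: "N \<noteq> 0 \<Longrightarrow> fejer_weight N 0 = 1"
  by (simp add: fejer_weight_def F_set_def)

lemma fejer_weight_tendsto: "(\<lambda>N. fejer_weight N k) \<longlonglongrightarrow> 1"
proof -
  obtain M where M: "k \<in> F_set M" using F_set_covers by blast
  have "(\<lambda>N. \<Prod>i\<in>UNIV. 1 - \<bar>real_of_int (k $ i)\<bar> / real N) \<longlonglongrightarrow> (\<Prod>i\<in>(UNIV::'a set). 1 - 0)"
    by (intro tendsto_prod tendsto_diff tendsto_const tendsto_divide_0[OF tendsto_const] filterlim_compose[OF filterlim_at_top_imp_at_infinity filterlim_real_sequentially])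
       (simp add: filterlim_ident)
  then have "(\<lambda>N. \<Prod>i\<in>UNIV. 1 - \<bar>real_of_int (k $ i)\<bar> / real N) \<longlonglongrightarrow> 1" by simp
  then show ?thesis
  proof (rule Lim_transform_eventually)
    show "\<forall>\<^sub>F N in sequentially. (\<Prod>i\<in>UNIV. 1 - \<bar>real_of_int (k $ i)\<bar> / real N) = fejer_weight N k"
      using eventually_ge_at_top[of M]
    proof eventually_elim
      case (elim N)
      then have "k \<in> F_set N" using F_set_mono M by blast
      then show ?case by (simp add: fejer_weight_def)
    qed
  qed
qed

lemma card_vec_box:
  fixes S :: "'d::finite \<Rightarrow> 'a set"
  shows "card {v. \<forall>i. v $ i \<in> S i} = (\<Prod>i\<in>UNIV. card (S i))"
proof -
  have "bij_betw vec_nth {v. \<forall>i. v $ i \<in> S i} (PiE UNIV S)"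
    by (rule bij_betw_byWitness[where f'=vec_lambda]) (auto simp: PiE_def)
  then have "card {v. \<forall>i. v $ i \<in> S i} = card (PiE UNIV S)" by (rule bij_betw_same_card)
  then show ?thesis by (simp add: card_PiE)
qed

text \<open>The squared modulus is a double sum over a box, grouped by the difference
  \<open>k\<close> of the two frequencies. In each coordinate \<open>N - |k $ i|\<close> pairs have
  the given difference, and division by \<open>N ^ CARD('d)\<close> leaves the triangle
  weights.\<close>

lemma fejer_expansion:
  fixes x :: "('d::finite) torus"
  shows "complex_of_real (fejer N x) = (\<Sum>k\<in>F_set N. complex_of_real (fejer_weight N k) * fourier_char k x)"
proof (cases "N = 0")
  case True
  then show ?thesis by (simp add: fejer_def F_set_def)
next
  case False
  define B where "B = {k::'d freq. \<forall>i. 1 \<le> k $ i \<and> k $ i \<le> int N}"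
  have "B \<subseteq> F_set (Suc N)" by (auto simp: B_def F_set_def abs_le_iff) (smt (verit))
  then have fB: "finite B" using finite_F_set finite_subset by blast
  have card: "card {w \<in> B \<times> B. fst w - snd w = k} = (\<Prod>i\<in>UNIV. nat (int N - \<bar>k $ i\<bar>))" if k: "k \<in> F_set N" for k
  proof -
    \<comment> \<open>The second frequency determines the pair; its coordinates range over the
      integers \<open>j\<close> with \<open>j\<close> and \<open>k $ i + j\<close> both in
      \<open>{1..N}\<close>.\<close>
    have "bij_betw snd {w \<in> B \<times> B. fst w - snd w = k} {v. \<forall>i. v $ i \<in> {1 + max 0 (- (k $ i)) .. int N - max 0 (k $ i)}}"
    proof (rule bij_betw_byWitness[where f'="\<lambda>v. (k + v, v)"])
      show "(\<lambda>v. (k + v, v)) ` {v. \<forall>i. v $ i \<in> {1 + max 0 (- (k $ i)) .. int N - max 0 (k $ i)}} \<subseteq> {w \<in> B \<times> B. fst w - snd w = k}"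
      proof (rule image_subsetI)
        fix v assume "v \<in> {v. \<forall>i. v $ i \<in> {1 + max 0 (- (k $ i)) .. int N - max 0 (k $ i)}}"
        then have i: "v $ i \<in> {1 + max 0 (- (k $ i)) .. int N - max 0 (k $ i)}" for i by blast
        have "1 \<le> v $ i" "v $ i \<le> int N" "1 \<le> k $ i + v $ i" "k $ i + v $ i \<le> int N" for i using i[of i] by auto
        then show "(k + v, v) \<in> {w \<in> B \<times> B. fst w - snd w = k}" by (simp add: B_def)
      qed
      show "snd ` {w \<in> B \<times> B. fst w - snd w = k} \<subseteq> {v. \<forall>i. v $ i \<in> {1 + max 0 (- (k $ i)) .. int N - max 0 (k $ i)}}"
      proof (rule image_subsetI)
        fix w assume w: "w \<in> {w \<in> B \<times> B. fst w - snd w = k}"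
        have "snd w $ i \<in> {1 + max 0 (- (k $ i)) .. int N - max 0 (k $ i)}" for i
        proof -
          have "1 \<le> fst w $ i" "fst w $ i \<le> int N" "1 \<le> snd w $ i" "snd w $ i \<le> int N" "k $ i = fst w $ i - snd w $ i"
            using w by (auto simp: B_def)
          then show ?thesis by auto
        qed
        then show "snd w \<in> {v. \<forall>i. v $ i \<in> {1 + max 0 (- (k $ i)) .. int N - max 0 (k $ i)}}" by auto
      qed
    qed auto
    then have "card {w \<in> B \<times> B. fst w - snd w = k} = (\<Prod>i\<in>UNIV. card {1 + max 0 (- (k $ i)) .. int N - max 0 (k $ i)})"
      using card_vec_box[of "\<lambda>i. {1 + max 0 (- (k $ i)) .. int N - max 0 (k $ i)}"] by (simp add: bij_betw_same_card)
    also have "\<dots> = (\<Prod>i\<in>UNIV. nat (int N - \<bar>k $ i\<bar>))"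
      by (rule prod.cong) (auto simp: max_def)
    finally show ?thesis .
  qed
  have weight: "real (card {w \<in> B \<times> B. fst w - snd w = k}) / real N ^ CARD('d) = fejer_weight N k" if k: "k \<in> F_set N" for k
  proof -
    have "real (nat (int N - \<bar>k $ i\<bar>)) / real N = 1 - \<bar>real_of_int (k $ i)\<bar> / real N" for i
    proof -
      have "\<bar>k $ i\<bar> < int N" using k by (simp add: F_set_def)
      then have "real (nat (int N - \<bar>k $ i\<bar>)) = real N - \<bar>real_of_int (k $ i)\<bar>" by simp
      then show ?thesis using False by (simp add: field_simps)
    qed
    then have "fejer_weight N k = (\<Prod>i\<in>UNIV. real (nat (int N - \<bar>k $ i\<bar>)) / real N)" using k by (simp add: fejer_weight_def)
    also have "\<dots> = (\<Prod>i\<in>UNIV. real (nat (int N - \<bar>k $ i\<bar>))) / real N ^ CARD('d)" by (simp add: prod_dividef)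
    finally show ?thesis unfolding card[OF k] by simp
  qed
  have "complex_of_real ((cmod (\<Sum>k\<in>B. fourier_char k x))\<^sup>2) = (\<Sum>k\<in>B. fourier_char k x) * cnj (\<Sum>k\<in>B. fourier_char k x)"
    by (rule complex_norm_square)
  also have "\<dots> = (\<Sum>w\<in>B \<times> B. fourier_char (fst w - snd w) x)"
    by (simp add: sum_product sum.cartesian_product fourier_char_add[of _ "- _", simplified] fourier_char_uminus split_def)
  also have "\<dots> = (\<Sum>k\<in>F_set N. \<Sum>w\<in>{w \<in> B \<times> B. fst w - snd w = k}. fourier_char (fst w - snd w) x)"
  proof (rule sum.group[symmetric])
    show "(\<lambda>w. fst w - snd w) ` (B \<times> B) \<subseteq> F_set N"
    proof (rule image_subsetI)
      fix w assume w: "w \<in> B \<times> B"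
      have "\<bar>fst w $ i - snd w $ i\<bar> < int N" for i
      proof -
        have "1 \<le> fst w $ i" "fst w $ i \<le> int N" "1 \<le> snd w $ i" "snd w $ i \<le> int N"
          using w by (auto simp: B_def)
        then show ?thesis by linarith
      qed
      then show "fst w - snd w \<in> F_set N" by (simp add: F_set_def)
    qed
  qed (use fB finite_F_set in auto)
  also have "\<dots> = (\<Sum>k\<in>F_set N. of_nat (card {w \<in> B \<times> B. fst w - snd w = k}) * fourier_char k x)"
    by (intro sum.cong refl) simp
  finally have eq: "complex_of_real ((cmod (\<Sum>k\<in>B. fourier_char k x))\<^sup>2) = \<dots>" .
  have "complex_of_real (fejer N x) = complex_of_real ((cmod (\<Sum>k\<in>B. fourier_char k x))\<^sup>2) / of_real (real N ^ CARD('d))"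
    by (simp add: fejer_def B_def)
  also have "\<dots> = (\<Sum>k\<in>F_set N. of_real (real (card {w \<in> B \<times> B. fst w - snd w = k}) / real N ^ CARD('d)) * fourier_char k x)"
    unfolding eq by (simp add: sum_divide_distrib)
  also have "\<dots> = (\<Sum>k\<in>F_set N. complex_of_real (fejer_weight N k) * fourier_char k x)"
    by (intro sum.cong refl arg_cong2[where f="(*)"] arg_cong[where f=complex_of_real] weight)
  finally show ?thesis .
qed

lemma fejer_nonneg: "0 \<le> fejer N x"
  by (simp add: fejer_def)

lemma borel_measurable_fejer_diff [measurable]: "(\<lambda>y. fejer N (x - y)) \<in> borel_measurable borel"
proof -
  have "(\<lambda>y. fejer N (x - y)) = (\<lambda>y. Re (\<Sum>k\<in>F_set N. complex_of_real (fejer_weight N k) * (fourier_char k x * cnj (fourier_char k y))))"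
    by (simp only: fourier_char_diff_point[symmetric] fejer_expansion[symmetric] Re_complex_of_real)
  then show ?thesis by simp
qed

section \<open>Fejer damping of coefficient sequences\<close>

definition damp_seq :: "nat \<Rightarrow> (('d::{finite,linorder}) freq \<Rightarrow> complex) \<Rightarrow> 'd freq \<Rightarrow> complex" where
  "damp_seq N = scale_seq (fejer_weight N)"

lemma damp_seq_in_l1: "a \<in> l1_seq \<Longrightarrow> damp_seq N a \<in> l1_seq"
  unfolding damp_seq_def by (rule scale_seq_in_l1[OF _ abs_fejer_weight_le_1])

lemma trunc_damp_seq: "trunc_seq N (damp_seq N a) = damp_seq N a"
  by (auto simp: trunc_seq_def damp_seq_def scale_seq_def fejer_weight_def F_plus_eq fun_eq_iff restrict_def)

lemma fourier_density_damp_seq: "fourier_density (damp_seq N a) x = trig_density N (damp_seq N a) x"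
  by (metis fourier_density_trunc trunc_damp_seq)

text \<open>\<open>N = 0\<close> is excluded because \<open>F_set 0\<close> is empty and so misses
  the zero frequency.\<close>

lemma sum_F_set_split:
  fixes g :: "('d::{finite,linorder}) freq \<Rightarrow> complex"
  assumes "N \<noteq> 0"
  shows "(\<Sum>k\<in>F_set N. g k) = g 0 + (\<Sum>k\<in>F_plus N. g (- k) + g k)"
proof -
  have "(F_set N :: 'd freq set) = insert 0 (uminus ` F_plus N \<union> F_plus N)"
  proof (intro equalityI subsetI)
    fix k :: "'d freq" assume k: "k \<in> F_set N"
    show "k \<in> insert 0 (uminus ` F_plus N \<union> F_plus N)"
    proof (cases "k = 0")
      case False
      then consider "k \<in> half_space" | "- k \<in> half_space" by (rule half_space_cases)
      then show ?thesis
      proof cases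
        case 2
        then have "- k \<in> F_plus N" using k by (simp add: F_plus_eq F_set_uminus_iff)
        then have "- (- k) \<in> uminus ` F_plus N" by (rule imageI)
        then show ?thesis by simp
      qed (use k in \<open>simp add: F_plus_eq\<close>)
    qed simp
  qed (use assms in \<open>auto simp: F_plus_eq F_set_uminus_iff F_set_def\<close>)
  moreover have "(uminus ` F_plus N) \<inter> F_plus N = ({} :: 'd freq set)"
    using uminus_notin_half_space by (auto simp: F_plus_eq)
  moreover have "(0 :: 'd freq) \<notin> uminus ` F_plus N \<union> F_plus N" by (auto simp: F_plus_eq)
  moreover have "(\<Sum>k\<in>uminus ` F_plus N. g k) = (\<Sum>k\<in>F_plus N. g (- k))"
    by (subst sum.reindex) (auto intro: inj_onI)
  ultimately show ?thesis by (simp add: sum.union_disjoint sum.distrib)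
qed

text \<open>Convolution multiplies Fourier coefficients; as the kernel has a finite expansion, this
  is an exchange of a finite sum with an integral.\<close>

lemma integral_fejer_density:
  fixes a :: "('d::{finite,linorder}) freq \<Rightarrow> complex"
  assumes a: "a \<in> l1_seq" and N: "N \<noteq> 0"
  shows "(\<integral>y. fourier_density a y * fejer N (x - y) \<partial>torus_vol) = fourier_density (damp_seq N a) x"
proof -
  obtain B where B: "\<bar>fourier_density a y\<bar> \<le> B" for y using fourier_density_bounded[OF a] by blast
  note [measurable] = borel_measurable_fourier_density[OF a]
  have int: "integrable torus_vol (\<lambda>y. complex_of_real (fourier_density a y) * fourier_char k y)" for k
    by (rule integrable_torus_vol_bounded[where B=B]) (auto simp: norm_mult B)
  have "complex_of_real (\<integral>y. fourier_density a y * fejer N (x - y) \<partial>torus_vol)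
      = (\<integral>y. complex_of_real (fourier_density a y) * complex_of_real (fejer N (x - y)) \<partial>torus_vol)"
    by (subst integral_complex_of_real[symmetric]) simp
  also have "\<dots> = (\<integral>y. (\<Sum>k\<in>F_set N. (of_real (fejer_weight N k) * fourier_char k x) * (complex_of_real (fourier_density a y) * fourier_char (- k) y)) \<partial>torus_vol)"
    by (simp add: fejer_expansion fourier_char_diff_point fourier_char_uminus sum_distrib_left mult_ac)
  also have "\<dots> = (\<Sum>k\<in>F_set N. (of_real (fejer_weight N k) * fourier_char k x) * (\<integral>y. complex_of_real (fourier_density a y) * fourier_char (- k) y \<partial>torus_vol))"
    by (subst Bochner_Integration.integral_sum) (intro integrable_mult_right int, simp)
  also have "\<dots> = (\<Sum>k\<in>F_set N. of_real (fejer_weight N k) * fourier_char k x * hermitian_ext a (- k))"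
    by (simp only: integral_fourier_density[OF a])
  also have "\<dots> = 1 + (\<Sum>k\<in>F_plus N. damp_seq N a k * fourier_char (- k) x + cnj (damp_seq N a k) * fourier_char k x)"
    unfolding sum_F_set_split[OF N]
  proof (intro arg_cong2[where f="(+)"] sum.cong refl)
    show "of_real (fejer_weight N (0 :: 'd freq)) * fourier_char 0 x * hermitian_ext a (- 0) = 1"
      by (simp add: fejer_weight_0 N hermitian_ext_def)
  next
    fix k :: "'d freq" assume "k \<in> F_plus N"
    then have k: "k \<in> half_space" "- k \<notin> half_space" "k \<noteq> 0" using F_plus_subset uminus_notin_half_space zero_notin_half_space by blast+
    then show "of_real (fejer_weight N (- k)) * fourier_char (- k) x * hermitian_ext a (- (- k)) = damp_seq N a k * fourier_char (- k) x"
      "of_real (fejer_weight N k) * fourier_char k x * hermitian_ext a (- k) = cnj (damp_seq N a k) * fourier_char k x"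
      by (simp_all add: damp_seq_def fejer_weight_uminus hermitian_ext_def)
  qed
  also have "\<dots> = complex_of_real (fourier_density (damp_seq N a) x)"
    unfolding fourier_density_damp_seq complex_of_trig_density ..
  finally show ?thesis by (simp only: of_real_eq_iff)
qed

lemma integral_fejer:
  fixes x :: "('d::{finite,linorder}) torus"
  assumes N: "N \<noteq> 0" shows "(\<integral>y. fejer N (x - y) \<partial>torus_vol) = 1"
proof -
  define z :: "'d freq \<Rightarrow> complex" where "z = trunc_seq 0 (\<lambda>_. 0)"
  have z: "z \<in> l1_seq" unfolding z_def by (rule trunc_seq_in_l1)
  have z0: "z k = 0" if "k \<in> half_space" for k using that by (simp add: z_def trunc_seq_def)
  have one: "fourier_density b y = 1" if "\<And>k. k \<in> half_space \<Longrightarrow> b k = 0" for b :: "'d freq \<Rightarrow> complex" and y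
    using that by (simp add: fourier_density_def cong: infsum_cong)
  \<comment> \<open>The zero sequence has density \<open>1\<close> and is its own damping, so this
    convolution computes the mass of the kernel.\<close>
  have "(\<integral>y. fourier_density z y * fejer N (x - y) \<partial>torus_vol) = fourier_density (damp_seq N z) x"
    by (rule integral_fejer_density[OF z N])
  then show ?thesis by (simp add: one z0 damp_seq_def)
qed

lemma abs_fejer_le:
  fixes x :: "('d::finite) torus"
  shows "\<bar>fejer N x\<bar> \<le> (\<Sum>k\<in>(F_set N :: 'd freq set). \<bar>fejer_weight N k\<bar>)"
proof -
  have "\<bar>fejer N x\<bar> = norm (complex_of_real (fejer N x))" by (rule norm_of_real[symmetric])
  also have "\<dots> \<le> (\<Sum>k\<in>F_set N. norm (complex_of_real (fejer_weight N k) * fourier_char k x))"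
    unfolding fejer_expansion by (rule norm_sum)
  finally show ?thesis by (simp add: norm_mult)
qed

lemma integrable_fejer:
  fixes x :: "('d::finite) torus"
  shows "integrable torus_vol (\<lambda>y. fejer N (x - y))"
  by (rule integrable_torus_vol_bounded[where B="\<Sum>k\<in>(F_set N :: 'd freq set). \<bar>fejer_weight N k\<bar>", OF borel_measurable_fejer_diff]) (simp only: real_norm_def abs_fejer_le)

lemma integrable_density_fejer:
  assumes a: "a \<in> l1_seq" shows "integrable torus_vol (\<lambda>y. fourier_density a y * fejer N (x - y))"
proof -
  obtain B where B: "\<bar>fourier_density a y\<bar> \<le> B" for y using fourier_density_bounded[OF a] by blast
  note [measurable] = borel_measurable_fourier_density[OF a]
  show ?thesis
  proof (rule Bochner_Integration.integrable_bound[OF integrable_mult_right[OF integrable_fejer, of B]])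
    show "AE y in torus_vol. norm (fourier_density a y * fejer N (x - y)) \<le> norm (B * fejer N (x - y))"
      using B order_trans[OF B abs_ge_self] by (auto simp: abs_mult intro!: mult_right_mono)
  qed measurable
qed

text \<open>An average against a non-negative kernel of mass one keeps every lower bound of the
  density. Plain truncation of the Fourier series does not have this property, which is the reason
  for Fejer means.\<close>

lemma damp_seq_pos_seq:
  fixes a :: "('d::{finite,linorder}) freq \<Rightarrow> complex"
  assumes a: "a \<in> pos_seq" and N: "N \<noteq> 0"
  shows "damp_seq N a \<in> pos_seq"
proof -
  obtain e where e: "e > 0" "\<And>x. e \<le> fourier_density a x" and l1: "a \<in> l1_seq" using a by (auto simp: pos_seq_def)
  have "e \<le> fourier_density (damp_seq N a) x" for x
  proof -
    have "e = (\<integral>y. e * fejer N (x - y) \<partial>torus_vol)" using integral_fejer[OF N, of x] by simp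
    also have "\<dots> \<le> (\<integral>y. fourier_density a y * fejer N (x - y) \<partial>torus_vol)"
      by (rule Bochner_Integration.integral_mono) (use integrable_fejer integrable_density_fejer[OF l1] e(2) in \<open>auto intro!: mult_right_mono fejer_nonneg\<close>)
    also have "\<dots> = fourier_density (damp_seq N a) x" by (rule integral_fejer_density[OF l1 N])
    finally show ?thesis .
  qed
  then show ?thesis using e(1) damp_seq_in_l1[OF l1] by (auto simp: pos_seq_def)
qed

lemma seq_measure_smooth_fejer:
  fixes a :: "('d::{finite,linorder}) freq \<Rightarrow> complex"
  assumes a: "a \<in> pos_seq" and N: "N \<noteq> 0"
  shows "seq_measure a \<star> fejer N = seq_measure (damp_seq N a)"
proof -
  obtain e where e: "e > 0" "\<And>x. e \<le> fourier_density a x" and l1: "a \<in> l1_seq" using a by (auto simp: pos_seq_def)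
  have nn: "0 \<le> fourier_density a x" for x using e(1) e(2)[of x] by linarith
  note [measurable] = borel_measurable_fourier_density[OF l1]
  have "(\<integral>y. fejer N (x - y) \<partial>seq_measure a) = fourier_density (damp_seq N a) x" for x
    unfolding seq_measure_def
    by (subst integral_density) (auto simp: nn integral_fejer_density[OF l1 N])
  then show ?thesis unfolding smooth_by_def by (simp add: seq_measure_def)
qed

lemma O_coords_damp_seq:
  fixes a :: "('d::{finite,linorder}) freq \<Rightarrow> complex"
  assumes a: "a \<in> pos_seq" and N: "N \<noteq> 0"
  shows "O_coords N (seq_measure a \<star> fejer N) = restrict (damp_seq N a) (F_plus N)"
  unfolding O_coords_def seq_measure_smooth_fejer[OF a N]
proof (rule restrict_ext)
  fix k :: "'d freq" assume "k \<in> F_plus N"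
  then have "k \<in> half_space" "k \<noteq> 0" using F_plus_subset zero_notin_half_space by blast+
  then show "fourier_coeff (seq_measure (damp_seq N a)) k = damp_seq N a k"
    by (simp add: fourier_coeff_seq_measure[OF damp_seq_pos_seq[OF a N]] hermitian_ext_def)
qed

text \<open>The convolution is a genuine point of \<open>\<P>\<^sub>N\<close>, so the
  finite-dimensional derivative is evaluated inside its domain.\<close>

lemma O_coords_damp_seq_in_O_set:
  fixes a :: "('d::{finite,linorder}) freq \<Rightarrow> complex"
  assumes a: "a \<in> pos_seq" and N: "N \<noteq> 0"
  shows "O_coords N (seq_measure a \<star> fejer N) \<in> O_set N"
    "I_map N (O_coords N (seq_measure a \<star> fejer N)) = seq_measure a \<star> fejer N"
proof -
  have eq: "trunc_seq N (restrict (damp_seq N a) (F_plus N)) = damp_seq N a"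
    by (simp only: trunc_seq_restrict trunc_damp_seq)
  show "O_coords N (seq_measure a \<star> fejer N) \<in> O_set N"
    using damp_seq_pos_seq[OF assms] by (simp add: O_coords_damp_seq[OF assms] O_set_eq eq space_block_space)
  show "I_map N (O_coords N (seq_measure a \<star> fejer N)) = seq_measure a \<star> fejer N"
    unfolding O_coords_damp_seq[OF assms] I_map_eq eq by (rule seq_measure_smooth_fejer[OF assms, symmetric])
qed

lemma I_map_upd_damp_seq:
  fixes a :: "('d::{finite,linorder}) freq \<Rightarrow> complex"
  assumes k: "k \<in> F_plus N"
  shows "I_map N ((restrict (damp_seq N a) (F_plus N))(k := z)) = seq_measure ((damp_seq N a)(k := z))"
proof -
  have "trunc_seq N ((restrict (damp_seq N a) (F_plus N))(k := z)) = (trunc_seq N (damp_seq N a))(k := z)"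
    using k F_plus_subset[of N] by (auto simp: trunc_seq_def fun_eq_iff)
  then show ?thesis unfolding I_map_eq trunc_damp_seq by simp
qed

section \<open>Derivatives of functions of measures\<close>

text \<open>The factor \<open>2\<close> comes from the frequencies \<open>k\<close> and
  \<open>- k\<close> together. For \<open>v = 1\<close> and \<open>v = \<i>\<close> the added
  direction is twice the real and twice the imaginary part of the character of \<open>k\<close>,
  which matches the \<open>2 * \<epsilon>\<close> in \<open>re_line\<close> and
  \<open>im_line\<close>.\<close>

lemma fourier_density_shift_coord:
  fixes a :: "('d::{finite,linorder}) freq \<Rightarrow> complex"
  assumes k: "k \<in> half_space" and a: "a \<in> l1_seq"
  shows "fourier_density (shift_coord k v a t) x = fourier_density a x + t * (2 * Re (v * fourier_char (- k) x))"
proof -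
  let ?c = "t * Re (v * fourier_char (- k) x)"
  have s: "((\<lambda>l. if l = k then ?c else 0) has_sum ?c) half_space"
    by (rule has_sum_finite_neutralI[of "{k}"]) (use k in auto)
  have "(\<Sum>\<^sub>\<infinity>l\<in>half_space. Re (shift_coord k v a t l * fourier_char (- l) x))
      = (\<Sum>\<^sub>\<infinity>l\<in>half_space. Re (a l * fourier_char (- l) x) + (if l = k then ?c else 0))"
    by (rule infsum_cong) (auto simp: shift_coord_def algebra_simps)
  also have "\<dots> = (\<Sum>\<^sub>\<infinity>l\<in>half_space. Re (a l * fourier_char (- l) x)) + ?c"
    by (subst infsum_add[OF fourier_density_summable[OF a] has_sum_imp_summable[OF s]]) (simp only: infsumI[OF s])
  finally show ?thesis by (simp add: fourier_density_def)
qed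

lemma perturb_seq_measure:
  fixes a :: "('d::{finite,linorder}) freq \<Rightarrow> complex"
  assumes k: "k \<in> half_space" and a: "a \<in> pos_seq" and s: "shift_coord k v a t \<in> pos_seq"
    and [measurable]: "h \<in> borel_measurable borel" and h: "\<And>x. \<bar>h x\<bar> \<le> B"
    and eq: "\<And>x. \<eta> * h x = t * (2 * Re (v * fourier_char (- k) x))"
  shows "perturb (seq_measure a) \<eta> h = seq_measure (shift_coord k v a t)"
proof -
  have l1: "a \<in> l1_seq" using a pos_seq_subset by blast
  obtain B' where B': "\<bar>fourier_density a y\<bar> \<le> B'" for y using fourier_density_bounded[OF l1] by blast
  have nn: "0 \<le> fourier_density b x" if "b \<in> pos_seq" for b :: "'d freq \<Rightarrow> complex" and x
    using that by (auto simp: pos_seq_def intro: order_trans less_imp_le)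
  have d: "fourier_density (shift_coord k v a t) x = fourier_density a x + \<eta> * h x" for x
    by (simp only: fourier_density_shift_coord[OF k l1] eq)
  show ?thesis
    unfolding seq_measure_def d
  proof (rule perturb_density[OF borel_measurable_fourier_density[OF l1] _ nn[OF a], where B="max B B'"])
    show "fourier_density a x \<le> max B B'" for x using B'[of x] by linarith
    show "\<bar>h x\<bar> \<le> max B B'" for x using h[of x] by linarith
    show "0 \<le> fourier_density a x + \<eta> * h x" for x using nn[OF s, of x] by (simp only: d)
  qed measurable
qed

lemma eventually_shift_coord_pos_seq:
  fixes a :: "('d::{finite,linorder}) freq \<Rightarrow> complex"
  assumes k: "k \<in> half_space" and a: "a \<in> pos_seq"
  shows "\<forall>\<^sub>F t in nhds 0. shift_coord k v a t \<in> pos_seq"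
proof -
  have l1: "a \<in> l1_seq" using a pos_seq_subset by blast
  obtain e where e: "e > 0" "\<And>b. b \<in> l1_seq \<Longrightarrow> l1_dist a b < e \<Longrightarrow> b \<in> pos_seq"
    using l1_open_pos_seq a unfolding l1_open_def by blast
  have dist: "l1_dist a (shift_coord k v a t) = \<bar>t\<bar> * norm v" for t
    using l1_dist_upd[OF k, of a "a k" "a k + of_real t * v"] by (simp add: shift_coord_def norm_mult)
  have "((\<lambda>t. \<bar>t\<bar> * norm v) \<longlongrightarrow> \<bar>0\<bar> * norm v) (nhds 0)" by (intro tendsto_intros filterlim_ident)
  then have "\<forall>\<^sub>F t in nhds 0. \<bar>t\<bar> * norm v < e" using e(1) by (intro order_tendstoD(2)) auto
  then show ?thesis
    by eventually_elim (rule e(2)[OF shift_coord_in_l1[OF k l1]], simp only: dist)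
qed

lemma field_differentiable_cong_nhds:
  fixes f g :: "real \<Rightarrow> real"
  assumes "\<forall>\<^sub>F t in nhds 0. f t = g t" "g field_differentiable at 0"
  shows "f field_differentiable at 0" "deriv f 0 = deriv g 0"
proof -
  show "f field_differentiable at 0"
    using assms unfolding field_differentiable_def by (metis DERIV_cong_ev)
  show "deriv f 0 = deriv g 0" by (rule deriv_cong_ev[OF assms(1) refl])
qed

text \<open>The factor \<open>2\<close> in the constant is that of total variation against
  \<open>l1_dist\<close>; \<open>max C 0\<close> appears because \<open>tv_lipschitz\<close>
  prescribes no sign for its constant.\<close>

lemma tv_lipschitz_l1_extension:
  fixes \<phi> :: "('d::{finite,linorder}) torus measure \<Rightarrow> real"
  assumes "tv_lipschitz \<phi>"
  obtains \<Psi> C where "l1_lipschitz \<Psi> C" "\<And>a. a \<in> pos_seq \<Longrightarrow> \<Psi> a = \<phi> (seq_measure a)"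
proof -
  obtain C where C: "\<bar>\<phi> m - \<phi> m'\<bar> \<le> C * tv_dist m m'" if "m \<in> torus_probs" "m' \<in> torus_probs" for m m'
    using assms unfolding tv_lipschitz_def by blast
  have lip: "\<bar>\<phi> (seq_measure a) - \<phi> (seq_measure b)\<bar> \<le> (2 * max C 0) * l1_dist a b" if ab: "a \<in> pos_seq" "b \<in> pos_seq" for a b
  proof -
    note m = seq_measure_torus_probs[OF ab(1)] seq_measure_torus_probs[OF ab(2)]
    have "\<bar>\<phi> (seq_measure a) - \<phi> (seq_measure b)\<bar> \<le> C * tv_dist (seq_measure a) (seq_measure b)" by (rule C[OF m])
    also have "\<dots> \<le> max C 0 * tv_dist (seq_measure a) (seq_measure b)" by (rule mult_right_mono[OF max.cobounded1 tv_dist_nonneg[OF m]])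
    also have "\<dots> \<le> max C 0 * (2 * l1_dist a b)" by (rule mult_left_mono[OF tv_dist_seq_measure_le[OF ab]]) simp
    finally show ?thesis by (simp add: mult_ac)
  qed
  obtain \<Psi> where \<Psi>: "\<And>a. a \<in> pos_seq \<Longrightarrow> \<Psi> a = \<phi> (seq_measure a)"
    "\<And>a b. a \<in> l1_seq \<Longrightarrow> b \<in> l1_seq \<Longrightarrow> \<bar>\<Psi> a - \<Psi> b\<bar> \<le> (2 * max C 0) * l1_dist a b"
    using mcshane_extension[where \<psi>="\<lambda>a. \<phi> (seq_measure a)", OF lip] by (metis max.cobounded2 mult_nonneg_nonneg zero_le_numeral)
  have "l1_lipschitz (\<lambda>a. if a \<in> l1_seq then \<Psi> a else 0) (2 * max C 0)"
    by standard (auto intro: \<Psi>(2))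
  moreover have "(if a \<in> l1_seq then \<Psi> a else 0) = \<phi> (seq_measure a)" if "a \<in> pos_seq" for a
    using that pos_seq_subset \<Psi>(1) by auto
  ultimately show ?thesis by (rule that)
qed

definition damped :: "nat \<Rightarrow> ((('d::{finite,linorder}) freq \<Rightarrow> complex) \<Rightarrow> real) \<Rightarrow> ('d freq \<Rightarrow> complex) \<Rightarrow> real" where
  "damped N \<Psi> a = (if a \<in> l1_seq then \<Psi> (damp_seq N a) else 0)"

text \<open>Weights of modulus at most \<open>1\<close> do not increase distances, so the constant
  is the same for all \<open>N\<close>; the weak-star convergence on lines depends on this
  uniformity.\<close>

lemma l1_lipschitz_damped:
  assumes "l1_lipschitz \<Psi> C" shows "l1_lipschitz (damped N \<Psi>) C"
proof
  interpret l1_lipschitz \<Psi> C by fact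
  show "0 \<le> C" by (rule C_nonneg)
  show "\<And>a. a \<notin> l1_seq \<Longrightarrow> damped N \<Psi> a = 0" by (simp add: damped_def)
  fix a b :: "'a freq \<Rightarrow> complex" assume ab: "a \<in> l1_seq" "b \<in> l1_seq"
  have "\<bar>\<Psi> (damp_seq N a) - \<Psi> (damp_seq N b)\<bar> \<le> C * l1_dist (damp_seq N a) (damp_seq N b)"
    by (rule lipschitz) (intro damp_seq_in_l1 ab)+
  also have "\<dots> \<le> C * l1_dist a b"
    unfolding damp_seq_def by (rule mult_left_mono[OF l1_dist_scale_seq_le[OF ab abs_fejer_weight_le_1] C_nonneg])
  finally show "\<bar>damped N \<Psi> a - damped N \<Psi> b\<bar> \<le> C * l1_dist a b" using ab by (simp add: damped_def)
qed

lemma damped_tendsto: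
  assumes "l1_lipschitz \<Psi> C" and a: "a \<in> l1_seq"
  shows "(\<lambda>N. damped N \<Psi> a) \<longlonglongrightarrow> \<Psi> a"
proof -
  interpret l1_lipschitz \<Psi> C by fact
  have "(\<lambda>N. l1_dist a (damp_seq N a)) \<longlonglongrightarrow> 0"
    unfolding damp_seq_def by (rule scale_seq_tendsto[OF a abs_fejer_weight_le_1 fejer_weight_tendsto])
  then have "(\<lambda>N. C * l1_dist a (damp_seq N a)) \<longlonglongrightarrow> 0" by (rule tendsto_mult_right_zero)
  then have "(\<lambda>N. damped N \<Psi> a - \<Psi> a) \<longlonglongrightarrow> 0"
  proof (rule Lim_null_comparison[rotated])
    show "\<forall>\<^sub>F N in sequentially. norm (damped N \<Psi> a - \<Psi> a) \<le> C * l1_dist a (damp_seq N a)"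
      using lipschitz[OF damp_seq_in_l1[OF a] a] a by (simp add: damped_def l1_dist_commute)
  qed
  then show ?thesis by (rule LIM_zero_cancel)
qed

lemma damped_shift_coord:
  assumes k: "k \<in> half_space" and a: "a \<in> l1_seq"
  shows "damped N \<Psi> (shift_coord k v a t) = \<Psi> (shift_coord k v (damp_seq N a) (fejer_weight N k * t))"
proof -
  have "damp_seq N (shift_coord k v a t) = shift_coord k v (damp_seq N a) (fejer_weight N k * t)"
    unfolding shift_coord_def damp_seq_def scale_seq_upd_coord[OF k] using k by (simp add: algebra_simps)
  then show ?thesis using shift_coord_in_l1[OF k a] by (simp add: damped_def)
qed

definition wirtinger_line :: "((('d::finite) freq \<Rightarrow> complex) \<Rightarrow> real) \<Rightarrow> 'd freq \<Rightarrow> ('d freq \<Rightarrow> complex) \<Rightarrow> complex" where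
  "wirtinger_line \<Psi> k a = of_real (line_deriv \<Psi> k 1 a) / 2 - \<i> / 2 * of_real (line_deriv \<Psi> k \<i> a)"

lemma line_deriv_eq_deriv:
  assumes "(\<lambda>t. \<Psi> (shift_coord k v a t)) field_differentiable at 0"
  shows "line_deriv \<Psi> k v a = deriv (\<lambda>t. \<Psi> (shift_coord k v a t)) 0"
  unfolding line_deriv_def by (rule seq_deriv_eq_deriv[OF assms])

text \<open>The directions \<open>1\<close>, \<open>\<i>\<close> give the coordinate derivatives; the halves give the directions of the real
  and imaginary parts of the characters, the last one for frequencies opposite to the half-space.\<close>

definition smooth_lines :: "((('d::{finite,linorder}) freq \<Rightarrow> complex) \<Rightarrow> real) \<Rightarrow> ('d freq \<Rightarrow> complex) \<Rightarrow> bool" where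
  "smooth_lines \<Psi> a \<longleftrightarrow> (\<forall>k\<in>half_space. \<forall>v\<in>{1, \<i>, 1 / 2, \<i> / 2, - (\<i> / 2)}.
     (\<lambda>t. \<Psi> (shift_coord k v a t)) field_differentiable at 0)"

lemma AE_smooth_lines:
  assumes "l1_lipschitz \<Psi> C"
  shows "AE a in gauss_seq p. smooth_lines (\<Psi> :: (('d::{finite,linorder}) freq \<Rightarrow> complex) \<Rightarrow> real) a"
proof -
  interpret l1_lipschitz \<Psi> C by fact
  have "AE a in gauss_seq p. \<forall>k\<in>(half_space :: 'd freq set). \<forall>v\<in>{1, \<i>, 1 / 2, \<i> / 2, - (\<i> / 2)}.
     (\<lambda>t. \<Psi> (shift_coord k v a t)) field_differentiable at 0"
  proof (subst AE_ball_countable[OF countable_half_space], rule ballI, subst AE_ball_countable, simp, rule ballI)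
    fix k :: "'d freq" and v assume k: "k \<in> half_space"
    show "AE a in gauss_seq p. (\<lambda>t. \<Psi> (shift_coord k v a t)) field_differentiable at 0"
      by (rule AE_line_differentiable[OF k])
  qed
  then show ?thesis by (simp only: smooth_lines_def)
qed

context
  fixes \<phi> :: "('d::{finite,linorder}) torus measure \<Rightarrow> real" and \<Psi> :: "('d freq \<Rightarrow> complex) \<Rightarrow> real"
  assumes \<Psi>: "\<And>a. a \<in> pos_seq \<Longrightarrow> \<Psi> a = \<phi> (seq_measure a)"
begin

lemma differentiable_in_direction_seq_measure:
  fixes a :: "'d freq \<Rightarrow> complex"
  assumes k: "k \<in> half_space" and a: "a \<in> pos_seq" and d: "(\<lambda>t. \<Psi> (shift_coord k v a t)) field_differentiable at 0"
    and hm: "h \<in> borel_measurable borel" and h: "\<And>x. \<bar>h x\<bar> \<le> 1" and eq: "\<And>x. h x = 2 * Re (v * fourier_char (- k) x)"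
  shows "differentiable_in_direction \<phi> (seq_measure a) h"
proof -
  have ev: "\<forall>\<^sub>F t in at 0. shift_coord k v a t \<in> pos_seq"
    using eventually_shift_coord_pos_seq[OF k a, of v] by (simp add: eventually_nhds_conv_at)
  have pert: "perturb (seq_measure a) t h = seq_measure (shift_coord k v a t)" if "shift_coord k v a t \<in> pos_seq" for t
    by (rule perturb_seq_measure[OF k a that hm h]) (simp only: eq)
  obtain D where D: "((\<lambda>t. \<Psi> (shift_coord k v a t)) has_field_derivative D) (at 0)"
    using d by (auto simp: field_differentiable_def)
  show ?thesis
    unfolding differentiable_in_direction_def
  proof (intro conjI exI)
    show "\<forall>\<^sub>F t in at 0. perturb (seq_measure a) t h \<in> torus_probs"
      using ev by eventually_elim (simp add: pert seq_measure_torus_probs)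
    have "((\<lambda>t. (\<Psi> (shift_coord k v a (0 + t)) - \<Psi> (shift_coord k v a 0)) / t) \<longlongrightarrow> D) (at 0)"
      using D by (simp only: DERIV_def)
    then show "((\<lambda>t. (\<phi> (perturb (seq_measure a) t h) - \<phi> (seq_measure a)) / t) \<longlongrightarrow> D) (at 0)"
    proof (rule Lim_transform_eventually)
      show "\<forall>\<^sub>F t in at 0. (\<Psi> (shift_coord k v a (0 + t)) - \<Psi> (shift_coord k v a 0)) / t
          = (\<phi> (perturb (seq_measure a) t h) - \<phi> (seq_measure a)) / t"
        using ev by eventually_elim (simp add: pert \<Psi> a)
    qed
  qed
qed

lemma differentiable_in_direction_fourier_char:
  fixes a :: "'d freq \<Rightarrow> complex"
  assumes a: "a \<in> pos_seq" and s: "smooth_lines \<Psi> a" and k: "k \<noteq> 0"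
  shows "differentiable_in_direction \<phi> (seq_measure a) (\<lambda>x. Re (fourier_char k x))"
    "differentiable_in_direction \<phi> (seq_measure a) (\<lambda>x. Im (fourier_char k x))"
proof -
  have s': "(\<lambda>t. \<Psi> (shift_coord l v a t)) field_differentiable at 0" if "l \<in> half_space" "v \<in> {1, \<i>, 1 / 2, \<i> / 2, - (\<i> / 2)}" for l v
    using s that unfolding smooth_lines_def by blast
  have le: "\<bar>Re (fourier_char k x)\<bar> \<le> 1" "\<bar>Im (fourier_char k x)\<bar> \<le> 1" for x
    using abs_Re_le_cmod[of "fourier_char k x"] abs_Im_le_cmod[of "fourier_char k x"] by simp_all
  have "differentiable_in_direction \<phi> (seq_measure a) (\<lambda>x. Re (fourier_char k x))
    \<and> differentiable_in_direction \<phi> (seq_measure a) (\<lambda>x. Im (fourier_char k x))"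
    using k
  proof (cases rule: half_space_cases)
    case 1
    show ?thesis
    proof
      show "differentiable_in_direction \<phi> (seq_measure a) (\<lambda>x. Re (fourier_char k x))"
        by (rule differentiable_in_direction_seq_measure[OF 1 a s'[OF 1, of "1 / 2"]]) (use le in \<open>auto simp: fourier_char_uminus\<close>)
      show "differentiable_in_direction \<phi> (seq_measure a) (\<lambda>x. Im (fourier_char k x))"
        by (rule differentiable_in_direction_seq_measure[OF 1 a s'[OF 1, of "\<i> / 2"]]) (use le in \<open>auto simp: fourier_char_uminus\<close>)
    qed
  next
    case 2
    show ?thesis
    proof
      show "differentiable_in_direction \<phi> (seq_measure a) (\<lambda>x. Re (fourier_char k x))"
        by (rule differentiable_in_direction_seq_measure[OF 2 a s'[OF 2, of "1 / 2"]]) (use le in auto)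
      \<comment> \<open>The coordinate is now \<open>- k\<close>, and the character paired with it
        in the density is that of \<open>k\<close> itself rather than its conjugate, hence the minus
        sign.\<close>
      show "differentiable_in_direction \<phi> (seq_measure a) (\<lambda>x. Im (fourier_char k x))"
        by (rule differentiable_in_direction_seq_measure[OF 2 a s'[OF 2, of "- (\<i> / 2)"]]) (use le in auto)
    qed
  qed
  then show "differentiable_in_direction \<phi> (seq_measure a) (\<lambda>x. Re (fourier_char k x))"
    "differentiable_in_direction \<phi> (seq_measure a) (\<lambda>x. Im (fourier_char k x))" by auto
qed

lemma re_im_line_eq:
  fixes a :: "'d freq \<Rightarrow> complex"
  assumes k: "k \<in> half_space" and a: "a \<in> pos_seq"
  shows "\<forall>\<^sub>F t in nhds 0. re_line \<phi> k (seq_measure a) t = \<Psi> (shift_coord k 1 a t)"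
    "\<forall>\<^sub>F t in nhds 0. im_line \<phi> k (seq_measure a) t = \<Psi> (shift_coord k \<i> a t)"
proof -
  have le: "\<bar>Re (fourier_char k x)\<bar> \<le> 1" "\<bar>Im (fourier_char k x)\<bar> \<le> 1" for x
    using abs_Re_le_cmod[of "fourier_char k x"] abs_Im_le_cmod[of "fourier_char k x"] by simp_all
  show "\<forall>\<^sub>F t in nhds 0. re_line \<phi> k (seq_measure a) t = \<Psi> (shift_coord k 1 a t)"
    using eventually_shift_coord_pos_seq[OF k a, of 1]
  proof eventually_elim
    case (elim t)
    have "perturb (seq_measure a) (2 * t) (\<lambda>x. Re (fourier_char k x)) = seq_measure (shift_coord k 1 a t)"
      by (rule perturb_seq_measure[OF k a elim _ le(1)]) (auto simp: fourier_char_uminus)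
    then show ?case by (simp only: re_line_def \<Psi>[OF elim])
  qed
  show "\<forall>\<^sub>F t in nhds 0. im_line \<phi> k (seq_measure a) t = \<Psi> (shift_coord k \<i> a t)"
    using eventually_shift_coord_pos_seq[OF k a, of \<i>]
  proof eventually_elim
    case (elim t)
    have "perturb (seq_measure a) (2 * t) (\<lambda>x. Im (fourier_char k x)) = seq_measure (shift_coord k \<i> a t)"
      by (rule perturb_seq_measure[OF k a elim _ le(2)]) (auto simp: fourier_char_uminus)
    then show ?case by (simp only: im_line_def \<Psi>[OF elim])
  qed
qed

lemma re_im_line_differentiable:
  fixes a :: "'d freq \<Rightarrow> complex"
  assumes a: "a \<in> pos_seq" and s: "smooth_lines \<Psi> a" and k: "k \<in> half_space"
  shows "re_line \<phi> k (seq_measure a) field_differentiable at 0" "im_line \<phi> k (seq_measure a) field_differentiable at 0"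
    "deriv (re_line \<phi> k (seq_measure a)) 0 = line_deriv \<Psi> k 1 a" "deriv (im_line \<phi> k (seq_measure a)) 0 = line_deriv \<Psi> k \<i> a"
proof -
  have s': "(\<lambda>t. \<Psi> (shift_coord k 1 a t)) field_differentiable at 0" "(\<lambda>t. \<Psi> (shift_coord k \<i> a t)) field_differentiable at 0"
    using s k unfolding smooth_lines_def by blast+
  show "re_line \<phi> k (seq_measure a) field_differentiable at 0" "im_line \<phi> k (seq_measure a) field_differentiable at 0"
    "deriv (re_line \<phi> k (seq_measure a)) 0 = line_deriv \<Psi> k 1 a" "deriv (im_line \<phi> k (seq_measure a)) 0 = line_deriv \<Psi> k \<i> a"
    using field_differentiable_cong_nhds[OF re_im_line_eq(1)[OF k a] s'(1)] field_differentiable_cong_nhds[OF re_im_line_eq(2)[OF k a] s'(2)]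
    by (simp_all add: line_deriv_eq_deriv[of \<Psi> k 1 a, OF s'(1)] line_deriv_eq_deriv[of \<Psi> k \<i> a, OF s'(2)])
qed

lemma fourier_deriv_eq:
  fixes a :: "'d freq \<Rightarrow> complex"
  assumes a: "a \<in> pos_seq" and s: "smooth_lines \<Psi> a" and k: "k \<noteq> 0"
  shows "fourier_deriv \<phi> k (seq_measure a) = (if k \<in> half_space then wirtinger_line \<Psi> k a else cnj (wirtinger_line \<Psi> (- k) a))"
proof -
  have "- k \<in> half_space" if "k \<notin> half_space" using half_space_cases[OF k] that by blast
  then show ?thesis
    using re_im_line_differentiable(3,4)[OF a s, of k] re_im_line_differentiable(3,4)[OF a s, of "- k"]
    by (auto simp: fourier_deriv_def wirtinger_def wirtinger_line_def Let_def simp flip: half_space_def)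
qed

text \<open>Damping turns a step \<open>t\<close> in coordinate \<open>k\<close> into a step
  \<open>fejer_weight N k * t\<close>. The weight is positive on \<open>F_plus N\<close>, so the
  step can be rescaled, and differentiability of \<open>damped N \<Psi>\<close> at \<open>a\<close>
  gives that of \<open>\<Psi>\<close> at the damped sequence.\<close>

lemma shift_coord_damp_differentiable:
  fixes a :: "'d freq \<Rightarrow> complex"
  assumes k: "k \<in> F_plus N" and a: "a \<in> l1_seq" and d: "(\<lambda>t. damped N \<Psi> (shift_coord k v a t)) field_differentiable at 0"
  shows "(\<lambda>t. \<Psi> (shift_coord k v (damp_seq N a) t)) field_differentiable at 0"
    "deriv (\<lambda>t. \<Psi> (shift_coord k v (damp_seq N a) t)) 0 = line_deriv (damped N \<Psi>) k v a / fejer_weight N k"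
proof -
  have kH: "k \<in> half_space" and w: "fejer_weight N k > 0" using k fejer_weight_pos by (auto simp: F_plus_eq)
  have eq: "\<Psi> (shift_coord k v (damp_seq N a) t) = damped N \<Psi> (shift_coord k v a (t / fejer_weight N k))" for t
    using w by (simp add: damped_shift_coord[OF kH a])
  have D: "((\<lambda>t. damped N \<Psi> (shift_coord k v a t)) has_field_derivative line_deriv (damped N \<Psi>) k v a) (at (0 / fejer_weight N k))"
    using d unfolding line_deriv_eq_deriv[of "damped N \<Psi>", OF d] by (simp add: field_differentiable_derivI)
  have "((\<lambda>t. \<Psi> (shift_coord k v (damp_seq N a) t)) has_field_derivative line_deriv (damped N \<Psi>) k v a * (1 / fejer_weight N k)) (at 0)"
    unfolding eq by (rule DERIV_chain2[where f="\<lambda>t. damped N \<Psi> (shift_coord k v a t)" and g="\<lambda>t. t / fejer_weight N k", OF D]) (use w in \<open>auto intro!: derivative_eq_intros\<close>)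
  then show "(\<lambda>t. \<Psi> (shift_coord k v (damp_seq N a) t)) field_differentiable at 0"
    "deriv (\<lambda>t. \<Psi> (shift_coord k v (damp_seq N a) t)) 0 = line_deriv (damped N \<Psi>) k v a / fejer_weight N k"
    by (auto simp: field_differentiable_def DERIV_imp_deriv)
qed

text \<open>Differentiability at the convolution is read off from that of
  \<open>damped N \<Psi>\<close> at the sequence \<open>a\<close> itself, which holds almost surely
  under the Gaussian law. The exceptional set thus lies in sequence space and need not be pulled
  back from \<open>O_set N\<close>.\<close>

lemma line_fin_differentiable:
  fixes a :: "'d freq \<Rightarrow> complex"
  assumes a: "a \<in> pos_seq" and s: "smooth_lines (damped N \<Psi>) a" and k: "k \<in> F_plus N" and N: "N \<noteq> 0"
  defines "b \<equiv> O_coords N (seq_measure a \<star> fejer N)"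
  shows "re_line_fin N \<phi> k b field_differentiable at 0" "im_line_fin N \<phi> k b field_differentiable at 0"
    "deriv (re_line_fin N \<phi> k b) 0 = line_deriv (damped N \<Psi>) k 1 a / fejer_weight N k"
    "deriv (im_line_fin N \<phi> k b) 0 = line_deriv (damped N \<Psi>) k \<i> a / fejer_weight N k"
proof -
  have kH: "k \<in> half_space" using k F_plus_subset by blast
  have l1: "a \<in> l1_seq" using a pos_seq_subset by blast
  note da = damp_seq_pos_seq[OF a N]
  have s': "(\<lambda>t. damped N \<Psi> (shift_coord k 1 a t)) field_differentiable at 0" "(\<lambda>t. damped N \<Psi> (shift_coord k \<i> a t)) field_differentiable at 0"
    using s kH unfolding smooth_lines_def by blast+
  have bk: "b k = damp_seq N a k" unfolding b_def O_coords_damp_seq[OF a N] using k by simp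
  have I: "I_map N (b(k := z)) = seq_measure ((damp_seq N a)(k := z))" for z
    unfolding b_def O_coords_damp_seq[OF a N] by (rule I_map_upd_damp_seq[OF k])
  have re: "\<forall>\<^sub>F t in nhds 0. re_line_fin N \<phi> k b t = \<Psi> (shift_coord k 1 (damp_seq N a) t)"
    using eventually_shift_coord_pos_seq[OF kH da, of 1]
  proof eventually_elim
    case (elim t)
    show ?case unfolding \<Psi>[OF elim] re_line_fin_def I bk by (simp add: shift_coord_def)
  qed
  have im: "\<forall>\<^sub>F t in nhds 0. im_line_fin N \<phi> k b t = \<Psi> (shift_coord k \<i> (damp_seq N a) t)"
    using eventually_shift_coord_pos_seq[OF kH da, of \<i>]
  proof eventually_elim
    case (elim t)
    show ?case unfolding \<Psi>[OF elim] im_line_fin_def I bk by (simp add: shift_coord_def mult.commute)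
  qed
  show "re_line_fin N \<phi> k b field_differentiable at 0" "im_line_fin N \<phi> k b field_differentiable at 0"
    "deriv (re_line_fin N \<phi> k b) 0 = line_deriv (damped N \<Psi>) k 1 a / fejer_weight N k"
    "deriv (im_line_fin N \<phi> k b) 0 = line_deriv (damped N \<Psi>) k \<i> a / fejer_weight N k"
    using field_differentiable_cong_nhds[OF re shift_coord_damp_differentiable(1)[OF k l1 s'(1)]]
      field_differentiable_cong_nhds[OF im shift_coord_damp_differentiable(1)[OF k l1 s'(2)]]
    by (simp_all add: shift_coord_damp_differentiable(2)[OF k l1 s'(1)] shift_coord_damp_differentiable(2)[OF k l1 s'(2)])
qed

lemma has_fourier_deriv_fin_smooth:
  fixes a :: "'d freq \<Rightarrow> complex"
  assumes a: "a \<in> pos_seq" and s: "smooth_lines (damped N \<Psi>) a" and N: "N \<noteq> 0"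
  shows "has_fourier_deriv_fin N \<phi> k (seq_measure a \<star> fejer N)"
  unfolding has_fourier_deriv_fin_def
  using O_coords_damp_seq_in_O_set[OF a N] line_fin_differentiable(1,2)[OF a s _ N] by auto

lemma fourier_deriv_fin_eq:
  fixes a :: "'d freq \<Rightarrow> complex"
  assumes a: "a \<in> pos_seq" and s: "smooth_lines (damped N \<Psi>) a" and k: "k \<noteq> 0" "k \<in> F_set N" and N: "N \<noteq> 0"
  shows "fourier_deriv_fin N \<phi> k (seq_measure a \<star> fejer N)
    = of_real (1 / fejer_weight N k) * (if k \<in> half_space then wirtinger_line (damped N \<Psi>) k a else cnj (wirtinger_line (damped N \<Psi>) (- k) a))"
proof -
  have "- k \<in> F_plus N" if "k \<notin> half_space"
    using half_space_cases[OF k(1)] that k(2) by (auto simp: F_plus_eq F_set_uminus_iff)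
  moreover have "k \<in> F_plus N \<longleftrightarrow> k \<in> half_space" using k(2) by (simp add: F_plus_eq)
  moreover have "complex_of_real (x / w) / 2 - \<i> / 2 * complex_of_real (y / w) = of_real (1 / w) * (of_real x / 2 - \<i> / 2 * of_real y)" for x y w
    by (simp add: algebra_simps)
  ultimately show ?thesis
    using line_fin_differentiable(3,4)[OF a s _ N, of k] line_fin_differentiable(3,4)[OF a s _ N, of "- k"]
    by (cases "k \<in> half_space") (simp_all only: fourier_deriv_fin_def wirtinger_def wirtinger_line_def Let_def fejer_weight_uminus
       complex_cnj_mult complex_cnj_complex_of_real if_True if_False simp_thms)
qed

end

section \<open>Transfer of weak-star convergence from sequences to measures\<close>

lemma borel_measurable_completion_AE:
  fixes f g :: "'a \<Rightarrow> 'b::topological_space"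
  assumes f: "f \<in> borel_measurable M" and eq: "AE x in M. f x = g x"
  shows "g \<in> borel_measurable (completion M)"
proof (rule measurableI)
  fix A :: "'b set" assume A[measurable]: "A \<in> sets borel"
  have [measurable]: "f \<in> borel_measurable (completion M)" using f by (rule measurable_completion)
  have [measurable]: "Measurable.pred (completion M) (\<lambda>x. f x \<in> A \<and> g x \<notin> A)" "Measurable.pred (completion M) (\<lambda>x. g x \<in> A \<and> f x \<notin> A)"
    using eq by (intro sets_completion_AE; auto elim!: eventually_mono)+
  have "g -` A \<inter> space (completion M) = {x \<in> space (completion M). (f x \<in> A \<and> \<not> (f x \<in> A \<and> g x \<notin> A)) \<or> (g x \<in> A \<and> f x \<notin> A)}"
    by auto
  also have "\<dots> \<in> sets (completion M)" by measurable
  finally show "g -` A \<inter> space (completion M) \<in> sets (completion M)" .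
qed simp

lemma completion_ex_borel_measurable_complex:
  fixes h :: "'a \<Rightarrow> complex"
  assumes h: "h \<in> borel_measurable (completion M)"
  shows "\<exists>h'\<in>borel_measurable M. AE x in M. h x = h' x"
proof -
  have R: "(\<lambda>x. Re (h x)) \<in> borel_measurable (completion M)" and I: "(\<lambda>x. Im (h x)) \<in> borel_measurable (completion M)"
    using h by simp_all
  obtain u where [measurable]: "u \<in> borel_measurable M" and u: "AE x in M. Re (h x) = u x"
    using completion_ex_borel_measurable_real[OF R] by blast
  obtain v where [measurable]: "v \<in> borel_measurable M" and v: "AE x in M. Im (h x) = v x"
    using completion_ex_borel_measurable_real[OF I] by blast
  have "AE x in M. h x = of_real (u x) + \<i> * of_real (v x)" using u v by eventually_elim (simp add: complex_eq_iff)
  moreover have "(\<lambda>x. complex_of_real (u x) + \<i> * complex_of_real (v x)) \<in> borel_measurable M"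
    by (intro borel_measurable_add borel_measurable_times borel_measurable_const measurable_compose[OF _ borel_measurable_of_real]) fact+
  ultimately show ?thesis by (rule rev_bexI[rotated])
qed

text \<open>A test function for \<open>\<P>\<close> is replaced by a Borel version, composed with
  \<open>seq_measure\<close>, and multiplied by the density of the conditioned law; integrals
  against \<open>\<P>\<close> become integrals against \<open>gauss_seq p\<close>.\<close>

lemma weak_star_tendsto_gauss_seq:
  fixes \<P> :: "('d::{finite,linorder}) torus measure measure" and u :: "nat \<Rightarrow> ('d freq \<Rightarrow> complex) \<Rightarrow> complex"
  assumes p: "p \<ge> 2" and lim: "weak_limit (P_meas p) \<P>"
    and um: "\<And>n. u n \<in> borel_measurable seq_space" and um0: "u0 \<in> borel_measurable seq_space"
    and bnd: "\<And>n. AE a in gauss_seq p. norm (u n a) \<le> B n" and bnd0: "AE a in gauss_seq p. norm (u0 a) \<le> B0"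
    and eq: "\<forall>\<^sub>F n in sequentially. AE m in \<P>. F n m = u n (coef_seq m)" and eq0: "AE m in \<P>. F0 m = u0 (coef_seq m)"
    and conv: "\<And>g :: ('d freq \<Rightarrow> complex) \<Rightarrow> complex. integrable (gauss_seq p) g \<Longrightarrow>
      (\<lambda>n. \<integral>a. u n a * g a \<partial>gauss_seq p) \<longlonglongrightarrow> (\<integral>a. u0 a * g a \<partial>gauss_seq p)"
  shows "weak_star_tendsto \<P> F F0"
proof -
  have sP: "sets \<P> = sets probs_borel" using lim by (simp add: weak_limit_def)
  note [measurable_cong] = sP
  have cm[measurable]: "coef_seq \<in> \<P> \<rightarrow>\<^sub>M seq_space" by measurable
  have L: "f \<in> L_inf \<P>" if w: "w \<in> borel_measurable seq_space" and b: "AE a in gauss_seq p. norm (w a) \<le> b"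
    and e: "AE m in \<P>. f m = w (coef_seq m)" for f w b
  proof -
    have "(\<lambda>m. w (coef_seq m)) \<in> borel_measurable \<P>" by (rule measurable_compose[OF cm w])
    then have "f \<in> borel_measurable (completion \<P>)" by (rule borel_measurable_completion_AE) (use e in \<open>auto elim!: eventually_mono\<close>)
    moreover have "AE m in \<P>. coef_seq m \<in> pos_seq \<and> m = seq_measure (coef_seq m) \<and> norm (w (coef_seq m)) \<le> b"
      by (rule AE_seq_measure_coef_seq[OF p lim]) (use b in \<open>auto elim!: eventually_mono\<close>)
    then have "AE m in \<P>. norm (f m) \<le> b" using e by eventually_elim simp
    ultimately show ?thesis unfolding L_inf_def by blast
  qed
  show ?thesis
    unfolding weak_star_tendsto_def
  proof (intro conjI allI impI)
    show "\<forall>\<^sub>F n in sequentially. F n \<in> L_inf \<P>" using eq by eventually_elim (rule L[OF um bnd])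
    show "F0 \<in> L_inf \<P>" by (rule L[OF um0 bnd0 eq0])
    fix h :: "'d torus measure \<Rightarrow> complex" assume h: "integrable (completion \<P>) h"
    \<comment> \<open>A function measurable for the completion does not compose with measurable
      maps; its Borel version \<open>h'\<close> does.\<close>
    obtain h' where h'[measurable]: "h' \<in> borel_measurable \<P>" and hh': "AE m in \<P>. h m = h' m"
      using completion_ex_borel_measurable_complex[OF borel_measurable_integrable[OF h]] by blast
    have "integrable (completion \<P>) h'"
      using h by (rule integrable_cong_AE[THEN iffD1, rotated 3])
        (use h hh' in \<open>auto intro: measurable_completion AE_completion\<close>)
    then have ih': "integrable \<P> h'" by (simp add: integrable_completion)
    \<comment> \<open>\<open>seq_measure\<close> is measurable as a map on \<open>pos_seq\<close>,
      hence the cut-off.\<close>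
    define g where "g a = indicator pos_seq a *\<^sub>R h' (seq_measure a)" for a :: "'d freq \<Rightarrow> complex"
    have hs: "h' \<in> borel_measurable probs_borel" using h' sP measurable_cong_sets by blast
    have gm[measurable]: "g \<in> borel_measurable seq_space"
    proof -
      have "(\<lambda>a. h' (seq_measure a)) \<in> borel_measurable (restrict_space seq_space pos_seq)"
        by (rule measurable_compose[OF measurable_seq_measure hs])
      then show ?thesis unfolding g_def using sets.Int[OF sets_pos_seq sets.top]
        by (subst (asm) borel_measurable_restrict_space_iff) (auto simp: space_seq_space)
    qed
    have pos: "AE m in \<P>. coef_seq m \<in> pos_seq \<and> m = seq_measure (coef_seq m) \<and> True"
      by (rule AE_seq_measure_coef_seq[OF p lim]) simp
    have gh: "AE m in \<P>. h m = g (coef_seq m)" "AE m in \<P>. h' m = g (coef_seq m)"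
      using pos hh' by (eventually_elim, simp add: g_def)+
    let ?Z = "measure (gauss_seq p) (pos_seq :: ('d freq \<Rightarrow> complex) set)"
    \<comment> \<open>The conditioning on positivity moves from the measure into the test
      function.\<close>
    define g0 where "g0 a = (indicator pos_seq a / ?Z) *\<^sub>R g a" for a
    have Z: "?Z > 0" by (rule prob_pos_seq[OF p])
    have ig: "integrable (gauss_seq p) g0"
    proof -
      have "integrable \<P> (\<lambda>m. g (coef_seq m))"
        using ih' by (rule integrable_cong_AE[THEN iffD1, rotated 3]) (use gh in auto)
      then have "integrable (distr \<P> seq_space coef_seq) g" by (subst integrable_distr_eq) auto
      then have "integrable (gauss_pos p) g" unfolding distr_coef_seq[OF p lim] .
      moreover have "(\<lambda>a. indicator pos_seq a / ?Z) \<in> borel_measurable (gauss_seq p)"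
        by (intro borel_measurable_divide borel_measurable_const borel_measurable_indicator) (simp add: sets_gauss_seq sets_pos_seq)
      ultimately show ?thesis unfolding gauss_pos_def g0_def using Z
        by (subst (asm) integrable_density) auto
    qed
    have int: "(\<integral>m. f m * h m \<partial>completion \<P>) = (\<integral>a. w a * g0 a \<partial>gauss_seq p)"
      if w[measurable]: "w \<in> borel_measurable seq_space" and b: "AE a in gauss_seq p. norm (w a) \<le> b"
      and e: "AE m in \<P>. f m = w (coef_seq m)" for f w b
    proof -
      have wc: "(\<lambda>m. w (coef_seq m) * g (coef_seq m)) \<in> borel_measurable \<P>" by measurable
      have "f \<in> borel_measurable (completion \<P>)" using L[OF w b e] by (simp add: L_inf_def)
      then have "(\<integral>m. f m * h m \<partial>completion \<P>) = (\<integral>m. w (coef_seq m) * g (coef_seq m) \<partial>completion \<P>)"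
        using h by (intro integral_cong_AE borel_measurable_times measurable_completion[OF wc] AE_completion)
          (use e gh(1) in \<open>auto elim: eventually_elim2\<close>)
      also have "\<dots> = (\<integral>m. w (coef_seq m) * g (coef_seq m) \<partial>\<P>)" by (rule integral_completion[OF wc])
      also have "\<dots> = (\<integral>a. w a * g a \<partial>distr \<P> seq_space coef_seq)" by (rule integral_distr[symmetric]) measurable
      also have "\<dots> = (\<integral>a. (indicator pos_seq a / ?Z) *\<^sub>R (w a * g a) \<partial>gauss_seq p)"
        unfolding distr_coef_seq[OF p lim] by (rule integral_gauss_pos) measurable
      also have "\<dots> = (\<integral>a. w a * g0 a \<partial>gauss_seq p)" by (simp add: g0_def)
      finally show ?thesis .
    qed
    have "\<forall>\<^sub>F n in sequentially. (\<integral>a. u n a * g0 a \<partial>gauss_seq p) = (\<integral>m. F n m * h m \<partial>completion \<P>)"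
      using eq by eventually_elim (rule int[OF um bnd, symmetric])
    with conv[OF ig] show "(\<lambda>n. \<integral>m. F n m * h m \<partial>completion \<P>) \<longlonglongrightarrow> (\<integral>m. F0 m * h m \<partial>completion \<P>)"
      unfolding int[OF um0 bnd0 eq0] by (rule Lim_transform_eventually)
  qed
qed

lemma (in l1_lipschitz) borel_measurable_wirtinger_line:
  "k \<in> half_space \<Longrightarrow> wirtinger_line \<Psi> k \<in> borel_measurable seq_space"
  unfolding wirtinger_line_def
  by (intro borel_measurable_diff borel_measurable_times borel_measurable_divide borel_measurable_const
      measurable_compose[OF _ borel_measurable_of_real] borel_measurable_line_deriv)

lemma (in l1_lipschitz) AE_norm_wirtinger_line_le:
  assumes k: "k \<in> half_space" shows "AE a in gauss_seq p. norm (wirtinger_line \<Psi> k a) \<le> C"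
  using AE_abs_line_deriv_le[OF k, where p=p and v=1] AE_abs_line_deriv_le[OF k, where p=p and v=\<i>]
proof eventually_elim
  case (elim a)
  have "norm (wirtinger_line \<Psi> k a) \<le> norm (complex_of_real (line_deriv \<Psi> k 1 a) / 2) + norm (\<i> / 2 * complex_of_real (line_deriv \<Psi> k \<i> a))"
    unfolding wirtinger_line_def by (rule norm_triangle_ineq4)
  also have "\<dots> = \<bar>line_deriv \<Psi> k 1 a\<bar> / 2 + \<bar>line_deriv \<Psi> k \<i> a\<bar> / 2" by (simp add: norm_mult norm_divide)
  finally show ?case using elim by simp
qed

text \<open>Linearity reduces the claim to the directions \<open>1\<close> and \<open>\<i>\<close>;
  the conjugated form serves the frequencies opposite to the half-space.\<close>

lemma tendsto_integral_wirtinger_line: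
  fixes \<Psi> :: "nat \<Rightarrow> (('d::{finite,linorder}) freq \<Rightarrow> complex) \<Rightarrow> real" and g :: "('d freq \<Rightarrow> complex) \<Rightarrow> complex"
  assumes lip: "\<And>n. l1_lipschitz (\<Psi> n) C" and lip0: "l1_lipschitz \<Psi>0 C"
    and lim: "\<And>a. a \<in> l1_seq \<Longrightarrow> (\<lambda>n. \<Psi> n a) \<longlonglongrightarrow> \<Psi>0 a"
    and k: "k \<in> half_space" and g: "integrable (gauss_seq p) g" and p: "p \<ge> 2"
  shows "(\<lambda>n. \<integral>a. wirtinger_line (\<Psi> n) k a * g a \<partial>gauss_seq p) \<longlonglongrightarrow> (\<integral>a. wirtinger_line \<Psi>0 k a * g a \<partial>gauss_seq p)"
    "(\<lambda>n. \<integral>a. cnj (wirtinger_line (\<Psi> n) k a) * g a \<partial>gauss_seq p) \<longlonglongrightarrow> (\<integral>a. cnj (wirtinger_line \<Psi>0 k a) * g a \<partial>gauss_seq p)"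
proof -
  let ?I = "\<lambda>L v. \<integral>a. line_deriv L k v a *\<^sub>R g a \<partial>gauss_seq p"
  have eq: "(\<integral>a. wirtinger_line L k a * g a \<partial>gauss_seq p) = ?I L 1 / 2 - \<i> / 2 * ?I L \<i>"
    "(\<integral>a. cnj (wirtinger_line L k a) * g a \<partial>gauss_seq p) = ?I L 1 / 2 + \<i> / 2 * ?I L \<i>" if "l1_lipschitz L C" for L
  proof -
    note int = l1_lipschitz.integrable_line_deriv[OF that k g]
    have "wirtinger_line L k a * g a = (line_deriv L k 1 a *\<^sub>R g a) / 2 - \<i> / 2 * (line_deriv L k \<i> a *\<^sub>R g a)"
      "cnj (wirtinger_line L k a) * g a = (line_deriv L k 1 a *\<^sub>R g a) / 2 + \<i> / 2 * (line_deriv L k \<i> a *\<^sub>R g a)" for a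
      by (simp_all add: wirtinger_line_def scaleR_conv_of_real algebra_simps)
    then show "(\<integral>a. wirtinger_line L k a * g a \<partial>gauss_seq p) = ?I L 1 / 2 - \<i> / 2 * ?I L \<i>"
      "(\<integral>a. cnj (wirtinger_line L k a) * g a \<partial>gauss_seq p) = ?I L 1 / 2 + \<i> / 2 * ?I L \<i>"
      using int[of 1] int[of \<i>] by (simp_all only: Bochner_Integration.integral_diff Bochner_Integration.integral_add
          integrable_divide integrable_mult_right integral_divide_zero integral_mult_right_zero)
  qed
  note lims = tendsto_integral_line_deriv[OF lip lip0 lim k g p]
  show "(\<lambda>n. \<integral>a. wirtinger_line (\<Psi> n) k a * g a \<partial>gauss_seq p) \<longlonglongrightarrow> (\<integral>a. wirtinger_line \<Psi>0 k a * g a \<partial>gauss_seq p)"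
    unfolding eq(1)[OF lip] eq(1)[OF lip0] by (intro tendsto_intros lims) simp_all
  show "(\<lambda>n. \<integral>a. cnj (wirtinger_line (\<Psi> n) k a) * g a \<partial>gauss_seq p) \<longlonglongrightarrow> (\<integral>a. cnj (wirtinger_line \<Psi>0 k a) * g a \<partial>gauss_seq p)"
    unfolding eq(2)[OF lip] eq(2)[OF lip0] by (intro tendsto_intros lims) simp_all
qed

theorem theorem3p10:
  fixes p :: real
    and \<phi> :: "('d::{finite,linorder}) torus measure \<Rightarrow> real"
    and \<P> :: "'d torus measure measure"
  assumes "p \<ge> 5"
    and "weak_limit (P_meas p) \<P>"
    and "tv_lipschitz \<phi>"
  shows "(AE m in \<P>. \<forall>k::'d freq. k \<noteq> 0 \<longrightarrow>
            differentiable_in_direction \<phi> m (\<lambda>x. Re (fourier_char k x)) \<and>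
            differentiable_in_direction \<phi> m (\<lambda>x. Im (fourier_char k x)))
       \<and> (AE m in \<P>. \<forall>k \<in> (\<Union>N. F_plus N).
            re_line \<phi> k m field_differentiable at 0 \<and> im_line \<phi> k m field_differentiable at 0)
       \<and> (\<forall>k::'d freq. k \<noteq> 0 \<longrightarrow>
            (\<forall>N. k \<in> F_set N \<longrightarrow> (AE m in \<P>. has_fourier_deriv_fin N \<phi> k (m \<star> fejer N))) \<and>
            weak_star_tendsto \<P> (\<lambda>N m. fourier_deriv_fin N \<phi> k (m \<star> fejer N)) (fourier_deriv \<phi> k))"
proof -
  have p: "p \<ge> 2" using assms(1) by simp
  note lim = assms(2)
  obtain \<Psi> C where lip: "l1_lipschitz \<Psi> C" and \<Psi>: "\<And>a. a \<in> pos_seq \<Longrightarrow> \<Psi> a = \<phi> (seq_measure a)"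
    using tv_lipschitz_l1_extension[OF assms(3)] by blast
  have lipN: "l1_lipschitz (damped N \<Psi>) C" for N by (rule l1_lipschitz_damped[OF lip])
  have good: "AE m in \<P>. coef_seq m \<in> pos_seq \<and> m = seq_measure (coef_seq m) \<and> smooth_lines \<Psi> (coef_seq m)"
    by (rule AE_seq_measure_coef_seq[OF p lim]) (use AE_smooth_lines[OF lip, where p=p] in \<open>auto elim!: eventually_mono\<close>)
  \<comment> \<open>Each \<open>N\<close> brings its own null set, because the derivative at the
    convolution is governed by the function \<open>damped N \<Psi>\<close>.\<close>
  have goodN: "AE m in \<P>. coef_seq m \<in> pos_seq \<and> m = seq_measure (coef_seq m) \<and> smooth_lines (damped N \<Psi>) (coef_seq m)" for N
    by (rule AE_seq_measure_coef_seq[OF p lim]) (use AE_smooth_lines[OF lipN[of N], where p=p] in \<open>auto elim!: eventually_mono\<close>)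
  have N0: "N \<noteq> 0" if "(k :: 'd freq) \<in> F_set N" for k N using that by (cases N) (auto simp: F_set_def)
  have "AE m in \<P>. \<forall>k::'d freq. k \<noteq> 0 \<longrightarrow>
            differentiable_in_direction \<phi> m (\<lambda>x. Re (fourier_char k x)) \<and>
            differentiable_in_direction \<phi> m (\<lambda>x. Im (fourier_char k x))"
    using good
  proof eventually_elim
    case (elim m)
    then show ?case using differentiable_in_direction_fourier_char[where \<Psi>=\<Psi> and \<phi>=\<phi>, OF \<Psi>, of "coef_seq m"] by metis
  qed
  moreover have "AE m in \<P>. \<forall>k \<in> (\<Union>N. F_plus N).
            re_line \<phi> k m field_differentiable at 0 \<and> im_line \<phi> k m field_differentiable at 0"
    using good
  proof eventually_elim
    case (elim m)
    then show ?case using re_im_line_differentiable(1,2)[where \<Psi>=\<Psi> and \<phi>=\<phi>, OF \<Psi>, of "coef_seq m"] unfolding half_space_def[symmetric] by metis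
  qed
  moreover have "AE m in \<P>. has_fourier_deriv_fin N \<phi> k (m \<star> fejer N)" if k: "k \<in> F_set N" for k :: "'d freq" and N
    using goodN[of N]
  proof eventually_elim
    case (elim m)
    then show ?case using has_fourier_deriv_fin_smooth[where \<Psi>=\<Psi> and \<phi>=\<phi>, OF \<Psi>, of "coef_seq m" N k] N0[OF k] by metis
  qed
  moreover have "weak_star_tendsto \<P> (\<lambda>N m. fourier_deriv_fin N \<phi> k (m \<star> fejer N)) (fourier_deriv \<phi> k)"
    if k: "k \<noteq> 0" for k :: "'d freq"
  proof -
    define D where "D L a = (if k \<in> half_space then wirtinger_line L k a else cnj (wirtinger_line L (- k) a))"
      for L :: "('d freq \<Rightarrow> complex) \<Rightarrow> real" and a
    have kk: "- k \<in> half_space" if "k \<notin> half_space" using half_space_cases[OF k] that by blast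
    have cnj: "cnj \<in> borel_measurable borel" by (intro borel_measurable_continuous_onI continuous_intros)
    have Dm: "D L \<in> borel_measurable seq_space" if "l1_lipschitz L C" for L
      using l1_lipschitz.borel_measurable_wirtinger_line[OF that] kk unfolding D_def
      by (cases "k \<in> half_space") (auto intro: measurable_compose[OF _ cnj])
    have Db: "AE a in gauss_seq p. norm (D L a) \<le> C" if "l1_lipschitz L C" for L
      using l1_lipschitz.AE_norm_wirtinger_line_le[OF that] kk unfolding D_def by (cases "k \<in> half_space") auto
    have Dlim: "(\<lambda>N. \<integral>a. D (damped N \<Psi>) a * g a \<partial>gauss_seq p) \<longlonglongrightarrow> (\<integral>a. D \<Psi> a * g a \<partial>gauss_seq p)"
      if g: "integrable (gauss_seq p) g" for g
      unfolding D_def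
      using tendsto_integral_wirtinger_line[OF lipN lip damped_tendsto[OF lip] _ g p] kk by (cases "k \<in> half_space") auto
    \<comment> \<open>For \<open>k\<close> outside \<open>F_set N\<close> the weight is
      \<open>0\<close> and the factor \<open>1 / 0\<close> equals \<open>0\<close>, so every
      \<open>u N\<close> is bounded; this concerns only finitely many \<open>N\<close>.\<close>
    define u where "u N a = of_real (1 / fejer_weight N k) * D (damped N \<Psi>) a" for N a
    show ?thesis
    proof (rule weak_star_tendsto_gauss_seq[OF p lim, where u=u and B="\<lambda>N. \<bar>1 / fejer_weight N k\<bar> * C"])
      show "u N \<in> borel_measurable seq_space" for N unfolding u_def using Dm[OF lipN] by simp
      show "D \<Psi> \<in> borel_measurable seq_space" by (rule Dm[OF lip])
      show "AE a in gauss_seq p. norm (D \<Psi> a) \<le> C" by (rule Db[OF lip])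
      show "AE a in gauss_seq p. norm (u N a) \<le> \<bar>1 / fejer_weight N k\<bar> * C" for N
        using Db[OF lipN[of N]]
      proof eventually_elim
        case (elim a)
        show ?case unfolding u_def norm_mult norm_of_real by (rule mult_left_mono[OF elim]) simp
      qed
      show "AE m in \<P>. fourier_deriv \<phi> k m = D \<Psi> (coef_seq m)"
        using good
      proof eventually_elim
        case (elim m)
        then show ?case using fourier_deriv_eq[where \<Psi>=\<Psi> and \<phi>=\<phi>, OF \<Psi>, of "coef_seq m" k] k unfolding D_def by metis
      qed
      obtain M where M: "k \<in> F_set M" using F_set_covers by blast
      show "\<forall>\<^sub>F N in sequentially. AE m in \<P>. fourier_deriv_fin N \<phi> k (m \<star> fejer N) = u N (coef_seq m)"
        using eventually_ge_at_top[of M]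
      proof eventually_elim
        case (elim N)
        then have kN: "k \<in> F_set N" using F_set_mono M by blast
        show ?case
          using goodN[of N]
        proof eventually_elim
          case (elim m)
          then show ?case using fourier_deriv_fin_eq[where \<Psi>=\<Psi> and \<phi>=\<phi>, OF \<Psi>, of "coef_seq m" N k] k kN N0[OF kN] unfolding u_def D_def by metis
        qed
      qed
      show "(\<lambda>N. \<integral>a. u N a * g a \<partial>gauss_seq p) \<longlonglongrightarrow> (\<integral>a. D \<Psi> a * g a \<partial>gauss_seq p)"
        if g: "integrable (gauss_seq p) g" for g :: "('d freq \<Rightarrow> complex) \<Rightarrow> complex"
      proof -
        \<comment> \<open>The inverse weights come from the chain rule and tend to \<open>1\<close>
          for the fixed frequency \<open>k\<close>, so they disappear in the limit.\<close>
        have "(\<lambda>N. of_real (1 / fejer_weight N k) * (\<integral>a. D (damped N \<Psi>) a * g a \<partial>gauss_seq p))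
          \<longlonglongrightarrow> of_real (1 / 1) * (\<integral>a. D \<Psi> a * g a \<partial>gauss_seq p)"
          by (intro tendsto_mult tendsto_of_real tendsto_divide tendsto_const fejer_weight_tendsto Dlim g) simp
        then show ?thesis by (simp add: u_def mult.assoc)
      qed
    qed
  qed
  ultimately show ?thesis by blast
qed

end
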